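(* Let $T>0$, $I\ge3$, $\lambda\ge0$, $g\in C_c(E)$ and $f\in C_0(\mathbb{R})\cap L^2(\mathbb{R})$. Let $\rho,a\in\Theta(m',M')$ and $B\in\Xi(M')$ for some $0<m'<M'<\infty$, and assume that $\rho$ satisfies the $\mathbf{H}^{(t)}$-hypothesis with respect to the interfaces $x_i\equiv i$, $1\le i\le I$. Then the parabolic problem $(\mathcal{P}^\lambda_{\mathrm{div},\Delta}(\rho,a,B))$ (with source term $g$ and terminal condition $f$) has a unique weak solution.
   Context: $E=[0,T]\times\mathbb{R}$, $\Delta=\{(t,i):0\le t\le T,\ 1\le i\le I\}$. $\Theta(m',M')$: measurable functions $[0,T]\times\mathbb{R}\to[m',M']$. $\Xi(M')$: measurable functions $[0,T]\times\mathbb{R}\to[-M',M']$. $C_c(E)$: continuous functions on $E$ with compact support; $C_0(\mathbb{R})$: continuous functions vanishing at infinity. $\mathbf{H}^{(t)}$-hypothesis for $\rho$: $\rho\in C^{1,0}(E\setminus\Delta)$ (continuous with continuous time derivative) and $\rho'_t$ is bounded on each of the sets $\{x<1\}$, $\{i<x<i+1\}$ ($1\le i\le I-1$), $\{x>I\}$ of $E$. $\frac{\mathrm{d}}{\mathrm{d}x}$ and $\frac{\mathrm{d}}{\mathrm{d}t}$ denote distributional derivatives. $L^2(0,T;H^1(\mathbb{R}))$: measurable $f(t,x)$ with $f(t,\cdot)\in H^1(\mathbb{R})$ for every $t$ and $\int_0^T\int_{\mathbb{R}}(|f|^2+|\frac{\mathrm{d}f}{\mathrm{d}x}|^2)dxdt<\infty$.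 $H^{1,1}(E)$: functions $f\in L^2(0,T;H^1(\mathbb{R}))$ with $\frac{\mathrm{d}f}{\mathrm{d}t}\in L^2(0,T;L^2(\mathbb{R}))$, with norm $(\|f\|^2+\|\frac{\mathrm{d}f}{\mathrm{d}x}\|^2+\|\frac{\mathrm{d}f}{\mathrm{d}t}\|^2)^{1/2}$, $\|\cdot\|$ being the norm of $L^2(0,T;L^2(\mathbb{R}))$. $H^{1,1}_0(E)$: closure in $H^{1,1}(E)$ of the $C^\infty$ functions on $E$ with compact support in $(0,T)\times\mathbb{R}$. The problem $(\mathcal{P}^\lambda_{\mathrm{div},\Delta}(\rho,a,B))$ is formally $u'_t+\frac\rho2(au'_x)'_x+Bu'_x-\lambda u=g$ off $\Delta$, $a(t,i+)u'_x(t,i+)=a(t,i-)u'_x(t,i-)$ for $1\le i\le I$, $u(T,\cdot)=f$, $\lim_{|x|\to\infty}u(t,x)=0$. A weak solution is a function $u\in L^2(0,T;H^1(\mathbb{R}))\cap C([0,T];L^2(\mathbb{R}))$ with $u(T,\cdot)=f$ a.e. such that for every $\varphi\in H^{1,1}_0(E)$ $$\int_0^T\!\!\int_{\mathbb{R}}u\frac{\mathrm{d}\varphi}{\mathrm{d}t}\rho^{-1}dxdt+\frac12\int_0^T\!\!\int_{\mathbb{R}}a\frac{\mathrm{d}u}{\mathrm{d}x}\frac{\mathrm{d}\varphi}{\mathrm{d}x}dxdt-\int_0^T\!\!\int_{\mathbb{R}}B\frac{\mathrm{d}u}{\mathrm{d}x}\varphi\rho^{-1}dxdt+\int_0^T\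!\!\int_{\mathbb{R}}u\Big(\lambda-\frac{\rho'_t}{\rho}\Big)\varphi\rho^{-1}dxdt=-\int_0^T\!\!\int_{\mathbb{R}}g\varphi\rho^{-1}dxdt.$$
   Formalization: In the definition of L²(0,T;H¹(ℝ)), "f(t,·)∈H¹(ℝ) for every t" is read as "for almost every t"; with "every t", u(T,·)=f would force f∈H¹(ℝ), so no weak solution would exist for f∈C_0∩L² outside H¹. *)

theory Defs
  imports "HOL-Analysis.Analysis"
begin

text \<open>
  Functions on \<open>[0,T] \<times> \<real>\<close> are total functions on \<^typ>\<open>real \<times> real\<close> whose values outside the
  strip are never used. Measurable means Lebesgue measurable.
\<close>

definition strip :: "real \<Rightarrow> (real \<times> real) set" where
  "strip T = {0..T} \<times> UNIV"

definition open_strip :: "real \<Rightarrow> (real \<times> real) set" where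
  "open_strip T = {0<..<T} \<times> UNIV"

definition interfaces :: "real \<Rightarrow> nat \<Rightarrow> (real \<times> real) set" where
  "interfaces T I = {(t, real i) | t i. 0 \<le> t \<and> t \<le> T \<and> 1 \<le> i \<and> i \<le> I}"


subsection \<open>Spaces of coefficients and data\<close>

definition Theta :: "real \<Rightarrow> real \<Rightarrow> real \<Rightarrow> (real \<times> real \<Rightarrow> real) set" where
  "Theta T m M =
     {r \<in> borel_measurable (lebesgue_on (strip T)). \<forall>p\<in>strip T. m \<le> r p \<and> r p \<le> M}"

definition Xi :: "real \<Rightarrow> real \<Rightarrow> (real \<times> real \<Rightarrow> real) set" where
  "Xi T M =
     {b \<in> borel_measurable (lebesgue_on (strip T)). \<forall>p\<in>strip T. - M \<le> b p \<and> b p \<le> M}"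

definition Cc_strip :: "real \<Rightarrow> (real \<times> real \<Rightarrow> real) set" where
  "Cc_strip T = {g. continuous_on (strip T) g \<and> compact (closure {p \<in> strip T. g p \<noteq> 0})}"

definition C0_real :: "(real \<Rightarrow> real) set" where
  "C0_real = {f. continuous_on UNIV f \<and> (f \<longlongrightarrow> 0) at_infinity}"

text \<open>The classical time derivative, one-sided at the times \<open>0\<close> and \<open>T\<close>.\<close>

definition time_deriv :: "real \<Rightarrow> (real \<times> real \<Rightarrow> real) \<Rightarrow> real \<times> real \<Rightarrow> real" where
  "time_deriv T r = (\<lambda>(t, x). vector_derivative (\<lambda>s. r (s, x)) (at t within {0..T}))"

definition Ht_hypothesis :: "real \<Rightarrow> nat \<Rightarrow> (real \<times> real \<Rightarrow> real) \<Rightarrow> bool" where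
  "Ht_hypothesis T I r \<longleftrightarrow>
     continuous_on (strip T - interfaces T I) r \<and>
     (\<forall>(t, x) \<in> strip T - interfaces T I. (\<lambda>s. r (s, x)) differentiable (at t within {0..T})) \<and>
     continuous_on (strip T - interfaces T I) (time_deriv T r) \<and>
     bounded (time_deriv T r ` {(t, x) \<in> strip T. x < 1}) \<and>
     (\<forall>i\<in>{1..I - 1}. bounded (time_deriv T r ` {(t, x) \<in> strip T. real i < x \<and> x < real i + 1})) \<and>
     bounded (time_deriv T r ` {(t, x) \<in> strip T. real I < x})"


subsection \<open>Square integrable functions and distributional derivatives\<close>

definition L2 :: "'a measure \<Rightarrow> ('a \<Rightarrow> real) set" where
  "L2 M = {f \<in> borel_measurable M. integrable M (\<lambda>x. (f x)\<^sup>2)}"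

definition L2_norm :: "'a measure \<Rightarrow> ('a \<Rightarrow> real) \<Rightarrow> real" where
  "L2_norm M f = sqrt (LINT x|M. (f x)\<^sup>2)"

primrec Ck :: "nat \<Rightarrow> ('a::real_normed_vector \<Rightarrow> real) \<Rightarrow> bool" where
  "Ck 0 f \<longleftrightarrow> continuous_on UNIV f"
| "Ck (Suc k) f \<longleftrightarrow>
     (\<forall>x. f differentiable (at x)) \<and> (\<forall>v. Ck k (\<lambda>x. frechet_derivative f (at x) v))"

definition test_functions :: "'a::real_normed_vector set \<Rightarrow> ('a \<Rightarrow> real) set" where
  "test_functions \<Omega> =
     {\<psi>. (\<forall>k. Ck k \<psi>) \<and> compact (closure {x. \<psi> x \<noteq> 0}) \<and> closure {x. \<psi> x \<noteq> 0} \<subseteq> \<Omega>}"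

definition locally_integrable :: "'a::euclidean_space set \<Rightarrow> ('a \<Rightarrow> real) \<Rightarrow> bool" where
  "locally_integrable \<Omega> f \<longleftrightarrow> (\<forall>K. compact K \<and> K \<subseteq> \<Omega> \<longrightarrow> set_integrable lebesgue K f)"

text \<open>The function \<open>h\<close> is the distributional derivative of \<open>f\<close> in direction \<open>b\<close> on the open
  set \<open>\<Omega>\<close>; it is determined up to a null subset of \<open>\<Omega>\<close>.\<close>

definition has_distr_deriv ::
  "'a::euclidean_space set \<Rightarrow> 'a \<Rightarrow> ('a \<Rightarrow> real) \<Rightarrow> ('a \<Rightarrow> real) \<Rightarrow> bool" where
  "has_distr_deriv \<Omega> b f h \<longleftrightarrow>
     locally_integrable \<Omega> f \<and> locally_integrable \<Omega> h \<and>
     (\<forall>\<psi>\<in>test_functions \<Omega>.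
        (LINT x:\<Omega>|lebesgue. f x * frechet_derivative \<psi> (at x) b) = - (LINT x:\<Omega>|lebesgue. h x * \<psi> x))"

text \<open>Chosen representatives of the distributional derivatives on \<open>(0,T) \<times> \<real>\<close>. They are
  meaningful only if the derivative exists as a locally integrable function, and are then only
  used in ways that do not depend on the choice.\<close>

definition distr_dt :: "real \<Rightarrow> (real \<times> real \<Rightarrow> real) \<Rightarrow> real \<times> real \<Rightarrow> real" where
  "distr_dt T f = (SOME h. has_distr_deriv (open_strip T) (1, 0) f h)"

definition distr_dx :: "real \<Rightarrow> (real \<times> real \<Rightarrow> real) \<Rightarrow> real \<times> real \<Rightarrow> real" where
  "distr_dx T f = (SOME h. has_distr_deriv (open_strip T) (0, 1) f h)"


subsection \<open>Sobolev spaces\<close>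

definition H1_real :: "(real \<Rightarrow> real) set" where
  "H1_real = {f \<in> L2 lebesgue. \<exists>h\<in>L2 lebesgue. has_distr_deriv UNIV 1 f h}"

text \<open>As usual for Bochner spaces, \<open>f (t, \<cdot>) \<in> H\<^sup>1(\<real>)\<close> is required for almost every \<open>t\<close>: requiring
  it at \<open>t = T\<close> would be incompatible with a terminal condition outside \<open>H\<^sup>1(\<real>)\<close>.\<close>

definition L2_H1 :: "real \<Rightarrow> (real \<times> real \<Rightarrow> real) set" where
  "L2_H1 T =
     {f \<in> L2 (lebesgue_on (strip T)).
        (AE t in lebesgue_on {0..T}. (\<lambda>x. f (t, x)) \<in> H1_real) \<and>
        (\<exists>h\<in>L2 (lebesgue_on (strip T)). has_distr_deriv (open_strip T) (0, 1) f h)}"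

definition H11 :: "real \<Rightarrow> (real \<times> real \<Rightarrow> real) set" where
  "H11 T =
     {f \<in> L2_H1 T. \<exists>h\<in>L2 (lebesgue_on (strip T)). has_distr_deriv (open_strip T) (1, 0) f h}"

definition H11_norm :: "real \<Rightarrow> (real \<times> real \<Rightarrow> real) \<Rightarrow> real" where
  "H11_norm T f =
     sqrt ((L2_norm (lebesgue_on (strip T)) f)\<^sup>2 +
           (L2_norm (lebesgue_on (strip T)) (distr_dx T f))\<^sup>2 +
           (L2_norm (lebesgue_on (strip T)) (distr_dt T f))\<^sup>2)"

text \<open>A test function on \<open>(0,T) \<times> \<real>\<close> vanishes near the boundary of the strip, so it is identified
  with its smooth extension by zero to the whole plane.\<close>

definition H11_0 :: "real \<Rightarrow> (real \<times> real \<Rightarrow> real) set" where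
  "H11_0 T =
     {f \<in> H11 T. \<forall>\<epsilon>>0. \<exists>\<psi>\<in>test_functions (open_strip T). H11_norm T (\<lambda>p. f p - \<psi> p) < \<epsilon>}"

definition C_L2 :: "real \<Rightarrow> (real \<times> real \<Rightarrow> real) set" where
  "C_L2 T =
     {u. \<forall>t\<in>{0..T}. (\<lambda>x. u (t, x)) \<in> L2 lebesgue \<and>
           ((\<lambda>s. L2_norm lebesgue (\<lambda>x. u (s, x) - u (t, x))) \<longlongrightarrow> 0) (at t within {0..T})}"


subsection \<open>Weak solutions of the parabolic problem\<close>

definition weak_solution ::
  "real \<Rightarrow> (real \<times> real \<Rightarrow> real) \<Rightarrow> (real \<times> real \<Rightarrow> real) \<Rightarrow> (real \<times> real \<Rightarrow> real) \<Rightarrow> real \<Rightarrow>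
   (real \<times> real \<Rightarrow> real) \<Rightarrow> (real \<Rightarrow> real) \<Rightarrow> (real \<times> real \<Rightarrow> real) \<Rightarrow> bool" where
  "weak_solution T \<rho> a B lam g f u \<longleftrightarrow>
     u \<in> L2_H1 T \<and> u \<in> C_L2 T \<and> (AE x in lebesgue. u (T, x) = f x) \<and>
     (\<forall>\<phi>\<in>H11_0 T.
        (LINT p|lebesgue_on (strip T). u p * distr_dt T \<phi> p * inverse (\<rho> p))
        + 1/2 * (LINT p|lebesgue_on (strip T). a p * distr_dx T u p * distr_dx T \<phi> p)
        - (LINT p|lebesgue_on (strip T). B p * distr_dx T u p * \<phi> p * inverse (\<rho> p))
        + (LINT p|lebesgue_on (strip T).
             u p * (lam - time_deriv T \<rho> p / \<rho> p) * \<phi> p * inverse (\<rho> p))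
        = - (LINT p|lebesgue_on (strip T). g p * \<phi> p * inverse (\<rho> p)))"

end

theory Submission
  imports Defs
begin

text \<open>
  Dividing the equation by \<open>\<rho>\<close> turns it into an evolution equation for \<open>b u\<close> with \<open>b = 1 / \<rho>\<close>,
  which is Lipschitz continuous in time but possibly discontinuous in space.

  Uniqueness: if \<open>(b v, \<phi>\<^sub>t) = A (v, \<phi>)\<close> for all test functions vanishing at one end of the time
  interval, with a coercive form \<open>A\<close>, then the time average \<open>\<phi> = (1/h) \<integral>\<^sub>0\<^sup>h v (\<cdot> + s) ds\<close> is
  admissible, and \<open>(b v, (v (\<cdot> + h) - v) / h)\<close> is at most half the Lipschitz constant of \<open>b\<close>
  times the squared norm of \<open>v\<close>. Letting \<open>h\<close> tend to \<open>0\<close> gives \<open>A (v, v) \<le> C (v, v)\<close>,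
  and \<open>v = 0\<close> after an exponential weight in time has been introduced.

  Existence: smooth functions \<open>\<psi>\<close> satisfy an energy estimate that controls \<open>\<psi>\<close> in \<open>C([0,T]; L\<^sup>2)\<close> and in
  \<open>L\<^sup>2(0,T; H\<^sup>1)\<close> by the terminal value and the residual of \<open>\<psi>\<close>. The pairs of terminal value and
  residual are dense, since an element orthogonal to all of them solves the adjoint equation with
  zero data and vanishes by the uniqueness argument with time reversed. Hence a solution is the limit of
  smooth functions, and it inherits the continuity in time.
\<close>

section \<open>Smooth functions and test functions\<close>

text \<open>The coefficient \<open>b\<close> may jump across the interfaces, so multiplication by
  \<open>b\<close> or \<rho> destroys the weak x-derivative, and the equation gives no time
  derivative of v itself. Instead of controlling a time derivative of \<open>b\<close> v in a dual
  space, the proof works with translations in time: they commute with the weak x-derivative and see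
  \<open>b\<close> only through its Lipschitz bound in that direction. Everything lives in the
  Hilbert space \<open>l2\<close> of classes on the whole plane. Functions on the strip are extended
  by zero, which is harmless for x-derivatives because the boundary of the strip is parallel to the
  x-axis. Two gaps have to be closed. A weak solution is tested only by functions that vanish near t
  = T, whereas uniqueness with time reversed needs tests free of that restriction; a time cut-off
  costs an error of size n on a layer of width 2/n, and continuity in time together with the zero
  terminal value of a difference removes it. And the dual of \<open>X\<close> is not modelled:
  residuals are pairs in L^2 modulo the annihilator of \<open>X\<close>.\<close>

lemma frechet_derivative_eqI:
  assumes "(f has_derivative f') (at x)"
  shows "frechet_derivative f (at x) = f'"
  using frechet_derivative_at[OF assms] by simp

text \<open>\<open>frechet_derivative\<close> is a chosen value; the existential form lets each
  closure property below supply its own derivative formula.\<close>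

lemma Ck_Suc_iff:
  "Ck (Suc k) f \<longleftrightarrow> (\<exists>f'. (\<forall>x. (f has_derivative f' x) (at x)) \<and> (\<forall>v. Ck k (\<lambda>x. f' x v)))"
proof
  assume "Ck (Suc k) f"
  then show "\<exists>f'. (\<forall>x. (f has_derivative f' x) (at x)) \<and> (\<forall>v. Ck k (\<lambda>x. f' x v))"
    by (intro exI[of _ "\<lambda>x. frechet_derivative f (at x)"]) (auto simp: frechet_derivative_works[symmetric])
next
  assume "\<exists>f'. (\<forall>x. (f has_derivative f' x) (at x)) \<and> (\<forall>v. Ck k (\<lambda>x. f' x v))"
  then obtain f' where f': "\<And>x. (f has_derivative f' x) (at x)" "\<And>v. Ck k (\<lambda>x. f' x v)"
    by blast
  have "frechet_derivative f (at x) = f' x" for x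
    using f'(1) by (rule frechet_derivative_eqI)
  then show "Ck (Suc k) f"
    using f' by (auto simp: differentiable_def)
qed

lemma Ck_SucI:
  assumes "\<And>x. (f has_derivative f' x) (at x)" "\<And>v. Ck k (\<lambda>x. f' x v)"
  shows "Ck (Suc k) f"
  unfolding Ck_Suc_iff using assms by blast

lemma Ck_SucE:
  assumes "Ck (Suc k) f"
  obtains f' where "\<And>x. (f has_derivative f' x) (at x)" "\<And>v. Ck k (\<lambda>x. f' x v)"
  using assms unfolding Ck_Suc_iff by blast

lemma Ck_imp_continuous:
  assumes "Ck k f"
  shows "continuous_on UNIV f"
proof (cases k)
  case (Suc n)
  with assms have "f differentiable (at x)" for x by simp
  then show ?thesis
    using differentiable_imp_continuous_within continuous_on_eq_continuous_within by blast
qed (use assms in auto)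

lemma Ck_mono1: "Ck (Suc k) f \<Longrightarrow> Ck k f"
proof (induction k arbitrary: f)
  case 0
  then show ?case using Ck_imp_continuous[of "Suc 0" f] by simp
next
  case (Suc k)
  from Suc.prems obtain f' where "\<And>x. (f has_derivative f' x) (at x)" "\<And>v. Ck (Suc k) (\<lambda>x. f' x v)"
    by (rule Ck_SucE) blast
  then show ?case by (intro Ck_SucI) (auto intro: Suc.IH simp del: Ck.simps)
qed

lemma Ck_const [simp]: "Ck k (\<lambda>x. c)"
proof (induction k arbitrary: c)
  case (Suc k)
  show ?case by (rule Ck_SucI[where f' = "\<lambda>_ _. 0"]) (auto intro: Suc)
qed auto

lemma Ck_add: "Ck k f \<Longrightarrow> Ck k g \<Longrightarrow> Ck k (\<lambda>x. f x + g x)"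
proof (induction k arbitrary: f g)
  case 0
  then show ?case by (auto intro: continuous_intros)
next
  case (Suc k)
  obtain f' g' where "\<And>x. (f has_derivative f' x) (at x)" "\<And>v. Ck k (\<lambda>x. f' x v)"
    and "\<And>x. (g has_derivative g' x) (at x)" "\<And>v. Ck k (\<lambda>x. g' x v)"
    using Suc.prems by (auto elim!: Ck_SucE simp del: Ck.simps)
  then show ?case
    by (intro Ck_SucI[where f' = "\<lambda>x v. f' x v + g' x v"]) (auto intro!: derivative_intros Suc.IH)
qed

lemma Ck_mult: "Ck k f \<Longrightarrow> Ck k g \<Longrightarrow> Ck k (\<lambda>x. f x * g x)"
proof (induction k arbitrary: f g)
  case 0
  then show ?case by (auto intro: continuous_intros)
next
  case (Suc k)
  obtain f' g' where *: "\<And>x. (f has_derivative f' x) (at x)" "\<And>v. Ck k (\<lambda>x. f' x v)"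
    "\<And>x. (g has_derivative g' x) (at x)" "\<And>v. Ck k (\<lambda>x. g' x v)"
    using Suc.prems by (auto elim!: Ck_SucE simp del: Ck.simps)
  have "Ck k f" "Ck k g"
    using Suc.prems by (auto intro: Ck_mono1 simp del: Ck.simps)
  with * show ?case
    by (intro Ck_SucI[where f' = "\<lambda>x v. f x * g' x v + f' x v * g x"])
      (auto intro!: has_derivative_mult Ck_add Suc.IH)
qed

lemma Ck_cmult: "Ck k f \<Longrightarrow> Ck k (\<lambda>x. c * f x)"
  by (rule Ck_mult[OF Ck_const])

lemma Ck_inverse:
  assumes "\<And>x. f x \<noteq> 0"
  shows "Ck k f \<Longrightarrow> Ck k (\<lambda>x. inverse (f x))"
proof (induction k)
  case 0
  with assms show ?case by (auto intro!: continuous_intros)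
next
  case (Suc k)
  obtain f' where *: "\<And>x. (f has_derivative f' x) (at x)" "\<And>v. Ck k (\<lambda>x. f' x v)"
    using Suc.prems by (auto elim!: Ck_SucE simp del: Ck.simps)
  have k: "Ck k (\<lambda>x. inverse (f x))"
    using Suc by (auto intro: Ck_mono1 simp del: Ck.simps)
  show ?case
  proof (rule Ck_SucI[where f' = "\<lambda>x v. (-1) * (inverse (f x) * f' x v * inverse (f x))"])
    show "((\<lambda>x. inverse (f x)) has_derivative (\<lambda>v. (-1) * (inverse (f x) * f' x v * inverse (f x)))) (at x)" for x
      using Deriv.has_derivative_inverse[OF assms *(1), of x] by simp
    show "Ck k (\<lambda>x. - 1 * (inverse (f x) * f' x v * inverse (f x)))" for v
      by (intro Ck_cmult Ck_mult k *)
  qed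
qed

lemma Ck_affine:
  assumes "bounded_linear L"
  shows "Ck k f \<Longrightarrow> Ck k (\<lambda>x. f (c + L x))"
proof (induction k arbitrary: f)
  case 0
  have "continuous_on UNIV (\<lambda>x. c + L x)"
    by (intro continuous_intros linear_continuous_on assms)
  with 0 show ?case
    using continuous_on_compose2[of UNIV f UNIV "\<lambda>x. c + L x"] by auto
next
  case (Suc k)
  obtain f' where *: "\<And>x. (f has_derivative f' x) (at x)" "\<And>v. Ck k (\<lambda>x. f' x v)"
    using Suc.prems by (auto elim!: Ck_SucE simp del: Ck.simps)
  show ?case
  proof (rule Ck_SucI[where f' = "\<lambda>x v. f' (c + L x) (L v)"])
    have "((\<lambda>x. c + L x) has_derivative L) (at x)" for x
      using has_derivative_add[OF has_derivative_const bounded_linear_imp_has_derivative[OF assms]] by simp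
    then show "((\<lambda>x. f (c + L x)) has_derivative (\<lambda>v. f' (c + L x) (L v))) (at x)" for x
      by (rule has_derivative_compose) (rule *)
    show "Ck k (\<lambda>x. f' (c + L x) (L v))" for v
      using Suc.IH[OF *(2)[of "L v"]] .
  qed
qed

lemma Ck_prod:
  "(\<And>i. i \<in> S \<Longrightarrow> Ck k (f i)) \<Longrightarrow> Ck k (\<lambda>x. \<Prod>i\<in>S. f i x)"
  by (induction S rule: infinite_finite_induct) (auto intro!: Ck_mult)

lemma Ck_real_SucI:
  fixes f :: "real \<Rightarrow> real"
  assumes "\<And>x. (f has_real_derivative f' x) (at x)" "Ck k f'"
  shows "Ck (Suc k) f"
  using assms by (intro Ck_SucI[where f' = "\<lambda>x v. f' x * v"])
    (auto simp: has_field_derivative_def intro!: Ck_mult)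

lemma Ck_exp_real: "Ck k (exp :: real \<Rightarrow> real)"
proof (induction k)
  case (Suc k)
  show ?case by (rule Ck_real_SucI[OF DERIV_exp Suc])
qed (auto intro: continuous_intros)

text \<open>The derivatives of \<open>exp (-1/x)\<close> have the form \<open>p (1/x) exp (-1/x)\<close> with a polynomial \<open>p\<close>.\<close>

definition flat :: "real poly \<Rightarrow> real \<Rightarrow> real" where
  "flat p x = (if x > 0 then poly p (1/x) * exp (- 1/x) else 0)"

text \<open>Substituting y = 1/x leaves a polynomial times exp (-y) at infinity, handled monomial by
  monomial.\<close>

lemma flat_at_right: "(flat p \<longlongrightarrow> 0) (at_right 0)"
proof -
  have mon: "((\<lambda>y::real. c * y ^ n * exp (- y)) \<longlongrightarrow> 0) at_top" for c n
    using tendsto_mult[OF tendsto_const[of c] tendsto_power_div_exp_0[of n]]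
    by (simp add: exp_minus field_simps)
  have "((\<lambda>y. \<Sum>i\<le>degree p. coeff p i * y ^ i * exp (- y)) \<longlongrightarrow> (\<Sum>i\<le>degree p. 0)) at_top"
    by (intro tendsto_sum mon)
  then have "((\<lambda>y. poly p y * exp (- y)) \<longlongrightarrow> 0) at_top"
    by (simp add: poly_altdef sum_distrib_right)
  then have "((\<lambda>x. poly p (inverse x) * exp (- inverse x)) \<longlongrightarrow> 0) (at_right 0)"
    by (rule filterlim_compose[OF _ filterlim_inverse_at_top_right])
  then show ?thesis
    by (rule Lim_transform_eventually)
      (auto simp: flat_def eventually_at_filter field_simps)
qed

text \<open>For x > 0 the chain rule gives x^(-2) (p - p')(1/x) exp (-1/x); the two
  \<open>pCons 0\<close> account for the factor x^(-2).\<close>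

lemma flat_has_derivative:
  "(flat p has_real_derivative flat (pCons 0 (pCons 0 (p - pderiv p))) x) (at x)"
proof (cases x "0::real" rule: linorder_cases)
  case less
  have "(flat p has_real_derivative 0) (at x)"
    by (rule DERIV_cong_ev[THEN iffD2, OF refl _ refl DERIV_const[of 0]])
      (use less in \<open>auto simp: flat_def intro!: eventually_mono[OF order_tendstoD(2)[OF tendsto_ident_at less]] 
        simp: eventually_nhds intro!: exI[of _ "{..<0}"]\<close>)
  with less show ?thesis by (simp add: flat_def)
next
  case greater
  have "((\<lambda>x. poly p (1/x) * exp (- 1/x)) has_real_derivative
      poly p (1/x) * (exp (- 1/x) * (1 / x\<^sup>2)) + poly (pderiv p) (1/x) * (- 1 / x\<^sup>2) * exp (- 1/x)) (at x)"
    using greater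
    by (auto intro!: derivative_eq_intros DERIV_chain2[OF poly_DERIV] simp: power2_eq_square)
  moreover have "\<forall>\<^sub>F y in nhds x. flat p y = poly p (1/y) * exp (- 1/y)"
    using greater by (auto simp: flat_def eventually_nhds intro!: exI[of _ "{0<..}"])
  ultimately have "(flat p has_real_derivative
      poly p (1/x) * (exp (- 1/x) * (1 / x\<^sup>2)) + poly (pderiv p) (1/x) * (- 1 / x\<^sup>2) * exp (- 1/x)) (at x)"
    by (subst DERIV_cong_ev[OF refl _ refl])
  with greater show ?thesis
    by (simp add: flat_def power2_eq_square field_simps)
next
  case equal
  \<comment> \<open>Division by h is one more factor of the variable, so from the right the
    difference quotient is again a flat function and tends to 0.\<close>
  have "((\<lambda>h. flat p h / h) \<longlongrightarrow> 0) (at_right 0)"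
    by (rule Lim_transform_eventually[OF flat_at_right[of "pCons 0 p"]])
      (auto simp: flat_def eventually_at_filter field_simps)
  moreover have "((\<lambda>h. flat p h / h) \<longlongrightarrow> 0) (at_left 0)"
    by (rule Lim_transform_eventually[OF tendsto_const])
      (auto simp: flat_def eventually_at_filter)
  ultimately have "((\<lambda>h. flat p h / h) \<longlongrightarrow> 0) (at 0)"
    by (simp add: filterlim_split_at)
  then show ?thesis
    using equal by (simp add: DERIV_def flat_def)
qed

lemma Ck_flat: "Ck k (flat p)"
proof (induction k arbitrary: p)
  case 0
  show ?case
    using DERIV_continuous_on[of UNIV "flat p", OF flat_has_derivative] by simp
next
  case (Suc k)
  show ?case by (rule Ck_real_SucI[OF flat_has_derivative Suc])
qed

text \<open>The classical transition from 0 on x \<le> 0 to 1 on x \<ge> 1; the denominator never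
  vanishes since x or 1 - x is positive. The cut-offs below are built from it.\<close>

definition smooth_step :: "real \<Rightarrow> real" where
  "smooth_step x = flat 1 x * inverse (flat 1 x + flat 1 (1 - x))"

lemma flat_one_pos: "0 < x \<Longrightarrow> flat 1 x > 0" "x \<le> 0 \<Longrightarrow> flat 1 x = 0"
  by (auto simp: flat_def)

lemma flat_one_nonneg: "flat 1 x \<ge> 0"
  by (auto simp: flat_def)

lemma flat_one_sum_pos: "flat 1 x + flat 1 (1 - x) > 0"
proof (cases "0 < x")
  case True
  then show ?thesis by (intro add_pos_nonneg flat_one_pos flat_one_nonneg)
next
  case False
  then show ?thesis by (intro add_nonneg_pos flat_one_pos flat_one_nonneg) auto
qed

lemma Ck_smooth_step: "Ck k smooth_step"
proof -
  have "Ck k (\<lambda>x::real. flat 1 (1 + (- x)))"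
    by (rule Ck_affine[OF _ Ck_flat]) (intro bounded_linear_minus bounded_linear_ident)
  then show ?thesis
    unfolding smooth_step_def[abs_def] using flat_one_sum_pos
    by (intro Ck_mult Ck_inverse Ck_add Ck_flat) (auto simp: less_imp_neq[symmetric])
qed

lemma smooth_step_simps:
  "x \<le> 0 \<Longrightarrow> smooth_step x = 0" "1 \<le> x \<Longrightarrow> smooth_step x = 1"
  "0 \<le> smooth_step x" "smooth_step x \<le> 1"
  "0 < x \<Longrightarrow> 0 < smooth_step x"
  using flat_one_sum_pos[of x] flat_one_nonneg[of x] flat_one_nonneg[of "1 - x"] flat_one_pos[of x]
    flat_one_pos(2)[of "1 - x"]
  by (auto simp: smooth_step_def field_simps zero_less_mult_iff)

section \<open>Smooth functions, directional derivatives and test functions\<close>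

definition smooth :: "('a::real_normed_vector \<Rightarrow> real) \<Rightarrow> bool" where
  "smooth f \<longleftrightarrow> (\<forall>k. Ck k f)"

lemma smooth_const [simp]: "smooth (\<lambda>x. c)"
  and smooth_add: "smooth f \<Longrightarrow> smooth g \<Longrightarrow> smooth (\<lambda>x. f x + g x)"
  and smooth_mult: "smooth f \<Longrightarrow> smooth g \<Longrightarrow> smooth (\<lambda>x. f x * g x)"
  and smooth_prod: "(\<And>i. i \<in> S \<Longrightarrow> smooth (F i)) \<Longrightarrow> smooth (\<lambda>x. \<Prod>i\<in>S. F i x)"
  and smooth_exp: "smooth (exp :: real \<Rightarrow> real)"
  and smooth_smooth_step: "smooth smooth_step"
  unfolding smooth_def
  by (auto intro: Ck_add Ck_mult Ck_affine Ck_prod Ck_exp_real Ck_smooth_step simp del: Ck.simps)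

lemma smooth_affine: "bounded_linear L \<Longrightarrow> smooth h \<Longrightarrow> smooth (\<lambda>x. h (c + L x))"
  unfolding smooth_def by (auto intro: Ck_affine simp del: Ck.simps)

lemma smooth_has_derivative:
  assumes "smooth f"
  shows "(f has_derivative frechet_derivative f (at x)) (at x)"
proof -
  have "Ck (Suc 0) f" using assms by (auto simp: smooth_def simp del: Ck.simps)
  then show ?thesis by (auto simp: frechet_derivative_works[symmetric])
qed

definition dd :: "'a::real_normed_vector \<Rightarrow> ('a \<Rightarrow> real) \<Rightarrow> 'a \<Rightarrow> real" where
  "dd e f x = frechet_derivative f (at x) e"

lemma smooth_dd: "smooth f \<Longrightarrow> smooth (dd e f)"
  unfolding smooth_def dd_def[abs_def] using Ck.simps(2) by blast

lemma smooth_continuous: "smooth f \<Longrightarrow> continuous_on S f"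
  unfolding smooth_def using Ck_imp_continuous continuous_on_subset by (metis subset_UNIV)

lemma smooth_borel: "smooth f \<Longrightarrow> f \<in> borel_measurable borel"
  by (intro borel_measurable_continuous_onI smooth_continuous)

lemma dd_eqI: "(f has_derivative f') (at x) \<Longrightarrow> dd e f x = f' e"
  unfolding dd_def by (simp add: frechet_derivative_eqI)

lemma dd_add:
  assumes "smooth f" "smooth g"
  shows "dd e (\<lambda>x. f x + g x) x = dd e f x + dd e g x"
proof -
  have "((\<lambda>x. f x + g x) has_derivative (\<lambda>v. dd v f x + dd v g x)) (at x)"
    unfolding dd_def by (intro has_derivative_add smooth_has_derivative assms)
  then show ?thesis by (rule dd_eqI)
qed

lemma dd_diff:
  assumes "smooth f" "smooth g"
  shows "dd e (\<lambda>x. f x - g x) x = dd e f x - dd e g x"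
proof -
  have "((\<lambda>x. f x - g x) has_derivative (\<lambda>v. dd v f x - dd v g x)) (at x)"
    unfolding dd_def by (intro has_derivative_diff smooth_has_derivative assms)
  then show ?thesis by (rule dd_eqI)
qed

lemma dd_mult:
  assumes "smooth f" "smooth g"
  shows "dd e (\<lambda>x. f x * g x) x = f x * dd e g x + dd e f x * g x"
proof -
  have "((\<lambda>x. f x * g x) has_derivative (\<lambda>v. f x * dd v g x + dd v f x * g x)) (at x)"
    unfolding dd_def by (intro has_derivative_mult smooth_has_derivative assms)
  then show ?thesis by (rule dd_eqI)
qed

lemma dd_const [simp]: "dd e (\<lambda>x. c) x = 0"
  using dd_eqI[OF has_derivative_const] .

lemma dd_cmult: "smooth f \<Longrightarrow> dd e (\<lambda>x. c * f x) x = c * dd e f x"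
  using dd_mult[of "\<lambda>x. c" f e x] by simp

lemma dd_affine:
  assumes "bounded_linear L" "smooth h"
  shows "dd e (\<lambda>x. h (c + L x)) x = dd (L e) h (c + L x)"
proof -
  have "((\<lambda>x. c + L x) has_derivative L) (at x)"
    using has_derivative_add[OF has_derivative_const bounded_linear_imp_has_derivative[OF assms(1)]] by simp
  from dd_eqI[OF has_derivative_compose[OF this smooth_has_derivative[OF assms(2)]], where e=e]
  show ?thesis by (simp add: dd_def)
qed

lemma dd_scaleR: "smooth f \<Longrightarrow> dd (c *\<^sub>R e) f x = c * dd e f x"
  using linear_scale[OF has_derivative_linear[OF smooth_has_derivative], of f x c e] by (simp add: dd_def)

lemma dd_line:
  assumes "smooth f"
  shows "((\<lambda>s. f (x + s *\<^sub>R e)) has_real_derivative dd e f (x + s *\<^sub>R e)) (at s)"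
proof -
  have "((\<lambda>s. x + s *\<^sub>R e) has_derivative (\<lambda>s. s *\<^sub>R e)) (at s)"
    by (auto intro!: derivative_eq_intros)
  from has_derivative_compose[OF this smooth_has_derivative[OF assms]]
  have "((\<lambda>s. f (x + s *\<^sub>R e)) has_derivative (\<lambda>r. dd (r *\<^sub>R e) f (x + s *\<^sub>R e))) (at s)"
    by (simp add: dd_def)
  moreover have "(\<lambda>r. dd (r *\<^sub>R e) f (x + s *\<^sub>R e)) = (*) (dd e f (x + s *\<^sub>R e))"
    by (auto simp: dd_scaleR[OF assms])
  ultimately show ?thesis
    by (simp add: has_field_derivative_def)
qed

text \<open>Any compact set outside which the function vanishes may replace the closure of the
  support, so supports of sums, products and translates never have to be computed.\<close>

lemma test_functions_iff:
  "\<psi> \<in> test_functions \<Omega> \<longleftrightarrow> smooth \<psi> \<and> (\<exists>K. compact K \<and> K \<subseteq> \<Omega> \<and> (\<forall>x. x \<notin> K \<longrightarrow> \<psi> x = 0))"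
  (is "?L \<longleftrightarrow> ?R")
proof
  assume ?L
  then show ?R
    unfolding test_functions_def smooth_def
    using closure_subset[of "{x. \<psi> x \<noteq> 0}"] by blast
next
  assume ?R
  then obtain K where K: "smooth \<psi>" "compact K" "K \<subseteq> \<Omega>" "{x. \<psi> x \<noteq> 0} \<subseteq> K" by blast
  then have "closure {x. \<psi> x \<noteq> 0} \<subseteq> K"
    by (simp add: closure_minimal compact_imp_closed)
  moreover from this have "compact (closure {x. \<psi> x \<noteq> 0})"
    using K(2) closed_closure compact_Int_closed[of K "closure {x. \<psi> x \<noteq> 0}"]
    by (simp add: Int_absorb1)
  ultimately show ?L
    using K unfolding test_functions_def smooth_def by auto
qed

lemma test_functionsI:
  "smooth \<psi> \<Longrightarrow> compact K \<Longrightarrow> K \<subseteq> \<Omega> \<Longrightarrow> (\<And>x. x \<notin> K \<Longrightarrow> \<psi> x = 0) \<Longrightarrow> \<psi> \<in> test_functions \<Omega>"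
  unfolding test_functions_iff by blast

lemma test_functionsE:
  assumes "\<psi> \<in> test_functions \<Omega>"
  obtains K where "smooth \<psi>" "compact K" "K \<subseteq> \<Omega>" "\<And>x. x \<notin> K \<Longrightarrow> \<psi> x = 0"
proof -
  from assms obtain K where "smooth \<psi>" "compact K" "K \<subseteq> \<Omega>" "\<forall>x. x \<notin> K \<longrightarrow> \<psi> x = 0"
    unfolding test_functions_iff by blast
  then show thesis using that by blast
qed

lemma test_smooth: "\<psi> \<in> test_functions \<Omega> \<Longrightarrow> smooth \<psi>"
  unfolding test_functions_iff by blast

lemma test_mono: "\<psi> \<in> test_functions \<Omega> \<Longrightarrow> \<Omega> \<subseteq> \<Omega>' \<Longrightarrow> \<psi> \<in> test_functions \<Omega>'"
  unfolding test_functions_iff by blast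

lemma test_UNIV: "\<psi> \<in> test_functions \<Omega> \<Longrightarrow> \<psi> \<in> test_functions UNIV"
  by (rule test_mono) auto

lemma test_zero [simp]: "(\<lambda>x. 0) \<in> test_functions \<Omega>"
  by (rule test_functionsI[of _ "{}"]) auto

lemma test_mult: "\<psi> \<in> test_functions \<Omega> \<Longrightarrow> smooth f \<Longrightarrow> (\<lambda>x. f x * \<psi> x) \<in> test_functions \<Omega>"
  by (erule test_functionsE, rule test_functionsI) (auto intro: smooth_mult)

lemma test_cmult: "\<psi> \<in> test_functions \<Omega> \<Longrightarrow> (\<lambda>x. c * \<psi> x) \<in> test_functions \<Omega>"
  by (erule test_mult) simp

lemma test_add:
  assumes "\<psi> \<in> test_functions \<Omega>" "\<phi> \<in> test_functions \<Omega>"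
  shows "(\<lambda>x. \<psi> x + \<phi> x) \<in> test_functions \<Omega>"
proof -
  obtain K K' where "compact K" "K \<subseteq> \<Omega>" "\<And>x. x \<notin> K \<Longrightarrow> \<psi> x = 0"
    "compact K'" "K' \<subseteq> \<Omega>" "\<And>x. x \<notin> K' \<Longrightarrow> \<phi> x = 0"
    using assms by (auto elim!: test_functionsE)
  then show ?thesis
    using assms by (intro test_functionsI[of _ "K \<union> K'"]) (auto intro: smooth_add test_smooth)
qed

lemma test_diff:
  "\<psi> \<in> test_functions \<Omega> \<Longrightarrow> \<phi> \<in> test_functions \<Omega> \<Longrightarrow> (\<lambda>x. \<psi> x - \<phi> x) \<in> test_functions \<Omega>"
  using test_add[OF _ test_cmult[of \<phi> \<Omega> "-1"], of \<psi>] by simp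

lemma test_dd: assumes "\<psi> \<in> test_functions \<Omega>" shows "dd e \<psi> \<in> test_functions \<Omega>"
proof -
  from assms obtain K where K: "smooth \<psi>" "compact K" "K \<subseteq> \<Omega>" "\<And>x. x \<notin> K \<Longrightarrow> \<psi> x = 0"
    by (rule test_functionsE) blast
  show ?thesis
  proof (rule test_functionsI[OF smooth_dd K(2,3)])
    fix x assume x: "x \<notin> K"
    have "(\<psi> has_derivative (\<lambda>_. 0)) (at x)"
    proof (rule has_derivative_transform_within_open[of "\<lambda>_. 0" _ x UNIV "- K"])
      show "open (- K)" using K(2) by (auto intro: compact_imp_closed)
    qed (use x K(4) in auto)
    then show "dd e \<psi> x = 0" by (rule dd_eqI)
  qed fact
qed

lemma test_shift:
  assumes "\<psi> \<in> test_functions \<Omega>" "\<And>y. y \<in> \<Omega> \<Longrightarrow> y - a \<in> \<Omega>'"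
  shows "(\<lambda>x. \<psi> (x + a)) \<in> test_functions \<Omega>'"
proof -
  from assms(1) obtain K where K: "smooth \<psi>" "compact K" "K \<subseteq> \<Omega>" "\<And>x. x \<notin> K \<Longrightarrow> \<psi> x = 0"
    by (rule test_functionsE) blast
  have "smooth (\<lambda>x. \<psi> (a + x))"
    by (rule smooth_affine[OF bounded_linear_ident K(1)])
  then show ?thesis
  proof (intro test_functionsI)
    show "compact ((\<lambda>y. y - a) ` K)"
      by (intro compact_continuous_image continuous_intros K)
    show "(\<lambda>y. y - a) ` K \<subseteq> \<Omega>'" using K assms by auto
    show "\<psi> (x + a) = 0" if "x \<notin> (\<lambda>y. y - a) ` K" for x
      using that by (intro K(4)) (auto simp: image_iff)
  qed (simp add: add.commute)
qed

lemma dd_shift: "smooth \<psi> \<Longrightarrow> dd e (\<lambda>x. \<psi> (x + a)) x = dd e \<psi> (x + a)"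
  using dd_affine[OF bounded_linear_ident, where h=\<psi> and e=e and c=a and x=x] by (simp add: add.commute)

lemma test_bounded:
  assumes "\<psi> \<in> test_functions \<Omega>"
  obtains C where "C > 0" "\<And>x. \<bar>\<psi> x\<bar> \<le> C"
proof -
  from assms obtain K where K: "smooth \<psi>" "compact K" "K \<subseteq> \<Omega>" "\<And>x. x \<notin> K \<Longrightarrow> \<psi> x = 0"
    by (rule test_functionsE) blast
  have "bounded (\<psi> ` K)"
    by (intro compact_imp_bounded compact_continuous_image smooth_continuous K)
  then obtain C where C: "C > 0" "\<And>x. x \<in> K \<Longrightarrow> \<bar>\<psi> x\<bar> \<le> C"
    unfolding bounded_pos by auto
  then have "\<bar>\<psi> x\<bar> \<le> C" for x using K(4)[of x] by (cases "x \<in> K") auto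
  with C that show ?thesis by blast
qed

section \<open>Smooth approximation of box indicators and the fundamental lemma of the calculus of
  variations\<close>

definition box_bump :: "'a::euclidean_space \<Rightarrow> 'a \<Rightarrow> nat \<Rightarrow> 'a \<Rightarrow> real" where
  "box_bump a b n x =
     (\<Prod>i\<in>Basis. smooth_step (real n * (x \<bullet> i - a \<bullet> i)) * smooth_step (real n * (b \<bullet> i - x \<bullet> i)))"

lemma smooth_step_scaled: "smooth (\<lambda>x. smooth_step (c + r * (x \<bullet> i)))"
  using smooth_affine[of "\<lambda>x. r * (x \<bullet> i)" smooth_step c, OF _ smooth_smooth_step]
    bounded_linear_const_mult[OF bounded_linear_inner_left, of r i]
  by simp

lemma box_bump_test: "box_bump a b n \<in> test_functions UNIV"
  "cbox a b \<subseteq> \<Omega> \<Longrightarrow> box_bump a b n \<in> test_functions \<Omega>"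
proof -
  have "smooth (\<lambda>x. smooth_step (real n * (x \<bullet> i - a \<bullet> i)) * smooth_step (real n * (b \<bullet> i - x \<bullet> i)))" for i
    using smooth_mult[OF smooth_step_scaled[of "- real n * (a \<bullet> i)" "real n" i]
        smooth_step_scaled[of "real n * (b \<bullet> i)" "- real n" i]]
    by (simp add: algebra_simps)
  then have smo: "smooth (box_bump a b n)"
    unfolding box_bump_def[abs_def] by (intro smooth_prod)
  have zero: "box_bump a b n x = 0" if "x \<notin> cbox a b" for x
  proof -
    from that obtain i where i: "i \<in> Basis" "x \<bullet> i < a \<bullet> i \<or> b \<bullet> i < x \<bullet> i"
      by (auto simp: mem_box not_le)
    then have "smooth_step (real n * (x \<bullet> i - a \<bullet> i)) * smooth_step (real n * (b \<bullet> i - x \<bullet> i)) = 0"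
      by (auto intro!: smooth_step_simps mult_nonneg_nonpos)
    with i(1) show ?thesis
      unfolding box_bump_def by (intro prod_zero) auto
  qed
  from smo zero show "cbox a b \<subseteq> \<Omega> \<Longrightarrow> box_bump a b n \<in> test_functions \<Omega>"
    by (intro test_functionsI[OF _ compact_cbox])
  from smo zero show "box_bump a b n \<in> test_functions UNIV"
    by (intro test_functionsI[OF _ compact_cbox]) auto
qed

lemma box_bump_le: "\<bar>box_bump a b n x\<bar> \<le> 1"
  unfolding box_bump_def abs_prod
  by (intro prod_le_1) (auto simp: abs_mult smooth_step_simps intro!: mult_le_one)

lemma box_bump_le_indicator: "\<bar>box_bump a b n x\<bar> \<le> indicator (cbox a b) x"
proof (cases "x \<in> cbox a b")
  case False
  then obtain i where i: "i \<in> Basis" "x \<bullet> i < a \<bullet> i \<or> b \<bullet> i < x \<bullet> i"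
    by (auto simp: mem_box not_le)
  then have "smooth_step (real n * (x \<bullet> i - a \<bullet> i)) * smooth_step (real n * (b \<bullet> i - x \<bullet> i)) = 0"
    by (auto intro!: smooth_step_simps mult_nonneg_nonpos)
  with i(1) have "box_bump a b n x = 0"
    unfolding box_bump_def by (intro prod_zero) auto
  then show ?thesis by simp
qed (use box_bump_le[of a b n x] in auto)

lemma smooth_step_scale_tendsto:
  "(\<lambda>n. smooth_step (real n * y)) \<longlonglongrightarrow> (if y > 0 then 1 else 0)"
proof (cases "y > 0")
  case True
  have "\<forall>\<^sub>F n in sequentially. smooth_step (real n * y) = 1"
    using eventually_ge_at_top[of "nat \<lceil>1 / y\<rceil>"]
  proof eventually_elim
    case (elim n)
    then have "1 / y \<le> real n" by linarith
    with True have "1 \<le> real n * y" by (simp add: field_simps)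
    then show ?case by (rule smooth_step_simps)
  qed
  with True show ?thesis by (simp add: tendsto_eventually)
next
  case False
  then have "smooth_step (real n * y) = 0" for n
    by (intro smooth_step_simps mult_nonneg_nonpos) auto
  with False show ?thesis by simp
qed

lemma box_bump_tendsto: "(\<lambda>n. box_bump a b n x) \<longlonglongrightarrow> indicator (box a b) x"
proof -
  have "indicator (box a b) x =
    (\<Prod>i\<in>Basis. (if x \<bullet> i - a \<bullet> i > 0 then 1 else 0) * (if b \<bullet> i - x \<bullet> i > 0 then 1 else 0) :: real)"
    by (auto simp: indicator_def mem_box prod_zero_iff)
  then show ?thesis
    unfolding box_bump_def by (auto intro!: tendsto_prod tendsto_mult smooth_step_scale_tendsto simp only:)
qed

lemma box_Int_box_ex:
  fixes a b a' b' :: "'a::euclidean_space"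
  shows "\<exists>c d. box a b \<inter> box a' b' = box c d"
  unfolding box_Int_box by blast

text \<open>Open boxes generate the Borel sets and are closed under intersection, so vanishing of
  the integrals spreads to all Borel sets; the set where \<open>g\<close> is positive and its
  complement then force \<open>g\<close> to vanish.\<close>

lemma AE_zero_if_box_integrals_zero:
  fixes g :: "'a::euclidean_space \<Rightarrow> real"
  assumes g: "integrable lborel g"
    and zero: "\<And>a b. (LINT x|lborel. indicator (box a b) x * g x) = 0"
  shows "AE x in lborel. g x = 0"
proof -
  have ind: "integrable lborel (\<lambda>x. indicator A x * g x)" if "A \<in> sets borel" for A
    using integrable_mult_indicator[OF _ g, of A] that by simp
  \<comment> \<open>Closure under complements needs the integral over the whole space, which is
    exhausted by centred cubes.\<close>
  have UNIV0: "(LINT x|lborel. g x) = 0"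
  proof -
    let ?B = "\<lambda>n. box (- (real n *\<^sub>R One)) (real n *\<^sub>R One) :: 'a set"
    have "(\<lambda>n. LINT x|lborel. indicator (?B n) x * g x) \<longlonglongrightarrow> (LINT x|lborel. g x)"
    proof (rule integral_dominated_convergence[where w = "\<lambda>x. \<bar>g x\<bar>"])
      show "AE x in lborel. (\<lambda>n. indicator (?B n) x * g x) \<longlonglongrightarrow> g x"
      proof (rule AE_I2, rule tendsto_eventually)
        fix x :: 'a
        obtain N where N: "\<bar>x \<bullet> i\<bar> < real N" if "i \<in> Basis" for i
        proof -
          obtain N where "norm x < real N" using reals_Archimedean2 by blast
          then show ?thesis using that[of N] Basis_le_norm[of _ x] by force
        qed
        have "indicator (?B n) x * g x = g x" if "n \<ge> N" for n
          using N that by (force simp: indicator_def mem_box abs_less_iff)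
        then show "\<forall>\<^sub>F n in sequentially. indicator (?B n) x * g x = g x"
          unfolding eventually_sequentially by blast
      qed
      show "AE x in lborel. norm (indicator (?B n) x * g x) \<le> \<bar>g x\<bar>" for n
        by (auto simp: indicator_def)
    qed (use g in auto)
    then show ?thesis using zero by (simp add: LIMSEQ_const_iff)
  qed
  have stable: "Int_stable (range (\<lambda>(a, b). box a b :: 'a set))" "range (\<lambda>(a, b). box a b :: 'a set) \<subseteq> Pow UNIV"
    unfolding Int_stable_def by (auto simp: image_iff) (metis box_Int_box_ex)
  have all: "(LINT x|lborel. indicator A x * g x) = 0" if "A \<in> sets borel" for A
  proof -
    have "A \<in> sigma_sets UNIV (range (\<lambda>(a, b). box a b))"
      using that by (simp add: borel_eq_box)
    from stable this show ?thesis
    proof (induction rule: sigma_sets_induct_disjoint)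
      case (compl A)
      then have A: "A \<in> sets borel" by (simp add: borel_eq_box)
      have "(LINT x|lborel. indicator (UNIV - A) x * g x) = (LINT x|lborel. g x - indicator A x * g x)"
        by (intro Bochner_Integration.integral_cong) (auto simp: indicator_def)
      also have "\<dots> = 0"
        using compl UNIV0 by (subst Bochner_Integration.integral_diff[OF g ind[OF A]]) auto
      finally show ?case .
    next
      case (union A)
      then have A: "A i \<in> sets borel" for i by (auto simp: borel_eq_box)
      have "(\<lambda>n. LINT x|lborel. indicator (\<Union>i<n. A i) x * g x) \<longlonglongrightarrow> (LINT x|lborel. indicator (\<Union>i. A i) x * g x)"
      proof (rule integral_dominated_convergence[where w = "\<lambda>x. \<bar>g x\<bar>"])
        show "AE x in lborel. (\<lambda>n. indicator (\<Union>i<n. A i) x * g x) \<longlonglongrightarrow> indicator (\<Union>i. A i) x * g x"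
          by (intro AE_I2 tendsto_mult_right LIMSEQ_indicator_UN)
        show "AE x in lborel. norm (indicator (\<Union>i<n. A i) x * g x) \<le> \<bar>g x\<bar>" for n
          by (auto simp: indicator_def)
      qed (use g A in auto)
      moreover have "(LINT x|lborel. indicator (\<Union>i<n. A i) x * g x) = 0" for n
      proof -
        have "indicator (\<Union>i<n. A i) x = (\<Sum>i<n. indicator (A i) x :: real)" for x
          by (rule indicator_UN_disjoint) (use union in \<open>auto intro: disjoint_family_on_mono\<close>)
        then have "(LINT x|lborel. indicator (\<Union>i<n. A i) x * g x) =
            (LINT x|lborel. (\<Sum>i<n. indicator (A i) x * g x))"
          by (simp add: sum_distrib_right)
        also have "\<dots> = (\<Sum>i<n. LINT x|lborel. indicator (A i) x * g x)"
          by (intro Bochner_Integration.integral_sum ind A)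
        finally show ?thesis using union by simp
      qed
      ultimately show ?case by (simp add: LIMSEQ_const_iff)
    qed (use zero in auto)
  qed
  define A where "A = {x. g x > 0}"
  have [measurable]: "g \<in> borel_measurable borel" using g by auto
  have A: "A \<in> sets borel" "- A \<in> sets borel" unfolding A_def by measurable
  have "(LINT x|lborel. indicator A x * g x) = 0" "(LINT x|lborel. - (indicator (- A) x * g x)) = 0"
    using all[OF A(1)] all[OF A(2)] by simp_all
  then have "AE x in lborel. indicator A x * g x = 0" "AE x in lborel. - (indicator (- A) x * g x) = 0"
    using integral_nonneg_eq_0_iff_AE[OF ind[OF A(1)]] 
      integral_nonneg_eq_0_iff_AE[OF integrable_minus[OF ind[OF A(2)]]]
    by (auto simp: indicator_def A_def)
  then show ?thesis
    by eventually_elim (auto simp: indicator_def split: if_splits)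
qed

text \<open>On a closed box inside \<Omega> the function is replaced by an integrable Borel
  representative, whose integrals over boxes are limits of integrals against
  \<open>box_bump\<close>. Countably many boxes cover \<Omega>.\<close>

lemma fundamental_lemma_variations:
  fixes f :: "'a::euclidean_space \<Rightarrow> real"
  assumes \<Omega>: "open \<Omega>" and f: "locally_integrable \<Omega> f"
    and zero: "\<And>\<psi>. \<psi> \<in> test_functions \<Omega> \<Longrightarrow> (LINT x:\<Omega>|lebesgue. f x * \<psi> x) = 0"
  shows "AE x in lebesgue. x \<in> \<Omega> \<longrightarrow> f x = 0"
proof -
  have on_box: "AE x in lebesgue. x \<in> cbox c d \<longrightarrow> f x = 0" if cd: "cbox c d \<subseteq> \<Omega>" for c d
  proof -
    let ?f = "\<lambda>x. indicator (cbox c d) x * f x"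
    have int: "integrable lebesgue ?f"
      using f cd unfolding locally_integrable_def set_integrable_def by auto
    then obtain g where g: "g \<in> borel_measurable lborel" "AE x in lborel. ?f x = g x"
      using completion_ex_borel_measurable_real[of ?f lborel] by auto
    have AE: "AE x in lebesgue. ?f x = g x" using g(2) by (rule AE_completion)
    have intg: "integrable lebesgue g"
      using int AE g(1) by (subst integrable_cong_AE[of _ _ ?f]) (auto simp: measurable_completion)
    then have intg': "integrable lborel g" using g(1) by (simp add: integrable_completion)
    have "AE x in lborel. g x = 0"
    proof (rule AE_zero_if_box_integrals_zero[OF intg'])
      fix a b :: 'a
      obtain a' b' where ab: "box a b \<inter> box c d = box a' b'" using box_Int_box_ex by blast
      \<comment> \<open>The bumps converge to indicators of open boxes, so the frontier of the
        closed box is discarded as a null set.\<close>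
      have "AE x in lebesgue. x \<notin> cbox c d - box c d"
        using negligible_frontier_interval[of c d] by (intro AE_not_in) (simp add: negligible_iff_null_sets)
      with AE have AE': "AE x in lebesgue. indicator (box a b) x * g x = indicator (box a' b') x * f x"
        unfolding ab[symmetric]
        by eventually_elim (auto simp: indicator_def dest: box_subset_cbox[THEN subsetD] split: if_splits)
      have "(LINT x|lborel. indicator (box a b) x * g x) = (LINT x|lebesgue. indicator (box a b) x * g x)"
        using g(1) by (intro integral_completion[symmetric]) auto
      also have "\<dots> = 0"
      proof (cases "box a' b' = {}")
        case True
        with AE' show ?thesis by (intro integral_eq_zero_AE) auto
      next
        case False
        have sub: "cbox a' b' \<subseteq> cbox c d"
          using ab closure_mono[of "box a' b'" "box c d"] closure_box[OF False] closure_cbox[of c d]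
            closure_mono[of "box a' b'" "cbox c d"] box_subset_cbox[of c d] by (metis Int_lower2 order_trans)
        have bf: "f x * box_bump a' b' n x = ?f x * box_bump a' b' n x" for n x
          using sub box_bump_le_indicator[of a' b' n x] by (cases "x \<in> cbox a' b'") auto
        have meas: "box_bump a' b' n \<in> borel_measurable lebesgue" for n
          using smooth_borel[OF test_smooth[OF box_bump_test(1)]] by (intro measurable_completion) auto
        have ob: "indicator \<Omega> x *\<^sub>R (f x * box_bump a' b' n x) = f x * box_bump a' b' n x" for n x
          using sub cd box_bump_le_indicator[of a' b' n x] by (cases "x \<in> cbox a' b'") auto
        have bn: "(LINT x|lebesgue. ?f x * box_bump a' b' n x) = 0" for n
          using zero[OF box_bump_test(2)[of a' b' \<Omega> n]] sub cd
          unfolding set_lebesgue_integral_def bf[symmetric] ob by blast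
        have "(\<lambda>n. LINT x|lebesgue. ?f x * box_bump a' b' n x) \<longlonglongrightarrow> (LINT x|lebesgue. ?f x * indicator (box a' b') x)"
        proof (rule integral_dominated_convergence[where w = "\<lambda>x. \<bar>?f x\<bar>"])
          show "AE x in lebesgue. (\<lambda>n. ?f x * box_bump a' b' n x) \<longlonglongrightarrow> ?f x * indicator (box a' b') x"
            by (intro AE_I2 tendsto_mult_left box_bump_tendsto)
          show "AE x in lebesgue. norm (?f x * box_bump a' b' n x) \<le> \<bar>?f x\<bar>" for n
            using mult_left_mono[OF box_bump_le, of "\<bar>?f x\<bar>" a' b' n x for x] by (intro AE_I2) (simp add: abs_mult)
        qed (use borel_measurable_integrable[OF int] meas int in \<open>auto intro!: borel_measurable_times[of ?f]
          borel_measurable_indicator integrable_abs\<close>)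
        then have "(LINT x|lebesgue. ?f x * indicator (box a' b') x) = 0"
          using bn by (simp add: LIMSEQ_const_iff)
        also have "(LINT x|lebesgue. ?f x * indicator (box a' b') x) = (LINT x|lebesgue. indicator (box a b) x * g x)"
        proof (rule integral_cong_AE)
          show "(\<lambda>x. ?f x * indicator (box a' b') x) \<in> borel_measurable lebesgue"
            using borel_measurable_integrable[OF int]
            by (rule borel_measurable_times) (auto intro!: borel_measurable_indicator)
          show "(\<lambda>x. indicator (box a b) x * g x) \<in> borel_measurable lebesgue"
            using g(1) by (intro measurable_completion) auto
          show "AE x in lebesgue. ?f x * indicator (box a' b') x = indicator (box a b) x * g x"
            using AE' by eventually_elim
              (use sub box_subset_cbox[of a' b'] in \<open>auto simp: indicator_def split: if_splits\<close>)
        qed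
        finally show ?thesis .
      qed
      finally show "(LINT x|lborel. indicator (box a b) x * g x) = 0" .
    qed
    then have "AE x in lebesgue. g x = 0" by (rule AE_completion)
    with AE show ?thesis
      by eventually_elim (auto simp: indicator_def split: if_splits)
  qed
  obtain \<D> where D: "countable \<D>" "\<D> \<subseteq> Pow \<Omega>" "\<And>X. X \<in> \<D> \<Longrightarrow> \<exists>a b. X = cbox a b" "\<Union>\<D> = \<Omega>"
    using open_countable_Union_open_cbox[OF \<Omega>] by metis
  have "AE x in lebesgue. \<forall>X\<in>\<D>. x \<in> X \<longrightarrow> f x = 0"
    using D on_box by (subst AE_ball_countable) (auto, metis PowD subsetD)
  then show ?thesis
    by eventually_elim (use D(4) in auto)
qed

section \<open>Square integrable functions as a Hilbert space\<close>

text \<open>A minimising sequence for the distance to \<open>S\<close> is Cauchy by the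
  parallelogram law; minimality of the limit along each direction of \<open>S\<close> gives
  orthogonality.\<close>

lemma projection_exists:
  fixes S :: "'a::{real_inner, complete_space} set"
  assumes S: "subspace S" "closed S"
  shows "\<exists>p\<in>S. \<forall>s\<in>S. (x - p) \<bullet> s = 0"
proof -
  define D where "D = (\<lambda>s. (norm (x - s))\<^sup>2) ` S"
  have "0 \<in> S" using S(1) by (rule subspace_0)
  then have D: "D \<noteq> {}" "bdd_below D" unfolding D_def by (auto intro!: bdd_belowI[of _ 0])
  have low: "Inf D \<le> (norm (x - s))\<^sup>2" if "s \<in> S" for s
    using that D(2) unfolding D_def by (intro cInf_lower) auto
  have "\<exists>s\<in>S. (norm (x - s))\<^sup>2 < Inf D + 1 / real (Suc n)" for n
    using cInf_lessD[OF D(1), of "Inf D + 1 / real (Suc n)"] unfolding D_def by auto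
  then obtain y where y: "\<And>n. y n \<in> S" "\<And>n. (norm (x - y n))\<^sup>2 < Inf D + 1 / real (Suc n)"
    by metis
  \<comment> \<open>The midpoint of two members of the sequence stays in \<open>S\<close>, so its
    distance to x is not below the infimum; in the parallelogram identity this bounds the distance
    between the members.\<close>
  have par: "(norm (y m - y n))\<^sup>2 \<le> 2 / real (Suc m) + 2 / real (Suc n)" for m n
  proof -
    have "(norm (y m - y n))\<^sup>2 = 2 * (norm (x - y m))\<^sup>2 + 2 * (norm (x - y n))\<^sup>2
      - 4 * (norm (x - (1/2) *\<^sub>R (y m + y n)))\<^sup>2"
      by (simp add: power2_norm_eq_inner inner_diff inner_add algebra_simps inner_commute)
    moreover have "(1/2) *\<^sub>R (y m + y n) \<in> S"
      using y S(1) by (intro subspace_scale subspace_add)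
    ultimately show ?thesis using low[of "(1/2) *\<^sub>R (y m + y n)"] y(2)[of m] y(2)[of n] by simp
  qed
  have "Cauchy y"
  proof (rule CauchyI)
    fix e :: real assume "e > 0"
    then obtain N where N: "4 / e\<^sup>2 < real N" using reals_Archimedean2 by blast
    have "norm (y m - y n) < e" if "m \<ge> N" "n \<ge> N" for m n
    proof -
      have "2 / real (Suc m) \<le> 2 / real (Suc N)" "2 / real (Suc n) \<le> 2 / real (Suc N)"
        using that by (auto intro!: divide_left_mono)
      moreover have "4 / real (Suc N) < e\<^sup>2"
        using N \<open>e > 0\<close> by (simp add: field_simps) (smt (verit) zero_less_power)
      ultimately have "(norm (y m - y n))\<^sup>2 < e\<^sup>2" using par[of m n] by linarith
      then show ?thesis using \<open>e > 0\<close> by (simp add: power2_less_imp_less)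
    qed
    then show "\<exists>N. \<forall>m\<ge>N. \<forall>n\<ge>N. norm (y m - y n) < e" by blast
  qed
  then obtain p where p: "y \<longlonglongrightarrow> p"
    using Cauchy_convergent convergent_def by blast
  have "p \<in> S" using S(2) y(1) p by (auto simp: closed_sequential_limits)
  have "(norm (x - p))\<^sup>2 \<le> Inf D + 0"
  proof (rule LIMSEQ_le)
    show "(\<lambda>n. (norm (x - y n))\<^sup>2) \<longlonglongrightarrow> (norm (x - p))\<^sup>2" by (intro tendsto_intros p)
    show "(\<lambda>n. Inf D + 1 / real (Suc n)) \<longlonglongrightarrow> Inf D + 0"
      using LIMSEQ_inverse_real_of_nat by (intro tendsto_intros) (simp add: inverse_eq_divide)
  qed (use y(2) less_imp_le in blast)
  then have min: "(norm (x - p))\<^sup>2 \<le> (norm (x - s))\<^sup>2" if "s \<in> S" for s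
    using low[OF that] by linarith
  have "(x - p) \<bullet> s = 0" if s: "s \<in> S" for s
  proof (cases "s = 0")
    case False
    \<comment> \<open>The minimiser of the quadratic function that sends t to |x - p - t
      s|^2.\<close>
    define t where "t = (x - p) \<bullet> s / (s \<bullet> s)"
    have "p + t *\<^sub>R s \<in> S" using s \<open>p \<in> S\<close> S(1) by (intro subspace_scale subspace_add)
    from min[OF this, unfolded power2_norm_eq_inner] have "0 \<le> - 2 * t * ((x - p) \<bullet> s) + t\<^sup>2 * (s \<bullet> s)"
      by (simp add: inner_diff inner_add algebra_simps inner_commute power2_eq_square)
    also have "\<dots> = - ((x - p) \<bullet> s)\<^sup>2 / (s \<bullet> s)"
      using False by (simp add: t_def power2_eq_square field_simps)
    finally have "0 \<le> - ((x - p) \<bullet> s)\<^sup>2 / (s \<bullet> s)" .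
    moreover have "s \<bullet> s > 0" using False by (simp only: inner_gt_zero_iff) simp
    ultimately show ?thesis by (simp only: zero_le_divide_iff) (auto simp: not_le[symmetric])
  qed simp
  with \<open>p \<in> S\<close> show ?thesis by blast
qed

lemma subspace_closure_subspace:
  fixes S :: "'a::real_normed_vector set"
  assumes "subspace S"
  shows "subspace (closure S)"
proof (rule subspaceI)
  show "0 \<in> closure S" using assms closure_subset subspace_0 by blast
  show "x + y \<in> closure S" if "x \<in> closure S" "y \<in> closure S" for x y
    using that unfolding closure_sequential
    by clarify (metis (mono_tags, lifting) assms subspace_add tendsto_add)
  show "c *\<^sub>R x \<in> closure S" if "x \<in> closure S" for c x
    using that unfolding closure_sequential
    by clarify (metis (mono_tags, lifting) assms subspace_scale tendsto_scaleR tendsto_const)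
qed

text \<open>The difference between x and its projection onto the closure is orthogonal to
  \<open>S\<close>, hence zero.\<close>

lemma dense_if_orthogonal_trivial:
  fixes S :: "'a::{real_inner, complete_space} set"
  assumes S: "subspace S" and triv: "\<And>x. (\<And>s. s \<in> S \<Longrightarrow> x \<bullet> s = 0) \<Longrightarrow> x = 0"
  shows "closure S = UNIV"
proof -
  have "x \<in> closure S" for x
  proof -
    obtain p where p: "p \<in> closure S" "\<And>s. s \<in> closure S \<Longrightarrow> (x - p) \<bullet> s = 0"
      using projection_exists[OF subspace_closure_subspace[OF S] closed_closure] by blast
    have "x - p = 0" by (rule triv) (use p(2) closure_subset in blast)
    with p(1) show ?thesis by simp
  qed
  then show ?thesis by blast
qed

lemma continuous_linear_eq_on_closure:
  fixes F G :: "'a::real_normed_vector \<Rightarrow> 'b::real_normed_vector"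
  assumes "continuous_on UNIV F" "continuous_on UNIV G" "\<And>x. x \<in> S \<Longrightarrow> F x = G x" "x \<in> closure S"
  shows "F x = G x"
proof -
  obtain s where s: "\<And>n. s n \<in> S" "s \<longlonglongrightarrow> x" using assms(4) unfolding closure_sequential by blast
  have "(\<lambda>n. F (s n)) \<longlonglongrightarrow> F x" "(\<lambda>n. G (s n)) \<longlonglongrightarrow> G x"
    using assms(1,2) s(2) by (auto simp: continuous_on_eq_continuous_at intro: isCont_tendsto_compose)
  with assms(3) s(1) show ?thesis using LIMSEQ_unique by auto
qed

section \<open>Square integrable functions and fast convergence\<close>

lemma L2D: "f \<in> L2 M \<Longrightarrow> f \<in> borel_measurable M" "f \<in> L2 M \<Longrightarrow> integrable M (\<lambda>x. (f x)\<^sup>2)"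
  unfolding L2_def by auto

lemma L2I: "f \<in> borel_measurable M \<Longrightarrow> integrable M (\<lambda>x. (f x)\<^sup>2) \<Longrightarrow> f \<in> L2 M"
  unfolding L2_def by auto

lemma L2_mult_integrable:
  assumes "f \<in> L2 M" "g \<in> L2 M"
  shows "integrable M (\<lambda>x. f x * g x)"
proof (rule Bochner_Integration.integrable_bound)
  show "integrable M (\<lambda>x. (f x)\<^sup>2 + (g x)\<^sup>2)" using assms by (intro Bochner_Integration.integrable_add L2D(2))
  show "(\<lambda>x. f x * g x) \<in> borel_measurable M" using assms[THEN L2D(1)] by simp
  have "\<bar>a * b\<bar> \<le> a\<^sup>2 + b\<^sup>2" for a b :: real
    using sum_squares_bound[of "\<bar>a\<bar>" "\<bar>b\<bar>"] mult_nonneg_nonneg[of "\<bar>a\<bar>" "\<bar>b\<bar>"]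
    unfolding abs_mult power2_abs by linarith
  then show "AE x in M. norm (f x * g x) \<le> norm ((f x)\<^sup>2 + (g x)\<^sup>2)" by (auto intro!: AE_I2)
qed

lemma L2_add: "f \<in> L2 M \<Longrightarrow> g \<in> L2 M \<Longrightarrow> (\<lambda>x. f x + g x) \<in> L2 M"
  using L2_mult_integrable[of f M g] unfolding L2_def by (auto simp: power2_sum mult.assoc)

lemma L2_bounded_mult:
  assumes "f \<in> L2 M" "c \<in> borel_measurable M" "\<And>x. x \<in> space M \<Longrightarrow> \<bar>c x\<bar> \<le> K"
  shows "(\<lambda>x. c x * f x) \<in> L2 M"
proof (rule L2I)
  show m: "(\<lambda>x. c x * f x) \<in> borel_measurable M" using L2D(1)[OF assms(1)] assms(2) by simp
  show "integrable M (\<lambda>x. (c x * f x)\<^sup>2)"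
  proof (rule Bochner_Integration.integrable_bound)
    show "integrable M (\<lambda>x. K\<^sup>2 * (f x)\<^sup>2)" using L2D(2)[OF assms(1)] by simp
    show "AE x in M. norm ((c x * f x)\<^sup>2) \<le> norm (K\<^sup>2 * (f x)\<^sup>2)"
    proof (rule AE_I2)
      fix x assume "x \<in> space M"
      then have "(c x)\<^sup>2 \<le> K\<^sup>2" using assms(3)[of x] by (simp add: abs_le_square_iff[symmetric])
      then show "norm ((c x * f x)\<^sup>2) \<le> norm (K\<^sup>2 * (f x)\<^sup>2)"
        by (simp add: power_mult_distrib mult_right_mono)
    qed
  qed (use m in simp)
qed

lemma L2_cmult: "f \<in> L2 M \<Longrightarrow> (\<lambda>x. c * f x) \<in> L2 M"
  by (rule L2_bounded_mult[where K = "\<bar>c\<bar>"]) auto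

lemma L2_uminus: "f \<in> L2 M \<Longrightarrow> (\<lambda>x. - f x) \<in> L2 M"
  using L2_cmult[of f M "-1"] by simp

lemma L2_diff: "f \<in> L2 M \<Longrightarrow> g \<in> L2 M \<Longrightarrow> (\<lambda>x. f x - g x) \<in> L2 M"
  using L2_add[of f M "\<lambda>x. - g x"] L2_uminus[of g M] by simp

lemma L2_zero: "(\<lambda>x. 0) \<in> L2 M"
  unfolding L2_def by auto

lemma L2_cong_AE: "f \<in> L2 M \<Longrightarrow> g \<in> borel_measurable M \<Longrightarrow> AE x in M. f x = g x \<Longrightarrow> g \<in> L2 M"
  unfolding L2_def by (auto intro: integrable_cong_AE_imp elim!: eventually_mono)

lemma L2_lborel_lebesgue: "f \<in> L2 lborel \<Longrightarrow> f \<in> L2 lebesgue"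
  unfolding L2_def by (auto simp: integrable_completion measurable_completion)

lemma L2_lebesgue_lborel: "f \<in> L2 lebesgue \<Longrightarrow> f \<in> borel_measurable borel \<Longrightarrow> f \<in> L2 lborel"
  unfolding L2_def by (auto simp: integrable_completion)

lemma L2_lebesgue_borel_rep:
  assumes "f \<in> L2 lebesgue"
  obtains g where "g \<in> L2 lborel" "AE x in lborel. f x = g x"
proof -
  obtain g where g: "g \<in> borel_measurable lborel" "AE x in lborel. f x = g x"
    using completion_ex_borel_measurable_real[of f lborel] L2D[OF assms] by auto
  have "g \<in> L2 lebesgue"
    using L2_cong_AE[OF assms, of g] g by (auto simp: measurable_completion AE_completion)
  with g that show ?thesis using L2_lebesgue_lborel by auto
qed

lemma power2_pow_eq: "(a ^ n)\<^sup>2 = (a\<^sup>2) ^ n" for a :: real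
  by (metis mult.commute power_mult)

lemma power2_two_pow: "((2::real) ^ n)\<^sup>2 = 4 ^ n" and power2_quarter_pow: "((1/4::real) ^ n)\<^sup>2 = (1/16) ^ n"
  unfolding power2_pow_eq by (simp_all add: power2_eq_square)

text \<open>The squared increments have integral at most K / 16^n, so they remain summable after
  weighting with 4^n. Almost everywhere the increments are therefore O(1 / 2^n).\<close>

lemma L2_fast_AE_convergent:
  assumes f: "\<And>n. f n \<in> L2 M"
    and fast: "\<And>n. (LINT x|M. (f (Suc n) x - f n x)\<^sup>2) \<le> K * (1/16)^n"
  shows "AE x in M. convergent (\<lambda>n. f n x)"
proof -
  let ?h = "\<lambda>n x. (f (Suc n) x - f n x)\<^sup>2"
  have int: "integrable M (?h n)" for n
    by (intro L2D(2) L2_diff f)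
  have [measurable]: "f n \<in> borel_measurable M" for n using f by (rule L2D)
  have "K \<ge> 0" using fast[of 0] by simp (smt (verit) integral_nonneg_AE AE_I2 zero_le_power2)
  have "(\<integral>\<^sup>+x. (\<Sum>n. ennreal (4^n * ?h n x)) \<partial>M) = (\<Sum>n. \<integral>\<^sup>+x. ennreal (4^n * ?h n x) \<partial>M)"
    by (intro nn_integral_suminf) measurable
  also have "\<dots> = (\<Sum>n. ennreal (LINT x|M. 4^n * ?h n x))"
    using int by (subst nn_integral_eq_integral) auto
  also have "\<dots> \<le> (\<Sum>n. ennreal (K * (1/4)^n))"
  proof (intro suminf_le)
    fix n
    have "(LINT x|M. 4^n * ?h n x) \<le> 4^n * (K * (1/16)^n)"
      using fast[of n] by (simp del: times_divide_eq_right)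
    also have "\<dots> = K * (4 * (1/16))^n" unfolding power_mult_distrib by simp
    finally show "ennreal (LINT x|M. 4^n * ?h n x) \<le> ennreal (K * (1/4)^n)"
      by (intro ennreal_leI) simp
  qed auto
  also have "\<dots> = ennreal (\<Sum>n. K * (1/4)^n)"
    using \<open>K \<ge> 0\<close> by (intro suminf_ennreal2) (auto intro!: summable_mult summable_geometric)
  also have "\<dots> < \<infinity>" by simp
  finally have "AE x in M. (\<Sum>n. ennreal (4^n * ?h n x)) \<noteq> \<infinity>"
    by (intro nn_integral_noteq_infinite) auto
  then show ?thesis
  proof eventually_elim
    case (elim x)
    then have "summable (\<lambda>n. 4^n * ?h n x)"
      by (intro summable_suminf_not_top) (auto simp: infinity_ennreal_def)
    then have "Bseq (\<lambda>n. 4^n * ?h n x)" by (rule summable_imp_Bseq)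
    then obtain C where C: "C > 0" "\<And>n. \<bar>4^n * ?h n x\<bar> \<le> C"
      unfolding Bseq_def real_norm_def by blast
    have "norm (f (Suc n) x - f n x) \<le> sqrt C * (1/2)^n" for n
    proof -
      have "(2^n * \<bar>f (Suc n) x - f n x\<bar>)\<^sup>2 \<le> (sqrt C)\<^sup>2"
        using C(2)[of n] C(1) unfolding power_mult_distrib power2_two_pow by simp
      then have "2^n * \<bar>f (Suc n) x - f n x\<bar> \<le> sqrt C"
        by (rule power2_le_imp_le) (use C(1) in simp)
      then show ?thesis by (simp add: field_simps)
    qed
    then have "summable (\<lambda>n. f (Suc n) x - f n x)"
      by (rule summable_comparison_test'[of "\<lambda>n. sqrt C * (1/2)^n" 0, rotated])
        (intro summable_mult summable_geometric, auto)
    then have "convergent (\<lambda>n. f n x - f 0 x)"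
      using sum_lessThan_telescope[of "\<lambda>n. f n x"] by (simp add: summable_iff_convergent)
    then show ?case using convergent_add[OF _ convergent_const[of "f 0 x"]] by fastforce
  qed
qed

text \<open>Fatou's lemma carries the uniform bound on the differences f m - f n over to the
  pointwise limit.\<close>

lemma L2_fast_limit:
  assumes f: "\<And>n. f n \<in> L2 M"
    and fast: "\<And>n. (LINT x|M. (f (Suc n) x - f n x)\<^sup>2) \<le> K * (1/16)^n"
    and g: "g \<in> borel_measurable M" "AE x in M. (\<lambda>n. f n x) \<longlonglongrightarrow> g x"
  shows "g \<in> L2 M" "(LINT x|M. (g x - f n x)\<^sup>2) \<le> 4 * K * (1/16)^n"
proof -
  have [measurable]: "f n \<in> borel_measurable M" for n using f by (rule L2D)
  note g(1)[measurable]
  have int: "integrable M (\<lambda>x. (f m x - f n x)\<^sup>2)" for m n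
    by (intro L2D(2) L2_diff f)
  have K: "K \<ge> 0" using fast[of 0] by simp (smt (verit) integral_nonneg_AE AE_I2 zero_le_power2)
  \<comment> \<open>Induction on j with |a - c|^2 \<le> 2 |a - b|^2 + 2 |b - c|^2: the factor 1/16
    at the next index turns 8 K into K/2, and K/2 + 2 K stays below 4 K.\<close>
  have bd: "(LINT x|M. (f (n + j) x - f n x)\<^sup>2) \<le> 4 * K * (1/16)^n" for n j
  proof (induction j arbitrary: n)
    case (Suc j)
    have *: "(a - c)\<^sup>2 \<le> 2 * (a - b)\<^sup>2 + 2 * (b - c)\<^sup>2" for a b c :: real
      using zero_le_power2[of "a - 2 * b + c"] by (simp add: power2_eq_square algebra_simps)
    have "(LINT x|M. (f (n + Suc j) x - f n x)\<^sup>2) \<le>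
      (LINT x|M. 2 * (f (Suc n + j) x - f (Suc n) x)\<^sup>2 + 2 * (f (Suc n) x - f n x)\<^sup>2)"
    proof (rule integral_mono)
      show "integrable M (\<lambda>x. 2 * (f (Suc n + j) x - f (Suc n) x)\<^sup>2 + 2 * (f (Suc n) x - f n x)\<^sup>2)"
        by (intro Bochner_Integration.integrable_add Bochner_Integration.integrable_mult_right int)
      show "integrable M (\<lambda>x. (f (n + Suc j) x - f n x)\<^sup>2)" by (rule int)
      show "(f (n + Suc j) x - f n x)\<^sup>2 \<le> 2 * (f (Suc n + j) x - f (Suc n) x)\<^sup>2 + 2 * (f (Suc n) x - f n x)\<^sup>2" for x
        using *[of "f (n + Suc j) x" "f n x" "f (Suc n) x"] by simp
    qed
    also have "\<dots> = 2 * (LINT x|M. (f (Suc n + j) x - f (Suc n) x)\<^sup>2) + 2 * (LINT x|M. (f (Suc n) x - f n x)\<^sup>2)"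
      by (subst Bochner_Integration.integral_add) (simp_all add: int)
    also have "\<dots> \<le> 2 * (4 * K * (1/16)^Suc n) + 2 * (K * (1/16)^n)"
      by (intro add_mono mult_left_mono Suc fast) auto
    also have "\<dots> \<le> 4 * K * (1/16)^n" using K by (simp add: field_simps)
    finally show ?case .
  qed (use K in simp)
  have nn: "(\<integral>\<^sup>+x. ennreal ((g x - f n x)\<^sup>2) \<partial>M) \<le> ennreal (4 * K * (1/16)^n)" for n
  proof -
    have "(\<integral>\<^sup>+x. ennreal ((g x - f n x)\<^sup>2) \<partial>M) = (\<integral>\<^sup>+x. liminf (\<lambda>m. ennreal ((f m x - f n x)\<^sup>2)) \<partial>M)"
    proof (rule nn_integral_cong_AE)
      show "AE x in M. ennreal ((g x - f n x)\<^sup>2) = liminf (\<lambda>m. ennreal ((f m x - f n x)\<^sup>2))"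
        using g(2)
      proof eventually_elim
        case (elim x)
        have "(\<lambda>m. ennreal ((f m x - f n x)\<^sup>2)) \<longlonglongrightarrow> ennreal ((g x - f n x)\<^sup>2)"
          by (intro tendsto_intros elim)
        then show ?case by (intro lim_imp_Liminf[symmetric]) auto
      qed
    qed
    also have "\<dots> \<le> liminf (\<lambda>m. \<integral>\<^sup>+x. ennreal ((f m x - f n x)\<^sup>2) \<partial>M)"
      by (intro nn_integral_liminf) measurable
    also have "\<dots> \<le> ennreal (4 * K * (1/16)^n)"
    proof (rule Liminf_le)
      show "\<forall>\<^sub>F m in sequentially. (\<integral>\<^sup>+x. ennreal ((f m x - f n x)\<^sup>2) \<partial>M) \<le> ennreal (4 * K * (1/16)^n)"
        using eventually_ge_at_top[of n]
      proof eventually_elim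
        case (elim m)
        then obtain j where "m = n + j" using le_Suc_ex by blast
        with bd[of n j] int show ?case by (subst nn_integral_eq_integral) (auto intro!: ennreal_leI)
      qed
    qed simp
    finally show ?thesis .
  qed
  have intg: "integrable M (\<lambda>x. (g x - f n x)\<^sup>2)" for n
    using nn[of n] by (intro integrableI_nonneg) (auto simp: less_top[symmetric] top_unique)
  have "(\<lambda>x. (g x - f 0 x) + f 0 x) \<in> L2 M"
    by (intro L2_add f L2I intg) measurable
  then show "g \<in> L2 M" by simp
  show "(LINT x|M. (g x - f n x)\<^sup>2) \<le> 4 * K * (1/16)^n"
    using nn[of n] nn_integral_eq_integral[OF intg[of n]] K by (simp add: ennreal_le_iff)
qed

\<comment> \<open>L^2 becomes a type so that it can carry an inner product, completeness and vector
  valued integrals. The relation is partial because only square integrable functions have a class,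
  and it is confined to Borel functions so that representatives can be translated and
  sliced.\<close>
quotient_type (overloaded) 'a l2 = "'a::euclidean_space \<Rightarrow> real" /
  partial: "\<lambda>f g. f \<in> L2 lborel \<and> g \<in> L2 lborel \<and> (AE x in lborel. f x = g x)"
proof (rule part_equivpI)
  show "\<exists>f::'a \<Rightarrow> real. f \<in> L2 lborel \<and> f \<in> L2 lborel \<and> (AE x in lborel. f x = f x)"
    using L2_zero by (intro exI[of _ "\<lambda>x. 0"]) auto
qed (auto intro!: sympI transpI elim: eventually_mono eventually_elim2)

definition fn :: "'a::euclidean_space l2 \<Rightarrow> 'a \<Rightarrow> real" where
  "fn w = rep_l2 w"

text \<open>Every Lebesgue measurable square integrable function has a class, but all representatives
  chosen by \<open>fn\<close> are Borel measurable.\<close>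

definition cls :: "('a::euclidean_space \<Rightarrow> real) \<Rightarrow> 'a l2" where
  "cls f = abs_l2 (SOME g. g \<in> L2 lborel \<and> (AE x in lborel. f x = g x))"

lemma fn_L2: "fn w \<in> L2 lborel"
  using Quotient3_rep_reflp[OF Quotient3_l2, of w] by (simp add: fn_def)

lemma fn_borel [measurable]: "fn w \<in> borel_measurable borel"
  using L2D(1)[OF fn_L2] by simp

lemma fn_cls:
  assumes "f \<in> L2 lebesgue"
  shows "AE x in lborel. fn (cls f) x = f x"
proof -
  define g where "g = (SOME g. g \<in> L2 lborel \<and> (AE x in lborel. f x = g x))"
  have g: "g \<in> L2 lborel" "AE x in lborel. f x = g x"
    using someI_ex[of "\<lambda>g. g \<in> L2 lborel \<and> (AE x in lborel. f x = g x)"] L2_lebesgue_borel_rep[OF assms]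
    unfolding g_def by (metis, metis)
  have "AE x in lborel. rep_l2 (abs_l2 g) x = g x"
    using Quotient3_rep_abs[OF Quotient3_l2, of g] g by auto
  with g(2) show ?thesis
    unfolding cls_def fn_def g_def[symmetric] by eventually_elim simp
qed

lemmas fn_cls' = fn_cls[OF L2_lborel_lebesgue]

lemma l2_eqI:
  assumes "AE x in lborel. fn u x = fn v x"
  shows "u = v"
  using assms fn_L2 Quotient3_rel_rep[OF Quotient3_l2, of u v] unfolding fn_def by metis

lemma cls_fn [simp]: "cls (fn w) = w"
  by (rule l2_eqI) (rule fn_cls'[OF fn_L2])

lemma cls_eqI: "f \<in> L2 lebesgue \<Longrightarrow> g \<in> L2 lebesgue \<Longrightarrow> AE x in lborel. f x = g x \<Longrightarrow> cls f = cls g"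
proof (rule l2_eqI)
  assume "f \<in> L2 lebesgue" "g \<in> L2 lebesgue" "AE x in lborel. f x = g x"
  from fn_cls[OF this(1)] fn_cls[OF this(2)] this(3)
  show "AE x in lborel. fn (cls f) x = fn (cls g) x" by eventually_elim simp
qed

lemma cls_eqD: 
  assumes "cls f = cls g" "f \<in> L2 lebesgue" "g \<in> L2 lebesgue" shows "AE x in lborel. f x = g x"
  using fn_cls[OF assms(2)] fn_cls[OF assms(3)] unfolding assms(1) by eventually_elim simp

instantiation l2 :: (euclidean_space) real_inner
begin

definition zero_l2 :: "'a l2" where "zero_l2 = cls (\<lambda>x. 0)"
definition plus_l2 :: "'a l2 \<Rightarrow> 'a l2 \<Rightarrow> 'a l2" where "plus_l2 u v = cls (\<lambda>x. fn u x + fn v x)"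
definition uminus_l2 :: "'a l2 \<Rightarrow> 'a l2" where "uminus_l2 u = cls (\<lambda>x. - fn u x)"
definition minus_l2 :: "'a l2 \<Rightarrow> 'a l2 \<Rightarrow> 'a l2" where "minus_l2 u v = cls (\<lambda>x. fn u x - fn v x)"
definition scaleR_l2 :: "real \<Rightarrow> 'a l2 \<Rightarrow> 'a l2" where "scaleR_l2 c u = cls (\<lambda>x. c * fn u x)"
definition inner_l2 :: "'a l2 \<Rightarrow> 'a l2 \<Rightarrow> real" where "inner_l2 u v = (LINT x|lborel. fn u x * fn v x)"
definition norm_l2 :: "'a l2 \<Rightarrow> real" where "norm_l2 u = sqrt (u \<bullet> u)"
definition dist_l2 :: "'a l2 \<Rightarrow> 'a l2 \<Rightarrow> real" where "dist_l2 u v = norm (u - v)"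
definition sgn_l2 :: "'a l2 \<Rightarrow> 'a l2" where "sgn_l2 u = inverse (norm u) *\<^sub>R u"
definition uniformity_l2 :: "('a l2 \<times> 'a l2) filter" where
  "uniformity_l2 = (INF e\<in>{0<..}. principal {(x, y). dist x y < e})"
definition open_l2 :: "'a l2 set \<Rightarrow> bool" where
  "open_l2 U = (\<forall>x\<in>U. \<forall>\<^sub>F (x', y) in uniformity. x' = x \<longrightarrow> y \<in> U)"

lemma fn_zero: "AE x in lborel. fn (0::'a l2) x = 0"
  unfolding zero_l2_def by (rule fn_cls'[OF L2_zero])
lemma fn_add: "AE x in lborel. fn (u + v :: 'a l2) x = fn u x + fn v x"
  unfolding plus_l2_def by (intro fn_cls' L2_add fn_L2)
lemma fn_uminus: "AE x in lborel. fn (- u :: 'a l2) x = - fn u x"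
  unfolding uminus_l2_def by (intro fn_cls' L2_uminus fn_L2)
lemma fn_diff: "AE x in lborel. fn (u - v :: 'a l2) x = fn u x - fn v x"
  unfolding minus_l2_def by (intro fn_cls' L2_diff fn_L2)
lemma fn_scaleR: "AE x in lborel. fn (c *\<^sub>R u :: 'a l2) x = c * fn u x"
  unfolding scaleR_l2_def by (intro fn_cls' L2_cmult fn_L2)

instance
proof
  fix u v w :: "'a l2" and c d :: real
  show "u + v + w = u + (v + w)"
    by (rule l2_eqI, use fn_add[of "u + v" w] fn_add[of u v] fn_add[of u "v + w"] fn_add[of v w] in eventually_elim) simp
  show "u + v = v + u"
    by (rule l2_eqI, use fn_add[of u v] fn_add[of v u] in eventually_elim) simp
  show "0 + u = u"
    by (rule l2_eqI, use fn_add[of 0 u] fn_zero in eventually_elim) simp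
  show "- u + u = 0"
    by (rule l2_eqI, use fn_add[of "- u" u] fn_zero fn_uminus[of u] in eventually_elim) simp
  show "u - v = u + - v"
    by (rule l2_eqI, use fn_add[of u "- v"] fn_diff[of u v] fn_uminus[of v] in eventually_elim) simp
  show "c *\<^sub>R (u + v) = c *\<^sub>R u + c *\<^sub>R v"
    by (rule l2_eqI, use fn_scaleR[of c "u + v"] fn_scaleR[of c u] fn_scaleR[of c v] fn_add[of u v]
      fn_add[of "c *\<^sub>R u" "c *\<^sub>R v"] in eventually_elim) (simp add: algebra_simps)
  show "(c + d) *\<^sub>R u = c *\<^sub>R u + d *\<^sub>R u"
    by (rule l2_eqI, use fn_scaleR[of "c + d" u] fn_scaleR[of c u] fn_scaleR[of d u]
      fn_add[of "c *\<^sub>R u" "d *\<^sub>R u"] in eventually_elim) (simp add: algebra_simps)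
  show "c *\<^sub>R d *\<^sub>R u = (c * d) *\<^sub>R u"
    by (rule l2_eqI, use fn_scaleR[of c "d *\<^sub>R u"] fn_scaleR[of d u] fn_scaleR[of "c * d" u] in eventually_elim) simp
  show "1 *\<^sub>R u = u"
    by (rule l2_eqI, use fn_scaleR[of 1 u] in eventually_elim) simp
  show "dist u v = norm (u - v)" by (rule dist_l2_def)
  show "sgn u = inverse (norm u) *\<^sub>R u" by (rule sgn_l2_def)
  show "(uniformity :: ('a l2 \<times> 'a l2) filter) = (INF e\<in>{0<..}. principal {(x, y). dist x y < e})"
    by (rule uniformity_l2_def)
  show "open U = (\<forall>x\<in>U. \<forall>\<^sub>F (x', y) in uniformity. x' = x \<longrightarrow> y \<in> U)" for U :: "'a l2 set"
    by (rule open_l2_def)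
  show "u \<bullet> v = v \<bullet> u" by (simp add: inner_l2_def mult.commute)
  show "(u + v) \<bullet> w = u \<bullet> w + v \<bullet> w"
  proof -
    have "(u + v) \<bullet> w = (LINT x|lborel. fn u x * fn w x + fn v x * fn w x)"
      unfolding inner_l2_def
      by (rule integral_cong_AE) (measurable, use fn_add[of u v] in \<open>eventually_elim, simp add: algebra_simps\<close>)
    then show ?thesis
      by (simp add: inner_l2_def L2_mult_integrable fn_L2)
  qed
  show "(c *\<^sub>R u) \<bullet> v = c * (u \<bullet> v)"
  proof -
    have "(c *\<^sub>R u) \<bullet> v = (LINT x|lborel. c * (fn u x * fn v x))"
      unfolding inner_l2_def
      by (rule integral_cong_AE) (measurable, use fn_scaleR[of c u] in \<open>eventually_elim, simp add: algebra_simps\<close>)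
    then show ?thesis by (simp add: inner_l2_def)
  qed
  show "0 \<le> u \<bullet> u" by (simp add: inner_l2_def)
  show "(u \<bullet> u = 0) = (u = 0)"
  proof
    assume "u \<bullet> u = 0"
    then have "AE x in lborel. fn u x * fn u x = 0"
      unfolding inner_l2_def
      by (subst (asm) integral_nonneg_eq_0_iff_AE) (auto intro: L2_mult_integrable fn_L2)
    then have z: "AE x in lborel. fn u x = 0" by simp
    show "u = 0"
      by (rule l2_eqI, use z fn_zero in eventually_elim) simp
  next
    assume "u = 0"
    then have "AE x in lborel. fn u x * fn u x = 0"
      using fn_zero by simp
    then show "u \<bullet> u = 0" unfolding inner_l2_def by (rule integral_eq_zero_AE)
  qed
  show "norm u = sqrt (u \<bullet> u)" by (rule norm_l2_def)
qed

end

lemma cls_inner: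
  assumes "f \<in> L2 lebesgue" "g \<in> L2 lebesgue"
  shows "cls f \<bullet> cls g = (LINT x|lebesgue. f x * g x)"
proof -
  have "cls f \<bullet> cls g = (LINT x|lebesgue. fn (cls f) x * fn (cls g) x)"
    unfolding inner_l2_def by (rule integral_completion[symmetric]) measurable
  also have "\<dots> = (LINT x|lebesgue. f x * g x)"
  proof (rule integral_cong_AE)
    show "AE x in lebesgue. fn (cls f) x * fn (cls g) x = f x * g x"
      by (rule AE_completion, use fn_cls[OF assms(1)] fn_cls[OF assms(2)] in eventually_elim) simp
    show "(\<lambda>x. fn (cls f) x * fn (cls g) x) \<in> borel_measurable lebesgue"
      by (rule measurable_completion) measurable
    show "(\<lambda>x. f x * g x) \<in> borel_measurable lebesgue"
      using assms[THEN L2D(1)] by (rule borel_measurable_times)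
  qed
  finally show ?thesis .
qed

lemma cls_inner':
  assumes "f \<in> L2 lborel" "g \<in> L2 lborel"
  shows "cls f \<bullet> cls g = (LINT x|lborel. f x * g x)"
  using cls_inner[OF assms[THEN L2_lborel_lebesgue]] L2_mult_integrable[OF assms]
  by (simp add: integral_completion)

lemma norm_cls: "f \<in> L2 lborel \<Longrightarrow> (norm (cls f))\<^sup>2 = (LINT x|lborel. (f x)\<^sup>2)"
  unfolding power2_norm_eq_inner by (simp add: cls_inner' power2_eq_square)

lemma cls_add:
  assumes "f \<in> L2 lebesgue" "g \<in> L2 lebesgue"
  shows "cls (\<lambda>x. f x + g x) = cls f + cls g"
  by (rule l2_eqI, use fn_cls[OF L2_add[OF assms]] fn_cls[OF assms(1)] fn_cls[OF assms(2)]
    fn_add[of "cls f" "cls g"] in eventually_elim) simp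

lemma cls_cmult:
  assumes "f \<in> L2 lebesgue"
  shows "cls (\<lambda>x. c * f x) = c *\<^sub>R cls f"
  by (rule l2_eqI, use fn_cls[OF L2_cmult[OF assms]] fn_cls[OF assms] fn_scaleR[of c "cls f"] in eventually_elim) simp

lemma cls_zero: "cls (\<lambda>x. 0) = 0"
  by (simp add: zero_l2_def)

lemma cls_uminus: "f \<in> L2 lebesgue \<Longrightarrow> cls (\<lambda>x. - f x) = - cls f"
  using cls_cmult[of f "-1"] by simp

lemma cls_diff: "f \<in> L2 lebesgue \<Longrightarrow> g \<in> L2 lebesgue \<Longrightarrow> cls (\<lambda>x. f x - g x) = cls f - cls g"
  using cls_add[of f "\<lambda>x. - g x"] cls_uminus[of g] L2_uminus[of g] by simp

text \<open>Riesz-Fischer: a subsequence with increments below 1 / 4^k converges almost everywhere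
  and in norm, and a Cauchy sequence converges along with any convergent subsequence.\<close>

instance l2 :: (euclidean_space) complete_space
proof
  fix X :: "nat \<Rightarrow> 'a l2" assume X: "Cauchy X"
  have "\<exists>N. \<forall>m\<ge>N. \<forall>n\<ge>N. norm (X m - X n) < (1/4)^k" for k
    using CauchyD[OF X, of "(1/4)^k"] by auto
  then obtain N where N: "\<And>k m n. m \<ge> N k \<Longrightarrow> n \<ge> N k \<Longrightarrow> norm (X m - X n) < (1/4)^k"
    by metis
  \<comment> \<open>The added 1 makes the partial sums strictly increasing, and the k-th one
    dominates \<open>N k\<close>.\<close>
  define r where "r k = (\<Sum>j\<le>k. N j + 1)" for k
  have mono: "strict_mono r" unfolding r_def by (rule strict_monoI_Suc) simp
  have rN: "N k \<le> r k" for k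
    unfolding r_def by (rule order_trans[OF _ member_le_sum[of k]]) auto
  define f where "f k = fn (X (r k))" for k
  have fL: "f k \<in> L2 lborel" for k unfolding f_def by (rule fn_L2)
  have fast: "(LINT x|lborel. (f (Suc k) x - f k x)\<^sup>2) \<le> 1 * (1/16)^k" for k
  proof -
    have "(LINT x|lborel. (f (Suc k) x - f k x)\<^sup>2) = (norm (X (r (Suc k)) - X (r k)))\<^sup>2"
      using norm_cls[OF L2_diff[OF fL[of "Suc k"] fL[of k]]]
      by (simp add: cls_diff L2_lborel_lebesgue fL) (simp add: f_def)
    also have "\<dots> \<le> ((1/4)^k)\<^sup>2"
    proof -
      have "N k \<le> r (Suc k)"
        using rN[of k] strict_monoD[OF mono, of k "Suc k"] by simp
      from N[OF this rN] show ?thesis by (intro power_mono) auto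
    qed
    finally show ?thesis unfolding power2_quarter_pow by simp
  qed
  define g where "g x = lim (\<lambda>k. f k x)" for x
  have "AE x in lborel. (\<lambda>k. f k x) \<longlonglongrightarrow> g x"
    using L2_fast_AE_convergent[OF fL fast] by eventually_elim (simp add: g_def convergent_LIMSEQ_iff)
  moreover have gm: "g \<in> borel_measurable lborel"
    unfolding g_def f_def by measurable
  ultimately have g: "g \<in> L2 lborel" "\<And>k. (LINT x|lborel. (g x - f k x)\<^sup>2) \<le> 4 * 1 * (1/16)^k"
    using L2_fast_limit[OF fL fast] by auto
  have "(X \<circ> r) \<longlonglongrightarrow> cls g"
  proof (rule Lim_null[THEN iffD2], rule Lim_null_comparison)
    have "norm ((X \<circ> r) k - cls g) \<le> 2 * (1/4)^k" for k
    proof -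
      have "(norm (cls g - X (r k)))\<^sup>2 \<le> 4 * (1/16)^k"
        using norm_cls[OF L2_diff[OF g(1) fL[of k]]] g(2)[of k]
        by (simp add: cls_diff L2_lborel_lebesgue fL g) (simp add: f_def)
      also have "\<dots> = (2 * (1/4)^k)\<^sup>2"
        unfolding power_mult_distrib power2_quarter_pow by simp
      finally show ?thesis
        unfolding o_def norm_minus_commute[of "X (r k)"] by (rule power2_le_imp_le) simp
    qed
    then show "\<forall>\<^sub>F k in sequentially. norm ((X \<circ> r) k - cls g) \<le> 2 * (1/4)^k" by simp
    show "(\<lambda>k. 2 * (1/4)^k :: real) \<longlonglongrightarrow> 0"
      by (intro tendsto_mult_right_zero LIMSEQ_power_zero) auto
  qed
  then have "X \<longlonglongrightarrow> cls g"
    using Cauchy_converges_subseq[OF X mono] by blast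
  then show "convergent X" by (auto simp: convergent_def)
qed

section \<open>Multiplication by bounded Borel functions\<close>

definition bounded_borel :: "('a::euclidean_space \<Rightarrow> real) \<Rightarrow> bool" where
  "bounded_borel c \<longleftrightarrow> c \<in> borel_measurable borel \<and> (\<exists>K. \<forall>x. \<bar>c x\<bar> \<le> K)"

lemma bounded_borelI: "c \<in> borel_measurable borel \<Longrightarrow> (\<And>x. \<bar>c x\<bar> \<le> K) \<Longrightarrow> bounded_borel c"
  unfolding bounded_borel_def by blast

lemma bounded_borelD: "bounded_borel c \<Longrightarrow> c \<in> borel_measurable borel"
  unfolding bounded_borel_def by blast

lemma bounded_borel_bound:
  assumes "bounded_borel c" obtains K where "K > 0" "\<And>x. \<bar>c x\<bar> \<le> K"
proof -
  obtain K where "\<And>x. \<bar>c x\<bar> \<le> K" using assms unfolding bounded_borel_def by blast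
  then have "\<And>x. \<bar>c x\<bar> \<le> max K 1" by (simp add: le_max_iff_disj)
  then show thesis using that[of "max K 1"] by auto
qed

lemma bounded_borel_const [simp]: "bounded_borel (\<lambda>x. k)"
  by (rule bounded_borelI[of _ "\<bar>k\<bar>"]) auto

lemma bounded_borel_mult:
  assumes "bounded_borel c" "bounded_borel d" shows "bounded_borel (\<lambda>x. c x * d x)"
proof -
  obtain K L where "\<And>x. \<bar>c x\<bar> \<le> K" "\<And>x. \<bar>d x\<bar> \<le> L" using assms unfolding bounded_borel_def by blast
  then show ?thesis
    using assms[THEN bounded_borelD] by (intro bounded_borelI[of _ "K * L"])
      (auto simp: abs_mult intro!: mult_mono order_trans[OF abs_ge_zero])
qed

lemma bounded_borel_add:
  assumes "bounded_borel c" "bounded_borel d" shows "bounded_borel (\<lambda>x. c x + d x)"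
proof -
  obtain K L where "\<And>x. \<bar>c x\<bar> \<le> K" "\<And>x. \<bar>d x\<bar> \<le> L" using assms unfolding bounded_borel_def by blast
  then show ?thesis
    using assms[THEN bounded_borelD] by (intro bounded_borelI[of _ "K + L"])
      (auto intro!: order_trans[OF abs_triangle_ineq] add_mono)
qed

lemma bounded_borel_uminus: "bounded_borel c \<Longrightarrow> bounded_borel (\<lambda>x. - c x)"
  using bounded_borel_mult[of "\<lambda>x. -1" c] by simp

lemma bounded_borel_diff: "bounded_borel c \<Longrightarrow> bounded_borel d \<Longrightarrow> bounded_borel (\<lambda>x. c x - d x)"
  using bounded_borel_add[of c "\<lambda>x. - d x"] bounded_borel_uminus[of d] by simp

lemma bounded_borel_indicator: "A \<in> sets borel \<Longrightarrow> bounded_borel (indicator A)"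
  by (rule bounded_borelI[of _ 1]) (auto simp: indicator_def)

lemmas bounded_borel_intros = bounded_borel_const bounded_borel_mult bounded_borel_add
  bounded_borel_uminus bounded_borel_diff

lemma bounded_borel_L2:
  assumes "bounded_borel c" "f \<in> L2 lborel" shows "(\<lambda>x. c x * f x) \<in> L2 lborel"
proof -
  obtain K where "\<And>x. \<bar>c x\<bar> \<le> K" using bounded_borel_bound[OF assms(1)] by metis
  then show ?thesis using bounded_borelD[OF assms(1)] by (intro L2_bounded_mult[OF assms(2)]) auto
qed

lemma bounded_borel_L2':
  assumes "bounded_borel c" "f \<in> L2 lebesgue" shows "(\<lambda>x. c x * f x) \<in> L2 lebesgue"
proof -
  obtain K where "\<And>x. \<bar>c x\<bar> \<le> K" using bounded_borel_bound[OF assms(1)] by metis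
  then show ?thesis using bounded_borelD[OF assms(1)]
    by (intro L2_bounded_mult[OF assms(2)]) (auto intro!: measurable_completion)
qed

definition mul :: "('a::euclidean_space \<Rightarrow> real) \<Rightarrow> 'a l2 \<Rightarrow> 'a l2" where
  "mul c w = cls (\<lambda>x. c x * fn w x)"

lemma fn_mul: "bounded_borel c \<Longrightarrow> AE x in lborel. fn (mul c w) x = c x * fn w x"
  unfolding mul_def by (intro fn_cls' bounded_borel_L2 fn_L2)

lemma mul_cls:
  assumes "bounded_borel c" "f \<in> L2 lebesgue"
  shows "mul c (cls f) = cls (\<lambda>x. c x * f x)"
  by (rule l2_eqI, use fn_mul[OF assms(1), of "cls f"] fn_cls[OF assms(2)]
    fn_cls[OF bounded_borel_L2'[OF assms]] in eventually_elim) simp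

lemma mul_add: assumes "bounded_borel c" shows "mul c (u + v) = mul c u + mul c v"
  by (rule l2_eqI, use fn_mul[OF assms, of u] fn_mul[OF assms, of v] fn_mul[OF assms, of "u + v"]
    fn_add[of u v] fn_add[of "mul c u" "mul c v"] in eventually_elim) (simp add: algebra_simps)

lemma mul_scaleR: assumes "bounded_borel c" shows "mul c (k *\<^sub>R u) = k *\<^sub>R mul c u"
  by (rule l2_eqI, use fn_mul[OF assms, of u] fn_mul[OF assms, of "k *\<^sub>R u"]
    fn_scaleR[of k u] fn_scaleR[of k "mul c u"] in eventually_elim) simp

lemma mul_mul:
  assumes "bounded_borel c" "bounded_borel d"
  shows "mul c (mul d u) = mul (\<lambda>x. c x * d x) u"
  by (rule l2_eqI, use fn_mul[OF assms(1), of "mul d u"] fn_mul[OF assms(2), of u]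
    fn_mul[OF bounded_borel_mult[OF assms], of u] in eventually_elim) simp

lemma mul_plus:
  assumes "bounded_borel c" "bounded_borel d"
  shows "mul (\<lambda>x. c x + d x) u = mul c u + mul d u"
  by (rule l2_eqI, use fn_mul[OF assms(1), of u] fn_mul[OF assms(2), of u]
    fn_mul[OF bounded_borel_add[OF assms], of u] fn_add[of "mul c u" "mul d u"] in eventually_elim)
   (simp add: algebra_simps)

lemma mul_const: "mul (\<lambda>x. k) u = k *\<^sub>R u"
  by (rule l2_eqI, use fn_mul[OF bounded_borel_const, of k u] fn_scaleR[of k u] in eventually_elim) simp

lemma inner_mul: assumes "bounded_borel c" shows "mul c u \<bullet> v = (LINT x|lborel. c x * fn u x * fn v x)"
  unfolding inner_l2_def
  by (rule integral_cong_AE)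
    (use bounded_borelD[OF assms] in measurable, use fn_mul[OF assms, of u] in \<open>eventually_elim, simp\<close>)

lemma inner_mul_integrable: "bounded_borel c \<Longrightarrow> integrable lborel (\<lambda>x. c x * fn u x * fn v x)"
  by (intro L2_mult_integrable bounded_borel_L2 fn_L2)

lemma inner_mul_swap: "bounded_borel c \<Longrightarrow> mul c u \<bullet> v = u \<bullet> mul c v"
  by (subst inner_commute[of u]) (simp add: inner_mul mult.assoc mult.left_commute mult.commute)

text \<open>The comparison is asked for only where \<open>u\<close> does not vanish: ellipticity of
  \<open>a\<close> is known on the strip alone, and it is applied to functions supported
  there.\<close>

lemma inner_mul_mono:
  assumes "bounded_borel c" "bounded_borel d"
    and "AE x in lborel. fn u x \<noteq> 0 \<longrightarrow> c x \<le> d x"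
  shows "mul c u \<bullet> u \<le> mul d u \<bullet> u"
  unfolding inner_mul[OF assms(1)] inner_mul[OF assms(2)]
proof (intro integral_mono_AE inner_mul_integrable assms(1,2))
  show "AE x in lborel. c x * fn u x * fn u x \<le> d x * fn u x * fn u x"
    using assms(3)
    by eventually_elim (metis mult.assoc mult_right_mono mult_zero_right order_refl zero_le_square)
qed

lemma norm_mul_le:
  assumes "bounded_borel c" "\<And>x. \<bar>c x\<bar> \<le> K" "K \<ge> 0"
  shows "norm (mul c u) \<le> K * norm u"
proof -
  have "mul c u \<bullet> mul c u = mul (\<lambda>x. c x * c x) u \<bullet> u"
    by (simp add: inner_mul_swap[symmetric] assms mul_mul bounded_borel_intros)
  also have "\<dots> \<le> mul (\<lambda>x. K\<^sup>2) u \<bullet> u"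
  proof (intro inner_mul_mono bounded_borel_mult bounded_borel_const assms(1) AE_I2 impI)
    show "c x * c x \<le> K\<^sup>2" for x
      using power_mono[OF assms(2) abs_ge_zero, of x 2] by (simp add: power2_eq_square)
  qed
  also have "\<dots> = (K * norm u)\<^sup>2"
    unfolding mul_const by (simp add: power_mult_distrib power2_norm_eq_inner)
  finally have "(norm (mul c u))\<^sup>2 \<le> (K * norm u)\<^sup>2" unfolding power2_norm_eq_inner .
  then show ?thesis by (rule power2_le_imp_le) (use assms(3) in simp)
qed

lemma bounded_linear_mul:
  assumes "bounded_borel c" shows "bounded_linear (mul c)"
proof -
  obtain K where "K > 0" "\<And>x. \<bar>c x\<bar> \<le> K" using bounded_borel_bound[OF assms] by blast
  then show ?thesis
    using mul_add[OF assms] mul_scaleR[OF assms] norm_mul_le[OF assms, of K]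
    by (intro bounded_linear_intro[of _ K]) (auto simp: mult.commute)
qed

lemma mul_zero: "bounded_borel c \<Longrightarrow> mul c 0 = 0"
  using mul_scaleR[of c 0 0] by simp

lemma mul_diff: "bounded_borel c \<Longrightarrow> mul c (u - v) = mul c u - mul c v"
  using bounded_linear_mul linear_diff bounded_linear.linear by blast

text \<open>Dominated convergence with majorant (K + L)^2 u^2. Cut-offs are removed through this
  lemma.\<close>

lemma mul_tendsto:
  assumes c: "\<And>n. bounded_borel (c n)" "\<And>n x. \<bar>c n x\<bar> \<le> K" and d: "bounded_borel d"
    and lim: "AE x in lborel. fn u x \<noteq> 0 \<longrightarrow> (\<lambda>n. c n x) \<longlonglongrightarrow> d x"
  shows "(\<lambda>n. mul (c n) u) \<longlonglongrightarrow> mul d u"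
proof -
  obtain L where L: "L > 0" "\<And>x. \<bar>d x\<bar> \<le> L" using bounded_borel_bound[OF d] by blast
  note [measurable] = bounded_borelD[OF c(1)] bounded_borelD[OF d]
  have eq: "(norm (mul (c n) u - mul d u))\<^sup>2 = (LINT x|lborel. (c n x - d x)\<^sup>2 * (fn u x)\<^sup>2)" for n
    unfolding power2_norm_eq_inner inner_l2_def
  proof (rule integral_cong_AE)
    show "AE x in lborel. fn (mul (c n) u - mul d u) x * fn (mul (c n) u - mul d u) x = (c n x - d x)\<^sup>2 * (fn u x)\<^sup>2"
      using fn_diff[of "mul (c n) u" "mul d u"] fn_mul[OF c(1)[of n], of u] fn_mul[OF d, of u]
    proof eventually_elim
      case (elim x)
      then have "fn (mul (c n) u - mul d u) x = (c n x - d x) * fn u x" by (simp only: left_diff_distrib)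
      then show ?case by (simp only: power2_eq_square mult_ac)
    qed
  qed measurable
  have "(\<lambda>n. LINT x|lborel. (c n x - d x)\<^sup>2 * (fn u x)\<^sup>2) \<longlonglongrightarrow> (LINT x|(lborel::'a measure). 0)"
  proof (rule integral_dominated_convergence[where w = "\<lambda>x. (K + L)\<^sup>2 * (fn u x)\<^sup>2"])
    show "integrable lborel (\<lambda>x. (K + L)\<^sup>2 * (fn u x)\<^sup>2)"
      by (intro Bochner_Integration.integrable_mult_right L2D(2) fn_L2)
    show "AE x in lborel. (\<lambda>n. (c n x - d x)\<^sup>2 * (fn u x)\<^sup>2) \<longlonglongrightarrow> 0"
      using lim
    proof eventually_elim
      case (elim x)
      show ?case
      proof (cases "fn u x = 0")
        case False
        then have "(\<lambda>n. (c n x - d x)\<^sup>2 * (fn u x)\<^sup>2) \<longlonglongrightarrow> (d x - d x)\<^sup>2 * (fn u x)\<^sup>2"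
          using elim by (intro tendsto_intros) auto
        then show ?thesis by simp
      qed simp
    qed
    show "AE x in lborel. norm ((c n x - d x)\<^sup>2 * (fn u x)\<^sup>2) \<le> (K + L)\<^sup>2 * (fn u x)\<^sup>2" for n
    proof (rule AE_I2)
      fix x
      have "\<bar>c n x - d x\<bar> \<le> \<bar>K + L\<bar>" using c(2)[of n x] L(2)[of x] by linarith
      then have "(c n x - d x)\<^sup>2 \<le> (K + L)\<^sup>2" by (simp add: abs_le_square_iff)
      then show "norm ((c n x - d x)\<^sup>2 * (fn u x)\<^sup>2) \<le> (K + L)\<^sup>2 * (fn u x)\<^sup>2"
        by (simp add: mult_right_mono)
    qed
  qed measurable
  then have "(\<lambda>n. sqrt ((norm (mul (c n) u - mul d u))\<^sup>2)) \<longlonglongrightarrow> sqrt 0"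
    unfolding eq by (intro tendsto_real_sqrt) simp
  then show ?thesis
    by (subst Lim_null) (simp add: tendsto_norm_zero_iff)
qed

section \<open>Translations as a group of isometries\<close>

lemma AE_lborel_shift:
  fixes a :: "'a::euclidean_space"
  assumes "AE x in lborel. P x" shows "AE x in lborel. P (x + a)"
proof -
  have "AE x in distr lborel borel ((+) a). P x" using assms by (subst lborel_distr_plus)
  then have "AE x in lborel. P (a + x)" by (rule AE_distrD[rotated]) simp
  then show ?thesis by (simp add: add.commute)
qed

lemma integral_lborel_shift:
  fixes f :: "'a::euclidean_space \<Rightarrow> real"
  assumes "f \<in> borel_measurable borel"
  shows "(LINT x|lborel. f (x + a)) = (LINT x|lborel. f x)"
proof -
  have "(LINT x|lborel. f x) = (LINT x|distr lborel borel ((+) a). f x)" by (simp add: lborel_distr_plus)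
  also have "\<dots> = (LINT x|lborel. f (a + x))" using assms by (intro integral_distr) auto
  finally show ?thesis by (simp add: add.commute)
qed

lemma L2_shift:
  fixes a :: "'a::euclidean_space"
  assumes "f \<in> L2 lborel" shows "(\<lambda>x. f (x + a)) \<in> L2 lborel"
proof (rule L2I)
  note [measurable] = L2D(1)[OF assms, simplified]
  show "(\<lambda>x. f (x + a)) \<in> borel_measurable lborel" by measurable
  have "integrable (distr lborel borel ((+) a)) (\<lambda>x. (f x)\<^sup>2)"
    using L2D(2)[OF assms] by (simp add: lborel_distr_plus)
  then have "integrable lborel (\<lambda>x. (f (a + x))\<^sup>2)"
    by (subst (asm) integrable_distr_eq) auto
  then show "integrable lborel (\<lambda>x. (f (x + a))\<^sup>2)" by (simp add: add.commute)
qed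

definition shift :: "'a::euclidean_space \<Rightarrow> 'a l2 \<Rightarrow> 'a l2" where
  "shift a w = cls (\<lambda>x. fn w (x + a))"

lemma fn_shift: "AE x in lborel. fn (shift a w) x = fn w (x + a)"
  unfolding shift_def by (intro fn_cls' L2_shift fn_L2)

lemma shift_cls:
  assumes "f \<in> L2 lborel" shows "shift a (cls f) = cls (\<lambda>x. f (x + a))"
  by (rule l2_eqI, use fn_shift[of a "cls f"] AE_lborel_shift[OF fn_cls'[OF assms], of a]
    fn_cls'[OF L2_shift[OF assms], of a] in eventually_elim) simp

lemma shift_add: "shift a (u + v) = shift a u + shift a v"
  by (rule l2_eqI, use fn_shift[of a u] fn_shift[of a v] fn_shift[of a "u + v"] AE_lborel_shift[OF fn_add[of u v], of a]
    fn_add[of "shift a u" "shift a v"] in eventually_elim) simp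

lemma shift_scaleR: "shift a (k *\<^sub>R u) = k *\<^sub>R shift a u"
  by (rule l2_eqI, use fn_shift[of a u] fn_shift[of a "k *\<^sub>R u"] AE_lborel_shift[OF fn_scaleR[of k u], of a]
    fn_scaleR[of k "shift a u"] in eventually_elim) simp

lemma shift_shift: "shift a (shift b u) = shift (a + b) u"
  by (rule l2_eqI, use fn_shift[of a "shift b u"] fn_shift[of "a + b" u] AE_lborel_shift[OF fn_shift[of b u], of a]
    in eventually_elim) (simp add: add.assoc)

lemma shift_0 [simp]: "shift 0 u = u"
  by (rule l2_eqI, use fn_shift[of 0 u] in eventually_elim) simp

lemma inner_shift_shift: "shift a u \<bullet> shift a v = u \<bullet> v"
proof -
  have "shift a u \<bullet> shift a v = (LINT x|lborel. fn u (x + a) * fn v (x + a))"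
    unfolding inner_l2_def
    by (rule integral_cong_AE, measurable, use fn_shift[of a u] fn_shift[of a v] in eventually_elim) simp
  also have "\<dots> = u \<bullet> v"
    unfolding inner_l2_def by (rule integral_lborel_shift) measurable
  finally show ?thesis .
qed

lemma inner_shift: "shift a u \<bullet> v = u \<bullet> shift (- a) v"
  using inner_shift_shift[of a u "shift (- a) v"] by (simp add: shift_shift)

lemma norm_shift [simp]: "norm (shift a u) = norm u"
  by (simp add: norm_eq_sqrt_inner inner_shift_shift)

lemma bounded_linear_shift: "bounded_linear (shift a)"
  by (rule bounded_linear_intro[of _ 1]) (auto simp: shift_add shift_scaleR)

lemma shift_diff: "shift a (u - v) = shift a u - shift a v"
  using bounded_linear_shift linear_diff bounded_linear.linear by blast

lemma bounded_borel_shift: "bounded_borel c \<Longrightarrow> bounded_borel (\<lambda>x. c (x + a))"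
  unfolding bounded_borel_def by auto

lemma shift_mul: assumes "bounded_borel c" shows "shift a (mul c u) = mul (\<lambda>x. c (x + a)) (shift a u)"
  by (rule l2_eqI, use fn_shift[of a "mul c u"] fn_shift[of a u] AE_lborel_shift[OF fn_mul[OF assms, of u], of a]
    fn_mul[OF bounded_borel_shift[OF assms], of a "shift a u"] in eventually_elim) simp

section \<open>Translations and weak derivatives\<close>

instance l2 :: (euclidean_space) banach ..

lemma dd_add_fun: "smooth f \<Longrightarrow> smooth g \<Longrightarrow> dd e (\<lambda>x. f x + g x) = (\<lambda>x. dd e f x + dd e g x)"
  and dd_mult_fun: "smooth f \<Longrightarrow> smooth g \<Longrightarrow> dd e (\<lambda>x. f x * g x) = (\<lambda>x. f x * dd e g x + dd e f x * g x)"
  and dd_cmult_fun: "smooth f \<Longrightarrow> dd e (\<lambda>x. c * f x) = (\<lambda>x. c * dd e f x)"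
  by (auto simp: dd_add dd_mult dd_cmult)

lemma L2_imp_locally_integrable:
  assumes "f \<in> L2 lebesgue"
  shows "locally_integrable \<Omega> f"
  unfolding locally_integrable_def
proof (intro allI impI)
  fix K :: "'a set" assume "compact K \<and> K \<subseteq> \<Omega>"
  then have K: "compact K" "K \<in> sets lebesgue" by (auto simp: compact_imp_closed)
  have "integrable lebesgue (\<lambda>x. indicator K x + (f x)\<^sup>2)"
    using K L2D(2)[OF assms] lmeasurable_compact[OF K(1)]
    by (intro Bochner_Integration.integrable_add integrable_real_indicator) (auto simp: fmeasurable_def)
  then show "set_integrable lebesgue K f"
    unfolding set_integrable_def
  proof (rule Bochner_Integration.integrable_bound)
    show "(\<lambda>x. indicator K x *\<^sub>R f x) \<in> borel_measurable lebesgue"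
      using L2D(1)[OF assms] K by (intro borel_measurable_scaleR borel_measurable_indicator)
    have "\<bar>y\<bar> \<le> 1 + y\<^sup>2" for y :: real
      using zero_le_power2[of "\<bar>y\<bar> - 1"] unfolding power2_diff power2_abs by simp
    then show "AE x in lebesgue. norm (indicator K x *\<^sub>R f x) \<le> norm (indicator K x + (f x)\<^sup>2)"
      by (auto intro!: AE_I2 simp: indicator_def)
  qed
qed

lemma test_borel: "\<psi> \<in> test_functions \<Omega> \<Longrightarrow> \<psi> \<in> borel_measurable borel"
  by (intro smooth_borel test_smooth)

lemma test_bounded_borel: "\<psi> \<in> test_functions \<Omega> \<Longrightarrow> bounded_borel \<psi>"
  using test_bounded[of \<psi> \<Omega>] test_borel[of \<psi> \<Omega>] by (metis bounded_borelI)

lemma bounded_compact_support_integrable: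
  fixes f :: "'a::euclidean_space \<Rightarrow> real"
  assumes "f \<in> borel_measurable borel" "compact K" "\<And>x. \<bar>f x\<bar> \<le> C" "\<And>x. x \<notin> K \<Longrightarrow> f x = 0"
  shows "integrable lborel f"
proof (rule Bochner_Integration.integrable_bound)
  show "integrable lborel (\<lambda>x. C * indicator K x)"
    using assms(2) emeasure_bounded_finite[OF compact_imp_bounded[OF assms(2)]]
    by (intro Bochner_Integration.integrable_mult_right integrable_real_indicator) (auto simp: compact_imp_closed)
  show "AE x in lborel. norm (f x) \<le> norm (C * indicator K x)"
    using assms(3,4) by (intro AE_I2) (auto simp: indicator_def intro: order_trans[OF _ abs_ge_self])
qed (use assms in simp)

lemma test_integrable:
  fixes \<psi> :: "'a::euclidean_space \<Rightarrow> real"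
  assumes "\<psi> \<in> test_functions \<Omega>" shows "integrable lborel \<psi>"
proof -
  obtain C where "\<And>x. \<bar>\<psi> x\<bar> \<le> C" using test_bounded[OF assms] by metis
  moreover obtain K where "compact K" "\<And>x. x \<notin> K \<Longrightarrow> \<psi> x = 0" 
    using assms by (rule test_functionsE) blast
  ultimately show ?thesis
    using test_borel[OF assms] by (intro bounded_compact_support_integrable)
qed

lemma test_L2:
  fixes \<psi> :: "'a::euclidean_space \<Rightarrow> real"
  assumes "\<psi> \<in> test_functions \<Omega>" shows "\<psi> \<in> L2 lborel"
proof (rule L2I)
  show "\<psi> \<in> borel_measurable lborel" using test_borel[OF assms] by simp
  show "integrable lborel (\<lambda>x. (\<psi> x)\<^sup>2)"
    unfolding power2_eq_square by (rule test_integrable[OF test_mult[OF assms test_smooth[OF assms]]])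
qed

lemmas test_L2' = L2_lborel_lebesgue[OF test_L2]

lemma inner_cls: "f \<in> L2 lebesgue \<Longrightarrow> w \<bullet> cls f = (LINT x|lebesgue. fn w x * f x)"
  using cls_inner[OF L2_lborel_lebesgue[OF fn_L2, of w], of f] by simp

text \<open>The fundamental lemma carried over to classes; identities between elements of
  \<open>l2\<close> are verified through it by testing.\<close>

lemma test_separating:
  assumes "\<And>\<psi>. \<psi> \<in> test_functions UNIV \<Longrightarrow> w \<bullet> cls \<psi> = 0"
  shows "w = 0"
proof -
  have "AE x in lebesgue. x \<in> UNIV \<longrightarrow> fn w x = 0"
  proof (rule fundamental_lemma_variations)
    show "locally_integrable UNIV (fn w)"
      by (intro L2_imp_locally_integrable L2_lborel_lebesgue fn_L2)
    show "(LINT x:UNIV|lebesgue. fn w x * \<psi> x) = 0" if "\<psi> \<in> test_functions UNIV" for \<psi>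
      using assms[OF that] inner_cls[OF test_L2'[OF that], of w] by (simp add: set_lebesgue_integral_def)
  qed simp
  then have "AE x in lborel. fn w x = 0" by (simp add: AE_completion_iff)
  then show ?thesis
    by (intro l2_eqI) (use fn_zero in \<open>auto elim: eventually_elim2\<close>)
qed

lemma test_separating_eq:
  assumes "\<And>\<psi>. \<psi> \<in> test_functions UNIV \<Longrightarrow> u \<bullet> cls \<psi> = w \<bullet> cls \<psi>"
  shows "u = w"
  using test_separating[of "u - w"] assms by (simp add: inner_diff_left)

lemma subspace_test_classes: "subspace (cls ` test_functions \<Omega>)"
proof (rule subspaceI)
  show "0 \<in> cls ` test_functions \<Omega>" using cls_zero test_zero by (metis image_eqI)
  show "x + y \<in> cls ` test_functions \<Omega>" if xy: "x \<in> cls ` test_functions \<Omega>" "y \<in> cls ` test_functions \<Omega>" for x y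
  proof -
    obtain \<psi> \<phi> where *: "\<psi> \<in> test_functions \<Omega>" "x = cls \<psi>" "\<phi> \<in> test_functions \<Omega>" "y = cls \<phi>" using xy by blast
    then show ?thesis
      by (intro image_eqI[of _ _ "\<lambda>x. \<psi> x + \<phi> x"])
        (simp_all add: cls_add[OF test_L2'[OF *(1)] test_L2'[OF *(3)]] test_add)
  qed
  show "c *\<^sub>R x \<in> cls ` test_functions \<Omega>" if x: "x \<in> cls ` test_functions \<Omega>" for c x
  proof -
    obtain \<psi> where *: "\<psi> \<in> test_functions \<Omega>" "x = cls \<psi>" using x by blast
    then show ?thesis
      by (intro image_eqI[of _ _ "\<lambda>x. c * \<psi> x"]) (simp_all add: cls_cmult[OF test_L2'[OF *(1)]] test_cmult)
  qed
qed

lemma test_dense: "closure (cls ` test_functions UNIV) = (UNIV :: 'a::euclidean_space l2 set)"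
  by (rule dense_if_orthogonal_trivial[OF subspace_test_classes]) (auto intro: test_separating)

lemma test_difference_bound:
  assumes "smooth \<psi>" "\<And>x. \<bar>dd e \<psi> x\<bar> \<le> C"
  shows "\<bar>\<psi> (x + s *\<^sub>R e) - \<psi> x\<bar> \<le> C * \<bar>s\<bar>"
proof -
  have "norm (\<psi> (x + s *\<^sub>R e) - \<psi> (x + 0 *\<^sub>R e)) \<le> C * norm (s - 0)"
    by (rule field_differentiable_bound[of UNIV _ "\<lambda>s. dd e \<psi> (x + s *\<^sub>R e)"])
      (use assms(2) dd_line[OF assms(1)] in auto)
  then show ?thesis by simp
qed

lemma has_vector_derivative_0_iff:
  "(f has_vector_derivative d) (at (0::real) within S) \<longleftrightarrow> ((\<lambda>s. (f s - f 0) /\<^sub>R s) \<longlongrightarrow> d) (at 0 within S)"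
proof -
  have "norm (f y - f 0 - y *\<^sub>R d) / \<bar>y\<bar> = norm ((f y - f 0) /\<^sub>R y - d)" if "y \<noteq> 0" for y
  proof -
    have "(f y - f 0) /\<^sub>R y - d = (f y - f 0 - y *\<^sub>R d) /\<^sub>R y"
      using that by (simp add: scaleR_diff_right)
    then show ?thesis by (simp add: divide_inverse mult.commute)
  qed
  then have "((\<lambda>y. norm (f y - f 0 - y *\<^sub>R d) / \<bar>y\<bar>) \<longlongrightarrow> 0) (at 0 within S) \<longleftrightarrow>
      ((\<lambda>y. norm ((f y - f 0) /\<^sub>R y - d)) \<longlongrightarrow> 0) (at 0 within S)"
    by (intro tendsto_cong) (auto simp: eventually_at_filter)
  then show ?thesis
    unfolding has_vector_derivative_def has_derivative_iff_norm
    by (simp add: bounded_linear_scaleR_left tendsto_norm_zero_iff Lim_null[of _ d])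
qed

text \<open>For |s| \<le> 1 the errors of the difference quotients are bounded by 2 C and supported
  in one ball, so dominated convergence upgrades the pointwise derivative to a derivative in
  L^2.\<close>

lemma shift_test_has_vector_derivative_0:
  fixes \<psi> :: "'a::euclidean_space \<Rightarrow> real"
  assumes \<psi>: "\<psi> \<in> test_functions \<Omega>"
  shows "((\<lambda>s. shift (s *\<^sub>R e) (cls \<psi>)) has_vector_derivative cls (dd e \<psi>)) (at 0)"
proof -
  note sm = test_smooth[OF \<psi>]
  obtain K where K: "compact K" "\<And>x. x \<notin> K \<Longrightarrow> \<psi> x = 0" using \<psi> by (rule test_functionsE) blast
  obtain C where C: "C > 0" "\<And>x. \<bar>dd e \<psi> x\<bar> \<le> C" using test_bounded[OF test_dd[OF \<psi>]] by blast
  obtain R where R: "\<And>x. x \<in> K \<Longrightarrow> norm x \<le> R"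
    using compact_imp_bounded[OF K(1)] bounded_iff by blast
  \<comment> \<open>Large enough to contain the support of \<psi> and of all its translates by s e
    with |s| \<le> 1.\<close>
  let ?B = "cball (0::'a) (R + norm e)"
  let ?q = "\<lambda>s x. (\<psi> (x + s *\<^sub>R e) - \<psi> x) / s - dd e \<psi> x"
  have q2: "\<bar>?q s x\<bar> \<le> 2 * C * indicator ?B x" if s: "s \<noteq> 0" "\<bar>s\<bar> \<le> 1" for s x
  proof (cases "x \<in> ?B")
    case True
    have "\<bar>(\<psi> (x + s *\<^sub>R e) - \<psi> x) / s\<bar> \<le> C"
      using test_difference_bound[OF sm C(2), of x s] s by (simp add: field_simps)
    then have "\<bar>?q s x\<bar> \<le> 2 * C" using C(2)[of x] unfolding abs_le_iff by linarith
    with True show ?thesis by simp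
  next
    case False
    have "x \<notin> K" using R[of x] False by (auto simp: not_le) (smt (verit) norm_ge_zero)
    moreover have "x + s *\<^sub>R e \<notin> K"
    proof
      assume "x + s *\<^sub>R e \<in> K"
      then have "norm x \<le> R + norm (s *\<^sub>R e)" using R norm_triangle_ineq4[of "x + s *\<^sub>R e" "s *\<^sub>R e"] by fastforce
      also have "norm (s *\<^sub>R e) \<le> norm e" using s by (simp add: mult_left_le_one_le)
      finally show False using False by simp
    qed
    moreover have "dd e \<psi> x = 0"
    proof (rule dd_eqI)
      show "(\<psi> has_derivative (\<lambda>_. 0)) (at x)"
      proof (rule has_derivative_transform_within_open[of "\<lambda>_. 0" _ x UNIV "- K"])
        show "open (- K)" using compact_imp_closed[OF K(1)] by auto
      qed (use K(2) \<open>x \<notin> K\<close> in auto)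
    qed
    ultimately show ?thesis using False K(2) by simp
  qed
  have qL: "?q s \<in> L2 lborel" for s
    using L2_diff[OF L2_cmult[OF L2_diff[OF L2_shift[OF test_L2[OF \<psi>], of "s *\<^sub>R e"] test_L2[OF \<psi>]], of "1/s"]
       test_L2[OF test_dd[OF \<psi>]]] by simp
  have cq: "(shift (s *\<^sub>R e) (cls \<psi>) - cls \<psi>) /\<^sub>R s - cls (dd e \<psi>) = cls (?q s)" for s
  proof -
    have sh: "(\<lambda>x. \<psi> (x + s *\<^sub>R e)) \<in> L2 lebesgue" using L2_shift[OF test_L2[OF \<psi>]] by (rule L2_lborel_lebesgue)
    have "cls (?q s) = cls (\<lambda>x. inverse s * (\<psi> (x + s *\<^sub>R e) - \<psi> x)) - cls (dd e \<psi>)"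
      using cls_diff[OF L2_cmult[OF L2_diff[OF sh test_L2'[OF \<psi>]], of "inverse s"] test_L2'[OF test_dd[OF \<psi>]]]
      by (simp add: divide_inverse mult.commute)
    then show ?thesis
      using L2_diff[OF sh test_L2'[OF \<psi>]] sh test_L2'[OF \<psi>]
      by (simp add: cls_cmult cls_diff shift_cls test_L2[OF \<psi>])
  qed
  have "((\<lambda>s. cls (?q s)) \<longlongrightarrow> 0) (at 0 within {-1..1})"
    unfolding tendsto_at_iff_sequentially
  proof (intro allI impI)
    fix X :: "nat \<Rightarrow> real" assume X: "\<forall>i. X i \<in> {-1..1} - {0}" "X \<longlonglongrightarrow> 0"
    have "(\<lambda>n. LINT x|lborel. (?q (X n) x)\<^sup>2) \<longlonglongrightarrow> (LINT x|(lborel::'a measure). 0)"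
    proof (rule integral_dominated_convergence[where w = "\<lambda>x. (2 * C)\<^sup>2 * indicator ?B x"])
      show "integrable lborel (\<lambda>x. (2 * C)\<^sup>2 * indicator ?B x)"
        by (intro Bochner_Integration.integrable_mult_right integrable_real_indicator) (use emeasure_bounded_finite[OF bounded_cball] in auto)
      show "AE x in lborel. norm ((?q (X n) x)\<^sup>2) \<le> (2 * C)\<^sup>2 * indicator ?B x" for n
      proof (rule AE_I2)
        fix x :: 'a
        have "\<bar>?q (X n) x\<bar>\<^sup>2 \<le> (2 * C * indicator ?B x)\<^sup>2"
          using q2[of "X n" x] X(1) by (intro power_mono) (auto simp: abs_le_iff)
        then show "norm ((?q (X n) x)\<^sup>2) \<le> (2 * C)\<^sup>2 * indicator ?B x"
          by (auto simp: indicator_def power_mult_distrib split: if_splits)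
      qed
      show "AE x in lborel. (\<lambda>n. (?q (X n) x)\<^sup>2) \<longlonglongrightarrow> 0"
      proof (rule AE_I2)
        fix x :: 'a
        have "((\<lambda>h. (\<psi> (x + (0 + h) *\<^sub>R e) - \<psi> (x + 0 *\<^sub>R e)) / h) \<longlongrightarrow> dd e \<psi> (x + 0 *\<^sub>R e)) (at 0)"
          using dd_line[OF sm, of x e 0] unfolding DERIV_def .
        then have "((\<lambda>h. (\<psi> (x + h *\<^sub>R e) - \<psi> x) / h) \<longlongrightarrow> dd e \<psi> x) (at 0)" by simp
        then have "((\<lambda>h. (\<psi> (x + h *\<^sub>R e) - \<psi> x) / h) \<circ> X) \<longlonglongrightarrow> dd e \<psi> x"
          unfolding tendsto_at_iff_sequentially using X by auto
        then have "(\<lambda>n. (?q (X n) x)\<^sup>2) \<longlonglongrightarrow> (dd e \<psi> x - dd e \<psi> x)\<^sup>2"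
          unfolding o_def by (intro tendsto_intros)
        then show "(\<lambda>n. (?q (X n) x)\<^sup>2) \<longlonglongrightarrow> 0" by simp
      qed
    qed (use L2D(1)[OF qL] in \<open>auto intro!: borel_measurable_power\<close>)
    then have "(\<lambda>n. sqrt ((norm (cls (?q (X n))))\<^sup>2)) \<longlonglongrightarrow> sqrt 0"
      unfolding norm_cls[OF qL] by (intro tendsto_real_sqrt) simp
    then show "((\<lambda>s. cls (?q s)) \<circ> X) \<longlonglongrightarrow> 0"
      by (simp add: tendsto_norm_zero_iff o_def)
  qed
  moreover have "at (0::real) within {-1..1} = at 0" by (rule at_within_interior) simp
  ultimately have "((\<lambda>s. cls (?q s)) \<longlongrightarrow> 0) (at 0)"
    by (simp only:)
  then have "((\<lambda>s. (shift (s *\<^sub>R e) (cls \<psi>) - cls \<psi>) /\<^sub>R s - cls (dd e \<psi>)) \<longlongrightarrow> 0) (at 0)"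
    by (simp only: cq)
  then have "((\<lambda>s. (shift (s *\<^sub>R e) (cls \<psi>) - cls \<psi>) /\<^sub>R s) \<longlongrightarrow> cls (dd e \<psi>)) (at 0)"
    by (rule Lim_null[THEN iffD2])
  then show ?thesis
    unfolding has_vector_derivative_0_iff by (simp only: scaleR_zero_left shift_0)
qed

lemma shift_test: "\<psi> \<in> test_functions \<Omega> \<Longrightarrow> shift a (cls \<psi>) = cls (\<lambda>x. \<psi> (x + a))"
  by (rule shift_cls[OF test_L2])

lemma test_shift_UNIV: "\<psi> \<in> test_functions \<Omega> \<Longrightarrow> (\<lambda>x. \<psi> (x + a)) \<in> test_functions UNIV"
  by (erule test_shift) simp

lemma shift_cls_dd:
  assumes "\<psi> \<in> test_functions \<Omega>"
  shows "shift a (cls (dd e \<psi>)) = cls (dd e (\<lambda>x. \<psi> (x + a)))"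
  unfolding shift_test[OF test_dd[OF assms]] dd_shift[OF test_smooth[OF assms], abs_def] ..

text \<open>By the group property the derivative at 0 determines the derivative at every r.\<close>

lemma shift_has_vector_derivative_translate:
  assumes "((\<lambda>s. shift (s *\<^sub>R e) u) has_vector_derivative z) (at 0)"
  shows "((\<lambda>s. shift (s *\<^sub>R e) u) has_vector_derivative shift (r *\<^sub>R e) z) (at r)"
proof -
  have "((\<lambda>s. shift (s *\<^sub>R e) u) has_vector_derivative z) (at (r - r))"
    using assms by simp
  moreover have "((\<lambda>s. s - r) has_real_derivative 1) (at r)"
    by (auto intro!: derivative_eq_intros)
  ultimately have "(((\<lambda>s. shift (s *\<^sub>R e) u) \<circ> (\<lambda>s. s - r)) has_vector_derivative 1 *\<^sub>R z) (at r)"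
    by (intro vector_diff_chain_at) (auto simp: has_real_derivative_iff_has_vector_derivative)
  then have "((\<lambda>s. shift (r *\<^sub>R e) (shift ((s - r) *\<^sub>R e) u)) has_vector_derivative shift (r *\<^sub>R e) z) (at r)"
    unfolding o_def by (intro bounded_linear.has_vector_derivative[OF bounded_linear_shift]) simp
  then show ?thesis by (simp add: shift_shift algebra_simps)
qed

lemma shift_test_has_vector_derivative:
  assumes "\<psi> \<in> test_functions \<Omega>"
  shows "((\<lambda>s. shift (s *\<^sub>R e) (cls \<psi>)) has_vector_derivative shift (r *\<^sub>R e) (cls (dd e \<psi>))) (at r within S)"
  by (rule has_vector_derivative_at_within, rule shift_has_vector_derivative_translate,
      rule shift_test_has_vector_derivative_0[OF assms])

text \<open>Translations are isometries, so strong continuity passes from the dense set of test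
  functions to all of L^2.\<close>

lemma continuous_on_shift: "continuous_on S (\<lambda>s::real. shift (s *\<^sub>R e) w)"
proof -
  have "isCont (\<lambda>s. shift (s *\<^sub>R e) w) r" for r
    unfolding continuous_at_eps_delta
  proof (intro allI impI)
    fix \<epsilon> :: real assume \<epsilon>: "\<epsilon> > 0"
    obtain \<psi> where \<psi>: "\<psi> \<in> test_functions UNIV" "dist (cls \<psi>) w < \<epsilon> / 3"
      using test_dense \<epsilon> closure_approachable[of w "cls ` test_functions UNIV"]
      by (metis (no_types, lifting) UNIV_I divide_pos_pos imageE zero_less_numeral)
    have "isCont (\<lambda>s. shift (s *\<^sub>R e) (cls \<psi>)) r"
      using shift_test_has_vector_derivative[OF \<psi>(1), of e r UNIV]
      by (auto intro: has_vector_derivative_continuous)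
    then obtain d where d: "d > 0" "\<And>s. dist s r < d \<Longrightarrow> dist (shift (s *\<^sub>R e) (cls \<psi>)) (shift (r *\<^sub>R e) (cls \<psi>)) < \<epsilon> / 3"
      unfolding continuous_at_eps_delta using \<epsilon> by (metis divide_pos_pos zero_less_numeral)
    have iso: "dist (shift (s *\<^sub>R e) (cls \<psi>)) (shift (s *\<^sub>R e) w) < \<epsilon> / 3" for s
      using \<psi>(2) unfolding dist_norm shift_diff[symmetric] by simp
    have "dist (shift (s *\<^sub>R e) w) (shift (r *\<^sub>R e) w) < \<epsilon>" if "dist s r < d" for s
      using iso[of s] iso[of r] d(2)[OF that]
        dist_triangle[of "shift (s *\<^sub>R e) w" "shift (r *\<^sub>R e) w" "shift (s *\<^sub>R e) (cls \<psi>)"]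
        dist_triangle[of "shift (s *\<^sub>R e) (cls \<psi>)" "shift (r *\<^sub>R e) w" "shift (r *\<^sub>R e) (cls \<psi>)"]
      by (simp add: dist_commute)
    with d(1) show "\<exists>d>0. \<forall>s. dist s r < d \<longrightarrow> dist (shift (s *\<^sub>R e) w) (shift (r *\<^sub>R e) w) < \<epsilon>" by blast
  qed
  then show ?thesis by (simp add: continuous_at_imp_continuous_on)
qed

text \<open>A relation rather than an operator, so that its graph is a closed subspace to which
  orthogonal projection applies. Tests range over the whole space, which fits classes extended by
  zero.\<close>

definition wderiv :: "'a::euclidean_space \<Rightarrow> 'a l2 \<Rightarrow> 'a l2 \<Rightarrow> bool" where
  "wderiv e w z \<longleftrightarrow> (\<forall>\<psi>\<in>test_functions UNIV. w \<bullet> cls (dd e \<psi>) = - (z \<bullet> cls \<psi>))"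

lemma wderivD: "wderiv e w z \<Longrightarrow> \<psi> \<in> test_functions \<Omega> \<Longrightarrow> w \<bullet> cls (dd e \<psi>) = - (z \<bullet> cls \<psi>)"
  unfolding wderiv_def using test_UNIV by blast

lemma closed_wderiv: "closed {(w, z). wderiv e w z}"
proof -
  have "{(w, z). wderiv e w z} = (\<Inter>\<psi>\<in>test_functions UNIV. {p. fst p \<bullet> cls (dd e \<psi>) = - (snd p \<bullet> cls \<psi>)})"
    by (auto simp: wderiv_def)
  also have "closed \<dots>"
    by (intro closed_INT ballI closed_Collect_eq continuous_intros)
  finally show ?thesis .
qed

lemma subspace_wderiv: "subspace {(w, z). wderiv e w z}"
  by (rule subspaceI) (auto simp: wderiv_def inner_add_left zero_prod_def scaleR_prod_def plus_prod_def split: prod.splits)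

lemma wderiv_diff: "wderiv e w z \<Longrightarrow> wderiv e w' z' \<Longrightarrow> wderiv e (w - w') (z - z')"
  by (simp add: wderiv_def inner_diff_left)

text \<open>Under the inner product with \<psi> the translation passes to \<psi>, where it is
  differentiable; the weak derivative turns that derivative into \<open>z\<close>, and the
  fundamental theorem of calculus integrates.\<close>

lemma wderiv_shift_integral:
  assumes wz: "wderiv e w z" and s: "s \<ge> 0"
  shows "shift (s *\<^sub>R e) w - w = integral {0..s} (\<lambda>r. shift (r *\<^sub>R e) z)"
proof (rule test_separating_eq)
  fix \<psi> :: "'a \<Rightarrow> real" assume \<psi>: "\<psi> \<in> test_functions UNIV"
  define h where "h r = w \<bullet> shift (r *\<^sub>R (- e)) (cls \<psi>)" for r
  have hd: "(h has_vector_derivative shift (r *\<^sub>R e) z \<bullet> cls \<psi>) (at r within {0..s})" for r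
  proof -
    have "(h has_vector_derivative w \<bullet> shift (r *\<^sub>R (- e)) (cls (dd (- e) \<psi>))) (at r within {0..s})"
      unfolding h_def
      by (intro bounded_linear.has_vector_derivative[OF bounded_linear_inner_right]
          shift_test_has_vector_derivative[OF \<psi>])
    also have "dd (- e) \<psi> = (\<lambda>x. (-1) * dd e \<psi> x)"
      using dd_scaleR[OF test_smooth[OF \<psi>], of "-1" e] by auto
    also have "w \<bullet> shift (r *\<^sub>R (- e)) (cls (\<lambda>x. (-1) * dd e \<psi> x)) = - (w \<bullet> shift (r *\<^sub>R (- e)) (cls (dd e \<psi>)))"
      unfolding cls_cmult[OF test_L2'[OF test_dd[OF \<psi>]], of "-1"] shift_scaleR by simp
    also have "\<dots> = z \<bullet> cls (\<lambda>x. \<psi> (x + r *\<^sub>R (- e)))"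
      unfolding shift_cls_dd[OF \<psi>] wderivD[OF wz test_shift_UNIV[OF \<psi>]] by (rule minus_minus)
    also have "\<dots> = shift (r *\<^sub>R e) z \<bullet> cls \<psi>"
      by (simp add: inner_shift shift_test[OF \<psi>])
    finally show ?thesis .
  qed
  have "((\<lambda>r. shift (r *\<^sub>R e) z \<bullet> cls \<psi>) has_integral h s - h 0) {0..s}"
    by (rule fundamental_theorem_of_calculus[OF s hd])
  moreover have "((\<lambda>r. shift (r *\<^sub>R e) z) has_integral integral {0..s} (\<lambda>r. shift (r *\<^sub>R e) z)) {0..s}"
    by (intro integrable_integral integrable_continuous_real continuous_on_shift)
  then have "((\<lambda>r. shift (r *\<^sub>R e) z \<bullet> cls \<psi>) has_integral integral {0..s} (\<lambda>r. shift (r *\<^sub>R e) z) \<bullet> cls \<psi>) {0..s}"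
    using has_integral_linear[OF _ bounded_linear_inner_left[of "cls \<psi>"]] by (simp add: o_def)
  ultimately have "integral {0..s} (\<lambda>r. shift (r *\<^sub>R e) z) \<bullet> cls \<psi> = h s - h 0"
    using has_integral_unique by blast
  then show "(shift (s *\<^sub>R e) w - w) \<bullet> cls \<psi> = integral {0..s} (\<lambda>r. shift (r *\<^sub>R e) z) \<bullet> cls \<psi>"
    by (simp add: h_def inner_diff_left inner_shift)
qed

lemma shift_integral_has_vector_derivative:
  "((\<lambda>s. integral {0..s} (\<lambda>r. shift (r *\<^sub>R e) z)) has_vector_derivative z) (at 0 within {0..1})"
  using integral_has_vector_derivative[OF continuous_on_shift, of 0 0 1 e z] by simp

text \<open>The integral formula covers s \<ge> 0, hence a one-sided derivative; this is enough to
  differentiate the constant functions below.\<close>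

lemma wderiv_has_vector_derivative:
  assumes "wderiv e w z"
  shows "((\<lambda>s. shift (s *\<^sub>R e) w) has_vector_derivative z) (at 0 within {0..1})"
proof -
  have "((\<lambda>s. w + integral {0..s} (\<lambda>r. shift (r *\<^sub>R e) z)) has_vector_derivative 0 + z) (at 0 within {0..1})"
    by (intro has_vector_derivative_add has_vector_derivative_const shift_integral_has_vector_derivative)
  then have "((\<lambda>s. w + integral {0..s} (\<lambda>r. shift (r *\<^sub>R e) z)) has_vector_derivative z) (at 0 within {0..1})"
    by simp
  then show ?thesis
    by (rule has_vector_derivative_transform[rotated 2]) (auto simp: wderiv_shift_integral[OF assms, symmetric])
qed

text \<open>The next three identities differentiate, at s = 0, an inner product of simultaneously
  translated functions, which is constant in s by isometry.\<close>

lemma zero_vector_derivative_of_const: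
  assumes "(g has_vector_derivative d) (at 0 within {0..1::real})" "\<And>s. g s = (k::real)"
  shows "d = 0"
proof -
  have "g = (\<lambda>s. k)" using assms(2) by auto
  then have "(g has_vector_derivative 0) (at 0 within {0..1})" by simp
  moreover have "at 0 within {0..1::real} \<noteq> bot" by (simp add: at_within_Icc_at_right trivial_limit_at_right_real)
  ultimately show ?thesis using assms(1) vector_derivative_unique_within by blast
qed

text \<open>A multiplier constant along \<open>e\<close> commutes with the translations along
  \<open>e\<close>, however irregular it is in the other directions. In the applications it is a
  weight or an indicator depending on time alone.\<close>

lemma wderiv_mul_invariant:
  assumes wz: "wderiv e w z" and c: "bounded_borel c" "\<And>x s. c (x + s *\<^sub>R e) = c x"
  shows "wderiv e (mul c w) (mul c z)"
  unfolding wderiv_def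
proof
  fix \<psi> :: "'a \<Rightarrow> real" assume \<psi>: "\<psi> \<in> test_functions UNIV"
  have "((\<lambda>s. mul c (shift (s *\<^sub>R e) w) \<bullet> shift (s *\<^sub>R e) (cls \<psi>)) has_vector_derivative
      mul c (shift (0 *\<^sub>R e) w) \<bullet> shift (0 *\<^sub>R e) (cls (dd e \<psi>)) + mul c z \<bullet> shift (0 *\<^sub>R e) (cls \<psi>)) (at 0 within {0..1})"
    by (intro bounded_bilinear.has_vector_derivative[OF bounded_bilinear_inner]
        bounded_linear.has_vector_derivative[OF bounded_linear_mul[OF c(1)]]
        wderiv_has_vector_derivative[OF wz] shift_test_has_vector_derivative[OF \<psi>])
  moreover have "mul c (shift (s *\<^sub>R e) w) \<bullet> shift (s *\<^sub>R e) (cls \<psi>) = mul c w \<bullet> cls \<psi>" for s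
    using shift_mul[OF c(1), of "s *\<^sub>R e" w] c(2) by (metis (no_types, lifting) ext inner_shift_shift)
  ultimately have "mul c w \<bullet> cls (dd e \<psi>) + mul c z \<bullet> cls \<psi> = 0"
    using zero_vector_derivative_of_const by fastforce
  then show "mul c w \<bullet> cls (dd e \<psi>) = - (mul c z \<bullet> cls \<psi>)" by simp
qed

lemma wderiv_integration_by_parts:
  assumes "wderiv e w z" "wderiv e u y"
  shows "w \<bullet> y = - (z \<bullet> u)"
proof -
  have "((\<lambda>s. shift (s *\<^sub>R e) w \<bullet> shift (s *\<^sub>R e) u) has_vector_derivative
      shift (0 *\<^sub>R e) w \<bullet> y + z \<bullet> shift (0 *\<^sub>R e) u) (at 0 within {0..1})"
    by (intro bounded_bilinear.has_vector_derivative[OF bounded_bilinear_inner]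
        wderiv_has_vector_derivative assms)
  from zero_vector_derivative_of_const[OF this, of "w \<bullet> u"]
  show ?thesis by (simp add: inner_shift_shift)
qed

lemma wderiv_test:
  assumes "\<psi> \<in> test_functions \<Omega>"
  shows "wderiv e (cls \<psi>) (cls (dd e \<psi>))"
  unfolding wderiv_def
proof
  fix \<phi> :: "'a \<Rightarrow> real" assume \<phi>: "\<phi> \<in> test_functions UNIV"
  have "((\<lambda>s. shift (s *\<^sub>R e) (cls \<psi>) \<bullet> shift (s *\<^sub>R e) (cls \<phi>)) has_vector_derivative
      shift (0 *\<^sub>R e) (cls \<psi>) \<bullet> shift (0 *\<^sub>R e) (cls (dd e \<phi>)) + shift (0 *\<^sub>R e) (cls (dd e \<psi>)) \<bullet> shift (0 *\<^sub>R e) (cls \<phi>))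
      (at 0 within {0..1})"
    by (rule bounded_bilinear.has_vector_derivative[OF bounded_bilinear_inner
        shift_test_has_vector_derivative[OF assms] shift_test_has_vector_derivative[OF \<phi>]])
  from zero_vector_derivative_of_const[OF this, of "cls \<psi> \<bullet> cls \<phi>"]
  show "cls \<psi> \<bullet> cls (dd e \<phi>) = - (cls (dd e \<psi>) \<bullet> cls \<phi>)" by (simp add: inner_shift_shift)
qed

lemma subspace_test_graph: "subspace ((\<lambda>\<psi>. (cls \<psi>, cls (dd e \<psi>))) ` test_functions \<Omega>)" (is "subspace (?g ` _)")
proof (rule subspaceI)
  show "0 \<in> ?g ` test_functions \<Omega>"
    by (rule image_eqI[of _ _ "\<lambda>x. 0"]) (auto simp: cls_zero zero_prod_def dd_const[abs_def])
  show "x + y \<in> ?g ` test_functions \<Omega>" if xy: "x \<in> ?g ` test_functions \<Omega>" "y \<in> ?g ` test_functions \<Omega>" for x y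
  proof -
    obtain \<psi> \<phi> where *: "\<psi> \<in> test_functions \<Omega>" "x = ?g \<psi>" "\<phi> \<in> test_functions \<Omega>" "y = ?g \<phi>" using xy by blast
    then show ?thesis
      by (intro image_eqI[of _ _ "\<lambda>x. \<psi> x + \<phi> x"])
        (simp_all add: test_add dd_add_fun[OF test_smooth[OF *(1)] test_smooth[OF *(3)]]
          cls_add[OF test_L2'[OF *(1)] test_L2'[OF *(3)]]
          cls_add[OF test_L2'[OF test_dd[OF *(1)]] test_L2'[OF test_dd[OF *(3)]]])
  qed
  show "c *\<^sub>R x \<in> ?g ` test_functions \<Omega>" if x: "x \<in> ?g ` test_functions \<Omega>" for c x
  proof -
    obtain \<psi> where *: "\<psi> \<in> test_functions \<Omega>" "x = ?g \<psi>" using x by blast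
    then show ?thesis
      by (intro image_eqI[of _ _ "\<lambda>x. c * \<psi> x"])
        (simp_all add: test_cmult dd_cmult_fun[OF test_smooth[OF *(1)]]
          cls_cmult[OF test_L2'[OF *(1)]] cls_cmult[OF test_L2'[OF test_dd[OF *(1)]]])
  qed
qed

text \<open>An element \<open>(u, y)\<close> of the graph that is orthogonal to the graph over test functions
  satisfies \<open>y' = u\<close> as well as \<open>u' = y\<close>,
  hence \<open>u \<bullet> u = - (y \<bullet> y)\<close>.\<close>

lemma wderiv_test_dense:
  assumes "wderiv e w z"
  shows "(w, z) \<in> closure ((\<lambda>\<psi>. (cls \<psi>, cls (dd e \<psi>))) ` test_functions UNIV)" (is "_ \<in> closure ?P")
proof -
  obtain p where p: "p \<in> closure ?P" and orth: "\<And>s. s \<in> closure ?P \<Longrightarrow> ((w, z) - p) \<bullet> s = 0"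
    using projection_exists[OF subspace_closure_subspace[OF subspace_test_graph] closed_closure] by blast
  obtain u y where uy: "p = (u, y)" by (cases p)
  note p = p[unfolded uy] and orth = orth[unfolded uy]
  \<comment> \<open>The projection stays in the closed graph, so the difference is again a pair of a
    function and its weak derivative.\<close>
  have "closure ?P \<subseteq> {(w, z). wderiv e w z}"
    by (intro closure_minimal closed_wderiv) (auto intro: wderiv_test)
  with p have "wderiv e u y" by blast
  with assms have d1: "wderiv e (w - u) (z - y)" by (rule wderiv_diff)
  \<comment> \<open>Orthogonality to the pairs of \<psi> and its derivative is exactly the weak
    equation that z - y has derivative w - u.\<close>
  have d2: "wderiv e (z - y) (w - u)"
    unfolding wderiv_def
  proof
    fix \<psi> :: "'a \<Rightarrow> real" assume "\<psi> \<in> test_functions UNIV"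
    then have "(cls \<psi>, cls (dd e \<psi>)) \<in> ?P" by (rule imageI)
    then have "(cls \<psi>, cls (dd e \<psi>)) \<in> closure ?P" by (rule subsetD[OF closure_subset])
    from orth[OF this] show "(z - y) \<bullet> cls (dd e \<psi>) = - ((w - u) \<bullet> cls \<psi>)" by simp
  qed
  have "(w - u) \<bullet> (w - u) = - ((z - y) \<bullet> (z - y))"
    by (rule wderiv_integration_by_parts[OF d1 d2])
  then have "w - u = 0" "z - y = 0"
    using inner_ge_zero[of "w - u"] inner_ge_zero[of "z - y"] inner_eq_zero_iff[of "w - u"] inner_eq_zero_iff[of "z - y"]
    by linarith+
  with p show ?thesis by simp
qed

section \<open>Steklov averages\<close>

definition avg :: "'a::euclidean_space \<Rightarrow> real \<Rightarrow> 'a l2 \<Rightarrow> 'a l2" where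
  "avg e h w = (1 / h) *\<^sub>R integral {0..h} (\<lambda>r. shift (r *\<^sub>R e) w)"

lemma shift_integrable: "(\<lambda>r::real. shift (r *\<^sub>R e) w) integrable_on {a..b}"
  by (intro integrable_continuous_real continuous_on_shift)

lemma inner_avg: "h > 0 \<Longrightarrow> u \<bullet> avg e h w = (1 / h) * integral {0..h} (\<lambda>r. u \<bullet> shift (r *\<^sub>R e) w)"
  unfolding avg_def
  using integral_linear[OF shift_integrable[of e w 0 h] bounded_linear_inner_right[of u]] by (simp add: o_def)

lemma avg_bounded_linear:
  assumes "h > 0" shows "bounded_linear (avg e h)"
proof (rule bounded_linear_intro[of _ 1])
  show "avg e h (u + v) = avg e h u + avg e h v" for u v
    unfolding avg_def by (simp add: shift_add Henstock_Kurzweil_Integration.integral_add[OF shift_integrable shift_integrable] algebra_simps)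
  show "avg e h (k *\<^sub>R u) = k *\<^sub>R avg e h u" for k u
    unfolding avg_def by (simp add: shift_scaleR)
  show "norm (avg e h u) \<le> norm u * 1" for u
  proof -
    have "norm (integral {0..h} (\<lambda>r. shift (r *\<^sub>R e) u)) \<le> norm u * (h - 0)"
      using assms by (intro integral_bound continuous_on_shift) auto
    with assms show ?thesis by (simp add: avg_def field_simps)
  qed
qed

lemma avg_tendsto: "((\<lambda>h. avg e h w) \<longlongrightarrow> w) (at 0 within {0..1})"
  using shift_integral_has_vector_derivative[of e w]
  unfolding has_vector_derivative_0_iff by (simp add: avg_def inverse_eq_divide)

section \<open>Uniqueness for a degenerate evolution equation\<close>

lemma bounded_borel_bound3:
  assumes "bounded_borel c1" "bounded_borel c2" "bounded_borel c3"
  obtains K where "K > 0" "\<And>x. \<bar>c1 x\<bar> \<le> K" "\<And>x. \<bar>c2 x\<bar> \<le> K" "\<And>x. \<bar>c3 x\<bar> \<le> K"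
proof -
  obtain K1 where "K1 > 0" "\<And>x. \<bar>c1 x\<bar> \<le> K1" using bounded_borel_bound[OF assms(1)] by blast
  moreover obtain K2 where "K2 > 0" "\<And>x. \<bar>c2 x\<bar> \<le> K2" using bounded_borel_bound[OF assms(2)] by blast
  moreover obtain K3 where "K3 > 0" "\<And>x. \<bar>c3 x\<bar> \<le> K3" using bounded_borel_bound[OF assms(3)] by blast
  ultimately show thesis by (intro that[of "max K1 (max K2 K3)"]) (auto simp: le_max_iff_disj)
qed

section \<open>Weights and cut-offs depending on time alone\<close>

lemma smooth_step_fst: "smooth (\<lambda>p::real \<times> real. smooth_step (c + r * fst p))"
  using smooth_affine[OF bounded_linear_const_mult[OF bounded_linear_fst, of r] smooth_smooth_step, of c] by simp

lemma smooth_exp_fst: "smooth (\<lambda>p::real \<times> real. exp (r * fst p))"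
  using smooth_affine[OF bounded_linear_const_mult[OF bounded_linear_fst, of r] smooth_exp, of 0] by simp

lemma dd_exp_fst: "dd e (\<lambda>p::real \<times> real. exp (r * fst p)) p = r * fst e * exp (r * fst p)"
proof (rule dd_eqI)
  show "((\<lambda>p. exp (r * fst p)) has_derivative (\<lambda>e. r * fst e * exp (r * fst p))) (at p)"
    by (auto intro!: derivative_eq_intros)
qed

lemma dd_x_fst:
  assumes "smooth (\<lambda>p::real \<times> real. h (fst p))"
  shows "dd (0, 1) (\<lambda>p. h (fst p)) (p :: real \<times> real) = 0"
proof -
  have "((\<lambda>s. h (fst (p + s *\<^sub>R (0, 1)))) has_real_derivative dd (0, 1) (\<lambda>p. h (fst p)) (p + 0 *\<^sub>R (0, 1))) (at 0)"
    using dd_line[OF assms, of p "(0, 1)" 0] by simp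
  moreover have "((\<lambda>s. h (fst (p + s *\<^sub>R (0, 1)))) has_real_derivative 0) (at (0::real))"
    by simp
  ultimately have "dd (0, 1) (\<lambda>p. h (fst p)) (p + 0 *\<^sub>R (0, 1)) = 0" by (rule DERIV_unique)
  then show ?thesis by (simp add: zero_prod_def[symmetric])
qed

lemma mul_mono_inner:
  assumes "bounded_borel c" "AE p in lborel. fn v p \<noteq> 0 \<longrightarrow> k \<le> c p"
  shows "k * (norm v)\<^sup>2 \<le> mul c v \<bullet> v"
  using inner_mul_mono[OF bounded_borel_const assms(1), of v k] assms(2)
  by (simp add: mul_const power2_norm_eq_inner)

lemma abs_inner_mul_le:
  assumes "bounded_borel c" "\<And>x. \<bar>c x\<bar> \<le> K" "K \<ge> 0"
  shows "\<bar>mul c u \<bullet> v\<bar> \<le> K * norm u * norm v"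
  using Cauchy_Schwarz_ineq2[of "mul c u" v] mult_right_mono[OF norm_mul_le[OF assms, of u] norm_ge_zero[of v]]
  by linarith

text \<open>For n > 0 equal to 1 where \<sigma> t \<le> \<kappa> - 2/n and to 0 where \<sigma> t
  \<ge> \<kappa> - 1/n; the remaining gap of width 1/n keeps supports compact inside the open
  half-plane. For n = 0 it vanishes identically.\<close>

definition time_cut :: "real \<Rightarrow> real \<Rightarrow> nat \<Rightarrow> real \<times> real \<Rightarrow> real" where
  "time_cut \<sigma> \<kappa> n p = smooth_step ((real n * \<kappa> - 1) + (- real n * \<sigma>) * fst p)"

lemma smooth_time_cut: "smooth (time_cut \<sigma> \<kappa> n)"
  unfolding time_cut_def[abs_def] by (rule smooth_step_fst)

lemma time_cut_le: "\<bar>time_cut \<sigma> \<kappa> n p\<bar> \<le> 1"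
  using smooth_step_simps by (auto simp: time_cut_def)

lemma bounded_borel_time_cut: "bounded_borel (time_cut \<sigma> \<kappa> n)"
  by (rule bounded_borelI[OF smooth_borel[OF smooth_time_cut] time_cut_le])

lemma time_cut_zero:
  assumes "\<kappa> - 1 / real n < \<sigma> * fst p"
  shows "time_cut \<sigma> \<kappa> n p = 0"
proof (cases "n = 0")
  case False
  with assms have "real n * (\<kappa> - 1 / real n) < real n * (\<sigma> * fst p)" by simp
  then show ?thesis unfolding time_cut_def using False by (intro smooth_step_simps) (simp add: algebra_simps)
qed (auto simp: time_cut_def smooth_step_simps)

lemma time_cut_tendsto:
  assumes "\<sigma> * fst p < \<kappa>"
  shows "(\<lambda>n. time_cut \<sigma> \<kappa> n p) \<longlonglongrightarrow> 1"
proof (rule tendsto_eventually)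
  obtain N where N: "2 / (\<kappa> - \<sigma> * fst p) < real N" using reals_Archimedean2 by blast
  have "time_cut \<sigma> \<kappa> n p = 1" if "n \<ge> N" for n
  proof -
    have "2 / (\<kappa> - \<sigma> * fst p) < real n" using N that by simp
    then have "2 < real n * (\<kappa> - \<sigma> * fst p)" using assms by (simp add: field_simps)
    then show ?thesis unfolding time_cut_def by (intro smooth_step_simps) (simp add: algebra_simps)
  qed
  then show "\<forall>\<^sub>F n in sequentially. time_cut \<sigma> \<kappa> n p = 1" unfolding eventually_sequentially by blast
qed

lemma time_cut_test:
  assumes \<psi>: "\<psi> \<in> test_functions \<Omega>"
  shows "(\<lambda>p. time_cut \<sigma> \<kappa> n p * \<psi> p) \<in> test_functions (\<Omega> \<inter> {p. \<sigma> * fst p < \<kappa>})"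
proof (cases "n = 0")
  case True
  then have "time_cut \<sigma> \<kappa> n p = 0" for p by (simp add: time_cut_def smooth_step_simps)
  then show ?thesis by simp
next
  case False
  obtain K where K: "compact K" "K \<subseteq> \<Omega>" "\<And>p. p \<notin> K \<Longrightarrow> \<psi> p = 0" using \<psi> by (rule test_functionsE) blast
  have "closed {p::real \<times> real. \<sigma> * fst p \<le> \<kappa> - 1 / real n}"
    by (intro closed_Collect_le continuous_intros)
  then have "compact (K \<inter> {p. \<sigma> * fst p \<le> \<kappa> - 1 / real n})" using K(1) by (rule compact_Int_closed[rotated])
  moreover have "\<sigma> * fst p < \<kappa>" if "\<sigma> * fst p \<le> \<kappa> - 1 / real n" for p :: "real \<times> real"
    using that False by (smt (verit) divide_pos_pos of_nat_0_less_iff neq0_conv)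
  moreover have "time_cut \<sigma> \<kappa> n p * \<psi> p = 0" if "p \<notin> K \<inter> {p. \<sigma> * fst p \<le> \<kappa> - 1 / real n}" for p
    using K(3)[of p] time_cut_zero[of \<kappa> n \<sigma> p] that by (auto simp: not_le)
  ultimately show ?thesis
    using K(2) by (intro test_functionsI[OF smooth_mult[OF smooth_time_cut test_smooth[OF \<psi>]]]) auto
qed

lemma dd_x_time_cut:
  assumes "smooth \<psi>"
  shows "dd (0, 1) (\<lambda>p. time_cut \<sigma> \<kappa> n p * \<psi> p) = (\<lambda>p. time_cut \<sigma> \<kappa> n p * dd (0, 1) \<psi> p)"
proof
  fix p
  have "dd (0, 1) (time_cut \<sigma> \<kappa> n) p = 0"
    using dd_x_fst[of "\<lambda>t. smooth_step ((real n * \<kappa> - 1) + (- real n * \<sigma>) * t)"] smooth_time_cut[of \<sigma> \<kappa> n]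
    by (simp add: time_cut_def[abs_def])
  then show "dd (0, 1) (\<lambda>p. time_cut \<sigma> \<kappa> n p * \<psi> p) p = time_cut \<sigma> \<kappa> n p * dd (0, 1) \<psi> p"
    by (simp add: dd_mult[OF smooth_time_cut assms])
qed

lemma mul_time_cut_tendsto:
  assumes "AE p in lborel. \<kappa> \<le> \<sigma> * fst p \<longrightarrow> fn u p = 0"
  shows "(\<lambda>n. mul (time_cut \<sigma> \<kappa> n) u) \<longlonglongrightarrow> u"
proof -
  have "AE p in lborel. fn u p \<noteq> 0 \<longrightarrow> (\<lambda>n. time_cut \<sigma> \<kappa> n p) \<longlonglongrightarrow> 1"
    using assms by eventually_elim (use time_cut_tendsto in force)
  from mul_tendsto[OF bounded_borel_time_cut time_cut_le bounded_borel_const this]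
  show ?thesis by (simp add: mul_const)
qed

lemma smooth_step_derivative_bound:
  obtains C where "C > 0" "\<And>x. \<bar>dd 1 smooth_step x\<bar> \<le> C" "\<And>x. 1 < x \<Longrightarrow> dd 1 smooth_step x = 0"
proof -
  have zero: "dd 1 smooth_step x = 0" if "x \<notin> {0..1}" for x
  proof (rule dd_eqI)
    show "(smooth_step has_derivative (\<lambda>_. 0)) (at x)"
    proof (rule has_derivative_transform_within_open[of "\<lambda>_. smooth_step x" _ x UNIV "if x < 0 then {..<0} else {1<..}"])
      show "smooth_step x = smooth_step y" if "y \<in> (if x < 0 then {..<0} else {1<..})" for y
        using that \<open>x \<notin> {0..1}\<close> by (auto simp: smooth_step_simps split: if_splits)
    qed (use that in auto)
  qed
  have "bounded (dd 1 smooth_step ` {0..1})"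
    by (intro compact_imp_bounded compact_continuous_image smooth_continuous smooth_dd smooth_smooth_step) simp
  then obtain C where C: "C > 0" "\<And>x. x \<in> {0..1} \<Longrightarrow> \<bar>dd 1 smooth_step x\<bar> \<le> C"
    unfolding bounded_pos by auto
  have "\<bar>dd 1 smooth_step x\<bar> \<le> C" for x using C zero[of x] by (cases "x \<in> {0..1}") auto
  then show thesis using that[of C] C(1) zero by auto
qed

text \<open>Height C n and layer width 2/n have a bounded product, with C independent of n and
  \<kappa>; this controls the cut-off at the terminal time.\<close>

lemma time_cut_derivative_bound:
  obtains C where "C > 0" "\<And>n \<kappa> p. \<bar>dd (1, 0) (time_cut 1 \<kappa> n) p\<bar> \<le> C * real n"
    "\<And>n \<kappa> p. 2 < real n * (\<kappa> - fst p) \<Longrightarrow> dd (1, 0) (time_cut 1 \<kappa> n) p = 0"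
proof -
  obtain C where C: "C > 0" "\<And>x. \<bar>dd 1 smooth_step x\<bar> \<le> C" "\<And>x. 1 < x \<Longrightarrow> dd 1 smooth_step x = 0"
    using smooth_step_derivative_bound by blast
  have eq: "dd (1, 0) (time_cut 1 \<kappa> n) p = (- real n) * dd 1 smooth_step ((real n * \<kappa> - 1) + (- real n) * fst p)" for n \<kappa> p
  proof -
    have "dd (1, 0) (time_cut 1 \<kappa> n) p = dd ((- real n * 1) *\<^sub>R 1) smooth_step ((real n * \<kappa> - 1) + (- real n * 1) * fst p)"
      using dd_affine[OF bounded_linear_const_mult[OF bounded_linear_fst] smooth_smooth_step,
          of "(1, 0)" "real n * \<kappa> - 1" "- real n * 1" p]
      unfolding time_cut_def[abs_def] by simp
    then show ?thesis unfolding dd_scaleR[OF smooth_smooth_step] by simp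
  qed
  show thesis
  proof (rule that[OF C(1)])
    show "\<bar>dd (1, 0) (time_cut 1 \<kappa> n) p\<bar> \<le> C * real n" for n \<kappa> p
      unfolding eq abs_mult mult.commute[of C] by (intro mult_mono C(2)) auto
    show "dd (1, 0) (time_cut 1 \<kappa> n) p = 0" if "2 < real n * (\<kappa> - fst p)" for n \<kappa> p
      using C(3)[of "(real n * \<kappa> - 1) + (- real n) * fst p"] that unfolding eq by (simp add: algebra_simps)
  qed
qed

text \<open>Global approximations are multiplied by \<open>time_cut\<close>, which commutes with the
  x-derivative; the approximation is sent to its limit first, the cut-off second.\<close>

lemma wderiv_test_dense_half_plane:
  fixes v z :: "(real \<times> real) l2"
  assumes wd: "wderiv (0, 1) v z"
    and v: "AE p in lborel. \<kappa> \<le> \<sigma> * fst p \<longrightarrow> fn v p = 0"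
    and z: "AE p in lborel. \<kappa> \<le> \<sigma> * fst p \<longrightarrow> fn z p = 0"
  shows "(v, z) \<in> closure ((\<lambda>\<psi>. (cls \<psi>, cls (dd (0, 1) \<psi>))) ` test_functions {p. \<sigma> * fst p < \<kappa>})"
    (is "_ \<in> closure ?P")
proof -
  let ?c = "time_cut \<sigma> \<kappa>"
  note bb = bounded_borel_time_cut[of \<sigma> \<kappa>]
  have cut: "(mul (?c n) v, mul (?c n) z) \<in> closure ?P" for n
  proof -
    have "(v, z) \<in> closure ((\<lambda>\<psi>. (cls \<psi>, cls (dd (0, 1) \<psi>))) ` test_functions UNIV)"
      by (rule wderiv_test_dense[OF wd])
    then obtain s where s: "\<And>k. s k \<in> (\<lambda>\<psi>. (cls \<psi>, cls (dd (0, 1) \<psi>))) ` test_functions UNIV" "s \<longlonglongrightarrow> (v, z)"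
      unfolding closure_sequential by blast
    have "(mul (?c n) (fst (s k)), mul (?c n) (snd (s k))) \<in> ?P" for k
    proof -
      obtain \<psi> where \<psi>: "\<psi> \<in> test_functions UNIV" "s k = (cls \<psi>, cls (dd (0, 1) \<psi>))" using s(1) by blast
      have "(\<lambda>p. ?c n p * \<psi> p) \<in> test_functions {p. \<sigma> * fst p < \<kappa>}"
        using time_cut_test[OF \<psi>(1), of \<sigma> \<kappa> n] by simp
      then show ?thesis
        by (rule image_eqI[rotated])
          (simp add: \<psi>(2) dd_x_time_cut[OF test_smooth[OF \<psi>(1)]] mul_cls[OF bb test_L2'[OF \<psi>(1)]] mul_cls[OF bb test_L2'[OF test_dd[OF \<psi>(1)]]])
    qed
    moreover have "(\<lambda>k. (mul (?c n) (fst (s k)), mul (?c n) (snd (s k)))) \<longlonglongrightarrow> (mul (?c n) v, mul (?c n) z)"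
      using tendsto_fst[OF s(2)] tendsto_snd[OF s(2)]
      by (intro tendsto_Pair bounded_linear.tendsto[OF bounded_linear_mul[OF bb]]) auto
    ultimately show ?thesis unfolding closure_sequential by (intro exI conjI) auto
  qed
  have "(\<lambda>n. (mul (?c n) v, mul (?c n) z)) \<longlonglongrightarrow> (v, z)"
    by (intro tendsto_Pair mul_time_cut_tendsto v z)
  with cut show ?thesis by (rule closed_sequentially[OF closed_closure])
qed

text \<open>Testing the equation with the forward time average of \<open>v\<close> turns the time
  derivative into a difference quotient, and \<open>b v (v\<^sub>h - v) \<le> b (v\<^sub>h\<^sup>2 - v\<^sup>2) / 2\<close> together
  with the Lipschitz continuity of \<open>b\<close> bounds it by a multiple of \<open>v\<^sup>2\<close>. The sign \<open>\<sigma>\<close> is the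
  direction of time.\<close>

lemma degenerate_energy_inequality:
  fixes v z :: "(real \<times> real) l2"
  assumes \<sigma>: "\<sigma> = 1 \<or> \<sigma> = (-1::real)"
    and b: "bounded_borel b" "\<And>p. 0 \<le> b p" "\<And>p s. b (p + s *\<^sub>R (1, 0)) \<le> b p + L * \<bar>s\<bar>"
    and wd: "wderiv (0, 1) v z"
    and v: "AE p in lborel. \<kappa> \<le> \<sigma> * fst p \<longrightarrow> fn v p = 0"
    and z: "AE p in lborel. \<kappa> \<le> \<sigma> * fst p \<longrightarrow> fn z p = 0"
    and eq: "\<And>\<psi>. \<psi> \<in> test_functions {p. \<sigma> * fst p < \<kappa>} \<Longrightarrow>
      \<sigma> * (mul b v \<bullet> cls (dd (1, 0) \<psi>)) = P \<bullet> cls (dd (0, 1) \<psi>) + R \<bullet> cls \<psi>"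
  shows "P \<bullet> z + R \<bullet> v \<le> L / 2 * (norm v)\<^sup>2"
proof -
  let ?G = "{p::real \<times> real. \<sigma> * fst p < \<kappa>}"
  \<comment> \<open>Replacing p by p + r e with r \<ge> 0 moves the support towards smaller \<sigma>
    t, so translated test functions stay in the half-plane.\<close>
  define e where "e = \<sigma> *\<^sub>R (1::real, 0::real)"
  have quot_test: "(1 / h) * (mul b v \<bullet> (shift (h *\<^sub>R e) (cls \<psi>) - cls \<psi>)) =
      P \<bullet> avg e h (cls (dd (0, 1) \<psi>)) + R \<bullet> avg e h (cls \<psi>)"
    if \<psi>: "\<psi> \<in> test_functions ?G" and h: "h > 0" for \<psi> h
  proof -
    have eq': "mul b v \<bullet> shift (r *\<^sub>R e) (cls (dd e \<psi>)) =
        P \<bullet> shift (r *\<^sub>R e) (cls (dd (0, 1) \<psi>)) + R \<bullet> shift (r *\<^sub>R e) (cls \<psi>)" if "r \<in> {0..h}" for r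
    proof -
      let ?\<psi> = "\<lambda>p. \<psi> (p + r *\<^sub>R e)"
      have \<psi>r: "?\<psi> \<in> test_functions ?G"
        using \<psi> by (rule test_shift) (use that \<sigma> in \<open>auto simp: e_def algebra_simps\<close>)
      have "dd e ?\<psi> = (\<lambda>p. \<sigma> * dd (1, 0) ?\<psi> p)"
        unfolding e_def by (rule ext, rule dd_scaleR) (rule test_smooth[OF \<psi>r, unfolded e_def])
      then have "mul b v \<bullet> shift (r *\<^sub>R e) (cls (dd e \<psi>)) = \<sigma> * (mul b v \<bullet> cls (dd (1, 0) ?\<psi>))"
        by (simp add: shift_cls_dd[OF \<psi>] cls_cmult[OF test_L2'[OF test_dd[OF \<psi>r]]])
      also have "\<dots> = P \<bullet> cls (dd (0, 1) ?\<psi>) + R \<bullet> cls ?\<psi>" by (rule eq[OF \<psi>r])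
      finally show ?thesis by (simp add: shift_cls_dd[OF \<psi>] shift_test[OF \<psi>])
    qed
    \<comment> \<open>The difference quotient is the average of the time derivative, so it arises by
      integrating the equation over the translates of \<psi>.\<close>
    have "shift (h *\<^sub>R e) (cls \<psi>) - cls \<psi> = h *\<^sub>R avg e h (cls (dd e \<psi>))"
      using wderiv_shift_integral[OF wderiv_test[OF \<psi>, of e], of h] h by (simp add: avg_def)
    then have "(1 / h) * (mul b v \<bullet> (shift (h *\<^sub>R e) (cls \<psi>) - cls \<psi>)) = mul b v \<bullet> avg e h (cls (dd e \<psi>))"
      using h by simp
    also have "\<dots> = (1 / h) * integral {0..h} (\<lambda>r. mul b v \<bullet> shift (r *\<^sub>R e) (cls (dd e \<psi>)))"
      by (rule inner_avg[OF h])
    also have "integral {0..h} (\<lambda>r. mul b v \<bullet> shift (r *\<^sub>R e) (cls (dd e \<psi>))) =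
        integral {0..h} (\<lambda>r. P \<bullet> shift (r *\<^sub>R e) (cls (dd (0, 1) \<psi>)) + R \<bullet> shift (r *\<^sub>R e) (cls \<psi>))"
      by (rule Henstock_Kurzweil_Integration.integral_cong) (rule eq')
    also have "\<dots> = integral {0..h} (\<lambda>r. P \<bullet> shift (r *\<^sub>R e) (cls (dd (0, 1) \<psi>))) +
        integral {0..h} (\<lambda>r. R \<bullet> shift (r *\<^sub>R e) (cls \<psi>))"
      by (rule Henstock_Kurzweil_Integration.integral_add)
        (intro integrable_continuous_real continuous_intros continuous_on_shift)+
    finally show ?thesis by (simp add: inner_avg[OF h] algebra_simps)
  qed
  have quot: "(1 / h) * (mul b v \<bullet> (shift (h *\<^sub>R e) v - v)) = P \<bullet> avg e h z + R \<bullet> avg e h v" if h: "h > 0" for h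
  proof -
    have bl: "bounded_linear (shift (h *\<^sub>R e))" "bounded_linear (avg e h)"
      by (rule bounded_linear_shift, rule avg_bounded_linear[OF h])
    \<comment> \<open>With the factor \<open>mul b v\<close> held fixed, both sides are continuous
      in the remaining pair, so (v, z) itself may take the place of a test function and its
      x-derivative.\<close>
    let ?F = "\<lambda>p. (1 / h) * (mul b v \<bullet> (shift (h *\<^sub>R e) (fst p) - fst p))"
    let ?H = "\<lambda>p. P \<bullet> avg e h (snd p) + R \<bullet> avg e h (fst p)"
    have "?F (v, z) = ?H (v, z)"
    proof (rule continuous_linear_eq_on_closure[OF _ _ _ wderiv_test_dense_half_plane[OF wd v z]])
      show "continuous_on UNIV ?F" "continuous_on UNIV ?H"
        by (intro continuous_intros bounded_linear.continuous_on[OF bl(1)] bounded_linear.continuous_on[OF bl(2)])+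
      show "?F p = ?H p" if "p \<in> (\<lambda>\<psi>. (cls \<psi>, cls (dd (0, 1) \<psi>))) ` test_functions ?G" for p
        using that quot_test[OF _ h] by auto
    qed
    then show ?thesis by simp
  qed
  have upper: "(1 / h) * (mul b v \<bullet> (shift (h *\<^sub>R e) v - v)) \<le> L / 2 * (norm v)\<^sup>2" if h: "h > 0" for h
  proof -
    let ?s = "shift (h *\<^sub>R e) v"
    have "0 \<le> mul b (?s - v) \<bullet> (?s - v)"
      using mul_mono_inner[OF b(1), of "?s - v" 0] b(2) by simp
    also have "\<dots> = mul b ?s \<bullet> ?s - 2 * (mul b v \<bullet> ?s) + mul b v \<bullet> v"
      by (simp add: mul_diff[OF b(1)] inner_diff inner_mul_swap[OF b(1), of ?s v] inner_commute algebra_simps)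
        (simp add: inner_commute[of "mul b v" ?s] inner_mul_swap[OF b(1)] inner_commute)
    finally have "2 * (mul b v \<bullet> ?s) \<le> mul b ?s \<bullet> ?s + mul b v \<bullet> v" by simp
    moreover have "mul b ?s \<bullet> ?s \<le> mul b v \<bullet> v + L * h * (norm v)\<^sup>2"
    proof -
      \<comment> \<open>Translating back transfers the shift from \<open>v\<close> to
        \<open>b\<close>; here the Lipschitz bound enters.\<close>
      have "mul b ?s = shift (h *\<^sub>R e) (mul (\<lambda>p. b (p - h *\<^sub>R e)) v)"
        using shift_mul[OF bounded_borel_shift[OF b(1), of "- (h *\<^sub>R e)"], of "h *\<^sub>R e" v] by simp
      then have "mul b ?s \<bullet> ?s = mul (\<lambda>p. b (p - h *\<^sub>R e)) v \<bullet> v"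
        by (simp add: inner_shift_shift)
      also have "\<dots> \<le> mul (\<lambda>p. b p + L * h) v \<bullet> v"
      proof (intro inner_mul_mono bounded_borel_add b(1) bounded_borel_const AE_I2 impI)
        show "bounded_borel (\<lambda>p. b (p - h *\<^sub>R e))" using bounded_borel_shift[OF b(1), of "- (h *\<^sub>R e)"] by simp
        show "b (p - h *\<^sub>R e) \<le> b p + L * h" for p
        proof -
          have "p - h *\<^sub>R e = p + (- h * \<sigma>) *\<^sub>R (1, 0)" by (cases p) (simp add: e_def)
          then have "b (p - h *\<^sub>R e) \<le> b p + L * \<bar>- h * \<sigma>\<bar>" using b(3)[of p "- h * \<sigma>"] by (simp only:)
          then show ?thesis using \<sigma> h by auto
        qed
      qed
      also have "\<dots> = mul b v \<bullet> v + L * h * (norm v)\<^sup>2"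
        by (simp add: mul_plus[OF b(1) bounded_borel_const] mul_const inner_add_left power2_norm_eq_inner)
      finally show ?thesis .
    qed
    ultimately have "mul b v \<bullet> (?s - v) \<le> h * (L / 2 * (norm v)\<^sup>2)"
      by (simp add: inner_diff_right algebra_simps)
    then show ?thesis using h by (simp add: field_simps)
  qed
  have "((\<lambda>h. P \<bullet> avg e h z + R \<bullet> avg e h v) \<longlongrightarrow> P \<bullet> z + R \<bullet> v) (at 0 within {0..1})"
    by (intro tendsto_intros avg_tendsto)
  moreover have "\<forall>\<^sub>F h in at 0 within {0..1}. P \<bullet> avg e h z + R \<bullet> avg e h v \<le> L / 2 * (norm v)\<^sup>2"
  proof -
    have "P \<bullet> avg e h z + R \<bullet> avg e h v \<le> L / 2 * (norm v)\<^sup>2" if "h > 0" for h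
      using upper[OF that] unfolding quot[OF that] .
    then show ?thesis unfolding eventually_at_filter by (intro always_eventually) auto
  qed
  ultimately show ?thesis
    by (rule tendsto_upperbound) (simp add: at_within_Icc_at_right trivial_limit_at_right_real)
qed

section \<open>Classes supported on the strip, and the uniqueness theorem\<close>

lemma open_open_strip: "open (open_strip T)"
  unfolding open_strip_def by (intro open_Times) auto

lemma strip_borel [measurable]: "strip T \<in> sets borel"
  unfolding strip_def by (intro borel_closed closed_Times) auto

abbreviation ind_strip :: "real \<Rightarrow> real \<times> real \<Rightarrow> real" where
  "ind_strip T \<equiv> indicator (open_strip T)"

lemma bounded_borel_ind_strip: "bounded_borel (ind_strip T)"
  by (intro bounded_borel_indicator borel_open open_open_strip)

lemma supported_iff: "mul (ind_strip T) v = v \<longleftrightarrow> (AE p in lborel. p \<notin> open_strip T \<longrightarrow> fn v p = 0)"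
proof
  assume *: "mul (ind_strip T) v = v"
  show "AE p in lborel. p \<notin> open_strip T \<longrightarrow> fn v p = 0"
    using fn_mul[OF bounded_borel_ind_strip, of T v] unfolding * by eventually_elim auto
next
  assume *: "AE p in lborel. p \<notin> open_strip T \<longrightarrow> fn v p = 0"
  show "mul (ind_strip T) v = v"
    by (rule l2_eqI, use * fn_mul[OF bounded_borel_ind_strip, of T v] in eventually_elim) (auto simp: indicator_def)
qed

text \<open>The form is general enough to contain the equation and its adjoint: \<beta> pairs
  \<open>z\<close> with the test function, \<gamma> pairs \<open>v\<close> with its x-derivative,
  and \<sigma> fixes the direction of time.\<close>

lemma parabolic_uniqueness:
  fixes v z :: "(real \<times> real) l2"
  assumes \<sigma>: "\<sigma> = 1 \<or> \<sigma> = (-1::real)" and \<kappa>: "\<And>p. p \<in> open_strip T \<Longrightarrow> \<sigma> * fst p < \<kappa>"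
    and m: "m > 0"
    and b: "bounded_borel b" "\<And>p. m \<le> b p" "\<And>p s. b (p + s *\<^sub>R (1, 0)) \<le> b p + L * \<bar>s\<bar>"
    and a: "bounded_borel a" "\<And>p. p \<in> open_strip T \<Longrightarrow> m \<le> a p"
    and bb: "bounded_borel \<beta>" "bounded_borel \<gamma>" "bounded_borel c"
    and wd: "wderiv (0, 1) v z" and v: "mul (ind_strip T) v = v" and z: "mul (ind_strip T) z = z"
    and eq: "\<And>\<psi>. \<psi> \<in> test_functions {p. \<sigma> * fst p < \<kappa>} \<Longrightarrow>
      \<sigma> * (mul b v \<bullet> cls (dd (1, 0) \<psi>)) =
      (mul a z + mul \<gamma> v) \<bullet> cls (dd (0, 1) \<psi>) + (mul \<beta> z + mul c v) \<bullet> cls \<psi>"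
  shows "v = 0"
proof -
  let ?G = "{p::real \<times> real. \<sigma> * fst p < \<kappa>}"
  obtain K where K: "K > 0" "\<And>p. \<bar>\<beta> p\<bar> \<le> K" "\<And>p. \<bar>\<gamma> p\<bar> \<le> K" "\<And>p. \<bar>c p\<bar> \<le> K"
    using bounded_borel_bound3[OF bb] by blast
  \<comment> \<open>Chosen so that \<mu> m pays for every loss in |V|^2: K for \<open>c\<close>, K^2
    / m for the two cross terms after \<open>a\<close> has absorbed the rest, |L| / 2 for the energy
    inequality; the final 1 is left over and forces V = 0.\<close>
  define \<mu> where "\<mu> = (K + K\<^sup>2 / m + \<bar>L\<bar> / 2 + 1) / m"
  have \<mu>: "\<mu> > 0" unfolding \<mu>_def using K(1) m by (intro divide_pos_pos add_nonneg_pos add_nonneg_nonneg) auto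
  define w where "w p = exp ((- \<sigma> * \<mu>) * fst p)" for p :: "real \<times> real"
  \<comment> \<open>The indicator makes the weight bounded on the plane; both factors depend on time
    alone, so the x-derivative passes through.\<close>
  define \<omega> where "\<omega> p = ind_strip T p * w p" for p
  have sw: "smooth w" unfolding w_def by (rule smooth_exp_fst)
  have \<omega>: "bounded_borel \<omega>"
  proof (rule bounded_borelI)
    show "\<omega> \<in> borel_measurable borel"
      unfolding \<omega>_def using bounded_borelD[OF bounded_borel_ind_strip, of T] smooth_borel[OF sw] by simp
    show "\<bar>\<omega> p\<bar> \<le> exp (\<mu> * T)" for p
    proof (cases "p \<in> open_strip T")
      case True
      then have "0 < fst p" "fst p < T" by (auto simp: open_strip_def)
      then have "(- \<sigma> * \<mu>) * fst p \<le> \<mu> * T" using \<mu> \<sigma>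
        by (auto intro: mult_left_mono order_trans[of _ 0] simp: mult_nonneg_nonneg)
      with True show ?thesis by (simp add: \<omega>_def w_def)
    qed (simp add: \<omega>_def)
  qed
  have \<omega>_inv: "\<omega> (p + s *\<^sub>R (0, 1)) = \<omega> p" for p s
    by (cases p) (auto simp: \<omega>_def w_def indicator_def open_strip_def)
  define V Z where "V = mul \<omega> v" and "Z = mul \<omega> z"
  have wdV: "wderiv (0, 1) V Z" unfolding V_def Z_def by (rule wderiv_mul_invariant[OF wd \<omega> \<omega>_inv])
  have sV: "AE p in lborel. p \<notin> open_strip T \<longrightarrow> fn V p = 0" and sZ: "AE p in lborel. p \<notin> open_strip T \<longrightarrow> fn Z p = 0"
    unfolding V_def Z_def using fn_mul[OF \<omega>, of v] fn_mul[OF \<omega>, of z]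
    by (eventually_elim, simp add: \<omega>_def)+
  \<comment> \<open>Moves the unbounded weight from the test function to the solution, where the
    support in the strip makes it bounded.\<close>
  have move: "mul d u \<bullet> cls (\<lambda>p. w p * f p) = mul d (mul \<omega> u) \<bullet> cls f"
    if d: "bounded_borel d" and u: "mul (ind_strip T) u = u" and f: "f \<in> L2 lebesgue" "(\<lambda>p. w p * f p) \<in> L2 lebesgue" for d u f
  proof -
    have "mul d u \<bullet> cls (\<lambda>p. w p * f p) = mul (ind_strip T) (mul d u) \<bullet> cls (\<lambda>p. w p * f p)"
      by (subst u[symmetric]) (simp add: mul_mul d bounded_borel_ind_strip mult.commute)
    also have "\<dots> = mul d u \<bullet> cls (\<lambda>p. ind_strip T p * (w p * f p))"
      by (simp add: inner_mul_swap[OF bounded_borel_ind_strip] mul_cls[OF bounded_borel_ind_strip f(2)])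
    also have "cls (\<lambda>p. ind_strip T p * (w p * f p)) = mul \<omega> (cls f)"
      by (simp add: mul_cls[OF \<omega> f(1)] \<omega>_def mult.assoc)
    also have "mul d u \<bullet> mul \<omega> (cls f) = mul d (mul \<omega> u) \<bullet> cls f"
      by (simp add: inner_mul_swap[OF \<omega>, symmetric] mul_mul \<omega> d mult.commute)
    finally show ?thesis .
  qed
  \<comment> \<open>Since \<sigma>^2 = 1, differentiating the weight adds \<mu> b to the zero-order
    coefficient in either direction of time.\<close>
  have c': "bounded_borel (\<lambda>p. c p + \<mu> * b p)" by (intro bounded_borel_intros bb b)
  have "(mul a Z + mul \<gamma> V) \<bullet> Z + (mul \<beta> Z + mul (\<lambda>p. c p + \<mu> * b p) V) \<bullet> V \<le> L / 2 * (norm V)\<^sup>2"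
  proof (rule degenerate_energy_inequality[OF \<sigma> b(1) _ b(3) wdV])
    show "0 \<le> b p" for p using b(2)[of p] m by linarith
    show "AE p in lborel. \<kappa> \<le> \<sigma> * fst p \<longrightarrow> fn V p = 0" using sV by eventually_elim (use \<kappa> in force)
    show "AE p in lborel. \<kappa> \<le> \<sigma> * fst p \<longrightarrow> fn Z p = 0" using sZ by eventually_elim (use \<kappa> in force)
    fix \<psi> assume \<psi>: "\<psi> \<in> test_functions ?G"
    let ?\<phi> = "\<lambda>p. w p * \<psi> p"
    have \<phi>: "?\<phi> \<in> test_functions ?G" by (rule test_mult[OF \<psi> sw])
    have dw: "dd (1, 0) w p = (- \<sigma> * \<mu>) * w p" "dd (0, 1) w p = 0" for p
      unfolding w_def dd_exp_fst by auto
    have dt: "dd (1, 0) ?\<phi> = (\<lambda>p. w p * dd (1, 0) \<psi> p + (- \<sigma> * \<mu>) * (w p * \<psi> p))"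
      and dx: "dd (0, 1) ?\<phi> = (\<lambda>p. w p * dd (0, 1) \<psi> p)"
      by (auto simp: dd_mult[OF sw test_smooth[OF \<psi>]] dw)
    note L = test_L2'[OF \<psi>] test_L2'[OF \<phi>] test_L2'[OF test_dd[OF \<psi>]] test_L2'[OF test_mult[OF test_dd[OF \<psi>] sw]]
    have "cls (dd (1, 0) ?\<phi>) = cls (\<lambda>p. w p * dd (1, 0) \<psi> p) + (- \<sigma> * \<mu>) *\<^sub>R cls ?\<phi>"
      unfolding dt by (simp only: cls_add[OF L(4) L2_cmult[OF L(2)]] cls_cmult[OF L(2)])
    then have "\<sigma> * (mul b v \<bullet> cls (dd (1, 0) ?\<phi>)) =
      \<sigma> * (mul b V \<bullet> cls (dd (1, 0) \<psi>)) - \<mu> * (mul b V \<bullet> cls \<psi>)"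
      unfolding V_def move[OF b(1) v L(3) L(4), symmetric] move[OF b(1) v L(1) L(2), symmetric]
      using \<sigma> by (auto simp: inner_add_right inner_diff_right)
    also have "\<sigma> * (mul b v \<bullet> cls (dd (1, 0) ?\<phi>)) = (mul a Z + mul \<gamma> V) \<bullet> cls (dd (0, 1) \<psi>) + (mul \<beta> Z + mul c V) \<bullet> cls \<psi>"
      unfolding eq[OF \<phi>] dx V_def Z_def
      by (simp add: inner_add_left move[OF a(1) z L(3) L(4)] move[OF bb(2) v L(3) L(4)]
          move[OF bb(1) z L(1) L(2)] move[OF bb(3) v L(1) L(2)])
    finally show "\<sigma> * (mul b V \<bullet> cls (dd (1, 0) \<psi>)) = (mul a Z + mul \<gamma> V) \<bullet> cls (dd (0, 1) \<psi>)
      + (mul \<beta> Z + mul (\<lambda>p. c p + \<mu> * b p) V) \<bullet> cls \<psi>"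
      by (simp add: mul_plus[OF bb(3) bounded_borel_mult[OF bounded_borel_const b(1)]] inner_add_left
          mul_mul[OF bounded_borel_const b(1), symmetric] mul_const)
  qed
  moreover have "m * (norm Z)\<^sup>2 \<le> mul a Z \<bullet> Z"
    by (rule mul_mono_inner[OF a(1)]) (use sZ in \<open>eventually_elim, use a(2) in blast\<close>)
  moreover have "\<mu> * (m * (norm V)\<^sup>2) \<le> \<mu> * (mul b V \<bullet> V)"
    using \<mu> b(2) by (intro mult_left_mono mul_mono_inner b(1)) auto
  moreover have "\<bar>mul \<gamma> V \<bullet> Z\<bar> \<le> K * norm V * norm Z" "\<bar>mul \<beta> Z \<bullet> V\<bar> \<le> K * norm Z * norm V"
    "\<bar>mul c V \<bullet> V\<bar> \<le> K * norm V * norm V"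
    using K by (intro abs_inner_mul_le bb; simp)+
  moreover have "(mul a Z + mul \<gamma> V) \<bullet> Z + (mul \<beta> Z + mul (\<lambda>p. c p + \<mu> * b p) V) \<bullet> V =
      mul a Z \<bullet> Z + mul \<gamma> V \<bullet> Z + mul \<beta> Z \<bullet> V + mul c V \<bullet> V + \<mu> * (mul b V \<bullet> V)"
    by (simp add: mul_plus[OF bb(3) bounded_borel_mult[OF bounded_borel_const b(1)]] inner_add_left
          mul_mul[OF bounded_borel_const b(1), symmetric] mul_const)
  \<comment> \<open>A completed square for the two cross terms, each of which is at most K |V|
    |Z|.\<close>
  moreover have "0 \<le> m * (norm Z)\<^sup>2 - 2 * (K * norm V * norm Z) + K\<^sup>2 / m * (norm V)\<^sup>2"
  proof -
    have "0 \<le> m * (norm Z - K / m * norm V)\<^sup>2" using m by simp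
    also have "\<dots> = m * (norm Z)\<^sup>2 - 2 * (K * norm V * norm Z) + K\<^sup>2 / m * (norm V)\<^sup>2"
      using m by (simp add: power2_eq_square field_simps)
    finally show ?thesis .
  qed
  moreover have "\<mu> * (m * (norm V)\<^sup>2) = (K + K\<^sup>2 / m + \<bar>L\<bar> / 2 + 1) * (norm V)\<^sup>2"
    using m by (simp add: \<mu>_def)
  moreover have "L / 2 * (norm V)\<^sup>2 \<le> \<bar>L\<bar> / 2 * (norm V)\<^sup>2" by (intro mult_right_mono) auto
  ultimately have "(norm V)\<^sup>2 \<le> 0"
    by (simp add: algebra_simps power2_eq_square)
  then have "V = 0" by simp
  then have "AE p in lborel. \<omega> p * fn v p = 0"
    using fn_mul[OF \<omega>, of v] fn_zero unfolding V_def by (auto elim: eventually_elim2)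
  then have "AE p in lborel. fn v p = 0"
    using v[unfolded supported_iff] by eventually_elim (auto simp: \<omega>_def w_def indicator_def split: if_splits)
  then show "v = 0"
    by (intro l2_eqI) (use fn_zero in \<open>auto elim: eventually_elim2\<close>)
qed

section \<open>The energy estimate\<close>

lemma fubini_plane:
  fixes F :: "real \<times> real \<Rightarrow> real"
  assumes "integrable lborel F"
  shows "(LINT t|lborel. LINT x|lborel. F (t, x)) = (LINT p|lborel. F p)"
    and "(LINT x|lborel. LINT t|lborel. F (t, x)) = (LINT p|lborel. F p)"
    and "integrable lborel (\<lambda>t. LINT x|lborel. F (t, x))"
    and "AE t in lborel. integrable lborel (\<lambda>x. F (t, x))"
    and "integrable lborel (\<lambda>x. LINT t|lborel. F (t, x))"
proof -
  have F: "integrable (lborel \<Otimes>\<^sub>M lborel) (\<lambda>(t, x). F (t, x))"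
    using assms by (simp add: lborel_prod)
  show "(LINT t|lborel. LINT x|lborel. F (t, x)) = (LINT p|lborel. F p)"
    using lborel_pair.integral_fst'[OF F] by (simp add: lborel_prod)
  show "(LINT x|lborel. LINT t|lborel. F (t, x)) = (LINT p|lborel. F p)"
    using lborel_pair.integral_snd[OF F] by (simp add: lborel_prod)
  show "integrable lborel (\<lambda>t. LINT x|lborel. F (t, x))"
    using lborel_pair.integrable_fst'[OF F] by simp
  show "AE t in lborel. integrable lborel (\<lambda>x. F (t, x))"
    using lborel_pair.AE_integrable_fst'[OF F] by simp
  show "integrable lborel (\<lambda>x. LINT t|lborel. F (t, x))"
    using lborel_pair.integrable_snd[OF F] by simp
qed

text \<open>With c = 0 and c = T this makes the closed and the open strip interchangeable up to null
  sets.\<close>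

lemma AE_fst_neq: "AE p in (lborel :: (real \<times> real) measure). fst p \<noteq> c"
proof -
  have "negligible {p::real \<times> real. p \<bullet> (1, 0) = c}"
    by (rule negligible_standard_hyperplane) (simp add: Basis_prod_def)
  then have "AE p in lebesgue. p \<notin> {p::real \<times> real. p \<bullet> (1, 0) = c}"
    by (intro AE_not_in) (simp add: negligible_iff_null_sets)
  then show ?thesis by (simp add: AE_completion_iff inner_prod_def)
qed

lemma borel_slice [measurable (raw)]:
  fixes F :: "real \<times> real \<Rightarrow> real"
  assumes "F \<in> borel_measurable borel"
  shows "(\<lambda>x. F (t, x)) \<in> borel_measurable borel" "(\<lambda>t. F (t, x)) \<in> borel_measurable borel"
proof -
  have "(\<lambda>x. (t, x)) \<in> borel_measurable borel" "(\<lambda>t. (t, x)) \<in> borel_measurable borel"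
    by (intro borel_measurable_continuous_onI continuous_intros)+
  from this[THEN measurable_compose, OF assms]
  show "(\<lambda>x. F (t, x)) \<in> borel_measurable borel" "(\<lambda>t. F (t, x)) \<in> borel_measurable borel" by auto
qed

lemma test_slice_x:
  fixes \<psi> :: "real \<times> real \<Rightarrow> real"
  assumes \<psi>: "\<psi> \<in> test_functions \<Omega>"
  shows "(\<lambda>x. \<psi> (t, x)) \<in> test_functions UNIV" "dd 1 (\<lambda>x. \<psi> (t, x)) = (\<lambda>x. dd (0, 1) \<psi> (t, x))"
proof -
  have L: "bounded_linear (\<lambda>x::real. (0::real, x))"
    by (intro bounded_linear_Pair bounded_linear_zero bounded_linear_ident)
  obtain K where K: "compact K" "\<And>p. p \<notin> K \<Longrightarrow> \<psi> p = 0" using \<psi> by (rule test_functionsE) blast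
  have sm: "smooth (\<lambda>x. \<psi> (t, x))"
    using smooth_affine[OF L test_smooth[OF \<psi>], of "(t, 0)"] by simp
  show "(\<lambda>x. \<psi> (t, x)) \<in> test_functions UNIV"
  proof (rule test_functionsI[OF sm])
    show "compact (snd ` K)" using K(1) by (intro compact_continuous_image continuous_intros)
    show "\<psi> (t, x) = 0" if "x \<notin> snd ` K" for x using that by (intro K(2)) force
  qed simp
  show "dd 1 (\<lambda>x. \<psi> (t, x)) = (\<lambda>x. dd (0, 1) \<psi> (t, x))"
    using dd_affine[OF L test_smooth[OF \<psi>], of 1 "(t, 0)"] by auto
qed

text \<open>In the application \<open>b = 1 / \<rho>\<close>, extended to all times by its values at \<open>0\<close> and \<open>T\<close>, \<open>bt\<close> is
  its time derivative on the strip, and \<open>N\<close> is the set of the interfaces.\<close>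

locale parabolic =
  fixes T m L lam :: real and b bt a B :: "real \<times> real \<Rightarrow> real" and N :: "real set"
  assumes T: "T > 0" and m: "m > 0" and lam: "lam \<ge> 0"
    and b: "bounded_borel b" "\<And>p. m \<le> b p" "\<And>p s. b (p + s *\<^sub>R (1, 0)) \<le> b p + L * \<bar>s\<bar>"
    and bt: "bounded_borel bt"
    and N: "finite N"
    and b_deriv: "\<And>t x. t \<in> {0..T} \<Longrightarrow> x \<notin> N \<Longrightarrow> ((\<lambda>s. b (s, x)) has_real_derivative bt (t, x)) (at t within {0..T})"
    and a: "bounded_borel a" "\<And>p. p \<in> open_strip T \<Longrightarrow> m \<le> a p"
    and B: "bounded_borel B"
begin

text \<open>The fundamental theorem is applied on each time line off \<open>N\<close>, and Fubini's
  theorem integrates over x, so jumps of \<open>b\<close> in x do no harm. The interval stays within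
  [0, T], where \<open>b\<close> has the derivative \<open>bt\<close>.\<close>

lemma time_integration_by_parts:
  assumes \<eta>: "\<eta> \<in> test_functions UNIV" and \<tau>: "0 \<le> \<tau>" "\<tau> \<le> T"
  shows "(LINT x|lborel. b (T, x) * \<eta> (T, x)) - (LINT x|lborel. b (\<tau>, x) * \<eta> (\<tau>, x)) =
    (LINT p|lborel. indicator ({\<tau>..T} \<times> UNIV) p * (bt p * \<eta> p + b p * dd (1, 0) \<eta> p))"
proof -
  define G where "G p = bt p * \<eta> p + b p * dd (1, 0) \<eta> p" for p
  have [measurable]: "\<eta> \<in> borel_measurable borel" "dd (1, 0) \<eta> \<in> borel_measurable borel"
    "b \<in> borel_measurable borel" "bt \<in> borel_measurable borel"
    using test_borel[OF \<eta>] test_borel[OF test_dd[OF \<eta>]] b(1) bt by (auto dest: bounded_borelD)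
  have [measurable]: "G \<in> borel_measurable borel" unfolding G_def by measurable
  obtain K where K: "compact K" "\<And>p. p \<notin> K \<Longrightarrow> \<eta> p = 0" using \<eta> by (rule test_functionsE) blast
  have Kdd: "dd (1, 0) \<eta> p = 0" if "p \<notin> K" for p
  proof (rule dd_eqI)
    show "(\<eta> has_derivative (\<lambda>_. 0)) (at p)"
    proof (rule has_derivative_transform_within_open[of "\<lambda>_. 0" _ p UNIV "- K"])
      show "open (- K)" using compact_imp_closed[OF K(1)] by auto
    qed (use K(2) that in auto)
  qed
  have "bounded_borel G"
    unfolding G_def by (intro bounded_borel_intros bt b test_bounded_borel[OF \<eta>] test_bounded_borel[OF test_dd[OF \<eta>]])
  then obtain C where C: "C > 0" "\<And>p. \<bar>G p\<bar> \<le> C" by (rule bounded_borel_bound) blast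
  have ind [measurable]: "{\<tau>..T} \<times> (UNIV::real set) \<in> sets borel" by (intro borel_closed closed_Times) auto
  have bd: "\<bar>indicator ({\<tau>..T} \<times> UNIV) p * G p\<bar> \<le> C" for p
    using C(2)[of p] C(1) by (auto simp: indicator_def)
  have int: "integrable lborel (\<lambda>p. indicator ({\<tau>..T} \<times> UNIV) p * G p)"
  proof (rule bounded_compact_support_integrable[OF _ K(1) bd])
    show "indicator ({\<tau>..T} \<times> UNIV) p * G p = 0" if "p \<notin> K" for p
      using that K(2) Kdd by (simp add: G_def)
  qed measurable
  have slice: "(LINT t|lborel. indicator ({\<tau>..T} \<times> UNIV) (t, x) * G (t, x)) = b (T, x) * \<eta> (T, x) - b (\<tau>, x) * \<eta> (\<tau>, x)"
    if x: "x \<notin> N" for x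
  proof -
    have "((\<lambda>t. G (t, x)) has_integral b (T, x) * \<eta> (T, x) - b (\<tau>, x) * \<eta> (\<tau>, x)) {\<tau>..T}"
    proof (rule fundamental_theorem_of_calculus[OF \<tau>(2)])
      fix t assume t: "t \<in> {\<tau>..T}"
      have "((\<lambda>s. \<eta> ((0, x) + s *\<^sub>R (1, 0))) has_real_derivative dd (1, 0) \<eta> ((0, x) + t *\<^sub>R (1, 0))) (at t)"
        by (rule dd_line[OF test_smooth[OF \<eta>]])
      then have "((\<lambda>s. \<eta> (s, x)) has_real_derivative dd (1, 0) \<eta> (t, x)) (at t)" by simp
      moreover have "((\<lambda>s. b (s, x)) has_real_derivative bt (t, x)) (at t within {\<tau>..T})"
        using b_deriv[OF _ x, of t] t \<tau> by (auto intro: DERIV_subset)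
      ultimately have "((\<lambda>s. b (s, x) * \<eta> (s, x)) has_real_derivative G (t, x)) (at t within {\<tau>..T})"
        using DERIV_mult[OF _ has_field_derivative_at_within, of "\<lambda>s. b (s, x)" "bt (t, x)" t "{\<tau>..T}"
            "\<lambda>s. \<eta> (s, x)" "dd (1, 0) \<eta> (t, x)"]
        unfolding G_def by (simp add: mult.commute[of "b (t, x)"])
      then show "((\<lambda>s. b (s, x) * \<eta> (s, x)) has_vector_derivative G (t, x)) (at t within {\<tau>..T})"
        by (simp add: has_real_derivative_iff_has_vector_derivative)
    qed
    then have "((\<lambda>t. indicator {\<tau>..T} t * G (t, x)) has_integral b (T, x) * \<eta> (T, x) - b (\<tau>, x) * \<eta> (\<tau>, x)) UNIV"
    proof -
      have "(\<lambda>t. indicator {\<tau>..T} t * G (t, x)) = (\<lambda>t. if t \<in> {\<tau>..T} then G (t, x) else 0)"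
        by (auto simp: indicator_def)
      with \<open>(_ has_integral _) {\<tau>..T}\<close> show ?thesis by (simp only: has_integral_restrict_UNIV)
    qed
    moreover have "integrable lborel (\<lambda>t. indicator {\<tau>..T} t * G (t, x))"
    proof (rule bounded_compact_support_integrable[where K = "{\<tau>..T}" and C = C])
      show "\<bar>indicator {\<tau>..T} t * G (t, x)\<bar> \<le> C" for t using C(2)[of "(t, x)"] C(1) by (auto simp: indicator_def)
    qed (auto)
    then have "((\<lambda>t. indicator {\<tau>..T} t * G (t, x)) has_integral (LINT t|lborel. indicator {\<tau>..T} t * G (t, x))) UNIV"
      by (rule has_integral_integral_lborel)
    ultimately have "(LINT t|lborel. indicator {\<tau>..T} t * G (t, x)) = b (T, x) * \<eta> (T, x) - b (\<tau>, x) * \<eta> (\<tau>, x)"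
      using has_integral_unique by blast
    then show ?thesis by (simp add: indicator_times)
  qed
  have sint: "integrable lborel (\<lambda>x. b (t, x) * \<eta> (t, x))" for t
  proof -
    obtain C' where C': "\<And>p. \<bar>b p * \<eta> p\<bar> \<le> C'"
      using bounded_borel_bound[OF bounded_borel_mult[OF b(1) test_bounded_borel[OF \<eta>]]] by metis
    show ?thesis
    proof (rule bounded_compact_support_integrable[where K = "snd ` K", OF _ _ C'])
      show "compact (snd ` K)" using K(1) by (intro compact_continuous_image continuous_intros)
      show "b (t, x) * \<eta> (t, x) = 0" if "x \<notin> snd ` K" for x
      proof -
        have "(t, x) \<notin> K" using that by force
        then show ?thesis using K(2) by simp
      qed
    qed measurable
  qed
  have "AE x in lborel. x \<notin> N"
    using N by (intro AE_not_in finite_imp_null_set_lborel)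
  have "(LINT p|lborel. indicator ({\<tau>..T} \<times> UNIV) p * G p) =
      (LINT x|lborel. LINT t|lborel. indicator ({\<tau>..T} \<times> UNIV) (t, x) * G (t, x))"
    by (rule fubini_plane(2)[OF int, symmetric])
  also have "\<dots> = (LINT x|lborel. b (T, x) * \<eta> (T, x) - b (\<tau>, x) * \<eta> (\<tau>, x))"
  proof (rule integral_cong_AE)
    show "(\<lambda>x. LINT t|lborel. indicator ({\<tau>..T} \<times> UNIV) (t, x) * G (t, x)) \<in> borel_measurable lborel"
      using fubini_plane(5)[OF int] by (rule borel_measurable_integrable)
    show "AE x in lborel. (LINT t|lborel. indicator ({\<tau>..T} \<times> UNIV) (t, x) * G (t, x)) = b (T, x) * \<eta> (T, x) - b (\<tau>, x) * \<eta> (\<tau>, x)"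
      using \<open>AE x in lborel. x \<notin> N\<close> by eventually_elim (rule slice)
  qed measurable
  also have "\<dots> = (LINT x|lborel. b (T, x) * \<eta> (T, x)) - (LINT x|lborel. b (\<tau>, x) * \<eta> (\<tau>, x))"
    by (rule Bochner_Integration.integral_diff[OF sint sint])
  finally show ?thesis unfolding G_def ..
qed

text \<open>The space L^2(0,T;H^1) as pairs of a function and its x-derivative, extended by zero; as
  a closed subspace it admits orthogonal projection.\<close>

definition X :: "((real \<times> real) l2 \<times> (real \<times> real) l2) set" where
  "X = {(v, z). wderiv (0, 1) v z \<and> mul (ind_strip T) v = v \<and> mul (ind_strip T) z = z}"

lemma XI: "wderiv (0, 1) v z \<Longrightarrow> mul (ind_strip T) v = v \<Longrightarrow> mul (ind_strip T) z = z \<Longrightarrow> (v, z) \<in> X"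
  by (simp add: X_def)

lemma X_eq: "X = {(v, z). wderiv (0, 1) v z} \<inter> {p. mul (ind_strip T) (fst p) = fst p} \<inter> {p. mul (ind_strip T) (snd p) = snd p}"
  by (auto simp: X_def)

lemma closed_X: "closed X"
  unfolding X_eq
  by (intro closed_Int closed_wderiv closed_Collect_eq continuous_intros
      bounded_linear.continuous_on[OF bounded_linear_mul[OF bounded_borel_ind_strip]])

lemma subspace_X: "subspace X"
  unfolding X_eq
  by (intro subspace_inter subspace_wderiv subspaceI)
    (auto simp: mul_add mul_scaleR mul_zero bounded_borel_ind_strip)

text \<open>A truncation in time, even a discontinuous one, leaves the x-derivative intact. Support
  in the closed strip is enough because its boundary lines are null sets.\<close>

lemma mul_indicator_time:
  assumes c: "bounded_borel c" "\<And>p s. c (p + s *\<^sub>R (0, 1)) = c p"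
    and supp: "\<And>p. fst p \<notin> {0..T} \<Longrightarrow> c p = 0" and wd: "wderiv (0, 1) w y"
  shows "(mul c w, mul c y) \<in> X"
proof (rule XI)
  show "wderiv (0, 1) (mul c w) (mul c y)" by (rule wderiv_mul_invariant[OF wd c])
  have "mul (ind_strip T) (mul c u) = mul c u" for u
    unfolding supported_iff
    using fn_mul[OF c(1), of u] AE_fst_neq[of 0] AE_fst_neq[of T]
  proof eventually_elim
    case (elim p)
    show ?case
    proof
      assume "p \<notin> open_strip T"
      then have "fst p \<notin> {0..T}" using elim by (cases p) (auto simp: open_strip_def)
      then show "fn (mul c u) p = 0" using elim supp by simp
    qed
  qed
  then show "mul (ind_strip T) (mul c w) = mul c w" "mul (ind_strip T) (mul c y) = mul c y" by auto
qed

text \<open>The backward operator applied to \<open>\<psi>\<close>, as the functional \<open>\<phi> \<mapsto> \<integral> F0 \<phi> + F1 \<phi>\<^sub>x\<close>.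
  Functionals on \<open>X\<close> determine such a pair only up to the orthogonal complement of \<open>X\<close>, which
  is why \<open>\<zeta>0\<close> and \<open>\<zeta>1\<close> occur below.\<close>

definition F0 :: "(real \<times> real \<Rightarrow> real) \<Rightarrow> (real \<times> real) l2" where
  "F0 \<psi> = mul (ind_strip T) (mul b (cls (dd (1, 0) \<psi>)) + mul (\<lambda>p. b p * B p) (cls (dd (0, 1) \<psi>)) - lam *\<^sub>R mul b (cls \<psi>))"

definition F1 :: "(real \<times> real \<Rightarrow> real) \<Rightarrow> (real \<times> real) l2" where
  "F1 \<psi> = - (1/2) *\<^sub>R mul (ind_strip T) (mul a (cls (dd (0, 1) \<psi>)))"

lemma bbB: "bounded_borel (\<lambda>p. b p * B p)"
  by (intro bounded_borel_mult b B)

text \<open>The residual is tested with r^2 \<psi>, where r^2 is the weight exp (2 k t) on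
  [\<tau>, T] and 0 elsewhere. This jumps in time at \<tau>, but \<open>X\<close> asks only for
  x-derivatives, so the pair belongs to \<open>X\<close> and the annihilators \<zeta>0, \<zeta>1
  drop out for every \<tau>.\<close>

lemma energy_estimate:
  "\<exists>C>0. \<forall>\<psi>\<in>test_functions UNIV. \<forall>\<zeta>0 \<zeta>1. (\<forall>y\<in>X. (\<zeta>0, \<zeta>1) \<bullet> y = 0) \<longrightarrow>
    (\<forall>\<tau>\<in>{0..T}. (LINT x|lborel. (\<psi> (\<tau>, x))\<^sup>2) + (norm (mul (ind_strip T) (cls \<psi>)))\<^sup>2 + (norm (mul (ind_strip T) (cls (dd (0, 1) \<psi>))))\<^sup>2
      \<le> C * (norm (cls (\<lambda>x. \<psi> (T, x)), F0 \<psi> + \<zeta>0, F1 \<psi> + \<zeta>1))\<^sup>2)"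
proof -
  obtain K where K: "K > 0" "\<And>p. \<bar>b p * B p\<bar> \<le> K" "\<And>p. \<bar>bt p\<bar> \<le> K" "\<And>p. \<bar>b p\<bar> \<le> K"
    using bounded_borel_bound3[OF bbB bt b(1)] by blast
  \<comment> \<open>Makes 2 k m equal to K + 2 K^2 / m + 2: K pays for \<open>bt\<close>, 2 K^2 / m
    for the drift, 1 for the residual \<open>F0\<close>, and 1 remains in front of |U|^2.\<close>
  define k where "k = (K + 2 * K\<^sup>2 / m + 2) / (2 * m)"
  have "K + 2 * K\<^sup>2 / m + 2 = k * (2 * m)"
    by (rule nonzero_divide_eq_eq[THEN iffD1, OF _ k_def[symmetric]]) (use m in simp)
  moreover have "2 * k * m = k * (2 * m)" by simp
  ultimately have k: "k > 0" "2 * k * m - K = 2 * K\<^sup>2 / m + 2"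
    using K(1) m by (simp add: k_def divide_pos_pos add_pos_nonneg, linarith)
  define R where "R = exp (k * T)"
  have R: "R \<ge> 1" using k(1) T by (simp add: R_def)
  define D where "D = R\<^sup>2 * K + R\<^sup>2 + 4 * R\<^sup>2 / m"
  have D: "D > 0" using R K(1) m by (auto simp: D_def intro!: add_pos_pos add_pos_nonneg)
  have main: "m * (LINT x|lborel. (\<psi> (\<tau>, x))\<^sup>2) + m / 4 * (norm (mul r (cls (dd (0, 1) \<psi>))))\<^sup>2 + (norm (mul r (cls \<psi>)))\<^sup>2
      \<le> D * (norm (cls (\<lambda>x. \<psi> (T, x)), F0 \<psi> + \<zeta>0, F1 \<psi> + \<zeta>1))\<^sup>2"
    if \<psi>: "\<psi> \<in> test_functions UNIV" and \<zeta>: "\<And>y. y \<in> X \<Longrightarrow> (\<zeta>0, \<zeta>1) \<bullet> y = 0" and \<tau>: "0 \<le> \<tau>" "\<tau> \<le> T"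
      and r: "r = (\<lambda>p. indicator ({\<tau>..T} \<times> UNIV) p * exp (k * fst p))" for \<psi> \<zeta>0 \<zeta>1 \<tau> r
  proof -
    let ?p = "cls \<psi>" and ?px = "cls (dd (0, 1) \<psi>)" and ?pt = "cls (dd (1, 0) \<psi>)"
    define w where "w p = exp ((2 * k) * fst p)" for p :: "real \<times> real"
    have sw: "smooth w" unfolding w_def by (rule smooth_exp_fst)
    have dw: "dd (1, 0) w p = 2 * k * w p" for p unfolding w_def dd_exp_fst by simp
    note \<psi>x = test_dd[OF \<psi>, of "(0, 1)"] and \<psi>t = test_dd[OF \<psi>, of "(1, 0)"]
    have ind [measurable]: "{\<tau>..T} \<times> (UNIV::real set) \<in> sets borel" by (intro borel_closed closed_Times) auto
    have rb: "bounded_borel r"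
    proof (rule bounded_borelI)
      have "(\<lambda>p::real \<times> real. exp (k * fst p)) \<in> borel_measurable borel" by (intro smooth_borel smooth_exp_fst)
      then show "r \<in> borel_measurable borel" unfolding r by measurable
      show "\<bar>r p\<bar> \<le> R" for p unfolding r R_def using k(1) by (auto simp: indicator_def)
    qed
    have rR: "\<bar>r p\<bar> \<le> R" for p unfolding r R_def using k(1) by (auto simp: indicator_def)
    have rsupp: "r p = 0" if "fst p \<notin> {0..T}" for p using that \<tau> by (cases p) (auto simp: r indicator_def)
    have rinv: "r (p + s *\<^sub>R (0, 1)) = r p" for p s by (cases p) (auto simp: r indicator_def)
    have ww: "indicator ({\<tau>..T} \<times> UNIV) p * w p = r p * r p" for p
      unfolding r w_def by (auto simp: indicator_def exp_add[symmetric] algebra_simps)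
    define U Y where "U = mul r ?p" and "Y = mul r ?px"
    \<comment> \<open>The actual test pair, r^2 \<psi> and its x-derivative; its membership in
      \<open>X\<close> removes \<zeta>0 and \<zeta>1 below.\<close>
    have UX: "(mul r U, mul r Y) \<in> X"
      unfolding U_def Y_def mul_mul[OF rb rb]
    proof (rule mul_indicator_time[OF bounded_borel_mult[OF rb rb]])
      show "r (p + s *\<^sub>R (0, 1)) * r (p + s *\<^sub>R (0, 1)) = r p * r p" for p s by (simp only: rinv)
      show "wderiv (0, 1) ?p ?px" by (rule wderiv_test[OF \<psi>])
    qed (simp add: rsupp)
    have supp: "mul (ind_strip T) (mul r u) = mul r u" for u
    proof -
      have "AE p in lborel. p \<notin> open_strip T \<longrightarrow> fn (mul r u) p = 0"
        using fn_mul[OF rb, of u] AE_fst_neq[of 0] AE_fst_neq[of T]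
      proof eventually_elim
        case (elim p)
        show ?case
        proof
          assume "p \<notin> open_strip T"
          then have "fst p \<notin> {0..T}" using elim by (cases p) (auto simp: open_strip_def)
          then show "fn (mul r u) p = 0" using elim rsupp by simp
        qed
      qed
      then show ?thesis by (simp add: supported_iff)
    qed
    have two: "(LINT p|lborel. r p * r p * (c p * f p * g p)) = mul c (mul r (cls f)) \<bullet> mul r (cls g)"
      if c: "bounded_borel c" and f: "f \<in> L2 lborel" "g \<in> L2 lborel" for c f g
    proof -
      have "mul c (mul r (cls f)) \<bullet> mul r (cls g) = cls (\<lambda>p. c p * (r p * f p)) \<bullet> cls (\<lambda>p. r p * g p)"
        by (simp add: mul_cls rb c f L2_lborel_lebesgue bounded_borel_L2)
      also have "\<dots> = (LINT p|lborel. (c p * (r p * f p)) * (r p * g p))"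
        by (intro cls_inner' bounded_borel_L2 c rb f)
      finally show ?thesis by (simp add: mult_ac)
    qed
    have intg: "integrable lborel (\<lambda>p. r p * r p * (c p * f p * g p))"
      if c: "bounded_borel c" and f: "f \<in> L2 lborel" "g \<in> L2 lborel" for c f g
    proof -
      have "integrable lborel (\<lambda>p. (c p * (r p * f p)) * (r p * g p))"
        by (intro L2_mult_integrable bounded_borel_L2 c rb f)
      then show ?thesis by (simp add: mult_ac)
    qed
    note L = test_L2[OF \<psi>] test_L2[OF \<psi>x] test_L2[OF \<psi>t]
    \<comment> \<open>Integrating b \<eta> by parts in time yields the slice at \<tau>, and
      differentiating the weight yields the absorbing term 2 k b \<psi>^2.\<close>
    define \<eta> where "\<eta> p = w p * (\<psi> p * \<psi> p)" for p
    have \<eta>: "\<eta> \<in> test_functions UNIV"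
      unfolding \<eta>_def by (intro test_mult[OF _ sw] test_mult[OF \<psi> test_smooth[OF \<psi>]])
    have d\<eta>: "dd (1, 0) \<eta> p = w p * (2 * k * (\<psi> p * \<psi> p) + 2 * (\<psi> p * dd (1, 0) \<psi> p))" for p
      unfolding \<eta>_def
      unfolding dd_mult[OF sw smooth_mult[OF test_smooth[OF \<psi>] test_smooth[OF \<psi>]]]
          dd_mult[OF test_smooth[OF \<psi>] test_smooth[OF \<psi>]] dw by (simp add: algebra_simps)
    have "(LINT x|lborel. b (T, x) * \<eta> (T, x)) - (LINT x|lborel. b (\<tau>, x) * \<eta> (\<tau>, x)) =
      (LINT p|lborel. indicator ({\<tau>..T} \<times> UNIV) p * (bt p * \<eta> p + b p * dd (1, 0) \<eta> p))"
      by (rule time_integration_by_parts[OF \<eta> \<tau>])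
    also have "\<dots> = (LINT p|lborel. r p * r p * (bt p * \<psi> p * \<psi> p) + (2 * k) * (r p * r p * (b p * \<psi> p * \<psi> p))
        + 2 * (r p * r p * (b p * \<psi> p * dd (1, 0) \<psi> p)))"
      unfolding ww[symmetric] d\<eta> by (intro Bochner_Integration.integral_cong refl) (simp add: \<eta>_def algebra_simps)
    also have "\<dots> = mul bt U \<bullet> U + (2 * k) * (mul b U \<bullet> U) + 2 * (mul b U \<bullet> mul r ?pt)"
      unfolding U_def by (simp add: intg bt b L two[symmetric])
    finally have 1: "(LINT x|lborel. b (T, x) * \<eta> (T, x)) - (LINT x|lborel. b (\<tau>, x) * \<eta> (\<tau>, x)) =
      mul bt U \<bullet> U + (2 * k) * (mul b U \<bullet> U) + 2 * (mul b U \<bullet> mul r ?pt)" .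
    let ?R0 = "F0 \<psi> + \<zeta>0" and ?R1 = "F1 \<psi> + \<zeta>1"
    have "mul r U \<bullet> ?R0 + mul r Y \<bullet> ?R1 = mul r U \<bullet> F0 \<psi> + mul r Y \<bullet> F1 \<psi>"
      using \<zeta>[OF UX] by (simp add: inner_add_right inner_commute)
    also have "mul r U \<bullet> F0 \<psi> = mul b U \<bullet> mul r ?pt + mul (\<lambda>p. b p * B p) U \<bullet> Y - lam * (mul b U \<bullet> U)"
    proof -
      have comm: "mul r U \<bullet> mul c u = mul c U \<bullet> mul r u" if "bounded_borel c" for c u
        by (simp add: inner_mul_swap[OF rb] inner_mul_swap[OF that] mul_mul rb that mult.commute)
      show ?thesis
        unfolding F0_def inner_mul_swap[OF bounded_borel_ind_strip, symmetric] supp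
        by (simp add: inner_add_right inner_diff_right comm b(1) bbB) (simp add: U_def Y_def)
    qed
    also have "mul r Y \<bullet> F1 \<psi> = - (1/2) * (mul a Y \<bullet> Y)"
    proof -
      have "mul r Y \<bullet> mul a ?px = mul a Y \<bullet> mul r ?px"
        by (simp add: inner_mul_swap[OF rb] inner_mul_swap[OF a(1)] mul_mul rb a mult.commute)
      then show ?thesis
        unfolding F1_def inner_scaleR_right inner_mul_swap[OF bounded_borel_ind_strip, symmetric] supp by (simp add: Y_def)
    qed
    finally have 2: "mul r U \<bullet> ?R0 + mul r Y \<bullet> ?R1 = mul b U \<bullet> mul r ?pt + mul (\<lambda>p. b p * B p) U \<bullet> Y
      - lam * (mul b U \<bullet> U) - (1/2) * (mul a Y \<bullet> Y)" by simp
    have Ysupp: "AE p in lborel. p \<notin> open_strip T \<longrightarrow> fn Y p = 0"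
      using supp[of ?px] unfolding Y_def supported_iff .
    have aY: "m * (norm Y)\<^sup>2 \<le> mul a Y \<bullet> Y"
      by (rule mul_mono_inner[OF a(1)]) (use Ysupp a(2) in \<open>auto elim: eventually_mono\<close>)
    have bU: "m * (norm U)\<^sup>2 \<le> mul b U \<bullet> U"
      using b by (intro mul_mono_inner) auto
    have btU: "\<bar>mul bt U \<bullet> U\<bar> \<le> K * norm U * norm U" and BUY: "\<bar>mul (\<lambda>p. b p * B p) U \<bullet> Y\<bar> \<le> K * norm U * norm Y"
      using K by (auto intro!: abs_inner_mul_le bt bbB)
    have RU: "\<bar>mul r U \<bullet> ?R0\<bar> \<le> R * norm U * norm ?R0" and RY: "\<bar>mul r Y \<bullet> ?R1\<bar> \<le> R * norm Y * norm ?R1"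
      using R rR by (auto intro!: abs_inner_mul_le rb)
    \<comment> \<open>Young's inequalities sharing out m |Y|^2: m/2 goes to the drift, m/4 to the
      residual \<open>F1\<close>, and m/4 survives in the estimate.\<close>
    have q1: "2 * (K * norm U * norm Y) \<le> m / 2 * (norm Y)\<^sup>2 + 2 * K\<^sup>2 / m * (norm U)\<^sup>2"
    proof -
      have "0 \<le> m / 2 * (norm Y - 2 * K / m * norm U)\<^sup>2" using m by simp
      also have "\<dots> = m / 2 * (norm Y)\<^sup>2 + 2 * K\<^sup>2 / m * (norm U)\<^sup>2 - 2 * (K * norm U * norm Y)"
        using m by (simp add: power2_eq_square field_simps)
      finally show ?thesis by simp
    qed
    have q2: "2 * (R * norm U * norm ?R0) \<le> (norm U)\<^sup>2 + R\<^sup>2 * (norm ?R0)\<^sup>2"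
      using zero_le_power2[of "norm U - R * norm ?R0"] by (simp add: power2_eq_square algebra_simps)
    have q3: "2 * (R * norm Y * norm ?R1) \<le> m / 4 * (norm Y)\<^sup>2 + 4 * R\<^sup>2 / m * (norm ?R1)\<^sup>2"
    proof -
      have "0 \<le> m / 4 * (norm Y - 4 * R / m * norm ?R1)\<^sup>2" using m by simp
      also have "\<dots> = m / 4 * (norm Y)\<^sup>2 + 4 * R\<^sup>2 / m * (norm ?R1)\<^sup>2 - 2 * (R * norm Y * norm ?R1)"
        using m by (simp add: power2_eq_square field_simps)
      finally show ?thesis by simp
    qed
    have sl: "(\<lambda>x. \<psi> (t, x)) \<in> L2 lborel" for t by (rule test_L2[OF test_slice_x(1)[OF \<psi>]])
    have sb: "integrable lborel (\<lambda>x. b (t, x) * (\<psi> (t, x))\<^sup>2)" for t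
    proof -
      have "(\<lambda>x. b (t, x)) \<in> borel_measurable lborel" using borel_slice(1)[OF bounded_borelD[OF b(1)]] by simp
      then have "integrable lborel (\<lambda>x. (b (t, x) * \<psi> (t, x)) * \<psi> (t, x))"
        using K(4) by (intro L2_mult_integrable L2_bounded_mult[OF sl]) (auto intro: sl)
      then show ?thesis by (simp add: power2_eq_square mult.assoc)
    qed
    have "m * (LINT x|lborel. (\<psi> (\<tau>, x))\<^sup>2) = (LINT x|lborel. m * (\<psi> (\<tau>, x))\<^sup>2)" by simp
    also have "\<dots> \<le> (LINT x|lborel. b (\<tau>, x) * (\<psi> (\<tau>, x))\<^sup>2)"
      using b(2) by (intro integral_mono sb Bochner_Integration.integrable_mult_right L2D(2) sl mult_right_mono) auto
    also have "\<dots> \<le> exp (2 * k * \<tau>) * (LINT x|lborel. b (\<tau>, x) * (\<psi> (\<tau>, x))\<^sup>2)"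
    proof -
      have "0 \<le> (LINT x|lborel. b (\<tau>, x) * (\<psi> (\<tau>, x))\<^sup>2)"
        using m b(2) by (intro Bochner_Integration.integral_nonneg mult_nonneg_nonneg) (auto intro: order_trans[of 0 m])
      then show ?thesis using k(1) \<tau> by (intro mult_le_cancel_right1[THEN iffD2]) auto
    qed
    also have "\<dots> = (LINT x|lborel. b (\<tau>, x) * \<eta> (\<tau>, x))"
      by (simp add: \<eta>_def w_def power2_eq_square mult_ac flip: Bochner_Integration.integral_mult_right_zero)
    finally have lhs: "m * (LINT x|lborel. (\<psi> (\<tau>, x))\<^sup>2) \<le> (LINT x|lborel. b (\<tau>, x) * \<eta> (\<tau>, x))" .
    have "(LINT x|lborel. b (T, x) * \<eta> (T, x)) = R\<^sup>2 * (LINT x|lborel. b (T, x) * (\<psi> (T, x))\<^sup>2)"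
      by (simp add: \<eta>_def w_def R_def power2_eq_square mult_ac exp_add[symmetric] flip: Bochner_Integration.integral_mult_right_zero)
    also have "\<dots> \<le> R\<^sup>2 * (LINT x|lborel. K * (\<psi> (T, x))\<^sup>2)"
      using K(4) by (intro mult_left_mono integral_mono sb Bochner_Integration.integrable_mult_right L2D(2) sl mult_right_mono) (auto simp: abs_le_iff)
    also have "\<dots> = R\<^sup>2 * K * (norm (cls (\<lambda>x. \<psi> (T, x))))\<^sup>2" by (simp add: norm_cls[OF sl])
    finally have rhs: "(LINT x|lborel. b (T, x) * \<eta> (T, x)) \<le> R\<^sup>2 * K * (norm (cls (\<lambda>x. \<psi> (T, x))))\<^sup>2" .
    have lamU: "0 \<le> lam * (mul b U \<bullet> U)"
      using lam bU m by (intro mult_nonneg_nonneg) (auto intro: order_trans[of 0 "m * (norm U)\<^sup>2"])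
    have kU: "2 * k * (m * (norm U)\<^sup>2) \<le> 2 * k * (mul b U \<bullet> U)"
      using bU k(1) by (intro mult_left_mono) auto
    have kk: "2 * k * (m * (norm U)\<^sup>2) = K * (norm U)\<^sup>2 + 2 * K\<^sup>2 / m * (norm U)\<^sup>2 + 2 * (norm U)\<^sup>2"
    proof -
      have "2 * k * m = K + 2 * K\<^sup>2 / m + 2" using k(2) by simp
      then have "(2 * k * m) * (norm U)\<^sup>2 = (K + 2 * K\<^sup>2 / m + 2) * (norm U)\<^sup>2" by simp
      then show ?thesis by (simp add: algebra_simps)
    qed
    have "m * (LINT x|lborel. (\<psi> (\<tau>, x))\<^sup>2) + m / 4 * (norm Y)\<^sup>2 + (norm U)\<^sup>2 \<le>
      R\<^sup>2 * K * (norm (cls (\<lambda>x. \<psi> (T, x))))\<^sup>2 + R\<^sup>2 * (norm ?R0)\<^sup>2 + 4 * R\<^sup>2 / m * (norm ?R1)\<^sup>2"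
    proof -
      have UU: "K * norm U * norm U = K * (norm U)\<^sup>2" by (simp add: power2_eq_square)
      have half: "m / 4 * (norm Y)\<^sup>2 + m / 4 * (norm Y)\<^sup>2 + m / 2 * (norm Y)\<^sup>2 = m * (norm Y)\<^sup>2" by (simp add: field_simps)
      show ?thesis
        using 1 2 lhs rhs aY btU BUY RU RY q1 q2 q3 lamU kU kk half unfolding UU abs_le_iff by linarith
    qed
    also have "\<dots> \<le> D * (norm (cls (\<lambda>x. \<psi> (T, x))))\<^sup>2 + D * (norm ?R0)\<^sup>2 + D * (norm ?R1)\<^sup>2"
      unfolding D_def using m K(1) by (intro add_mono mult_right_mono) auto
    also have "\<dots> = D * (norm (cls (\<lambda>x. \<psi> (T, x)), ?R0, ?R1))\<^sup>2"
      by (simp add: norm_Pair algebra_simps)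
    finally show ?thesis unfolding U_def Y_def by simp
  qed
  \<comment> \<open>The summands bound the slice, the x-derivative and the function itself; the last
    two come from \<open>main\<close> at \<tau> = 0, where the weight is at least 1 on the
    strip.\<close>
  define C where "C = D / m + 4 * D / m + D"
  have "C > 0" using D m by (auto simp: C_def intro!: add_pos_pos divide_pos_pos)
  have strip_le: "(norm (mul (ind_strip T) u))\<^sup>2 \<le> (norm (mul (\<lambda>p. indicator ({0..T} \<times> UNIV) p * exp (k * fst p)) u))\<^sup>2" for u
  proof -
    let ?r = "\<lambda>p::real \<times> real. indicator ({0..T} \<times> UNIV) p * exp (k * fst p)"
    have [measurable]: "{0..T} \<times> (UNIV::real set) \<in> sets borel" by (intro borel_closed closed_Times) auto
    have [measurable]: "(\<lambda>p::real \<times> real. exp (c * fst p)) \<in> borel_measurable borel" for c by (intro smooth_borel smooth_exp_fst)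
    have rb: "bounded_borel ?r"
    proof (rule bounded_borelI)
      show "\<bar>?r p\<bar> \<le> exp (k * T)" for p using k(1) by (auto simp: indicator_def)
    qed measurable
    let ?q = "\<lambda>p. ind_strip T p * exp (- k * fst p)"
    have iQm [measurable]: "ind_strip T \<in> borel_measurable borel" by (rule bounded_borelD[OF bounded_borel_ind_strip])
    have q1: "\<bar>?q p\<bar> \<le> 1" for p using k(1) by (cases p) (auto simp: indicator_def open_strip_def)
    have qb: "bounded_borel ?q" by (rule bounded_borelI[OF _ q1]) measurable
    have "(\<lambda>p. ?q p * ?r p) = ind_strip T"
      by (auto simp: indicator_def open_strip_def exp_minus)
    then have "mul (ind_strip T) u = mul ?q (mul ?r u)" by (simp only: mul_mul[OF qb rb])
    then have "norm (mul (ind_strip T) u) \<le> 1 * norm (mul ?r u)" using norm_mul_le[OF qb q1] by simp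
    then show ?thesis by (intro power_mono) auto
  qed
  show ?thesis
  proof (intro exI[of _ C] conjI ballI allI impI \<open>C > 0\<close>)
    fix \<psi> :: "real \<times> real \<Rightarrow> real" and \<zeta>0 \<zeta>1 \<tau> assume \<psi>: "\<psi> \<in> test_functions UNIV" and \<zeta>: "\<forall>y\<in>X. (\<zeta>0, \<zeta>1) \<bullet> y = 0" and \<tau>: "\<tau> \<in> {0..T}"
    let ?E = "(norm (cls (\<lambda>x. \<psi> (T, x)), F0 \<psi> + \<zeta>0, F1 \<psi> + \<zeta>1))\<^sup>2"
    have nn: "0 \<le> (LINT x|lborel. (\<psi> (t, x))\<^sup>2)" for t by simp
    have "m * (LINT x|lborel. (\<psi> (\<tau>, x))\<^sup>2) \<le> D * ?E"
      using main[OF \<psi> _ _ _ refl, of \<zeta>0 \<zeta>1 \<tau>] \<zeta> \<tau> m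
      by (auto intro: order_trans[rotated] simp: add_nonneg_nonneg)
    then have 1: "(LINT x|lborel. (\<psi> (\<tau>, x))\<^sup>2) \<le> D / m * ?E" using m by (simp add: field_simps)
    have m0: "m * (LINT x|lborel. (\<psi> (0, x))\<^sup>2) + m / 4 * (norm (mul (\<lambda>p. indicator ({0..T} \<times> UNIV) p * exp (k * fst p)) (cls (dd (0, 1) \<psi>))))\<^sup>2 +
        (norm (mul (\<lambda>p. indicator ({0..T} \<times> UNIV) p * exp (k * fst p)) (cls \<psi>)))\<^sup>2 \<le> D * ?E"
      by (rule main[OF \<psi> _ _ _ refl]) (use \<zeta> T in auto)
    have m1: "0 \<le> m * (LINT x|lborel. (\<psi> (0, x))\<^sup>2)" using nn[of 0] m by simp
    have 2: "(norm (mul (ind_strip T) (cls \<psi>)))\<^sup>2 \<le> D * ?E"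
      using m0 m1 m strip_le[of "cls \<psi>"] zero_le_power2 by (smt (verit) divide_pos_pos mult_nonneg_nonneg)
    have "m / 4 * (norm (mul (ind_strip T) (cls (dd (0, 1) \<psi>))))\<^sup>2 \<le> D * ?E"
      using m0 m1 mult_left_mono[OF strip_le[of "cls (dd (0, 1) \<psi>)"], of "m / 4"] m
        zero_le_power2[of "norm (mul (\<lambda>p. indicator ({0..T} \<times> UNIV) p * exp (k * fst p)) (cls \<psi>))"] by linarith
    then have 3: "(norm (mul (ind_strip T) (cls (dd (0, 1) \<psi>))))\<^sup>2 \<le> 4 * D / m * ?E" using m by (simp add: field_simps)
    have "C * ?E = D / m * ?E + 4 * D / m * ?E + D * ?E" unfolding C_def by (simp add: algebra_simps)
    with 1 2 3 show "(LINT x|lborel. (\<psi> (\<tau>, x))\<^sup>2) + (norm (mul (ind_strip T) (cls \<psi>)))\<^sup>2 + (norm (mul (ind_strip T) (cls (dd (0, 1) \<psi>))))\<^sup>2 \<le> C * ?E"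
      by linarith
  qed
qed

end

text \<open>Multiplication by a cut-off in time that equals 1 at \<open>t\<close>. Hence terminal
  values of plane test functions include all test functions of x.\<close>

lemma test_tensor:
  fixes e :: "real \<Rightarrow> real" and t :: real
  assumes e: "e \<in> test_functions UNIV"
  obtains \<psi> where "\<psi> \<in> test_functions UNIV" "\<And>x. \<psi> (t, x) = e x"
proof
  define \<theta> where "\<theta> p = smooth_step ((2 - t) + 1 * fst p) * smooth_step ((2 + t) + (-1) * fst p)" for p :: "real \<times> real"
  have s\<theta>: "smooth \<theta>" unfolding \<theta>_def by (intro smooth_mult smooth_step_fst)
  obtain K where K: "smooth e" "compact K" "\<And>x. x \<notin> K \<Longrightarrow> e x = 0" using e by (rule test_functionsE) blast
  have "smooth (\<lambda>p::real \<times> real. e (snd p))"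
    using smooth_affine[OF bounded_linear_snd K(1), of 0] by simp
  with s\<theta> have "smooth (\<lambda>p. \<theta> p * e (snd p))" by (rule smooth_mult)
  then show "(\<lambda>p. \<theta> p * e (snd p)) \<in> test_functions UNIV"
  proof (rule test_functionsI)
    show "compact ({t - 2..t + 2} \<times> K)" using K(2) by (intro compact_Times) auto
    show "\<theta> p * e (snd p) = 0" if "p \<notin> {t - 2..t + 2} \<times> K" for p
    proof (cases "snd p \<in> K")
      case True
      then have "fst p < t - 2 \<or> t + 2 < fst p" using that by (cases p) auto
      then show ?thesis unfolding \<theta>_def by (auto simp: smooth_step_simps)
    qed (simp add: K(3))
  qed simp
  show "\<theta> (t, x) * e (snd (t, x)) = e x" for x
    by (simp add: \<theta>_def smooth_step_simps)
qed

context parabolic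
begin

lemma slice_L2:
  fixes \<psi> :: "real \<times> real \<Rightarrow> real"
  shows "\<psi> \<in> test_functions \<Omega> \<Longrightarrow> (\<lambda>x. \<psi> (t, x)) \<in> L2 lborel"
  by (rule test_L2[OF test_slice_x(1)])

lemma F_add:
  assumes "\<psi> \<in> test_functions UNIV" "\<phi> \<in> test_functions UNIV"
  shows "F0 (\<lambda>p. \<psi> p + \<phi> p) = F0 \<psi> + F0 \<phi>" "F1 (\<lambda>p. \<psi> p + \<phi> p) = F1 \<psi> + F1 \<phi>"
    "cls (\<lambda>x. \<psi> (t, x) + \<phi> (t, x)) = cls (\<lambda>x. \<psi> (t, x)) + cls (\<lambda>x. \<phi> (t, x))"
  using cls_add[OF slice_L2[OF assms(1), THEN L2_lborel_lebesgue] slice_L2[OF assms(2), THEN L2_lborel_lebesgue]]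
  by (simp_all add: F0_def F1_def dd_add_fun[OF test_smooth[OF assms(1)] test_smooth[OF assms(2)]]
      cls_add[OF test_L2'[OF assms(1)] test_L2'[OF assms(2)]]
      cls_add[OF test_L2'[OF test_dd[OF assms(1)]] test_L2'[OF test_dd[OF assms(2)]]]
      mul_add mul_diff b(1) bbB a(1) bounded_borel_ind_strip mul_scaleR scaleR_add_right)

lemma F_cmult:
  assumes "\<psi> \<in> test_functions UNIV"
  shows "F0 (\<lambda>p. c * \<psi> p) = c *\<^sub>R F0 \<psi>" "F1 (\<lambda>p. c * \<psi> p) = c *\<^sub>R F1 \<psi>"
    "cls (\<lambda>x. c * \<psi> (t, x)) = c *\<^sub>R cls (\<lambda>x. \<psi> (t, x))"
  using cls_cmult[OF slice_L2[OF assms, THEN L2_lborel_lebesgue]]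
  by (simp_all add: F0_def F1_def dd_cmult_fun[OF test_smooth[OF assms]]
      cls_cmult[OF test_L2'[OF assms]] cls_cmult[OF test_L2'[OF test_dd[OF assms]]]
      mul_add mul_diff b(1) bbB a(1) bounded_borel_ind_strip mul_scaleR scaleR_add_right scaleR_diff_right mult.commute[of lam])

text \<open>The attainable data: terminal value and residual of a smooth function. Adding the whole
  annihilator of \<open>X\<close> makes the choice of the pair that represents the residual
  immaterial.\<close>

definition W :: "(real l2 \<times> (real \<times> real) l2 \<times> (real \<times> real) l2) set" where
  "W = {(cls (\<lambda>x. \<psi> (T, x)), F0 \<psi> + \<zeta>0, F1 \<psi> + \<zeta>1) | \<psi> \<zeta>0 \<zeta>1.
     \<psi> \<in> test_functions UNIV \<and> (\<forall>y\<in>X. (\<zeta>0, \<zeta>1) \<bullet> y = 0)}"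

lemma WI: "\<psi> \<in> test_functions UNIV \<Longrightarrow> (\<And>y. y \<in> X \<Longrightarrow> (\<zeta>0, \<zeta>1) \<bullet> y = 0) \<Longrightarrow>
    (cls (\<lambda>x. \<psi> (T, x)), F0 \<psi> + \<zeta>0, F1 \<psi> + \<zeta>1) \<in> W"
  unfolding W_def by blast

lemma subspace_W: "subspace W"
proof (rule subspaceI)
  have "(cls (\<lambda>x. 0 * 0), F0 (\<lambda>p. 0 * 0) + 0, F1 (\<lambda>p. 0 * 0) + 0) \<in> W"
    by (rule WI) (auto simp: zero_prod_def[symmetric])
  moreover have "F0 (\<lambda>p. 0 * 0) = 0" "F1 (\<lambda>p. 0 * 0) = 0"
    using F_cmult[of "\<lambda>p. 0" 0] by simp_all
  ultimately show "0 \<in> W" by (simp add: cls_zero zero_prod_def)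
  show "x + y \<in> W" if xy: "x \<in> W" "y \<in> W" for x y
  proof -
    obtain \<psi> \<zeta>0 \<zeta>1 \<phi> \<xi>0 \<xi>1 where *: "x = (cls (\<lambda>x. \<psi> (T, x)), F0 \<psi> + \<zeta>0, F1 \<psi> + \<zeta>1)" "\<psi> \<in> test_functions UNIV"
      "\<And>y. y \<in> X \<Longrightarrow> (\<zeta>0, \<zeta>1) \<bullet> y = 0" "y = (cls (\<lambda>x. \<phi> (T, x)), F0 \<phi> + \<xi>0, F1 \<phi> + \<xi>1)" "\<phi> \<in> test_functions UNIV"
      "\<And>y. y \<in> X \<Longrightarrow> (\<xi>0, \<xi>1) \<bullet> y = 0" using xy unfolding W_def by blast
    have "(cls (\<lambda>x. \<psi> (T, x) + \<phi> (T, x)), F0 (\<lambda>p. \<psi> p + \<phi> p) + (\<zeta>0 + \<xi>0), F1 (\<lambda>p. \<psi> p + \<phi> p) + (\<zeta>1 + \<xi>1)) \<in> W"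
    proof (rule WI[OF test_add[OF *(2,5)]])
      fix y assume "y \<in> X"
      then show "(\<zeta>0 + \<xi>0, \<zeta>1 + \<xi>1) \<bullet> y = 0"
        using *(3,6)[of y] by (cases y) (simp add: inner_add_left)
    qed
    then show ?thesis unfolding F_add[OF *(2,5)] *(1,4) by (simp add: algebra_simps)
  qed
  show "c *\<^sub>R x \<in> W" if x: "x \<in> W" for c x
  proof -
    obtain \<psi> \<zeta>0 \<zeta>1 where *: "x = (cls (\<lambda>x. \<psi> (T, x)), F0 \<psi> + \<zeta>0, F1 \<psi> + \<zeta>1)" "\<psi> \<in> test_functions UNIV"
      "\<And>y. y \<in> X \<Longrightarrow> (\<zeta>0, \<zeta>1) \<bullet> y = 0" using x unfolding W_def by blast
    have "(cls (\<lambda>x. c * \<psi> (T, x)), F0 (\<lambda>p. c * \<psi> p) + c *\<^sub>R \<zeta>0, F1 (\<lambda>p. c * \<psi> p) + c *\<^sub>R \<zeta>1) \<in> W"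
    proof (rule WI[OF test_cmult[OF *(2)]])
      fix y assume "y \<in> X"
      then show "(c *\<^sub>R \<zeta>0, c *\<^sub>R \<zeta>1) \<bullet> y = 0"
        using *(3)[of y] by (cases y) (simp add: distrib_left[symmetric])
    qed
    then show ?thesis by (simp add: F_cmult[OF *(2)] *(1) scaleR_add_right)
  qed
qed

text \<open>An element orthogonal to \<open>W\<close> solves the adjoint problem with zero data.\<close>

lemma W_dense: "closure W = UNIV"
proof (rule dense_if_orthogonal_trivial[OF subspace_W])
  fix q assume orth: "\<And>s. s \<in> W \<Longrightarrow> q \<bullet> s = 0"
  obtain p v z where q: "q = (p, v, z)" by (cases q) auto
  have orth1: "p \<bullet> cls (\<lambda>x. \<psi> (T, x)) + v \<bullet> F0 \<psi> + z \<bullet> F1 \<psi> = 0" if "\<psi> \<in> test_functions UNIV" for \<psi>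
    using orth[OF WI[OF that, of 0 0]] by (simp add: q zero_prod_def[symmetric])
  have orth2: "v \<bullet> \<zeta>0 + z \<bullet> \<zeta>1 = 0" if "\<And>y. y \<in> X \<Longrightarrow> (\<zeta>0, \<zeta>1) \<bullet> y = 0" for \<zeta>0 \<zeta>1
    using orth[OF WI[OF test_zero, of \<zeta>0 \<zeta>1]] that orth1[OF test_zero] by (simp add: q inner_add_right)
  \<comment> \<open>Orthogonality to all annihilators of \<open>X\<close> places (v, z) in
    \<open>X\<close>, because the difference from its projection is itself such an
    annihilator.\<close>
  have "(v, z) \<in> X"
  proof -
    obtain y where y: "y \<in> X" "\<And>s. s \<in> X \<Longrightarrow> ((v, z) - y) \<bullet> s = 0"
      using projection_exists[OF subspace_X closed_X] by blast
    obtain y0 y1 where yy: "y = (y0, y1)" by (cases y)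
    have "v \<bullet> (v - y0) + z \<bullet> (z - y1) = 0"
      by (rule orth2) (use y(2) yy in simp)
    moreover have "(v - y0) \<bullet> y0 + (z - y1) \<bullet> y1 = 0" using y(2)[OF y(1)] by (simp add: yy)
    ultimately have "(v - y0) \<bullet> (v - y0) + (z - y1) \<bullet> (z - y1) = 0"
      by (simp add: inner_diff_right inner_diff_left inner_commute)
    then have "(v - y0) = 0 \<and> (z - y1) = 0"
      using inner_ge_zero[of "v - y0"] inner_ge_zero[of "z - y1"]
        inner_eq_zero_iff[of "v - y0"] inner_eq_zero_iff[of "z - y1"] by linarith
    with y(1) yy show ?thesis by simp
  qed
  then have vz: "wderiv (0, 1) v z" "mul (ind_strip T) v = v" "mul (ind_strip T) z = z" by (auto simp: X_def)
  have a2: "bounded_borel (\<lambda>p. a p / 2)" using bounded_borel_mult[OF a(1) bounded_borel_const[of "1/2"]] by simp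
  have nbB: "bounded_borel (\<lambda>p. - (b p * B p))" by (intro bounded_borel_uminus bbB)
  have lb: "bounded_borel (\<lambda>p. lam * b p)" by (intro bounded_borel_mult bounded_borel_const b)
  \<comment> \<open>Time runs forward here, and tests supported in t < T remove the terminal
    component. In the adjoint equation the drift multiplies \<open>v\<close> against the
    x-derivative of the test function, so it enters through \<gamma>; the factor 1/2 at
    \<open>a\<close> explains m / 2.\<close>
  have v0: "v = 0"
  proof (rule parabolic_uniqueness[where \<sigma> = 1 and \<kappa> = T and T = T and m = "m / 2" and b = b and L = L and a = "\<lambda>p. a p / 2"
        and \<beta> = "\<lambda>_. 0" and \<gamma> = "\<lambda>p. - (b p * B p)" and c = "\<lambda>p. lam * b p" and z = z])
    show "m / 2 \<le> b p" for p using b(2)[of p] m by linarith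
    show "m / 2 \<le> a p / 2" if "p \<in> open_strip T" for p using a(2)[OF that] by linarith
    show "1 * fst p < T" if "p \<in> open_strip T" for p using that by (auto simp: open_strip_def)
    fix \<psi> :: "real \<times> real \<Rightarrow> real" assume \<psi>: "\<psi> \<in> test_functions {p. 1 * fst p < T}"
    have "\<psi> (T, x) = 0" for x
    proof -
      obtain K where "K \<subseteq> {p. 1 * fst p < T}" "\<And>p. p \<notin> K \<Longrightarrow> \<psi> p = 0" using \<psi> by (rule test_functionsE) blast
      then show ?thesis by force
    qed
    then have e: "v \<bullet> F0 \<psi> + z \<bullet> F1 \<psi> = 0" using orth1[OF test_UNIV[OF \<psi>]] by (simp add: cls_zero)
    have "v \<bullet> F0 \<psi> = mul b v \<bullet> cls (dd (1, 0) \<psi>) + mul (\<lambda>p. b p * B p) v \<bullet> cls (dd (0, 1) \<psi>) - lam * (mul b v \<bullet> cls \<psi>)"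
      unfolding F0_def inner_mul_swap[OF bounded_borel_ind_strip, symmetric] vz(2)
      by (simp add: inner_add_right inner_diff_right inner_mul_swap b(1) bbB)
    moreover have "z \<bullet> F1 \<psi> = - (1/2) * (mul a z \<bullet> cls (dd (0, 1) \<psi>))"
      unfolding F1_def inner_scaleR_right inner_mul_swap[OF bounded_borel_ind_strip, symmetric] vz(3)
      by (simp add: inner_mul_swap a(1))
    moreover have "mul (\<lambda>p. a p / 2) z = (1/2) *\<^sub>R mul a z"
      using mul_mul[OF bounded_borel_const[of "1/2"] a(1), of z] by (simp add: mul_const)
    moreover have "mul (\<lambda>p. - (b p * B p)) v = - mul (\<lambda>p. b p * B p) v"
      using mul_mul[OF bounded_borel_const[of "-1"] bbB, of v] by (simp add: mul_const)
    moreover have "mul (\<lambda>p. lam * b p) v = lam *\<^sub>R mul b v"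
      using mul_mul[OF bounded_borel_const[of lam] b(1), of v] by (simp add: mul_const)
    ultimately show "1 * (mul b v \<bullet> cls (dd (1, 0) \<psi>)) = (mul (\<lambda>p. a p / 2) z + mul (\<lambda>p. - (b p * B p)) v) \<bullet> cls (dd (0, 1) \<psi>) +
        (mul (\<lambda>_. 0) z + mul (\<lambda>p. lam * b p) v) \<bullet> cls \<psi>"
      using e by (simp add: mul_const inner_diff_left)
  qed (use m b a2 nbB lb vz in auto)
  have z0: "z = 0"
    by (rule test_separating) (use wderivD[OF vz(1)] v0 in simp)
  \<comment> \<open>With v and z gone only the terminal component is left, and the slices at T
    contain all test functions of x.\<close>
  have "p = 0"
  proof (rule test_separating)
    fix e :: "real \<Rightarrow> real" assume "e \<in> test_functions UNIV"
    then obtain \<psi> where "\<psi> \<in> test_functions UNIV" "\<And>x. \<psi> (T, x) = e x" by (rule test_tensor[where t = T]) blast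
    then show "p \<bullet> cls e = 0" using orth1[of \<psi>] v0 z0 by simp
  qed
  with v0 z0 q show "q = 0" by (simp add: zero_prod_def)
qed

lemma test_class_in_X:
  assumes "\<phi> \<in> test_functions (open_strip T)"
  shows "(cls \<phi>, cls (dd (0, 1) \<phi>)) \<in> X"
proof (rule XI)
  have "mul (ind_strip T) (cls f) = cls f" if f: "f \<in> test_functions (open_strip T)" for f
  proof -
    obtain K where K: "K \<subseteq> open_strip T" "\<And>p. p \<notin> K \<Longrightarrow> f p = 0" using f by (rule test_functionsE) blast
    have "ind_strip T p * f p = f p" for p using K(1) K(2)[of p] by (cases "p \<in> open_strip T") auto
    then have "(\<lambda>p. ind_strip T p * f p) = f" by blast
    then show ?thesis using mul_cls[OF bounded_borel_ind_strip test_L2'[OF f], of T] by simp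
  qed
  then show "mul (ind_strip T) (cls \<phi>) = cls \<phi>" "mul (ind_strip T) (cls (dd (0, 1) \<phi>)) = cls (dd (0, 1) \<phi>)"
    using assms test_dd[OF assms] by auto
qed (rule wderiv_test[OF assms])

text \<open>Links \<open>F0\<close> and \<open>F1\<close> to the weak formulation: integrating b
  \<psi> \<phi> in time moves the time derivative to \<phi> at the cost of the \<open>bt\<close>
  term, and \<phi> vanishes at both ends.\<close>

lemma test_equation:
  assumes \<psi>: "\<psi> \<in> test_functions UNIV" and \<phi>: "\<phi> \<in> test_functions (open_strip T)"
  shows "F0 \<psi> \<bullet> cls \<phi> + F1 \<psi> \<bullet> cls (dd (0, 1) \<phi>) =
    - (mul bt (mul (ind_strip T) (cls \<psi>)) \<bullet> cls \<phi>) - mul b (mul (ind_strip T) (cls \<psi>)) \<bullet> cls (dd (1, 0) \<phi>)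
    + mul (\<lambda>p. b p * B p) (mul (ind_strip T) (cls (dd (0, 1) \<psi>))) \<bullet> cls \<phi>
    - lam * (mul b (mul (ind_strip T) (cls \<psi>)) \<bullet> cls \<phi>)
    - 1/2 * (mul a (mul (ind_strip T) (cls (dd (0, 1) \<psi>))) \<bullet> cls (dd (0, 1) \<phi>))"
proof -
  have comm: "mul c (mul (ind_strip T) u) = mul (ind_strip T) (mul c u)" if "bounded_borel c" for c u
    by (simp add: mul_mul that bounded_borel_ind_strip mult.commute)
  obtain K where K: "K \<subseteq> open_strip T" "\<And>p. p \<notin> K \<Longrightarrow> \<phi> p = 0" using \<phi> by (rule test_functionsE) blast
  have supp: "\<phi> p = 0" "dd (1, 0) \<phi> p = 0" if "p \<notin> open_strip T" for p
  proof -
    show "\<phi> p = 0" using K that by blast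
    obtain K' where "K' \<subseteq> open_strip T" "\<And>p. p \<notin> K' \<Longrightarrow> dd (1, 0) \<phi> p = 0"
      using test_dd[OF \<phi>] by (rule test_functionsE) blast
    then show "dd (1, 0) \<phi> p = 0" using that by blast
  qed
  define \<eta> where "\<eta> p = \<psi> p * \<phi> p" for p
  have \<eta>: "\<eta> \<in> test_functions UNIV"
    unfolding \<eta>_def using test_mult[OF test_UNIV[OF \<phi>] test_smooth[OF \<psi>]] .
  have d\<eta>: "dd (1, 0) \<eta> p = \<psi> p * dd (1, 0) \<phi> p + dd (1, 0) \<psi> p * \<phi> p" for p
    unfolding \<eta>_def[abs_def] by (rule dd_mult[OF test_smooth[OF \<psi>] test_smooth[OF \<phi>]])
  have "\<eta> (T, x) = 0" "\<eta> (0, x) = 0" for x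
    by (auto simp: \<eta>_def supp open_strip_def)
  then have "0 = (LINT p|lborel. indicator ({0..T} \<times> UNIV) p * (bt p * \<eta> p + b p * dd (1, 0) \<eta> p))"
    using time_integration_by_parts[OF \<eta>, of 0] T by simp
  also have "\<dots> = (LINT p|lborel. (ind_strip T p * (bt p * \<psi> p)) * \<phi> p + ((ind_strip T p * (b p * \<psi> p)) * dd (1, 0) \<phi> p
      + (ind_strip T p * (b p * dd (1, 0) \<psi> p)) * \<phi> p))"
  proof (intro Bochner_Integration.integral_cong refl)
    fix p :: "real \<times> real"
    show "indicator ({0..T} \<times> UNIV) p * (bt p * \<eta> p + b p * dd (1, 0) \<eta> p) =
      (ind_strip T p * (bt p * \<psi> p)) * \<phi> p + ((ind_strip T p * (b p * \<psi> p)) * dd (1, 0) \<phi> p + (ind_strip T p * (b p * dd (1, 0) \<psi> p)) * \<phi> p)"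
    proof (cases "p \<in> open_strip T")
      case True
      then have "p \<in> {0..T} \<times> UNIV" by (auto simp: open_strip_def)
      with True show ?thesis
        by (simp add: d\<eta>) (simp add: \<eta>_def algebra_simps)
    next
      case False
      then show ?thesis by (simp add: d\<eta> supp) (simp add: \<eta>_def supp)
    qed
  qed
  also have "\<dots> = cls (\<lambda>p. ind_strip T p * (bt p * \<psi> p)) \<bullet> cls \<phi> + (cls (\<lambda>p. ind_strip T p * (b p * \<psi> p)) \<bullet> cls (dd (1, 0) \<phi>)
      + cls (\<lambda>p. ind_strip T p * (b p * dd (1, 0) \<psi> p)) \<bullet> cls \<phi>)"
  proof -
    note L = bounded_borel_L2[OF bounded_borel_ind_strip bounded_borel_L2[OF bt test_L2[OF \<psi>]]]
      bounded_borel_L2[OF bounded_borel_ind_strip bounded_borel_L2[OF b(1) test_L2[OF \<psi>]]]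
      bounded_borel_L2[OF bounded_borel_ind_strip bounded_borel_L2[OF b(1) test_L2[OF test_dd[OF \<psi>]]]]
    note L' = test_L2[OF \<phi>] test_L2[OF test_dd[OF \<phi>]]
    show ?thesis
      unfolding cls_inner'[OF L(1) L'(1)] cls_inner'[OF L(2) L'(2)] cls_inner'[OF L(3) L'(1)]
      by (subst Bochner_Integration.integral_add, (intro Bochner_Integration.integrable_add L2_mult_integrable L L')+,
          subst Bochner_Integration.integral_add) (intro L2_mult_integrable L L' refl)+
  qed
  also have "\<dots> = mul (ind_strip T) (mul bt (cls \<psi>)) \<bullet> cls \<phi> + (mul (ind_strip T) (mul b (cls \<psi>)) \<bullet> cls (dd (1, 0) \<phi>)
      + mul (ind_strip T) (mul b (cls (dd (1, 0) \<psi>))) \<bullet> cls \<phi>)"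
    by (simp add: mul_cls bt b(1) bounded_borel_ind_strip test_L2'[OF \<psi>] test_L2'[OF test_dd[OF \<psi>]] bounded_borel_L2')
  finally have "mul (ind_strip T) (mul b (cls (dd (1, 0) \<psi>))) \<bullet> cls \<phi> =
    - (mul (ind_strip T) (mul bt (cls \<psi>)) \<bullet> cls \<phi>) - mul (ind_strip T) (mul b (cls \<psi>)) \<bullet> cls (dd (1, 0) \<phi>)" by linarith
  then show ?thesis
    by (simp add: F0_def F1_def comm bt b(1) bbB a(1) mul_add mul_diff mul_scaleR bounded_borel_ind_strip inner_add_left inner_diff_left)
qed

end

section \<open>Existence\<close>

text \<open>The slices are even Lipschitz in time: the time derivative is bounded and all supports
  lie in one compact set.\<close>

lemma test_slices_continuous:
  fixes \<psi> :: "real \<times> real \<Rightarrow> real"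
  assumes \<psi>: "\<psi> \<in> test_functions UNIV"
  shows "((\<lambda>s. cls (\<lambda>x. \<psi> (s, x))) \<longlongrightarrow> cls (\<lambda>x. \<psi> (t, x))) (at t within S)"
proof -
  obtain K where K: "compact K" "\<And>p. p \<notin> K \<Longrightarrow> \<psi> p = 0" using \<psi> by (rule test_functionsE) blast
  have K2: "compact (snd ` K)" using K(1) by (intro compact_continuous_image continuous_intros)
  have zero: "\<psi> (s, x) = 0" if "x \<notin> snd ` K" for s x using that by (intro K(2)) force
  obtain C where C: "C > 0" "\<And>p. \<bar>dd (1, 0) \<psi> p\<bar> \<le> C" using test_bounded[OF test_dd[OF \<psi>]] by blast
  have sl: "(\<lambda>x. \<psi> (s, x)) \<in> L2 lborel" for s by (rule test_L2[OF test_slice_x(1)[OF \<psi>]])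
  define M where "M = measure lborel (snd ` K)"
  have fin: "emeasure lborel (snd ` K) < \<infinity>" using emeasure_bounded_finite[OF compact_imp_bounded[OF K2]] .
  have ms: "snd ` K \<in> sets lborel" using K2 by (simp add: compact_imp_closed borel_closed)
  have bound: "norm (cls (\<lambda>x. \<psi> (s, x)) - cls (\<lambda>x. \<psi> (t, x))) \<le> sqrt M * C * \<bar>s - t\<bar>" for s
  proof (rule power2_le_imp_le)
    have "(norm (cls (\<lambda>x. \<psi> (s, x)) - cls (\<lambda>x. \<psi> (t, x))))\<^sup>2 = (LINT x|lborel. (\<psi> (s, x) - \<psi> (t, x))\<^sup>2)"
      using norm_cls[OF L2_diff[OF sl[of s] sl[of t]]]
      by (simp add: cls_diff[OF sl[THEN L2_lborel_lebesgue] sl[THEN L2_lborel_lebesgue]])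
    also have "\<dots> \<le> (LINT x|lborel. (C * \<bar>s - t\<bar>)\<^sup>2 * indicator (snd ` K) x)"
    proof (intro integral_mono L2D(2) L2_diff sl)
      show "integrable lborel (\<lambda>x. (C * \<bar>s - t\<bar>)\<^sup>2 * indicator (snd ` K) x)"
        using fin ms by (intro Bochner_Integration.integrable_mult_right integrable_real_indicator)
      show "(\<psi> (s, x) - \<psi> (t, x))\<^sup>2 \<le> (C * \<bar>s - t\<bar>)\<^sup>2 * indicator (snd ` K) x" for x
      proof (cases "x \<in> snd ` K")
        case True
        have "\<bar>\<psi> ((t, x) + (s - t) *\<^sub>R (1, 0)) - \<psi> (t, x)\<bar> \<le> C * \<bar>s - t\<bar>"
          by (rule test_difference_bound[OF test_smooth[OF \<psi>] C(2)])
        then have "\<bar>\<psi> (s, x) - \<psi> (t, x)\<bar>\<^sup>2 \<le> (C * \<bar>s - t\<bar>)\<^sup>2" by (intro power_mono) auto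
        with True show ?thesis by simp
      qed (simp add: zero)
    qed
    also have "\<dots> = (sqrt M * C * \<bar>s - t\<bar>)\<^sup>2"
      using fin ms by (simp add: M_def power_mult_distrib mult_ac)
    finally show "(norm (cls (\<lambda>x. \<psi> (s, x)) - cls (\<lambda>x. \<psi> (t, x))))\<^sup>2 \<le> (sqrt M * C * \<bar>s - t\<bar>)\<^sup>2" .
    show "0 \<le> sqrt M * C * \<bar>s - t\<bar>" using C(1) by (simp add: M_def)
  qed
  show ?thesis
  proof (rule Lim_null[THEN iffD2], rule Lim_null_comparison)
    show "\<forall>\<^sub>F s in at t within S. norm (cls (\<lambda>x. \<psi> (s, x)) - cls (\<lambda>x. \<psi> (t, x))) \<le> sqrt M * C * \<bar>s - t\<bar>"
      using bound by (intro always_eventually) blast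
    have "((\<lambda>s. sqrt M * C * \<bar>s - t\<bar>) \<longlongrightarrow> sqrt M * C * \<bar>t - t\<bar>) (at t within S)"
      by (intro tendsto_intros)
    then show "((\<lambda>s. sqrt M * C * \<bar>s - t\<bar>) \<longlongrightarrow> 0) (at t within S)" by simp
  qed
qed

lemma L2_fast_lim:
  assumes f: "\<And>n. f n \<in> L2 M"
    and fast: "\<And>n. (LINT x|M. (f (Suc n) x - f n x)\<^sup>2) \<le> K * (1/16)^n"
  shows "AE x in M. (\<lambda>n. f n x) \<longlonglongrightarrow> lim (\<lambda>n. f n x)" "(\<lambda>x. lim (\<lambda>n. f n x)) \<in> L2 M"
    "(LINT x|M. (lim (\<lambda>n. f n x) - f n x)\<^sup>2) \<le> 4 * K * (1/16)^n"
proof -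
  have [measurable]: "f n \<in> borel_measurable M" for n using f by (rule L2D)
  show AE: "AE x in M. (\<lambda>n. f n x) \<longlonglongrightarrow> lim (\<lambda>n. f n x)"
    using L2_fast_AE_convergent[OF f fast] by eventually_elim (simp add: convergent_LIMSEQ_iff)
  have "(\<lambda>x. lim (\<lambda>n. f n x)) \<in> borel_measurable M" by measurable
  from L2_fast_limit[OF f fast this AE]
  show "(\<lambda>x. lim (\<lambda>n. f n x)) \<in> L2 M" "(LINT x|M. (lim (\<lambda>n. f n x) - f n x)\<^sup>2) \<le> 4 * K * (1/16)^n" .
qed

lemma cls_norm_diff_le:
  assumes "f \<in> L2 lborel" "g \<in> L2 lborel" "(LINT x|lborel. (g x - f x)\<^sup>2) \<le> 4 * K * (1/16)^n" "K \<ge> 0"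
  shows "norm (cls g - cls f) \<le> 2 * sqrt K * (1/4)^n"
proof (rule power2_le_imp_le)
  have "(norm (cls g - cls f))\<^sup>2 = (LINT x|lborel. (g x - f x)\<^sup>2)"
    using norm_cls[OF L2_diff[OF assms(2,1)]]
    by (simp add: cls_diff[OF assms(2,1)[THEN L2_lborel_lebesgue]])
  also have "\<dots> \<le> 4 * K * (1/16)^n" by (rule assms(3))
  also have "\<dots> = (2 * sqrt K * (1/4)^n)\<^sup>2"
    unfolding power_mult_distrib power2_quarter_pow using assms(4) by simp
  finally show "(norm (cls g - cls f))\<^sup>2 \<le> (2 * sqrt K * (1/4)^n)\<^sup>2" .
qed (use assms(4) in simp)

lemma geometric_bound_tendsto:
  fixes X :: "nat \<Rightarrow> 'a::real_normed_vector"
  assumes "\<And>n. norm (y - X n) \<le> C * (1/4)^n"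
  shows "X \<longlonglongrightarrow> y"
proof (rule Lim_null[THEN iffD2], rule Lim_null_comparison)
  show "\<forall>\<^sub>F n in sequentially. norm (X n - y) \<le> C * (1/4)^n"
    using assms by (auto simp: norm_minus_commute)
  show "(\<lambda>n. C * (1/4)^n :: real) \<longlonglongrightarrow> 0"
    by (intro tendsto_mult_right_zero LIMSEQ_power_zero) auto
qed

context parabolic
begin

lemma F_diff:
  assumes "\<psi> \<in> test_functions UNIV" "\<phi> \<in> test_functions UNIV"
  shows "F0 (\<lambda>p. \<psi> p - \<phi> p) = F0 \<psi> - F0 \<phi>" "F1 (\<lambda>p. \<psi> p - \<phi> p) = F1 \<psi> - F1 \<phi>"
    "cls (\<lambda>x. \<psi> (t, x) - \<phi> (t, x)) = cls (\<lambda>x. \<psi> (t, x)) - cls (\<lambda>x. \<phi> (t, x))"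
  using F_add[OF assms(1) test_cmult[OF assms(2), of "-1"]] F_cmult[OF assms(2), of "-1"] by simp_all

text \<open>The third datum is 0 because the source has no part in divergence form.\<close>

lemma approximate_solutions:
  obtains \<psi> \<zeta>0 \<zeta>1 where "\<And>n. \<psi> n \<in> test_functions UNIV" "\<And>n y. y \<in> X \<Longrightarrow> (\<zeta>0 n, \<zeta>1 n) \<bullet> y = 0"
    "\<And>n. norm ((f, G, 0) - (cls (\<lambda>x. \<psi> n (T, x)), F0 (\<psi> n) + \<zeta>0 n, F1 (\<psi> n) + \<zeta>1 n)) \<le> (1/4)^n"
proof -
  have "\<exists>\<psi> \<zeta>0 \<zeta>1. \<psi> \<in> test_functions UNIV \<and> (\<forall>y\<in>X. (\<zeta>0, \<zeta>1) \<bullet> y = 0) \<and>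
      norm ((f, G, 0) - (cls (\<lambda>x. \<psi> (T, x)), F0 \<psi> + \<zeta>0, F1 \<psi> + \<zeta>1)) \<le> (1/4)^n" for n
  proof -
    have "(f, G, 0) \<in> closure W" using W_dense by simp
    moreover have "(0::real) < (1/4)^n" by simp
    ultimately obtain s where s: "s \<in> W" "dist s (f, G, 0) < (1/4)^n"
      unfolding closure_approachable by blast
    then obtain \<psi> \<zeta>0 \<zeta>1 where "s = (cls (\<lambda>x. \<psi> (T, x)), F0 \<psi> + \<zeta>0, F1 \<psi> + \<zeta>1)"
      "\<psi> \<in> test_functions UNIV" "\<forall>y\<in>X. (\<zeta>0, \<zeta>1) \<bullet> y = 0"
      unfolding W_def by blast
    with s(2) show ?thesis
      by (intro exI[of _ \<psi>] exI[of _ \<zeta>0] exI[of _ \<zeta>1]) (simp only: dist_norm norm_minus_commute less_imp_le simp_thms)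
  qed
  then show thesis using that by metis
qed

text \<open>The energy estimate bounds differences of approximations uniformly in \<tau>, so the
  limit is controlled on every slice and not merely on almost every one. Continuity in time and the
  terminal condition depend on this.\<close>

lemma existence:
  fixes f :: "real l2" and G :: "(real \<times> real) l2"
  obtains u :: "real \<times> real \<Rightarrow> real" and z :: "(real \<times> real) l2"
  where "u \<in> borel_measurable borel"
    and "\<And>t. t \<in> {0..T} \<Longrightarrow> (\<lambda>x. u (t, x)) \<in> L2 lborel"
    and "\<And>t. t \<in> {0..T} \<Longrightarrow> ((\<lambda>s. norm (cls (\<lambda>x. u (s, x)) - cls (\<lambda>x. u (t, x)))) \<longlongrightarrow> 0) (at t within {0..T})"
    and "cls (\<lambda>x. u (T, x)) = f"
    and "(\<lambda>p. ind_strip T p * u p) \<in> L2 lborel"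
    and "(cls (\<lambda>p. ind_strip T p * u p), z) \<in> X"
    and "AE t in lborel. t \<in> {0<..<T} \<longrightarrow> (\<exists>y. wderiv 1 (cls (\<lambda>x. u (t, x))) y)"
    and "\<And>\<phi>. \<phi> \<in> test_functions (open_strip T) \<Longrightarrow>
      mul b (cls (\<lambda>p. ind_strip T p * u p)) \<bullet> cls (dd (1, 0) \<phi>) + 1/2 * (mul a z \<bullet> cls (dd (0, 1) \<phi>))
      - mul (\<lambda>p. b p * B p) z \<bullet> cls \<phi>
      + (lam * (mul b (cls (\<lambda>p. ind_strip T p * u p)) \<bullet> cls \<phi>) + mul bt (cls (\<lambda>p. ind_strip T p * u p)) \<bullet> cls \<phi>) = - (G \<bullet> cls \<phi>)"
proof -
  obtain C where C: "C > 0" and energy: "\<And>\<psi> \<zeta>0 \<zeta>1 \<tau>. \<psi> \<in> test_functions UNIV \<Longrightarrow> (\<And>y. y \<in> X \<Longrightarrow> (\<zeta>0, \<zeta>1) \<bullet> y = 0) \<Longrightarrow> \<tau> \<in> {0..T} \<Longrightarrow>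
      (LINT x|lborel. (\<psi> (\<tau>, x))\<^sup>2) + (norm (mul (ind_strip T) (cls \<psi>)))\<^sup>2 + (norm (mul (ind_strip T) (cls (dd (0, 1) \<psi>))))\<^sup>2
      \<le> C * (norm (cls (\<lambda>x. \<psi> (T, x)), F0 \<psi> + \<zeta>0, F1 \<psi> + \<zeta>1))\<^sup>2"
    using energy_estimate by blast
  obtain \<psi> \<zeta>0 \<zeta>1 where \<psi>: "\<And>n. \<psi> n \<in> test_functions UNIV" and \<zeta>: "\<And>n y. y \<in> X \<Longrightarrow> (\<zeta>0 n, \<zeta>1 n) \<bullet> y = 0"
    and close: "\<And>n. norm ((f, G, 0) - (cls (\<lambda>x. \<psi> n (T, x)), F0 (\<psi> n) + \<zeta>0 n, F1 (\<psi> n) + \<zeta>1 n)) \<le> (1/4)^n"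
    using approximate_solutions[of f G] by blast
  let ?d = "\<lambda>n. (cls (\<lambda>x. \<psi> n (T, x)), F0 (\<psi> n) + \<zeta>0 n, F1 (\<psi> n) + \<zeta>1 n)"
  have close3: "norm (f - cls (\<lambda>x. \<psi> n (T, x)), G - (F0 (\<psi> n) + \<zeta>0 n), 0 - (F1 (\<psi> n) + \<zeta>1 n)) \<le> 1 * (1/4)^n" for n
    using close[of n] by (simp only: diff_Pair mult_1)
  have closes: "norm (f - cls (\<lambda>x. \<psi> n (T, x))) \<le> 1 * (1/4)^n" "norm (G - (F0 (\<psi> n) + \<zeta>0 n)) \<le> 1 * (1/4)^n"
    "norm (0 - (F1 (\<psi> n) + \<zeta>1 n)) \<le> 1 * (1/4)^n" for n
    by (rule order_trans[OF norm_fst_le close3] order_trans[OF norm_fst_le order_trans[OF norm_snd_le close3]]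
      order_trans[OF norm_snd_le order_trans[OF norm_snd_le close3]])+
  \<comment> \<open>Consecutive data differ by at most 2 / 4^n in norm, and squaring produces the
    factor 4.\<close>
  define K where "K = C * 4"
  have K: "K > 0" using C by (simp add: K_def)
  have inc: "(LINT x|lborel. (\<psi> (Suc n) (\<tau>, x) - \<psi> n (\<tau>, x))\<^sup>2) +
      (norm (mul (ind_strip T) (cls (\<lambda>p. \<psi> (Suc n) p - \<psi> n p))))\<^sup>2 +
      (norm (mul (ind_strip T) (cls (dd (0, 1) (\<lambda>p. \<psi> (Suc n) p - \<psi> n p)))))\<^sup>2 \<le> K * (1/16)^n" if \<tau>: "\<tau> \<in> {0..T}" for n \<tau>
  proof -
    let ?\<psi> = "\<lambda>p. \<psi> (Suc n) p - \<psi> n p"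
    have \<psi>d: "?\<psi> \<in> test_functions UNIV" by (rule test_diff[OF \<psi> \<psi>])
    have eqd: "(cls (\<lambda>x. ?\<psi> (T, x)), F0 ?\<psi> + (\<zeta>0 (Suc n) - \<zeta>0 n), F1 ?\<psi> + (\<zeta>1 (Suc n) - \<zeta>1 n)) = ?d (Suc n) - ?d n"
      by (simp add: F_diff[OF \<psi> \<psi>])
    have "norm (?d (Suc n) - ?d n) \<le> norm ((f, G, 0) - ?d (Suc n)) + norm ((f, G, 0) - ?d n)"
      using norm_triangle_ineq4[of "(f, G, 0) - ?d n" "(f, G, 0) - ?d (Suc n)"] by (simp only: diff_diff_eq2 add_diff_cancel_left' diff_diff_add algebra_simps) simp
    also have "\<dots> \<le> (1/4)^Suc n + (1/4)^n" by (intro add_mono close)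
    also have "\<dots> \<le> 2 * (1/4)^n" by simp
    finally have "(norm (?d (Suc n) - ?d n))\<^sup>2 \<le> (2 * (1/4)^n)\<^sup>2" by (intro power_mono) auto
    also have "\<dots> = 4 * (1/16)^n" unfolding power_mult_distrib power2_quarter_pow by simp
    finally have "C * (norm (?d (Suc n) - ?d n))\<^sup>2 \<le> K * (1/16)^n"
      using C by (simp add: K_def)
    moreover have "(\<zeta>0 (Suc n) - \<zeta>0 n, \<zeta>1 (Suc n) - \<zeta>1 n) \<bullet> y = 0" if "y \<in> X" for y
      using \<zeta>[OF that, of n] \<zeta>[OF that, of "Suc n"] by (cases y) (simp add: inner_diff_left)
    ultimately show ?thesis
      using energy[OF \<psi>d _ \<tau>, of "\<zeta>0 (Suc n) - \<zeta>0 n" "\<zeta>1 (Suc n) - \<zeta>1 n"] unfolding eqd by (meson order_trans)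
  qed
  have T0: "T \<in> {0..T}" using T by simp
  have sl: "(\<lambda>x. \<psi> n (t, x)) \<in> L2 lborel" for n t by (rule slice_L2[OF \<psi>])
  have fast1: "(LINT x|lborel. (\<psi> (Suc n) (\<tau>, x) - \<psi> n (\<tau>, x))\<^sup>2) \<le> K * (1/16)^n" if "\<tau> \<in> {0..T}" for n \<tau>
    using inc[OF that, of n] by (smt (verit) zero_le_power2)
  have sq: "(norm (mul (ind_strip T) (cls f)))\<^sup>2 = (LINT p|lborel. (ind_strip T p * f p)\<^sup>2)" if "f \<in> L2 lborel" for f
    using norm_cls[OF bounded_borel_L2[OF bounded_borel_ind_strip that]] mul_cls[OF bounded_borel_ind_strip L2_lborel_lebesgue[OF that]] by simp
  define v where "v n p = ind_strip T p * \<psi> n p" for n p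
  define y where "y n p = ind_strip T p * dd (0, 1) (\<psi> n) p" for n p
  have vL: "v n \<in> L2 lborel" for n unfolding v_def by (intro bounded_borel_L2 bounded_borel_ind_strip test_L2[OF \<psi>])
  have yL: "y n \<in> L2 lborel" for n unfolding y_def by (intro bounded_borel_L2 bounded_borel_ind_strip test_L2[OF test_dd[OF \<psi>]])
  have fast2: "(LINT p|lborel. (v (Suc n) p - v n p)\<^sup>2) \<le> K * (1/16)^n" for n
  proof -
    have "(LINT p|lborel. (v (Suc n) p - v n p)\<^sup>2) = (norm (mul (ind_strip T) (cls (\<lambda>p. \<psi> (Suc n) p - \<psi> n p))))\<^sup>2"
      unfolding sq[OF test_L2[OF test_diff[OF \<psi> \<psi>]]] by (simp add: v_def right_diff_distrib)
    then show ?thesis using inc[OF T0, of n] by (smt (verit) zero_le_power2 integral_nonneg_AE AE_I2)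
  qed
  have fast3: "(LINT p|lborel. (y (Suc n) p - y n p)\<^sup>2) \<le> K * (1/16)^n" for n
  proof -
    have "(LINT p|lborel. (y (Suc n) p - y n p)\<^sup>2) = (norm (mul (ind_strip T) (cls (dd (0, 1) (\<lambda>p. \<psi> (Suc n) p - \<psi> n p)))))\<^sup>2"
      unfolding sq[OF test_L2[OF test_dd[OF test_diff[OF \<psi> \<psi>]]]]
      by (simp add: y_def right_diff_distrib dd_diff[OF test_smooth[OF \<psi>] test_smooth[OF \<psi>]])
    then show ?thesis using inc[OF T0, of n] by (smt (verit) zero_le_power2 integral_nonneg_AE AE_I2)
  qed
  \<comment> \<open>One pointwise limit serves the plane and all slices at once, so their
    representatives agree by construction; where the sequence diverges, \<open>lim\<close> is some
    fixed value.\<close>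
  define u where "u p = lim (\<lambda>n. \<psi> n p)" for p
  define Z where "Z p = lim (\<lambda>n. y n p)" for p
  have \<psi>m [measurable]: "\<psi> n \<in> borel_measurable borel" for n by (rule test_borel[OF \<psi>])
  have um [measurable]: "u \<in> borel_measurable borel" unfolding u_def by measurable
  note lim1 = L2_fast_lim[of "\<lambda>n x. \<psi> n (t, x)" lborel K for t, OF sl fast1, folded u_def]
  note lim2 = L2_fast_lim[OF vL fast2]
  note lim3 = L2_fast_lim[OF yL fast3, folded Z_def]
  have uL: "(\<lambda>x. u (t, x)) \<in> L2 lborel" if "t \<in> {0..T}" for t by (rule lim1(2)[OF that])
  have dist1: "norm (cls (\<lambda>x. u (t, x)) - cls (\<lambda>x. \<psi> n (t, x))) \<le> 2 * sqrt K * (1/4)^n" if "t \<in> {0..T}" for t n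
    using K by (intro cls_norm_diff_le sl uL that lim1(3)) auto
  have conv1: "(\<lambda>n. cls (\<lambda>x. \<psi> n (t, x))) \<longlonglongrightarrow> cls (\<lambda>x. u (t, x))" if "t \<in> {0..T}" for t
    by (rule geometric_bound_tendsto[OF dist1[OF that]])
  have iQu: "lim (\<lambda>n. v n p) = ind_strip T p * u p" if "(\<lambda>n. v n p) \<longlonglongrightarrow> lim (\<lambda>n. v n p)" for p
  proof (cases "p \<in> open_strip T")
    case True
    then show ?thesis by (simp add: v_def u_def)
  next
    case False
    then show ?thesis by (simp add: v_def)
  qed
  \<comment> \<open>True at every point, even where the sequence diverges: inside the strip both
    sides are the same \<open>lim\<close>, outside both are 0.\<close>
  have iQu': "(\<lambda>p. lim (\<lambda>n. v n p)) = (\<lambda>p. ind_strip T p * u p)"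
    by (rule ext) (auto simp: v_def u_def indicator_def)
  note lim2 = lim2[unfolded fun_cong[OF iQu']]
  have conv2: "(\<lambda>n. cls (v n)) \<longlonglongrightarrow> cls (\<lambda>p. ind_strip T p * u p)"
    using K by (intro geometric_bound_tendsto[OF cls_norm_diff_le[OF vL lim2(2,3)]]) auto
  have conv3: "(\<lambda>n. cls (y n)) \<longlonglongrightarrow> cls Z"
    using K by (intro geometric_bound_tendsto[OF cls_norm_diff_le[OF yL lim3(2,3)]]) auto
  have clsv: "cls (v n) = mul (ind_strip T) (cls (\<psi> n))" and clsy: "cls (y n) = mul (ind_strip T) (cls (dd (0, 1) (\<psi> n)))" for n
    unfolding v_def y_def
    by (simp_all add: mul_cls[OF bounded_borel_ind_strip test_L2'[OF \<psi>]] mul_cls[OF bounded_borel_ind_strip test_L2'[OF test_dd[OF \<psi>]]])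
  have inX: "(cls (v n), cls (y n)) \<in> X" for n
    unfolding clsv clsy
    by (rule mul_indicator_time[OF bounded_borel_ind_strip _ _ wderiv_test[OF \<psi>]])
      (auto simp: indicator_def open_strip_def)
  let ?u = "cls (\<lambda>p. ind_strip T p * u p)"
  have "(?u, cls Z) \<in> X"
  proof (rule closed_sequentially[OF closed_X])
    show "(\<lambda>n. (cls (v n), cls (y n))) \<longlonglongrightarrow> (?u, cls Z)" by (intro tendsto_Pair conv2 conv3)
  qed (rule inX)
  moreover have "((\<lambda>s. norm (cls (\<lambda>x. u (s, x)) - cls (\<lambda>x. u (t, x)))) \<longlongrightarrow> 0) (at t within {0..T})" if t: "t \<in> {0..T}" for t
  proof (rule tendstoI)
    fix e :: real assume e: "e > 0"
    have "(\<lambda>n. 2 * sqrt K * (1/4)^n :: real) \<longlonglongrightarrow> 0"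
      by (intro tendsto_mult_right_zero LIMSEQ_power_zero) auto
    then have "\<forall>\<^sub>F n in sequentially. 2 * sqrt K * (1/4)^n < e / 3"
      using e by (intro order_tendstoD) auto
    then obtain n where n: "2 * sqrt K * (1/4)^n < e / 3"
      unfolding eventually_sequentially by blast
    have "\<forall>\<^sub>F s in at t within {0..T}. s \<in> {0..T}" by (simp add: eventually_at_filter)
    moreover have "\<forall>\<^sub>F s in at t within {0..T}. dist (cls (\<lambda>x. \<psi> n (s, x))) (cls (\<lambda>x. \<psi> n (t, x))) < e / 3"
      using e by (intro tendstoD[OF test_slices_continuous[OF \<psi>]]) auto
    ultimately show "\<forall>\<^sub>F s in at t within {0..T}. dist (norm (cls (\<lambda>x. u (s, x)) - cls (\<lambda>x. u (t, x)))) 0 < e"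
    proof eventually_elim
      case (elim s)
      have "norm (cls (\<lambda>x. u (s, x)) - cls (\<lambda>x. u (t, x))) \<le>
          norm (cls (\<lambda>x. u (s, x)) - cls (\<lambda>x. \<psi> n (s, x))) + norm (cls (\<lambda>x. \<psi> n (s, x)) - cls (\<lambda>x. \<psi> n (t, x)))
          + norm (cls (\<lambda>x. u (t, x)) - cls (\<lambda>x. \<psi> n (t, x)))"
        using dist_triangle[of "cls (\<lambda>x. u (s, x))" "cls (\<lambda>x. u (t, x))" "cls (\<lambda>x. \<psi> n (s, x))"]
          dist_triangle[of "cls (\<lambda>x. \<psi> n (s, x))" "cls (\<lambda>x. u (t, x))" "cls (\<lambda>x. \<psi> n (t, x))"]
        unfolding dist_norm norm_minus_commute[of "cls (\<lambda>x. \<psi> n (t, x))"] by linarith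
      also have "\<dots> < e"
        using dist1[OF elim(1), of n] dist1[OF t, of n] n elim(2) unfolding dist_norm by linarith
      finally show ?case by simp
    qed
  qed
  moreover have "cls (\<lambda>x. u (T, x)) = f"
    by (rule LIMSEQ_unique[OF conv1[OF T0] geometric_bound_tendsto[OF closes(1)]])
  moreover have "AE t in lborel. t \<in> {0<..<T} \<longrightarrow> (\<exists>y. wderiv 1 (cls (\<lambda>x. u (t, x))) y)"
  proof -
    \<comment> \<open>Convergence of the x-derivatives in L^2 of the plane makes the squared slice
      distances converge in L^1 of time, hence almost everywhere along a subsequence; closedness of
      the graph then gives almost every slice a weak derivative.\<close>
    define h where "h n t = (LINT x|lborel. (Z (t, x) - y n (t, x))\<^sup>2)" for n t
    have ZL: "Z \<in> L2 lborel" by (rule lim3(2))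
    have sqi: "integrable lborel (\<lambda>p. (Z p - y n p)\<^sup>2)" for n by (intro L2D(2) L2_diff ZL yL)
    have hint: "integrable lborel (h n)" for n
      unfolding h_def using fubini_plane(3)[OF sqi] .
    have hle: "(LINT t|lborel. norm (h n t)) \<le> 4 * K * (1/16)^n" for n
      using lim3(3)[of n] fubini_plane(1)[OF sqi, of n] by (simp add: h_def)
    have "(\<lambda>n. LINT t|lborel. norm (h n t)) \<longlonglongrightarrow> 0"
    proof (rule Lim_null_comparison)
      show "\<forall>\<^sub>F n in sequentially. norm (LINT t|lborel. norm (h n t)) \<le> 4 * K * (1/16)^n"
        using hle by (intro always_eventually allI) (simp add: Bochner_Integration.integral_nonneg)
      show "(\<lambda>n. 4 * K * (1/16)^n :: real) \<longlonglongrightarrow> 0"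
        by (intro tendsto_mult_right_zero LIMSEQ_power_zero) auto
    qed
    then obtain r where r: "strict_mono r" "AE t in lborel. (\<lambda>n. h (r n) t) \<longlonglongrightarrow> 0"
      using tendsto_L1_AE_subseq[of lborel h] hint by blast
    have Zm [measurable]: "Z \<in> borel_measurable borel" using L2D(1)[OF ZL] by simp
    have "AE t in lborel. integrable lborel (\<lambda>x. (Z (t, x))\<^sup>2)"
      by (rule fubini_plane(4)[OF L2D(2)[OF ZL]])
    with r(2) show ?thesis
    proof eventually_elim
      case (elim t)
      show ?case
      proof
        assume t: "t \<in> {0<..<T}"
        then have yt: "y n (t, x) = dd (0, 1) (\<psi> n) (t, x)" for n x by (simp add: y_def open_strip_def)
        have ZtL: "(\<lambda>x. Z (t, x)) \<in> L2 lborel"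
          using elim(2) borel_slice(1)[OF Zm] by (intro L2I) auto
        have dL: "(\<lambda>x. dd (0, 1) (\<psi> n) (t, x)) \<in> L2 lborel" for n
          by (rule slice_L2[OF test_dd[OF \<psi>]])
        have "(norm (cls (\<lambda>x. Z (t, x)) - cls (\<lambda>x. dd (0, 1) (\<psi> n) (t, x))))\<^sup>2 = h n t" for n
          using norm_cls[OF L2_diff[OF ZtL dL[of n]]]
          by (simp add: h_def yt cls_diff[OF L2_lborel_lebesgue[OF ZtL] L2_lborel_lebesgue[OF dL]])
        then have "(\<lambda>n. sqrt ((norm (cls (\<lambda>x. Z (t, x)) - cls (\<lambda>x. dd (0, 1) (\<psi> (r n)) (t, x))))\<^sup>2)) \<longlonglongrightarrow> sqrt 0"
          using elim(1) by (intro tendsto_real_sqrt) simp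
        then have "(\<lambda>n. norm (cls (\<lambda>x. dd (0, 1) (\<psi> (r n)) (t, x)) - cls (\<lambda>x. Z (t, x)))) \<longlonglongrightarrow> 0"
          by (simp add: norm_minus_commute)
        then have c2: "(\<lambda>n. cls (\<lambda>x. dd (0, 1) (\<psi> (r n)) (t, x))) \<longlonglongrightarrow> cls (\<lambda>x. Z (t, x))"
          by (rule Lim_null[THEN iffD2, OF tendsto_norm_zero_cancel])
        have c1: "(\<lambda>n. cls (\<lambda>x. \<psi> (r n) (t, x))) \<longlonglongrightarrow> cls (\<lambda>x. u (t, x))"
          using LIMSEQ_subseq_LIMSEQ[OF conv1[of t] r(1)] t by (simp add: o_def)
        have "(cls (\<lambda>x. \<psi> (r n) (t, x)), cls (\<lambda>x. dd (0, 1) (\<psi> (r n)) (t, x))) \<in> {(w, y). wderiv 1 w y}" for n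
          using wderiv_test[OF test_slice_x(1)[OF \<psi>[of "r n"], of t], of 1] unfolding test_slice_x(2)[OF \<psi>] by simp
        then have "(cls (\<lambda>x. u (t, x)), cls (\<lambda>x. Z (t, x))) \<in> {(w, y). wderiv 1 w y}"
          by (rule closed_sequentially[OF closed_wderiv]) (rule tendsto_Pair[OF c1 c2])
        then show "\<exists>y. wderiv 1 (cls (\<lambda>x. u (t, x))) y" by blast
      qed
    qed
  qed
  moreover have "mul b ?u \<bullet> cls (dd (1, 0) \<phi>) + 1/2 * (mul a (cls Z) \<bullet> cls (dd (0, 1) \<phi>))
      - mul (\<lambda>p. b p * B p) (cls Z) \<bullet> cls \<phi>
      + (lam * (mul b ?u \<bullet> cls \<phi>) + mul bt ?u \<bullet> cls \<phi>) = - (G \<bullet> cls \<phi>)"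
    if \<phi>: "\<phi> \<in> test_functions (open_strip T)" for \<phi>
  proof -
    have "(\<lambda>n. - (mul bt (cls (v n)) \<bullet> cls \<phi>) - mul b (cls (v n)) \<bullet> cls (dd (1, 0) \<phi>)
    + mul (\<lambda>p. b p * B p) (cls (y n)) \<bullet> cls \<phi> - lam * (mul b (cls (v n)) \<bullet> cls \<phi>)
    - 1/2 * (mul a (cls (y n)) \<bullet> cls (dd (0, 1) \<phi>))) \<longlonglongrightarrow>
      - (mul bt ?u \<bullet> cls \<phi>) - mul b ?u \<bullet> cls (dd (1, 0) \<phi>)
    + mul (\<lambda>p. b p * B p) (cls Z) \<bullet> cls \<phi> - lam * (mul b ?u \<bullet> cls \<phi>)
    - 1/2 * (mul a (cls Z) \<bullet> cls (dd (0, 1) \<phi>))"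
      by (intro tendsto_intros bounded_linear.tendsto[OF bounded_linear_mul] bt b(1) bbB a(1) conv2 conv3)
    \<comment> \<open>The annihilators may be added because \<phi> and its x-derivative form a pair
      in \<open>X\<close>; convergence is known for the completed residuals.\<close>
    moreover have "- (mul bt (cls (v n)) \<bullet> cls \<phi>) - mul b (cls (v n)) \<bullet> cls (dd (1, 0) \<phi>)
    + mul (\<lambda>p. b p * B p) (cls (y n)) \<bullet> cls \<phi> - lam * (mul b (cls (v n)) \<bullet> cls \<phi>)
    - 1/2 * (mul a (cls (y n)) \<bullet> cls (dd (0, 1) \<phi>)) = (F0 (\<psi> n) + \<zeta>0 n) \<bullet> cls \<phi> + (F1 (\<psi> n) + \<zeta>1 n) \<bullet> cls (dd (0, 1) \<phi>)" for n
      using test_equation[OF \<psi>[of n] \<phi>] \<zeta>[OF test_class_in_X[OF \<phi>], of n] unfolding clsv clsy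
      by (simp add: inner_add_left)
    moreover have "(\<lambda>n. F0 (\<psi> n) + \<zeta>0 n) \<longlonglongrightarrow> G"
      by (rule geometric_bound_tendsto[OF closes(2)])
    moreover have "(\<lambda>n. F1 (\<psi> n) + \<zeta>1 n) \<longlonglongrightarrow> 0"
      by (rule geometric_bound_tendsto[OF closes(3)])
    ultimately have "- (mul bt ?u \<bullet> cls \<phi>) - mul b ?u \<bullet> cls (dd (1, 0) \<phi>)
      + mul (\<lambda>p. b p * B p) (cls Z) \<bullet> cls \<phi> - lam * (mul b ?u \<bullet> cls \<phi>)
      - 1/2 * (mul a (cls Z) \<bullet> cls (dd (0, 1) \<phi>)) = G \<bullet> cls \<phi> + 0 \<bullet> cls (dd (0, 1) \<phi>)"
      by (intro LIMSEQ_unique[OF _ tendsto_add[OF tendsto_inner[OF _ tendsto_const] tendsto_inner[OF _ tendsto_const]]]) auto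
    then show ?thesis by simp
  qed
  ultimately show thesis using that[of u "cls Z"] um uL lim2(2) by blast
qed

end

section \<open>Functions on the strip and distributional derivatives\<close>

lemma AE_strip: "AE p in lebesgue. indicator (strip T) p = ind_strip T p"
proof (rule AE_completion)
  show "AE p in lborel. indicator (strip T) p = ind_strip T p"
    using AE_fst_neq[of 0] AE_fst_neq[of T]
    by eventually_elim (auto simp: strip_def open_strip_def indicator_def)
qed

lemma strip_lebesgue: "strip T \<inter> space lebesgue \<in> sets lebesgue"
  using strip_borel by (simp add: sets_completionI_sets)

lemma integral_lebesgue_cong_AE:
  fixes f g :: "'a::euclidean_space \<Rightarrow> real"
  assumes "f \<in> borel_measurable lebesgue" "AE x in lebesgue. f x = g x"
  shows "(LINT x|lebesgue. f x) = (LINT x|lebesgue. g x)"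
  using assms borel_measurable_AE[OF assms] by (intro integral_cong_AE)

lemma L2_lebesgue_cong_AE:
  fixes f g :: "'a::euclidean_space \<Rightarrow> real"
  assumes "f \<in> L2 lebesgue" "AE x in lebesgue. f x = g x"
  shows "g \<in> L2 lebesgue"
  by (rule L2_cong_AE[OF assms(1) borel_measurable_AE[OF L2D(1)[OF assms(1)] assms(2)] assms(2)])

lemma L2_strip_iff: "h \<in> L2 (lebesgue_on (strip T)) \<longleftrightarrow> (\<lambda>p. ind_strip T p * h p) \<in> L2 lebesgue"
proof -
  have "h \<in> L2 (lebesgue_on (strip T)) \<longleftrightarrow> (\<lambda>p. indicator (strip T) p * h p) \<in> L2 lebesgue"
    unfolding L2_def using integrable_restrict_space[OF strip_lebesgue, of T "\<lambda>p. (h p)\<^sup>2"]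
    by (simp add: borel_measurable_restrict_space_iff[OF strip_lebesgue] power_mult_distrib power2_eq_square[of "indicator _ _"]
        indicator_inter_arith[symmetric])
  also have "\<dots> \<longleftrightarrow> (\<lambda>p. ind_strip T p * h p) \<in> L2 lebesgue"
  proof -
    have "AE p in lebesgue. indicator (strip T) p * h p = ind_strip T p * h p"
      using AE_strip[of T] by eventually_elim simp
    moreover from this have "AE p in lebesgue. ind_strip T p * h p = indicator (strip T) p * h p"
      by eventually_elim (rule sym)
    ultimately show ?thesis by (intro iffI) (erule (1) L2_lebesgue_cong_AE)+
  qed
  finally show ?thesis .
qed

text \<open>The bridge from functions on the closed strip to classes on the plane. The open strip
  appears because test functions live there; the difference is a null set.\<close>

definition strip_class :: "real \<Rightarrow> (real \<times> real \<Rightarrow> real) \<Rightarrow> (real \<times> real) l2" where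
  "strip_class T h = cls (\<lambda>p. ind_strip T p * h p)"

lemma strip_class_diff:
  assumes "h \<in> L2 (lebesgue_on (strip T))" "k \<in> L2 (lebesgue_on (strip T))"
  shows "strip_class T (\<lambda>p. h p - k p) = strip_class T h - strip_class T k"
  using assms cls_diff[of "\<lambda>p. ind_strip T p * h p" "\<lambda>p. ind_strip T p * k p"]
  unfolding L2_strip_iff strip_class_def by (simp add: right_diff_distrib)

lemma strip_class_supported: "h \<in> L2 (lebesgue_on (strip T)) \<Longrightarrow> mul (ind_strip T) (strip_class T h) = strip_class T h"
  unfolding L2_strip_iff strip_class_def
  by (simp add: mul_cls[OF bounded_borel_ind_strip] mult.assoc[symmetric] indicator_inter_arith[symmetric])

lemma strip_class_cong:
  assumes "h \<in> L2 (lebesgue_on (strip T))" "AE p in lebesgue. p \<in> open_strip T \<longrightarrow> h p = k p"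
  shows "k \<in> L2 (lebesgue_on (strip T))" "strip_class T h = strip_class T k"
proof -
  have AE: "AE p in lebesgue. ind_strip T p * h p = ind_strip T p * k p"
    using assms(2) by eventually_elim (auto simp: indicator_def)
  from assms(1) have h: "(\<lambda>p. ind_strip T p * h p) \<in> L2 lebesgue" by (simp add: L2_strip_iff)
  from L2_lebesgue_cong_AE[OF h AE] show k: "k \<in> L2 (lebesgue_on (strip T))" by (simp add: L2_strip_iff)
  show "strip_class T h = strip_class T k"
    unfolding strip_class_def using h k AE by (intro cls_eqI) (auto simp: L2_strip_iff AE_completion_iff)
qed

lemma strip_class_test: "\<psi> \<in> test_functions (open_strip T) \<Longrightarrow> strip_class T \<psi> = cls \<psi>"
proof -
  assume \<psi>: "\<psi> \<in> test_functions (open_strip T)"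
  obtain K where K: "K \<subseteq> open_strip T" "\<And>p. p \<notin> K \<Longrightarrow> \<psi> p = 0" using \<psi> by (rule test_functionsE) blast
  have "ind_strip T p * \<psi> p = \<psi> p" for p using K(1) K(2)[of p] by (cases "p \<in> open_strip T") auto
  then have "(\<lambda>p. ind_strip T p * \<psi> p) = \<psi>" by blast
  then show ?thesis by (simp add: strip_class_def)
qed

lemma test_L2_strip: "\<psi> \<in> test_functions \<Omega> \<Longrightarrow> \<psi> \<in> L2 (lebesgue_on (strip T))"
  unfolding L2_strip_iff by (intro bounded_borel_L2' bounded_borel_ind_strip test_L2')

text \<open>Every integral of the weak formulation passes through this identity, which replaces the
  given coefficient by a bounded Borel function agreeing with it almost everywhere on the open
  strip.\<close>

lemma strip_integral:
  assumes c: "bounded_borel c" and h: "h \<in> L2 (lebesgue_on (strip T))" and k: "k \<in> L2 (lebesgue_on (strip T))"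
    and F: "AE p in lebesgue. p \<in> open_strip T \<longrightarrow> F p = c p * h p * k p"
  shows "(LINT p|lebesgue_on (strip T). F p) = mul c (strip_class T h) \<bullet> strip_class T k"
proof -
  note L = h[unfolded L2_strip_iff] k[unfolded L2_strip_iff]
  have "mul c (strip_class T h) \<bullet> strip_class T k = (LINT p|lebesgue. (c p * (ind_strip T p * h p)) * (ind_strip T p * k p))"
    unfolding strip_class_def mul_cls[OF c L(1)] by (rule cls_inner[OF bounded_borel_L2'[OF c L(1)] L(2)])
  also have "\<dots> = (LINT p|lebesgue. indicator (strip T) p *\<^sub>R F p)"
  proof (rule integral_lebesgue_cong_AE)
    show "(\<lambda>p. (c p * (ind_strip T p * h p)) * (ind_strip T p * k p)) \<in> borel_measurable lebesgue"
      by (intro borel_measurable_integrable L2_mult_integrable bounded_borel_L2' c L)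
    show "AE p in lebesgue. (c p * (ind_strip T p * h p)) * (ind_strip T p * k p) = indicator (strip T) p *\<^sub>R F p"
      using AE_strip[of T] F by eventually_elim (auto simp: indicator_def)
  qed
  also have "\<dots> = (LINT p|lebesgue_on (strip T). F p)"
    by (rule integral_restrict_space[OF strip_lebesgue, symmetric])
  finally show ?thesis by simp
qed

lemma L2_norm_strip: "h \<in> L2 (lebesgue_on (strip T)) \<Longrightarrow> L2_norm (lebesgue_on (strip T)) h = norm (strip_class T h)"
  using strip_integral[OF bounded_borel_const[of 1], of h T h "\<lambda>p. (h p)\<^sup>2"]
  by (simp add: L2_norm_def norm_eq_sqrt_inner mul_const power2_eq_square)

section \<open>Distributional derivatives on the strip\<close>

lemma locally_integrable_diff:
  "locally_integrable \<Omega> f \<Longrightarrow> locally_integrable \<Omega> g \<Longrightarrow> locally_integrable \<Omega> (\<lambda>x. f x - g x)"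
  unfolding locally_integrable_def by (auto intro: set_integral_diff)

lemma locally_integrable_test_integrable:
  assumes "locally_integrable \<Omega> f" "\<psi> \<in> test_functions \<Omega>"
  shows "set_integrable lebesgue \<Omega> (\<lambda>x. f x * \<psi> x)"
proof -
  obtain K where K: "compact K" "K \<subseteq> \<Omega>" "\<And>x. x \<notin> K \<Longrightarrow> \<psi> x = 0" using assms(2) by (rule test_functionsE) blast
  obtain C where C: "\<And>x. \<bar>\<psi> x\<bar> \<le> C" using test_bounded[OF assms(2)] by metis
  have int: "integrable lebesgue (\<lambda>x. indicator K x *\<^sub>R f x)"
    using assms(1) K unfolding locally_integrable_def set_integrable_def by blast
  have "integrable lebesgue (\<lambda>x. (indicator K x *\<^sub>R f x) * \<psi> x)"
  proof (rule Bochner_Integration.integrable_bound)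
    show "integrable lebesgue (\<lambda>x. C * (indicator K x *\<^sub>R f x))" using int by (rule Bochner_Integration.integrable_mult_right)
    show "(\<lambda>x. (indicator K x *\<^sub>R f x) * \<psi> x) \<in> borel_measurable lebesgue"
      using borel_measurable_integrable[OF int] L2D(1)[OF test_L2'[OF assms(2)]] by (rule borel_measurable_times)
    show "AE x in lebesgue. norm ((indicator K x *\<^sub>R f x) * \<psi> x) \<le> norm (C * (indicator K x *\<^sub>R f x))"
    proof (rule AE_I2)
      fix x
      have "\<bar>\<psi> x\<bar> \<le> \<bar>C\<bar>" using C[of x] by linarith
      then show "norm ((indicator K x *\<^sub>R f x) * \<psi> x) \<le> norm (C * (indicator K x *\<^sub>R f x))"
        by (simp add: abs_mult mult.commute mult_right_mono)
    qed
  qed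
  moreover have "(\<lambda>x. (indicator K x *\<^sub>R f x) * \<psi> x) = (\<lambda>x. indicator \<Omega> x *\<^sub>R (f x * \<psi> x))"
  proof
    fix x show "(indicator K x *\<^sub>R f x) * \<psi> x = indicator \<Omega> x *\<^sub>R (f x * \<psi> x)"
      using K(2) K(3)[of x] by (cases "x \<in> K") auto
  qed
  ultimately show ?thesis unfolding set_integrable_def by simp
qed

lemma distr_deriv_unique:
  assumes "open \<Omega>" "has_distr_deriv \<Omega> e f h" "has_distr_deriv \<Omega> e f k"
  shows "AE x in lebesgue. x \<in> \<Omega> \<longrightarrow> h x = k x"
proof -
  have li: "locally_integrable \<Omega> h" "locally_integrable \<Omega> k" using assms(2,3) by (auto simp: has_distr_deriv_def)
  have "AE x in lebesgue. x \<in> \<Omega> \<longrightarrow> h x - k x = 0"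
  proof (rule fundamental_lemma_variations[OF assms(1) locally_integrable_diff[OF li]])
    fix \<psi> assume \<psi>: "\<psi> \<in> test_functions \<Omega>"
    have "(LINT x:\<Omega>|lebesgue. (h x - k x) * \<psi> x) = (LINT x:\<Omega>|lebesgue. h x * \<psi> x) - (LINT x:\<Omega>|lebesgue. k x * \<psi> x)"
      unfolding left_diff_distrib by (intro set_integral_diff locally_integrable_test_integrable li \<psi>)
    also have "\<dots> = 0" using assms(2,3) \<psi> by (auto simp: has_distr_deriv_def)
    finally show "(LINT x:\<Omega>|lebesgue. (h x - k x) * \<psi> x) = 0" .
  qed
  then show ?thesis by simp
qed

lemma strip_locally_integrable:
  assumes "h \<in> L2 (lebesgue_on (strip T))" shows "locally_integrable (open_strip T) h"
  unfolding locally_integrable_def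
proof (intro allI impI)
  fix K assume K: "compact K \<and> K \<subseteq> open_strip T"
  then have "set_integrable lebesgue K (\<lambda>p. ind_strip T p * h p)"
    using L2_imp_locally_integrable[OF assms[unfolded L2_strip_iff], of UNIV] unfolding locally_integrable_def by auto
  moreover have "indicator K p *\<^sub>R (ind_strip T p * h p) = indicator K p *\<^sub>R h p" for p
    using K by (cases "p \<in> K") auto
  then have "(\<lambda>p. indicator K p *\<^sub>R (ind_strip T p * h p)) = (\<lambda>p. indicator K p *\<^sub>R h p)" by blast
  ultimately show "set_integrable lebesgue K h" unfolding set_integrable_def by simp
qed

lemma strip_distr_deriv_iff:
  assumes f: "f \<in> L2 (lebesgue_on (strip T))" and h: "h \<in> L2 (lebesgue_on (strip T))"
  shows "has_distr_deriv (open_strip T) e f h \<longleftrightarrow>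
    (\<forall>\<psi>\<in>test_functions (open_strip T). strip_class T f \<bullet> cls (dd e \<psi>) = - (strip_class T h \<bullet> cls \<psi>))"
proof -
  have int: "(LINT p:open_strip T|lebesgue. k p * \<phi> p) = strip_class T k \<bullet> cls \<phi>"
    if "k \<in> L2 (lebesgue_on (strip T))" "\<phi> \<in> test_functions UNIV" for k \<phi>
    using cls_inner[OF that(1)[unfolded L2_strip_iff] test_L2'[OF that(2)]]
    by (simp add: strip_class_def set_lebesgue_integral_def mult.assoc)
  show ?thesis
    unfolding has_distr_deriv_def dd_def[symmetric]
    using strip_locally_integrable[OF f] strip_locally_integrable[OF h]
      int[OF f test_UNIV[OF test_dd]] int[OF h test_UNIV] by (auto cong: ball_cong)
qed

text \<open>Two distributional derivatives agree almost everywhere on the open strip, so the chosen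
  one inherits square integrability and class from any witness.\<close>

lemma chosen_distr_deriv:
  assumes "has_distr_deriv (open_strip T) e f h" "h \<in> L2 (lebesgue_on (strip T))"
    and d: "d = (SOME h. has_distr_deriv (open_strip T) e f h)"
  shows "has_distr_deriv (open_strip T) e f d" "d \<in> L2 (lebesgue_on (strip T))" "strip_class T d = strip_class T h"
proof -
  show 1: "has_distr_deriv (open_strip T) e f d" using someI[of "has_distr_deriv (open_strip T) e f", OF assms(1)] by (simp add: d)
  have "AE p in lebesgue. p \<in> open_strip T \<longrightarrow> h p = d p"
    by (rule distr_deriv_unique[OF open_open_strip assms(1) 1])
  from strip_class_cong[OF assms(2) this] show "d \<in> L2 (lebesgue_on (strip T))" "strip_class T d = strip_class T h" by auto
qed

lemma test_distr_deriv:
  assumes "\<psi> \<in> test_functions (open_strip T)"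
  shows "has_distr_deriv (open_strip T) e \<psi> (dd e \<psi>)"
  unfolding strip_distr_deriv_iff[OF test_L2_strip[OF assms] test_L2_strip[OF test_dd[OF assms]]]
    strip_class_test[OF assms] strip_class_test[OF test_dd[OF assms]]
  using wderivD[OF wderiv_test[OF assms]] by blast

text \<open>A time cut-off commutes with the x-derivative, so an equation involving x-derivatives
  alone extends to tests that do not vanish near the time boundary.\<close>

lemma extend_wderiv_equation:
  fixes \<sigma> \<kappa> :: real and v z :: "(real \<times> real) l2"
  assumes v: "AE p in lborel. \<kappa> \<le> \<sigma> * fst p \<longrightarrow> fn v p = 0" and z: "AE p in lborel. \<kappa> \<le> \<sigma> * fst p \<longrightarrow> fn z p = 0"
    and eq: "\<And>\<psi>. \<psi> \<in> test_functions (\<Omega> \<inter> {p. \<sigma> * fst p < \<kappa>}) \<Longrightarrow> v \<bullet> cls (dd (0, 1) \<psi>) = - (z \<bullet> cls \<psi>)"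
    and \<psi>: "\<psi> \<in> test_functions \<Omega>"
  shows "v \<bullet> cls (dd (0, 1) \<psi>) = - (z \<bullet> cls \<psi>)"
proof (rule LIMSEQ_unique)
  let ?c = "time_cut \<sigma> \<kappa>"
  note bb = bounded_borel_time_cut[of \<sigma> \<kappa>]
  show "(\<lambda>n. mul (?c n) v \<bullet> cls (dd (0, 1) \<psi>)) \<longlonglongrightarrow> v \<bullet> cls (dd (0, 1) \<psi>)"
    by (intro tendsto_intros mul_time_cut_tendsto v)
  have "mul (?c n) v \<bullet> cls (dd (0, 1) \<psi>) = - (mul (?c n) z \<bullet> cls \<psi>)" for n
    using eq[OF time_cut_test[OF \<psi>, of \<sigma> \<kappa> n]] unfolding dd_x_time_cut[OF test_smooth[OF \<psi>]]
    by (simp add: inner_mul_swap[OF bb] mul_cls[OF bb test_L2'[OF \<psi>]] mul_cls[OF bb test_L2'[OF test_dd[OF \<psi>]]])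
  then show "(\<lambda>n. mul (?c n) v \<bullet> cls (dd (0, 1) \<psi>)) \<longlonglongrightarrow> - (z \<bullet> cls \<psi>)"
    by (simp only:) (intro tendsto_intros mul_time_cut_tendsto z)
qed

lemma strip_wderiv:
  assumes f: "f \<in> L2 (lebesgue_on (strip T))" and h: "h \<in> L2 (lebesgue_on (strip T))"
    and d: "has_distr_deriv (open_strip T) (0, 1) f h"
  shows "wderiv (0, 1) (strip_class T f) (strip_class T h)"
  unfolding wderiv_def
proof
  have zero: "AE p in lborel. p \<notin> open_strip T \<longrightarrow> fn (strip_class T k) p = 0" if "k \<in> L2 (lebesgue_on (strip T))" for k
    using strip_class_supported[OF that] by (simp add: supported_iff)
  have zero1: "AE p in lborel. T \<le> 1 * fst p \<longrightarrow> fn (strip_class T k) p = 0" and zero2: "AE p in lborel. 0 \<le> (-1) * fst p \<longrightarrow> fn (strip_class T k) p = 0"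
    if "k \<in> L2 (lebesgue_on (strip T))" for k
    using zero[OF that] by (eventually_elim, auto simp: open_strip_def)+
  \<comment> \<open>The two ends of the strip are released one after the other, first t = 0 and then
    t = T.\<close>
  have os: "(UNIV \<inter> {p. 1 * fst p < T}) \<inter> {p. (-1) * fst p < 0} = open_strip T"
    by (auto simp: open_strip_def)
  have 1: "strip_class T f \<bullet> cls (dd (0, 1) \<psi>) = - (strip_class T h \<bullet> cls \<psi>)" if \<psi>: "\<psi> \<in> test_functions (UNIV \<inter> {p. 1 * fst p < T})" for \<psi>
    by (rule extend_wderiv_equation[OF zero2[OF f] zero2[OF h] _ \<psi>])
      (use d in \<open>simp add: os[simplified] strip_distr_deriv_iff[OF f h]\<close>)
  show "strip_class T f \<bullet> cls (dd (0, 1) \<psi>) = - (strip_class T h \<bullet> cls \<psi>)" if \<psi>: "\<psi> \<in> test_functions UNIV" for \<psi>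
    by (rule extend_wderiv_equation[OF zero1[OF f] zero1[OF h] 1 \<psi>])
qed

lemma L2_norm_lebesgue: "h \<in> L2 lebesgue \<Longrightarrow> L2_norm lebesgue h = norm (cls h)"
  using cls_inner[of h h] by (simp add: L2_norm_def norm_eq_sqrt_inner power2_eq_square)

lemma wderiv_imp_H1_real:
  assumes w: "w \<in> L2 lborel" and d: "wderiv 1 (cls w) y"
  shows "w \<in> H1_real"
proof -
  have "has_distr_deriv UNIV 1 w (fn y)"
    unfolding has_distr_deriv_def dd_def[symmetric]
  proof (intro conjI ballI)
    show "locally_integrable UNIV w" "locally_integrable UNIV (fn y)"
      by (intro L2_imp_locally_integrable L2_lborel_lebesgue w fn_L2)+
    fix \<psi> :: "real \<Rightarrow> real" assume \<psi>: "\<psi> \<in> test_functions UNIV"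
    show "(LINT x:UNIV|lebesgue. w x * dd 1 \<psi> x) = - (LINT x:UNIV|lebesgue. fn y x * \<psi> x)"
      using wderivD[OF d \<psi>] cls_inner[OF L2_lborel_lebesgue[OF w] test_L2'[OF test_dd[OF \<psi>, of 1]]] inner_cls[OF test_L2'[OF \<psi>], of y]
      by (simp add: set_lebesgue_integral_def)
  qed
  then show ?thesis
    unfolding H1_real_def using L2_lborel_lebesgue[OF w] L2_lborel_lebesgue[OF fn_L2] by blast
qed

section \<open>Test functions and the Sobolev spaces of the strip\<close>

lemma test_in_H11:
  assumes \<psi>: "\<psi> \<in> test_functions (open_strip T)"
  shows "\<psi> \<in> H11 T"
proof -
  have "(\<lambda>x. \<psi> (t, x)) \<in> H1_real" for t
    using test_slice_x(1)[OF \<psi>, of t] by (intro wderiv_imp_H1_real[OF test_L2 wderiv_test])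
  then show ?thesis
    unfolding H11_def L2_H1_def
    using test_distr_deriv[OF \<psi>] test_L2_strip[OF \<psi>] test_L2_strip[OF test_dd[OF \<psi>]] by blast
qed

lemma H11_derivatives:
  assumes "\<phi> \<in> H11 T"
  shows "\<phi> \<in> L2 (lebesgue_on (strip T))"
    "has_distr_deriv (open_strip T) (0, 1) \<phi> (distr_dx T \<phi>)" "distr_dx T \<phi> \<in> L2 (lebesgue_on (strip T))"
    "has_distr_deriv (open_strip T) (1, 0) \<phi> (distr_dt T \<phi>)" "distr_dt T \<phi> \<in> L2 (lebesgue_on (strip T))"
  using assms chosen_distr_deriv[OF _ _ distr_dx_def] chosen_distr_deriv[OF _ _ distr_dt_def]
  unfolding H11_def L2_H1_def by blast+

lemma test_distr_classes:
  assumes "\<psi> \<in> test_functions (open_strip T)"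
  shows "strip_class T (distr_dx T \<psi>) = cls (dd (0, 1) \<psi>)" "strip_class T (distr_dt T \<psi>) = cls (dd (1, 0) \<psi>)"
  using chosen_distr_deriv(3)[OF test_distr_deriv[OF assms] test_L2_strip[OF test_dd[OF assms]] distr_dx_def]
    chosen_distr_deriv(3)[OF test_distr_deriv[OF assms] test_L2_strip[OF test_dd[OF assms]] distr_dt_def]
  by (simp_all add: strip_class_test[OF test_dd[OF assms]])

lemma distr_deriv_diff:
  assumes f: "f \<in> L2 (lebesgue_on (strip T))" "h \<in> L2 (lebesgue_on (strip T))" "has_distr_deriv (open_strip T) e f h"
    and g: "g \<in> L2 (lebesgue_on (strip T))" "k \<in> L2 (lebesgue_on (strip T))" "has_distr_deriv (open_strip T) e g k"
  shows "has_distr_deriv (open_strip T) e (\<lambda>p. f p - g p) (\<lambda>p. h p - k p)"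
  using f(3) g(3)
  unfolding strip_distr_deriv_iff[OF f(1,2)] strip_distr_deriv_iff[OF g(1,2)]
    strip_distr_deriv_iff[OF L2_diff[OF f(1) g(1)] L2_diff[OF f(2) g(2)]] strip_class_diff[OF f(1) g(1)] strip_class_diff[OF f(2) g(2)]
  by (simp add: inner_diff_left)

lemma strip_class_distr_diff:
  assumes f: "f \<in> L2 (lebesgue_on (strip T))" "h \<in> L2 (lebesgue_on (strip T))" "has_distr_deriv (open_strip T) e f h"
    and g: "g \<in> L2 (lebesgue_on (strip T))" "k \<in> L2 (lebesgue_on (strip T))" "has_distr_deriv (open_strip T) e g k"
    and d: "d = (SOME h. has_distr_deriv (open_strip T) e (\<lambda>p. f p - g p) h)"
  shows "d \<in> L2 (lebesgue_on (strip T))" "strip_class T d = strip_class T h - strip_class T k"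
  using chosen_distr_deriv(2,3)[OF distr_deriv_diff[OF f g] L2_diff[OF f(2) g(2)] d] strip_class_diff[OF f(2) g(2)] by auto

text \<open>\<open>H11_norm\<close> contains chosen derivatives of the difference; their classes are
  differences of classes, so smallness of the norm splits into three limits.\<close>

lemma H11_0_approximation:
  assumes \<phi>: "\<phi> \<in> H11_0 T"
  obtains \<psi> where "\<And>n. \<psi> n \<in> test_functions (open_strip T)"
    "(\<lambda>n. cls (\<psi> n)) \<longlonglongrightarrow> strip_class T \<phi>" "(\<lambda>n. cls (dd (0, 1) (\<psi> n))) \<longlonglongrightarrow> strip_class T (distr_dx T \<phi>)"
    "(\<lambda>n. cls (dd (1, 0) (\<psi> n))) \<longlonglongrightarrow> strip_class T (distr_dt T \<phi>)"
proof -
  have "\<exists>\<psi>\<in>test_functions (open_strip T). H11_norm T (\<lambda>p. \<phi> p - \<psi> p) < (1/4)^n" for n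
    using \<phi> unfolding H11_0_def by auto
  then obtain \<psi> where \<psi>: "\<And>n. \<psi> n \<in> test_functions (open_strip T)" "\<And>n. H11_norm T (\<lambda>p. \<phi> p - \<psi> n p) < (1/4)^n"
    by metis
  have H: "\<phi> \<in> H11 T" using \<phi> by (simp add: H11_0_def)
  note D = H11_derivatives[OF H] and D' = H11_derivatives[OF test_in_H11[OF \<psi>(1)]]
  have bounds: "norm (strip_class T \<phi> - cls (\<psi> n)) \<le> 1 * (1/4)^n" "norm (strip_class T (distr_dx T \<phi>) - cls (dd (0, 1) (\<psi> n))) \<le> 1 * (1/4)^n"
    "norm (strip_class T (distr_dt T \<phi>) - cls (dd (1, 0) (\<psi> n))) \<le> 1 * (1/4)^n" for n
  proof -
    let ?d = "\<lambda>p. \<phi> p - \<psi> n p"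
    note dx = strip_class_distr_diff[OF D(1,3,2) D'(1,3,2)[of n] distr_dx_def]
      and dt = strip_class_distr_diff[OF D(1,5,4) D'(1,5,4)[of n] distr_dt_def]
    have 0: "strip_class T ?d = strip_class T \<phi> - cls (\<psi> n)"
      using strip_class_diff[OF D(1) D'(1)[of n]] by (simp add: strip_class_test[OF \<psi>(1)])
    have 1: "strip_class T (distr_dx T ?d) = strip_class T (distr_dx T \<phi>) - cls (dd (0, 1) (\<psi> n))"
      using dx(2) by (simp add: test_distr_classes[OF \<psi>(1)])
    have 2: "strip_class T (distr_dt T ?d) = strip_class T (distr_dt T \<phi>) - cls (dd (1, 0) (\<psi> n))"
      using dt(2) by (simp add: test_distr_classes[OF \<psi>(1)])
    have n: "H11_norm T ?d = sqrt ((norm (strip_class T \<phi> - cls (\<psi> n)))\<^sup>2 + (norm (strip_class T (distr_dx T \<phi>) - cls (dd (0, 1) (\<psi> n))))\<^sup>2 +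
        (norm (strip_class T (distr_dt T \<phi>) - cls (dd (1, 0) (\<psi> n))))\<^sup>2)"
      unfolding H11_norm_def L2_norm_strip[OF L2_diff[OF D(1) D'(1)]] L2_norm_strip[OF dx(1)] L2_norm_strip[OF dt(1)] 0 1 2 ..
    have le: "x \<le> sqrt (x\<^sup>2 + y\<^sup>2 + w\<^sup>2)" "y \<le> sqrt (x\<^sup>2 + y\<^sup>2 + w\<^sup>2)" "w \<le> sqrt (x\<^sup>2 + y\<^sup>2 + w\<^sup>2)" for x y w :: real
      by (intro real_le_rsqrt; simp)+
    show "norm (strip_class T \<phi> - cls (\<psi> n)) \<le> 1 * (1/4)^n" "norm (strip_class T (distr_dx T \<phi>) - cls (dd (0, 1) (\<psi> n))) \<le> 1 * (1/4)^n"
    "norm (strip_class T (distr_dt T \<phi>) - cls (dd (1, 0) (\<psi> n))) \<le> 1 * (1/4)^n"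
      unfolding mult_1 by (rule order_trans[OF le(1) less_imp_le[OF \<psi>(2)[of n, unfolded n]]]
        order_trans[OF le(2) less_imp_le[OF \<psi>(2)[of n, unfolded n]]] order_trans[OF le(3) less_imp_le[OF \<psi>(2)[of n, unfolded n]]])+
  qed
  show thesis
    by (rule that[OF \<psi>(1)]) (rule geometric_bound_tendsto bounds)+
qed

section \<open>The parabolic problem\<close>

lemma clamp_lipschitz: "\<bar>max 0 (min T (t + s)) - max 0 (min T t)\<bar> \<le> \<bar>s\<bar>" for T :: real
  by (auto simp: max_def min_def)

text \<open>Truncation to [l, h] makes the bounds hold at every point, including those where the
  Borel version differs from \<open>c\<close>.\<close>

lemma bounded_borel_representative:
  fixes c :: "real \<times> real \<Rightarrow> real"
  assumes "c \<in> borel_measurable (lebesgue_on (strip T))" "\<And>p. p \<in> strip T \<Longrightarrow> l \<le> c p \<and> c p \<le> h" "l \<le> h"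
  obtains d where "bounded_borel d" "\<And>p. l \<le> d p" "AE p in lebesgue. p \<in> open_strip T \<longrightarrow> c p = d p"
proof -
  have "(\<lambda>p. indicator (strip T) p *\<^sub>R c p) \<in> borel_measurable lebesgue"
    using assms(1) borel_measurable_restrict_space_iff[OF strip_lebesgue] by blast
  then obtain c0 where c0: "c0 \<in> borel_measurable lborel" "AE p in lborel. indicator (strip T) p *\<^sub>R c p = c0 p"
    using completion_ex_borel_measurable_real by blast
  show thesis
  proof
    show "bounded_borel (\<lambda>p. max l (min h (c0 p)))"
    proof (rule bounded_borelI)
      show "(\<lambda>p. max l (min h (c0 p))) \<in> borel_measurable borel" using c0(1) by simp
      show "\<bar>max l (min h (c0 p))\<bar> \<le> \<bar>l\<bar> + \<bar>h\<bar>" for p using assms(3) by (auto simp: max_def min_def)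
    qed
    show "AE p in lebesgue. p \<in> open_strip T \<longrightarrow> c p = max l (min h (c0 p))"
      using AE_completion[OF c0(2)]
    proof eventually_elim
      case (elim p)
      show ?case
      proof
        assume "p \<in> open_strip T"
        then have "p \<in> strip T" by (auto simp: open_strip_def strip_def)
        with elim assms(2)[OF this] show "c p = max l (min h (c0 p))" by auto
      qed
    qed
  qed auto
qed

lemma time_deriv_bounded:
  assumes "I \<ge> 3" and H: "Ht_hypothesis T I \<rho>"
  obtains K where "K > 0" "\<And>t x. t \<in> {0..T} \<Longrightarrow> x \<notin> real ` {1..I} \<Longrightarrow> \<bar>time_deriv T \<rho> (t, x)\<bar> \<le> K"
proof -
  let ?A = "{(t, x) \<in> strip T. x < 1} \<union> (\<Union>i\<in>{1..I - 1}. {(t, x) \<in> strip T. real i < x \<and> x < real i + 1})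
    \<union> {(t, x) \<in> strip T. real I < x}"
  have "bounded (time_deriv T \<rho> ` ?A)"
    using H unfolding Ht_hypothesis_def image_Un image_UN bounded_Un by (auto intro!: bounded_UN)
  then obtain K where K: "K > 0" "\<And>p. p \<in> ?A \<Longrightarrow> \<bar>time_deriv T \<rho> p\<bar> \<le> K"
    unfolding bounded_pos by (auto simp del: Un_iff)
  have "(t, x) \<in> ?A" if t: "t \<in> {0..T}" and x: "x \<notin> real ` {1..I}" for t x
  proof (cases "x < 1 \<or> real I < x")
    case True
    then show ?thesis using t by (auto simp: strip_def)
  next
    case False
    \<comment> \<open>Off the interfaces the integer part locates the open unit interval around x; x
      \<ge> 1 keeps \<open>nat\<close> from truncating.\<close>
    define i where "i = nat \<lfloor>x\<rfloor>"
    have i: "real i \<le> x" "x < real i + 1" using False by (auto simp: i_def)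
    have "1 \<le> i" using False by (auto simp: i_def le_nat_iff le_floor_iff)
    moreover have "i \<le> I" using False i(1) by linarith
    ultimately have "real i \<noteq> x" using x by auto
    moreover have "i \<noteq> I" using False i(1) \<open>real i \<noteq> x\<close> by auto
    ultimately have "i \<in> {1..I - 1}" "real i < x" using \<open>1 \<le> i\<close> \<open>i \<le> I\<close> i(1) by auto
    then show ?thesis using t i(2) by (auto simp: strip_def)
  qed
  then show thesis by (intro that[OF K(1)] K(2))
qed

text \<open>Turns the hypotheses into the axioms of \<open>parabolic\<close>. Continuity and
  differentiability of \<rho> are given off the interfaces, so \<open>b\<close> is made constant on
  that null set; beyond [0, T] it is frozen in time, so that the Lipschitz bound holds for all
  translations.\<close>

lemma coefficients:
  assumes T: "T > 0" and I: "I \<ge> 3" and lam: "lam \<ge> 0" and mM: "0 < m'" "m' < M'"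
    and \<rho>: "\<rho> \<in> Theta T m' M'" and a: "a \<in> Theta T m' M'" and B: "B \<in> Xi T M'" and H: "Ht_hypothesis T I \<rho>"
  obtains m L b bt a' B' where "parabolic T m L lam b bt a' B' (real ` {1..I})"
    "AE p in lebesgue. p \<in> open_strip T \<longrightarrow> inverse (\<rho> p) = b p"
    "AE p in lebesgue. p \<in> open_strip T \<longrightarrow> - (time_deriv T \<rho> p / \<rho> p) * inverse (\<rho> p) = bt p"
    "AE p in lebesgue. p \<in> open_strip T \<longrightarrow> a p = a' p"
    "AE p in lebesgue. p \<in> open_strip T \<longrightarrow> B p = B' p"
proof -
  let ?N = "real ` {1..I}"
  define off where "off = (UNIV :: real set) \<times> (- ?N)"
  have "closed ?N" by (rule finite_imp_closed) simp
  then have "open off" unfolding off_def by (intro open_Times) auto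
  then have off: "off \<in> sets borel" by (rule borel_open)
  have si: "strip T - interfaces T I = strip T \<inter> off"
    by (auto simp: strip_def interfaces_def off_def image_iff)
  have rb: "m' \<le> \<rho> p" "\<rho> p \<le> M'" if "p \<in> strip T" for p using \<rho> that by (auto simp: Theta_def)
  \<comment> \<open>Projection onto the strip along the time axis; being nonexpansive, it preserves
    the Lipschitz constant in time.\<close>
  define cl where "cl p = (max 0 (min T (fst p)), snd p)" for p :: "real \<times> real"
  have cl: "cl p \<in> strip T" for p using T by (auto simp: cl_def strip_def)
  have cl_id: "cl p = p" if "p \<in> strip T" for p using that by (cases p) (auto simp: cl_def strip_def)
  define b where "b p = (if p \<in> off then inverse (\<rho> (cl p)) else inverse M')" for p
  define bt where "bt p = (if p \<in> strip T \<inter> off then - (inverse (\<rho> p) * time_deriv T \<rho> p * inverse (\<rho> p)) else 0)" for p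
  obtain K where K: "K > 0" "\<And>t x. t \<in> {0..T} \<Longrightarrow> x \<notin> ?N \<Longrightarrow> \<bar>time_deriv T \<rho> (t, x)\<bar> \<le> K"
    using time_deriv_bounded[OF I H] by blast
  have inv: "inverse M' \<le> inverse (\<rho> p)" "inverse (\<rho> p) \<le> inverse m'" "\<rho> p \<noteq> 0" if "p \<in> strip T" for p
    using rb[OF that] mM by (auto intro!: le_imp_inverse_le)
  have rpos: "0 < \<rho> p" if "p \<in> strip T" for p using rb(1)[OF that] mM by linarith
  have b_low: "inverse M' \<le> b p" and b_up: "\<bar>b p\<bar> \<le> inverse m'" for p
  proof -
    have "0 < inverse M'" "inverse M' \<le> inverse m'" using mM by (auto intro!: le_imp_inverse_le)
    moreover have "\<bar>inverse (\<rho> (cl p))\<bar> = inverse (\<rho> (cl p))" "\<bar>inverse M'\<bar> = inverse M'"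
      using positive_imp_inverse_positive[OF rpos[OF cl[of p]]] mM by simp_all
    ultimately show "inverse M' \<le> b p" "\<bar>b p\<bar> \<le> inverse m'"
      using inv(1,2)[OF cl[of p]] unfolding b_def by (simp_all only: split: if_split) simp_all
  qed
  have b_meas: "b \<in> borel_measurable borel"
    unfolding b_def
  proof (rule borel_measurable_continuous_on_if[OF off])
    have "continuous_on off (\<lambda>p. \<rho> (cl p))"
    proof (rule continuous_on_compose2[of "strip T - interfaces T I" \<rho>])
      show "continuous_on (strip T - interfaces T I) \<rho>" using H by (simp add: Ht_hypothesis_def)
      show "continuous_on off cl" unfolding cl_def by (intro continuous_intros)
      show "cl ` off \<subseteq> strip T - interfaces T I" unfolding si using cl by (auto simp: off_def cl_def)
    qed
    then show "continuous_on off (\<lambda>p. inverse (\<rho> (cl p)))"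
      using inv(3)[OF cl] by (intro continuous_intros) auto
  qed auto
  have so: "strip T \<inter> off \<in> sets borel" using off strip_borel by auto
  have bt_meas: "bt \<in> borel_measurable borel"
    unfolding bt_def
  proof (rule borel_measurable_continuous_on_if[OF so])
    show "continuous_on (strip T \<inter> off) (\<lambda>p. - (inverse (\<rho> p) * time_deriv T \<rho> p * inverse (\<rho> p)))"
      using H inv(3) unfolding Ht_hypothesis_def si by (intro continuous_intros) auto
  qed auto
  \<comment> \<open>Bounds the time derivative of 1 / \<rho>, using 1 / \<rho> \<le> 1 / m' twice
    and the bound K for the time derivative of \<rho>.\<close>
  define L where "L = inverse m' * K * inverse m'"
  have bt_le: "\<bar>bt p\<bar> \<le> L" for p
  proof (cases "p \<in> strip T \<inter> off")
    case True
    then have "\<bar>time_deriv T \<rho> p\<bar> \<le> K" using K(2)[of "fst p" "snd p"] by (auto simp: strip_def off_def)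
    moreover have "\<bar>inverse (\<rho> p)\<bar> \<le> inverse m'" using inv[of p] rb[of p] mM True by auto
    ultimately show ?thesis using True mM K(1)
      by (simp add: bt_def L_def abs_mult) (intro mult_mono; simp)
  next
    case False
    then show ?thesis using mM K(1) by (simp only: bt_def L_def if_False) simp
  qed
  have b_deriv: "((\<lambda>s. b (s, x)) has_real_derivative bt (t, x)) (at t within {0..T})" if t: "t \<in> {0..T}" and x: "x \<notin> ?N" for t x
  proof -
    have p: "(t, x) \<in> strip T \<inter> off" using t x by (auto simp: strip_def off_def)
    then have "(\<lambda>s. \<rho> (s, x)) differentiable (at t within {0..T})"
      using H unfolding Ht_hypothesis_def si by blast
    then have "((\<lambda>s. \<rho> (s, x)) has_vector_derivative time_deriv T \<rho> (t, x)) (at t within {0..T})"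
      unfolding time_deriv_def by (simp add: vector_derivative_works)
    then have "((\<lambda>s. \<rho> (s, x)) has_real_derivative time_deriv T \<rho> (t, x)) (at t within {0..T})"
      by (simp add: has_real_derivative_iff_has_vector_derivative)
    from DERIV_inverse'[OF this] have "((\<lambda>s. inverse (\<rho> (s, x))) has_real_derivative bt (t, x)) (at t within {0..T})"
      using p inv(3)[of "(t, x)"] by (simp add: bt_def)
    then show ?thesis
    proof (rule has_field_derivative_transform_within[of _ _ _ _ 1])
      show "inverse (\<rho> (s, x)) = b (s, x)" if "s \<in> {0..T}" for s
        using that x cl_id[of "(s, x)"] by (simp add: b_def off_def strip_def)
    qed (use t in auto)
  qed
  have b_lip: "b (p + s *\<^sub>R (1, 0)) \<le> b p + L * \<bar>s\<bar>" for p s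
  proof (cases "snd p \<in> ?N")
    case True
    then have "p \<notin> off" "p + s *\<^sub>R (1, 0) \<notin> off" by (auto simp: off_def mem_Times_iff)
    then show ?thesis using mM K(1) by (simp add: b_def L_def)
  next
    case False
    obtain t x where p: "p = (t, x)" by (cases p)
    let ?c = "\<lambda>t. max 0 (min T t)"
    have cb: "b (s, x) = b (?c s, x)" for s
      using T by (simp add: b_def off_def cl_def mem_Times_iff)
    have "norm (b (?c (t + s), x) - b (?c t, x)) \<le> L * norm (?c (t + s) - ?c t)"
    proof (rule field_differentiable_bound[of "{0..T}"])
      show "((\<lambda>s. b (s, x)) has_field_derivative bt (r, x)) (at r within {0..T})" if "r \<in> {0..T}" for r
        using b_deriv[OF that] False p by simp
    qed (use T bt_le in auto)
    also have "\<dots> \<le> L * \<bar>s\<bar>"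
      using clamp_lipschitz[of T t s] mM K(1) by (intro mult_left_mono) (auto simp: L_def)
    finally have "b (t + s, x) - b (t, x) \<le> L * \<bar>s\<bar>" unfolding cb[of "t + s"] cb[of t] real_norm_def by linarith
    then show ?thesis by (simp add: p)
  qed
  obtain a' where a': "bounded_borel a'" "\<And>p. m' \<le> a' p" "AE p in lebesgue. p \<in> open_strip T \<longrightarrow> a p = a' p"
    by (rule bounded_borel_representative[of a T m' M']) (use a mM in \<open>auto simp: Theta_def\<close>)
  obtain B' where B': "bounded_borel B'" "AE p in lebesgue. p \<in> open_strip T \<longrightarrow> B p = B' p"
    by (rule bounded_borel_representative[of B T "- M'" M']) (use B mM in \<open>auto simp: Xi_def\<close>)
  \<comment> \<open>One ellipticity constant has to serve both 1 / \<rho> \<ge> 1 / M' and a \<ge>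
    m'.\<close>
  have "parabolic T (min m' (inverse M')) L lam b bt a' B' ?N"
  proof
    show "min m' (inverse M') \<le> b p" for p using b_low[of p] by linarith
    show "min m' (inverse M') \<le> a' p" for p using a'(2)[of p] by linarith
    show "bounded_borel b" by (rule bounded_borelI[OF b_meas b_up])
    show "bounded_borel bt" by (rule bounded_borelI[OF bt_meas bt_le])
  qed (use T lam mM a' B' b_lip b_deriv in auto)
  moreover have "AE p in lebesgue. p \<in> off"
  proof -
    have "AE p in (lborel :: (real \<times> real) measure). p \<bullet> (0, 1) \<noteq> c" for c
    proof -
      have "negligible {p::real \<times> real. p \<bullet> (0, 1) = c}"
        by (rule negligible_standard_hyperplane) (simp add: Basis_prod_def)
      then have "AE p in lebesgue. p \<notin> {p::real \<times> real. p \<bullet> (0, 1) = c}"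
        by (intro AE_not_in) (simp add: negligible_iff_null_sets)
      then show ?thesis by (simp add: AE_completion_iff)
    qed
    then have "AE p in (lborel :: (real \<times> real) measure). \<forall>c\<in>?N. p \<bullet> (0, 1) \<noteq> c"
      by (intro AE_finite_allI) auto
    then show ?thesis
      by (intro AE_completion) (auto elim!: eventually_mono simp: off_def inner_prod_def mem_Times_iff)
  qed
  then have "AE p in lebesgue. p \<in> open_strip T \<longrightarrow> inverse (\<rho> p) = b p"
    "AE p in lebesgue. p \<in> open_strip T \<longrightarrow> - (time_deriv T \<rho> p / \<rho> p) * inverse (\<rho> p) = bt p"
  proof -
    have st: "p \<in> strip T" if "p \<in> open_strip T" for p using that by (auto simp: open_strip_def strip_def)
    show "AE p in lebesgue. p \<in> open_strip T \<longrightarrow> inverse (\<rho> p) = b p"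
      using \<open>AE p in lebesgue. p \<in> off\<close> by eventually_elim (use cl_id st in \<open>simp add: b_def\<close>)
    show "AE p in lebesgue. p \<in> open_strip T \<longrightarrow> - (time_deriv T \<rho> p / \<rho> p) * inverse (\<rho> p) = bt p"
      using \<open>AE p in lebesgue. p \<in> off\<close> by eventually_elim (use st in \<open>simp add: bt_def divide_inverse\<close>)
  qed
  ultimately show thesis using that a'(3) B'(2) by blast
qed

context parabolic
begin

text \<open>The weak formulation with all terms on one side. Its three test arguments are
  independent, so that passing from test functions to \<open>H11_0\<close> is mere
  continuity.\<close>

definition residual :: "(real \<times> real) l2 \<Rightarrow> (real \<times> real) l2 \<Rightarrow> (real \<times> real) l2 \<Rightarrow> (real \<times> real) l2 \<Rightarrow>
    (real \<times> real) l2 \<Rightarrow> (real \<times> real) l2 \<Rightarrow> real" where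
  "residual v z G \<phi>t \<phi>x \<phi> = mul b v \<bullet> \<phi>t + 1/2 * (mul a z \<bullet> \<phi>x) - mul (\<lambda>p. b p * B p) z \<bullet> \<phi>
     + (lam * (mul b v \<bullet> \<phi>) + mul bt v \<bullet> \<phi>) + G \<bullet> \<phi>"

text \<open>Since \<open>bt\<close> represents the time derivative of 1 / \<rho>, the zero-order
  coefficient of the weak formulation, divided by \<rho>, splits into lam b + bt.\<close>

lemma weak_form_iff_residual:
  assumes r: "AE p in lebesgue. p \<in> open_strip T \<longrightarrow> inverse (\<rho> p) = b p"
    "AE p in lebesgue. p \<in> open_strip T \<longrightarrow> - (time_deriv T \<rho> p / \<rho> p) * inverse (\<rho> p) = bt p"
    "AE p in lebesgue. p \<in> open_strip T \<longrightarrow> a' p = a p"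
    "AE p in lebesgue. p \<in> open_strip T \<longrightarrow> B' p = B p"
    and L: "u \<in> L2 (lebesgue_on (strip T))" "ux \<in> L2 (lebesgue_on (strip T))" "g \<in> L2 (lebesgue_on (strip T))"
      "\<phi> \<in> L2 (lebesgue_on (strip T))" "\<phi>x \<in> L2 (lebesgue_on (strip T))" "\<phi>t \<in> L2 (lebesgue_on (strip T))"
  shows "(LINT p|lebesgue_on (strip T). u p * \<phi>t p * inverse (\<rho> p))
        + 1/2 * (LINT p|lebesgue_on (strip T). a' p * ux p * \<phi>x p)
        - (LINT p|lebesgue_on (strip T). B' p * ux p * \<phi> p * inverse (\<rho> p))
        + (LINT p|lebesgue_on (strip T). u p * (lam - time_deriv T \<rho> p / \<rho> p) * \<phi> p * inverse (\<rho> p))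
        = - (LINT p|lebesgue_on (strip T). g p * \<phi> p * inverse (\<rho> p))
    \<longleftrightarrow> residual (strip_class T u) (strip_class T ux) (mul b (strip_class T g)) (strip_class T \<phi>t) (strip_class T \<phi>x) (strip_class T \<phi>) = 0"
proof -
  have "(LINT p|lebesgue_on (strip T). u p * \<phi>t p * inverse (\<rho> p)) = mul b (strip_class T u) \<bullet> strip_class T \<phi>t"
    by (rule strip_integral[OF b(1) L(1,6)]) (use r(1) in \<open>eventually_elim, simp\<close>)
  moreover have "(LINT p|lebesgue_on (strip T). a' p * ux p * \<phi>x p) = mul a (strip_class T ux) \<bullet> strip_class T \<phi>x"
    by (rule strip_integral[OF a(1) L(2,5)]) (use r(3) in \<open>eventually_elim, simp\<close>)
  moreover have "(LINT p|lebesgue_on (strip T). B' p * ux p * \<phi> p * inverse (\<rho> p)) = mul (\<lambda>p. b p * B p) (strip_class T ux) \<bullet> strip_class T \<phi>"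
    by (rule strip_integral[OF bbB L(2,4)]) (use r(1,4) in \<open>eventually_elim, simp\<close>)
  moreover have lb: "bounded_borel (\<lambda>p. lam * b p)" by (intro bounded_borel_mult bounded_borel_const b)
  have "(LINT p|lebesgue_on (strip T). u p * (lam - time_deriv T \<rho> p / \<rho> p) * \<phi> p * inverse (\<rho> p)) =
      mul (\<lambda>p. lam * b p + bt p) (strip_class T u) \<bullet> strip_class T \<phi>"
  proof (rule strip_integral[OF bounded_borel_add[OF lb bt] L(1,4)])
    show "AE p in lebesgue. p \<in> open_strip T \<longrightarrow>
        u p * (lam - time_deriv T \<rho> p / \<rho> p) * \<phi> p * inverse (\<rho> p) = (lam * b p + bt p) * u p * \<phi> p"
      using r(1,2)
    proof eventually_elim
      case (elim p)
      show ?case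
      proof
        assume "p \<in> open_strip T"
        with elim have e: "b p = inverse (\<rho> p)" "bt p = - (time_deriv T \<rho> p / \<rho> p) * inverse (\<rho> p)" by auto
        show "u p * (lam - time_deriv T \<rho> p / \<rho> p) * \<phi> p * inverse (\<rho> p) = (lam * b p + bt p) * u p * \<phi> p"
          unfolding e by (simp add: algebra_simps)
      qed
    qed
  qed
  moreover have "mul (\<lambda>p. lam * b p + bt p) (strip_class T u) \<bullet> strip_class T \<phi> = lam * (mul b (strip_class T u) \<bullet> strip_class T \<phi>) + mul bt (strip_class T u) \<bullet> strip_class T \<phi>"
    by (simp add: mul_plus[OF lb bt] inner_add_left mul_mul[OF bounded_borel_const b(1), symmetric] mul_const)
  moreover have "(LINT p|lebesgue_on (strip T). g p * \<phi> p * inverse (\<rho> p)) = mul b (strip_class T g) \<bullet> strip_class T \<phi>"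
    by (rule strip_integral[OF b(1) L(3,4)]) (use r(1) in \<open>eventually_elim, simp\<close>)
  ultimately show ?thesis unfolding residual_def by linarith
qed

lemma residual_tendsto:
  assumes "U \<longlonglongrightarrow> \<phi>t" "Y \<longlonglongrightarrow> \<phi>x" "Z \<longlonglongrightarrow> \<phi>"
  shows "(\<lambda>n. residual v z G (U n) (Y n) (Z n)) \<longlonglongrightarrow> residual v z G \<phi>t \<phi>x \<phi>"
  unfolding residual_def by (intro tendsto_intros assms)

lemma residual_zero_on_H11_0:
  assumes \<phi>: "\<phi> \<in> H11_0 T"
    and eq: "\<And>\<psi>. \<psi> \<in> test_functions (open_strip T) \<Longrightarrow> residual v z G (cls (dd (1, 0) \<psi>)) (cls (dd (0, 1) \<psi>)) (cls \<psi>) = 0"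
  shows "residual v z G (strip_class T (distr_dt T \<phi>)) (strip_class T (distr_dx T \<phi>)) (strip_class T \<phi>) = 0"
proof -
  obtain \<psi> where \<psi>: "\<And>n. \<psi> n \<in> test_functions (open_strip T)"
    "(\<lambda>n. cls (\<psi> n)) \<longlonglongrightarrow> strip_class T \<phi>" "(\<lambda>n. cls (dd (0, 1) (\<psi> n))) \<longlonglongrightarrow> strip_class T (distr_dx T \<phi>)"
    "(\<lambda>n. cls (dd (1, 0) (\<psi> n))) \<longlonglongrightarrow> strip_class T (distr_dt T \<phi>)"
    using H11_0_approximation[OF \<phi>] by blast
  have "(\<lambda>n. residual v z G (cls (dd (1, 0) (\<psi> n))) (cls (dd (0, 1) (\<psi> n))) (cls (\<psi> n))) \<longlonglongrightarrow>
      residual v z G (strip_class T (distr_dt T \<phi>)) (strip_class T (distr_dx T \<phi>)) (strip_class T \<phi>)"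
    by (rule residual_tendsto[OF \<psi>(4,3,2)])
  then show ?thesis using eq[OF \<psi>(1)] by (simp add: LIMSEQ_const_iff)
qed

end

text \<open>Fubini relates the class on the plane, determined up to null sets, to the slices of
  \<open>d\<close>, which are prescribed at every time.\<close>

lemma AE_slices:
  assumes d: "d \<in> L2 (lebesgue_on (strip T))" and slices: "\<And>t. t \<in> {0..T} \<Longrightarrow> (\<lambda>x. d (t, x)) \<in> L2 lebesgue"
  shows "AE t in lborel. (t \<notin> {0<..<T} \<longrightarrow> (AE x in lborel. fn (strip_class T d) (t, x) = 0)) \<and>
    (t \<in> {0<..<T} \<longrightarrow> (\<lambda>x. fn (strip_class T d) (t, x)) \<in> L2 lborel \<and> cls (\<lambda>x. fn (strip_class T d) (t, x)) = cls (\<lambda>x. d (t, x)))"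
proof -
  have "AE p in lborel. fn (strip_class T d) p = ind_strip T p * d p"
    unfolding strip_class_def by (rule fn_cls) (use d in \<open>simp add: L2_strip_iff\<close>)
  then have "AE p in lborel \<Otimes>\<^sub>M lborel. fn (strip_class T d) p = ind_strip T p * d p" by (subst lborel_prod)
  then have "AE t in lborel. AE x in lborel. fn (strip_class T d) (t, x) = ind_strip T (t, x) * d (t, x)"
    by (rule lborel_pair.AE_pair)
  then show ?thesis
  proof eventually_elim
    case (elim t)
    have "AE x in lborel. fn (strip_class T d) (t, x) = 0" if "t \<notin> {0<..<T}"
      using elim by eventually_elim (use that in \<open>auto simp: open_strip_def\<close>)
    moreover have "(\<lambda>x. fn (strip_class T d) (t, x)) \<in> L2 lborel \<and> cls (\<lambda>x. fn (strip_class T d) (t, x)) = cls (\<lambda>x. d (t, x))"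
      if t: "t \<in> {0<..<T}"
    proof -
      have AE: "AE x in lborel. fn (strip_class T d) (t, x) = d (t, x)"
        using elim by eventually_elim (use t in \<open>simp add: open_strip_def\<close>)
      then have AE': "AE x in lborel. d (t, x) = fn (strip_class T d) (t, x)" by eventually_elim (rule sym)
      have dt: "(\<lambda>x. d (t, x)) \<in> L2 lebesgue" using t by (intro slices) auto
      have fL: "(\<lambda>x. fn (strip_class T d) (t, x)) \<in> L2 lebesgue"
        by (rule L2_lebesgue_cong_AE[OF dt AE_completion[OF AE']])
      moreover have "(\<lambda>x. fn (strip_class T d) (t, x)) \<in> borel_measurable borel" by (rule borel_slice(1)[OF fn_borel])
      ultimately show ?thesis
        using L2_lebesgue_lborel cls_eqI[OF fL dt AE] by blast
    qed
    ultimately show ?case by blast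
  qed
qed

lemma Cc_strip_L2:
  assumes g: "g \<in> Cc_strip T" shows "g \<in> L2 (lebesgue_on (strip T))"
proof -
  let ?g = "\<lambda>p. indicator (strip T) p *\<^sub>R g p"
  let ?K = "closure {p \<in> strip T. g p \<noteq> 0}"
  have c: "continuous_on (strip T) g" and K: "compact ?K" using g by (auto simp: Cc_strip_def)
  have m: "?g \<in> borel_measurable borel"
    using borel_measurable_continuous_on_indicator[OF strip_borel c] by simp
  have "closed (strip T)" unfolding strip_def by (intro closed_Times) auto
  then have sub: "?K \<subseteq> strip T" by (intro closure_minimal) auto
  have "bounded (g ` ?K)"
    by (intro compact_imp_bounded compact_continuous_image continuous_on_subset[OF c sub] K)
  then obtain C where C: "C > 0" "\<And>p. p \<in> ?K \<Longrightarrow> \<bar>g p\<bar> \<le> C" unfolding bounded_pos by auto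
  have out: "?g p = 0" if "p \<notin> ?K" for p
    using that closure_subset[of "{p \<in> strip T. g p \<noteq> 0}"] by (auto simp: indicator_def)
  have bd: "\<bar>?g p\<bar> \<le> C" for p
    using C(2)[of p] C(1) out[of p] by (cases "p \<in> ?K") (auto simp: indicator_def)
  have "?g \<in> L2 lborel"
  proof (rule L2I)
    show "integrable lborel (\<lambda>p. (?g p)\<^sup>2)"
    proof (rule bounded_compact_support_integrable[OF _ K])
      show "\<bar>(?g p)\<^sup>2\<bar> \<le> C\<^sup>2" for p using power_mono[OF bd[of p] abs_ge_zero, of 2] by simp
    qed (use m out in auto)
  qed (use m in simp)
  then have "(\<lambda>p. ind_strip T p * ?g p) \<in> L2 lebesgue"
    by (intro L2_lborel_lebesgue bounded_borel_L2 bounded_borel_ind_strip)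
  moreover have "(\<lambda>p. ind_strip T p * ?g p) = (\<lambda>p. ind_strip T p * g p)"
  proof
    show "ind_strip T p * ?g p = ind_strip T p * g p" for p
      by (auto simp: indicator_def open_strip_def strip_def)
  qed
  ultimately show ?thesis by (simp only: L2_strip_iff)
qed

context parabolic
begin

text \<open>The derivative of the cut-off has size C n, and before T - 2/n it vanishes. Its
  contribution is therefore at most a constant times the supremum of |D t| over this last layer,
  which tends to 0.\<close>

lemma time_cut_error_tendsto:
  assumes D: "AE t in lborel. (t \<notin> {0<..<T} \<longrightarrow> (AE x in lborel. fn v (t, x) = 0)) \<and>
      (t \<in> {0<..<T} \<longrightarrow> (\<lambda>x. fn v (t, x)) \<in> L2 lborel \<and> cls (\<lambda>x. fn v (t, x)) = D t)"
    and lim: "(D \<longlongrightarrow> 0) (at T within {0..T})"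
    and \<psi>: "\<psi> \<in> test_functions UNIV"
  shows "(\<lambda>n. mul b v \<bullet> cls (\<lambda>p. dd (1, 0) (time_cut 1 T n) p * \<psi> p)) \<longlonglongrightarrow> 0"
proof -
  obtain C where C: "C > 0" "\<And>n \<kappa> p. \<bar>dd (1, 0) (time_cut 1 \<kappa> n) p\<bar> \<le> C * real n"
    "\<And>n \<kappa> p. 2 < real n * (\<kappa> - fst p) \<Longrightarrow> dd (1, 0) (time_cut 1 \<kappa> n) p = 0"
    using time_cut_derivative_bound by blast
  obtain K where K: "compact K" "\<And>p. p \<notin> K \<Longrightarrow> \<psi> p = 0" using \<psi> by (rule test_functionsE) blast
  obtain C1 where C1: "C1 > 0" "\<And>p. \<bar>b p * \<psi> p\<bar> \<le> C1"
    using bounded_borel_bound[OF bounded_borel_mult[OF b(1) test_bounded_borel[OF \<psi>]]] by blast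
  have K2: "compact (snd ` K)" using K(1) by (intro compact_continuous_image continuous_intros)
  define \<mu> where "\<mu> = measure lborel (snd ` K)"
  have fin: "emeasure lborel (snd ` K) < \<infinity>" by (rule emeasure_bounded_finite[OF compact_imp_bounded[OF K2]])
  have ms: "snd ` K \<in> sets lborel" using K2 by (simp add: compact_imp_closed borel_closed)
  \<comment> \<open>n R bounds the L^2 norm of every slice of \<open>q n\<close>, whose support lies
    in a set of measure \<mu>.\<close>
  define R where "R = C * C1 * sqrt \<mu>"
  have R: "R \<ge> 0" using C(1) C1(1) by (simp add: R_def \<mu>_def)
  define q where "q n p = b p * (dd (1, 0) (time_cut 1 T n) p * \<psi> p)" for n p
  have dtest: "(\<lambda>p. dd (1, 0) (time_cut 1 T n) p * \<psi> p) \<in> test_functions UNIV" for n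
    by (intro test_mult[OF \<psi>] smooth_dd smooth_time_cut)
  have qL: "q n \<in> L2 lborel" for n
    unfolding q_def by (rule bounded_borel_L2[OF b(1) test_L2[OF dtest]])
  have qm: "q n \<in> borel_measurable borel" for n using L2D(1)[OF qL] by simp
  have qbd: "\<bar>q n p\<bar> \<le> C * C1 * real n" for n p
  proof -
    have "\<bar>q n p\<bar> = \<bar>dd (1, 0) (time_cut 1 T n) p\<bar> * \<bar>b p * \<psi> p\<bar>"
      by (simp add: q_def abs_mult)
    also have "\<dots> \<le> (C * real n) * C1" using C(1) by (intro mult_mono C(2) C1(2)) auto
    finally show ?thesis by (simp add: mult_ac)
  qed
  have qout: "q n (t, x) = 0" if "x \<notin> snd ` K" for n t x
    using K(2)[of "(t, x)"] that by (force simp: q_def)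
  have q2: "integrable lborel (\<lambda>x. (q n (t, x))\<^sup>2)" for n t
  proof (rule bounded_compact_support_integrable[OF _ K2])
    show "\<bar>(q n (t, x))\<^sup>2\<bar> \<le> (C * C1 * real n)\<^sup>2" for x
      using power_mono[OF qbd[of n "(t, x)"] abs_ge_zero, of 2] by simp
  qed (use borel_slice(1)[OF qm] qout in auto)
  have qsl: "(\<lambda>x. q n (t, x)) \<in> L2 lborel" for n t
    using borel_slice(1)[OF qm] q2 by (intro L2I) auto
  have qn: "norm (cls (\<lambda>x. q n (t, x))) \<le> real n * R" for n t
  proof (rule power2_le_imp_le)
    have "(norm (cls (\<lambda>x. q n (t, x))))\<^sup>2 = (LINT x|lborel. (q n (t, x))\<^sup>2)" by (rule norm_cls[OF qsl])
    also have "\<dots> \<le> (LINT x|lborel. (C * C1 * real n)\<^sup>2 * indicator (snd ` K) x)"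
    proof (intro integral_mono q2)
      show "integrable lborel (\<lambda>x. (C * C1 * real n)\<^sup>2 * indicator (snd ` K) x)"
        using fin ms by (intro Bochner_Integration.integrable_mult_right integrable_real_indicator)
      show "(q n (t, x))\<^sup>2 \<le> (C * C1 * real n)\<^sup>2 * indicator (snd ` K) x" for x
        using power_mono[OF qbd[of n "(t, x)"] abs_ge_zero, of 2] qout[of x n t] by (cases "x \<in> snd ` K") auto
    qed
    also have "\<dots> = (real n * R)\<^sup>2"
      using fin ms by (simp add: R_def \<mu>_def power_mult_distrib mult_ac)
    finally show "(norm (cls (\<lambda>x. q n (t, x))))\<^sup>2 \<le> (real n * R)\<^sup>2" .
  qed (use R in simp)
  have Fint: "integrable lborel (\<lambda>p. fn v p * q n p)" for n by (intro L2_mult_integrable fn_L2 qL)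
  have e: "mul b v \<bullet> cls (\<lambda>p. dd (1, 0) (time_cut 1 T n) p * \<psi> p) = (LINT t|lborel. LINT x|lborel. fn v (t, x) * q n (t, x))" for n
  proof -
    have "mul b v \<bullet> cls (\<lambda>p. dd (1, 0) (time_cut 1 T n) p * \<psi> p) = cls (fn v) \<bullet> cls (q n)"
      by (simp add: inner_mul_swap[OF b(1)] mul_cls[OF b(1) test_L2'[OF dtest]] q_def[abs_def])
    also have "\<dots> = (LINT p|lborel. fn v p * q n p)" by (rule cls_inner'[OF fn_L2 qL])
    finally show ?thesis using fubini_plane(1)[OF Fint] by simp
  qed
  show ?thesis
  proof (rule tendstoI)
    fix \<epsilon> :: real assume \<epsilon>: "\<epsilon> > 0"
    \<comment> \<open>The 1 avoids division by zero and makes the final inequality strict when R =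
      0.\<close>
    define \<epsilon>' where "\<epsilon>' = \<epsilon> / (2 * R + 1)"
    have \<epsilon>': "\<epsilon>' > 0" "2 * \<epsilon>' * R < \<epsilon>"
    proof -
      show "\<epsilon>' > 0" using \<epsilon> R by (simp add: \<epsilon>'_def)
      have "\<epsilon> = \<epsilon>' * (2 * R + 1)" using R by (simp add: \<epsilon>'_def)
      then show "2 * \<epsilon>' * R < \<epsilon>" using \<open>\<epsilon>' > 0\<close> by (simp add: algebra_simps)
    qed
    obtain \<delta> where \<delta>: "\<delta> > 0" "\<And>t. t \<in> {0..T} \<Longrightarrow> t \<noteq> T \<Longrightarrow> dist t T < \<delta> \<Longrightarrow> norm (D t) < \<epsilon>'"
      using tendstoD[OF lim \<epsilon>'(1)] unfolding eventually_at by auto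
    obtain N0 where N0: "2 / \<delta> < real N0" using reals_Archimedean2 by blast
    have "norm (LINT t|lborel. LINT x|lborel. fn v (t, x) * q n (t, x)) < \<epsilon>" if n: "n \<ge> N0 + 1" for n
    proof -
      have n0: "real n > 0" using n by simp
      have "2 / \<delta> < real n" using N0 n by simp
      then have nd: "2 / real n < \<delta>" using \<delta>(1) n0 by (simp add: field_simps)
      let ?h = "\<lambda>t. LINT x|lborel. fn v (t, x) * q n (t, x)"
      \<comment> \<open>Height of order n on a layer of length 2/n: the integral 2 \<epsilon>' R
        does not depend on n.\<close>
      let ?w = "\<lambda>t. \<epsilon>' * (real n * R) * indicator {T - 2 / real n..T} t"
      have hint: "integrable lborel ?h" by (rule fubini_plane(3)[OF Fint])
      have "norm (LINT t|lborel. ?h t) \<le> (LINT t|lborel. norm (?h t))" by (rule integral_norm_bound)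
      also have "\<dots> \<le> (LINT t|lborel. ?w t)"
      proof (rule integral_mono_AE)
        show "integrable lborel (\<lambda>t. norm (?h t))" by (rule integrable_norm[OF hint])
        show "integrable lborel ?w"
          by (intro Bochner_Integration.integrable_mult_right integrable_real_indicator) auto
        show "AE t in lborel. norm (?h t) \<le> ?w t"
          using D AE_lborel_singleton[of T]
        proof eventually_elim
          case (elim t)
          \<comment> \<open>Outside the strip \<open>v\<close> vanishes, before the layer the
            cut-off is constant, and inside it Cauchy-Schwarz and the smallness of \<open>D\<close>
            apply.\<close>
          consider "t \<notin> {0<..<T}" | "t \<in> {0<..<T}" "t < T - 2 / real n" | "t \<in> {0<..<T}" "T - 2 / real n \<le> t" by linarith
          then show ?case
          proof cases
            case 1
            with elim have "AE x in lborel. fn v (t, x) * q n (t, x) = 0" by (auto elim: eventually_mono)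
            then have "?h t = 0" by (rule integral_eq_zero_AE)
            then show ?thesis using \<epsilon>'(1) R by (simp add: indicator_def)
          next
            case 2
            have "2 < real n * (T - fst (t, x))" for x using 2(2) n0 by (simp add: field_simps)
            then have "q n (t, x) = 0" for x using C(3)[of n T "(t, x)"] by (simp add: q_def)
            then show ?thesis using \<epsilon>'(1) R by (simp add: indicator_def)
          next
            case 3
            with elim have s: "(\<lambda>x. fn v (t, x)) \<in> L2 lborel" "cls (\<lambda>x. fn v (t, x)) = D t" by auto
            have "?h t = D t \<bullet> cls (\<lambda>x. q n (t, x))"
              using cls_inner'[OF s(1) qsl[of n t]] s(2) by simp
            then have "norm (?h t) \<le> norm (D t) * norm (cls (\<lambda>x. q n (t, x)))"
              using Cauchy_Schwarz_ineq2 by simp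
            also have "\<dots> \<le> \<epsilon>' * (real n * R)"
            proof (intro mult_mono qn less_imp_le[OF \<delta>(2)])
              show "dist t T < \<delta>" using 3 nd by (simp add: dist_real_def)
            qed (use 3 \<epsilon>'(1) in auto)
            finally show ?thesis using 3 by (simp add: indicator_def)
          qed
        qed
      qed
      also have "\<dots> = 2 * \<epsilon>' * R" using n0 by (simp add: field_simps)
      also have "\<dots> < \<epsilon>" by (rule \<epsilon>'(2))
      finally show ?thesis .
    qed
    then show "\<forall>\<^sub>F n in sequentially. dist (mul b v \<bullet> cls (\<lambda>p. dd (1, 0) (time_cut 1 T n) p * \<psi> p)) 0 < \<epsilon>"
      unfolding e eventually_sequentially dist_norm by (intro exI[of _ "N0 + 1"]) auto
  qed
qed

text \<open>Multiplied by the cut-off, \<psi> becomes an admissible test; by the product rule the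
  surplus is exactly the term treated in \<open>time_cut_error_tendsto\<close>.\<close>

lemma extend_residual_to_terminal_time:
  assumes D: "AE t in lborel. (t \<notin> {0<..<T} \<longrightarrow> (AE x in lborel. fn v (t, x) = 0)) \<and>
      (t \<in> {0<..<T} \<longrightarrow> (\<lambda>x. fn v (t, x)) \<in> L2 lborel \<and> cls (\<lambda>x. fn v (t, x)) = D t)"
    and lim: "(D \<longlongrightarrow> 0) (at T within {0..T})"
    and supp: "mul (ind_strip T) v = v" "mul (ind_strip T) z = z"
    and eq: "\<And>\<psi>. \<psi> \<in> test_functions (open_strip T) \<Longrightarrow> residual v z 0 (cls (dd (1, 0) \<psi>)) (cls (dd (0, 1) \<psi>)) (cls \<psi>) = 0"
    and \<psi>: "\<psi> \<in> test_functions {p. (-1) * fst p < 0}"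
  shows "residual v z 0 (cls (dd (1, 0) \<psi>)) (cls (dd (0, 1) \<psi>)) (cls \<psi>) = 0"
proof -
  let ?c = "time_cut 1 T"
  let ?r = "\<lambda>n. residual (mul (?c n) v) (mul (?c n) z) 0 (cls (dd (1, 0) \<psi>)) (cls (dd (0, 1) \<psi>)) (cls \<psi>)"
  let ?e = "\<lambda>n. mul b v \<bullet> cls (\<lambda>p. dd (1, 0) (?c n) p * \<psi> p)"
  note bb = bounded_borel_time_cut[of 1 T]
  have zero: "AE p in lborel. T \<le> 1 * fst p \<longrightarrow> fn u p = 0" if "mul (ind_strip T) u = u" for u
    using that unfolding supported_iff by eventually_elim (auto simp: open_strip_def)
  have "?r \<longlonglongrightarrow> residual v z 0 (cls (dd (1, 0) \<psi>)) (cls (dd (0, 1) \<psi>)) (cls \<psi>)"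
    unfolding residual_def
    by (intro tendsto_intros bounded_linear.tendsto[OF bounded_linear_mul] b(1) bt bbB a(1)
        mul_time_cut_tendsto zero supp)
  moreover have "?r n = - ?e n" for n
  proof -
    let ?\<psi> = "\<lambda>p. ?c n p * \<psi> p"
    have t1: "?\<psi> \<in> test_functions (open_strip T)"
      by (rule test_mono[OF time_cut_test[OF \<psi>]]) (auto simp: open_strip_def)
    have dt: "dd (1, 0) ?\<psi> = (\<lambda>p. ?c n p * dd (1, 0) \<psi> p + dd (1, 0) (?c n) p * \<psi> p)"
      by (rule dd_mult_fun[OF smooth_time_cut test_smooth[OF \<psi>]])
    note L = test_L2'[OF test_mult[OF test_dd[OF \<psi>, of "(1, 0)"] smooth_time_cut[of 1 T n]]]
      test_L2'[OF test_mult[OF \<psi> smooth_dd[OF smooth_time_cut[of 1 T n]], of "(1, 0)"]]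
    have comm: "mul d u \<bullet> cls (\<lambda>p. ?c n p * f p) = mul d (mul (?c n) u) \<bullet> cls f"
      if "bounded_borel d" "f \<in> L2 lebesgue" for d u f
    proof -
      have "mul d u \<bullet> cls (\<lambda>p. ?c n p * f p) = mul (?c n) (mul d u) \<bullet> cls f"
        by (simp add: inner_mul_swap[OF bb] mul_cls[OF bb that(2)])
      then show ?thesis by (simp add: mul_mul bb that(1) mult.commute)
    qed
    have "residual v z 0 (cls (dd (1, 0) ?\<psi>)) (cls (dd (0, 1) ?\<psi>)) (cls ?\<psi>) = ?r n + ?e n"
      unfolding residual_def dt cls_add[OF L] dd_x_time_cut[OF test_smooth[OF \<psi>]]
      by (simp add: inner_add_right comm b(1) a(1) bt bbB test_L2'[OF \<psi>] test_L2'[OF test_dd[OF \<psi>]])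
    then show ?thesis using eq[OF t1] by linarith
  qed
  then have "?r \<longlonglongrightarrow> - 0"
    by (simp only:) (intro tendsto_minus time_cut_error_tendsto[OF D lim test_UNIV[OF \<psi>]])
  ultimately show ?thesis using LIMSEQ_unique by fastforce
qed

lemma residual_uniqueness:
  assumes D: "AE t in lborel. (t \<notin> {0<..<T} \<longrightarrow> (AE x in lborel. fn v (t, x) = 0)) \<and>
      (t \<in> {0<..<T} \<longrightarrow> (\<lambda>x. fn v (t, x)) \<in> L2 lborel \<and> cls (\<lambda>x. fn v (t, x)) = D t)"
    and lim: "(D \<longlongrightarrow> 0) (at T within {0..T})"
    and supp: "mul (ind_strip T) v = v" "mul (ind_strip T) z = z" and wd: "wderiv (0, 1) v z"
    and eq: "\<And>\<psi>. \<psi> \<in> test_functions (open_strip T) \<Longrightarrow> residual v z 0 (cls (dd (1, 0) \<psi>)) (cls (dd (0, 1) \<psi>)) (cls \<psi>) = 0"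
  shows "v = 0"
proof -
  have a2: "bounded_borel (\<lambda>p. a p / 2)" using bounded_borel_mult[OF a(1) bounded_borel_const[of "1/2"]] by simp
  have nbB: "bounded_borel (\<lambda>p. - (b p * B p))" by (intro bounded_borel_uminus bbB)
  have lb: "bounded_borel (\<lambda>p. lam * b p)" by (intro bounded_borel_mult bounded_borel_const b)
  \<comment> \<open>Time is reversed: tests vanish near t = 0 only. The drift now pairs
    \<open>z\<close> with the test function and enters through \<beta>, and the time derivative of 1
    / \<rho> joins the zero-order coefficient.\<close>
  show ?thesis
  proof (rule parabolic_uniqueness[where \<sigma> = "-1" and \<kappa> = 0 and T = T and m = "m / 2" and b = b and L = L and a = "\<lambda>p. a p / 2"
        and \<gamma> = "\<lambda>_. 0" and \<beta> = "\<lambda>p. - (b p * B p)" and c = "\<lambda>p. lam * b p + bt p" and z = z])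
    show "m / 2 \<le> b p" for p using b(2)[of p] m by linarith
    show "m / 2 \<le> a p / 2" if "p \<in> open_strip T" for p using a(2)[OF that] by linarith
    show "- 1 * fst p < 0" if "p \<in> open_strip T" for p using that by (auto simp: open_strip_def)
    show "bounded_borel (\<lambda>p. lam * b p + bt p)" by (intro bounded_borel_add lb bt)
    fix \<psi> :: "real \<times> real \<Rightarrow> real" assume \<psi>: "\<psi> \<in> test_functions {p. - 1 * fst p < 0}"
    have "residual v z 0 (cls (dd (1, 0) \<psi>)) (cls (dd (0, 1) \<psi>)) (cls \<psi>) = 0"
      by (rule extend_residual_to_terminal_time[OF D lim supp eq \<psi>])
    moreover have "mul (\<lambda>p. a p / 2) z = (1/2) *\<^sub>R mul a z"
      using mul_mul[OF bounded_borel_const[of "1/2"] a(1), of z] by (simp add: mul_const)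
    moreover have "mul (\<lambda>p. - (b p * B p)) z = - mul (\<lambda>p. b p * B p) z"
      using mul_mul[OF bounded_borel_const[of "-1"] bbB, of z] by (simp add: mul_const)
    moreover have "mul (\<lambda>p. lam * b p + bt p) v = lam *\<^sub>R mul b v + mul bt v"
      using mul_mul[OF bounded_borel_const[of lam] b(1), of v] by (simp add: mul_const mul_plus[OF lb bt])
    ultimately show "- 1 * (mul b v \<bullet> cls (dd (1, 0) \<psi>)) = (mul (\<lambda>p. a p / 2) z + mul (\<lambda>_. 0) v) \<bullet> cls (dd (0, 1) \<psi>) +
        (mul (\<lambda>p. - (b p * B p)) z + mul (\<lambda>p. lam * b p + bt p) v) \<bullet> cls \<psi>"
      unfolding residual_def by (simp add: mul_const inner_add_left inner_diff_left)
  qed (use m b a2 nbB supp wd in auto)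
qed

end

text \<open>A nonzero value would persist on an interval next to t, which has positive
  measure.\<close>

lemma AE_zero_imp_continuous_zero:
  fixes D :: "real \<Rightarrow> 'a::real_normed_vector"
  assumes T: "T > 0" and AE: "AE t in lborel. t \<in> {0<..<T} \<longrightarrow> D t = 0"
    and t: "t \<in> {0..T}" and lim: "(D \<longlongrightarrow> D t) (at t within {0..T})"
  shows "D t = 0"
proof (rule ccontr)
  assume "D t \<noteq> 0"
  then have "\<forall>\<^sub>F s in at t within {0..T}. D s \<noteq> 0" using lim by (rule tendsto_imp_eventually_ne[rotated])
  then obtain \<delta> where \<delta>: "\<delta> > 0" "\<And>s. s \<in> {0..T} \<Longrightarrow> s \<noteq> t \<Longrightarrow> dist s t < \<delta> \<Longrightarrow> D s \<noteq> 0"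
    unfolding eventually_at by auto
  \<comment> \<open>At t = T only the left side of t lies in the interval; otherwise the right side
    is used.\<close>
  obtain c d where cd: "c < d" "{c<..<d} \<subseteq> {0<..<T} \<inter> {s. s \<noteq> t \<and> dist s t < \<delta>}"
  proof (cases "t < T")
    case True
    show ?thesis
    proof (rule that)
      show "t < min T (t + \<delta>)" using True \<delta>(1) by simp
      show "{t<..<min T (t + \<delta>)} \<subseteq> {0<..<T} \<inter> {s. s \<noteq> t \<and> dist s t < \<delta>}"
        by (rule subsetI) (use t in \<open>simp add: dist_real_def\<close>)
    qed
  next
    case False
    show ?thesis
    proof (rule that)
      show "max 0 (t - \<delta>) < t" using False T \<delta>(1) by simp
      show "{max 0 (t - \<delta>)<..<t} \<subseteq> {0<..<T} \<inter> {s. s \<noteq> t \<and> dist s t < \<delta>}"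
        by (rule subsetI) (use t in \<open>simp add: dist_real_def\<close>)
    qed
  qed
  have "AE s in lborel. s \<notin> {c<..<d}"
    using AE by eventually_elim (use cd(2) \<delta>(2) in force)
  then have "{c<..<d} \<in> null_sets lborel" by (subst AE_iff_null_sets) auto
  then show False using cd(1) by (auto simp: null_sets_def)
qed

context parabolic
begin

lemma unique_weak_solution:
  fixes f :: "real \<Rightarrow> real"
  assumes r: "AE p in lebesgue. p \<in> open_strip T \<longrightarrow> inverse (\<rho> p) = b p"
    "AE p in lebesgue. p \<in> open_strip T \<longrightarrow> - (time_deriv T \<rho> p / \<rho> p) * inverse (\<rho> p) = bt p"
    "AE p in lebesgue. p \<in> open_strip T \<longrightarrow> a' p = a p"
    "AE p in lebesgue. p \<in> open_strip T \<longrightarrow> B' p = B p"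
    and g: "g \<in> L2 (lebesgue_on (strip T))" and f: "f \<in> L2 lebesgue"
  shows "\<exists>u. weak_solution T \<rho> a' B' lam g f u"
    and "weak_solution T \<rho> a' B' lam g f u \<Longrightarrow> weak_solution T \<rho> a' B' lam g f w \<Longrightarrow> t \<in> {0..T} \<Longrightarrow>
      AE x in lebesgue. u (t, x) = w (t, x)"
proof -
  show "\<exists>u. weak_solution T \<rho> a' B' lam g f u"
  proof -
    obtain u z where um: "u \<in> borel_measurable borel" and ut: "\<And>t. t \<in> {0..T} \<Longrightarrow> (\<lambda>x. u (t, x)) \<in> L2 lborel"
      and uc: "\<And>t. t \<in> {0..T} \<Longrightarrow> ((\<lambda>s. norm (cls (\<lambda>x. u (s, x)) - cls (\<lambda>x. u (t, x)))) \<longlongrightarrow> 0) (at t within {0..T})"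
      and uT: "cls (\<lambda>x. u (T, x)) = cls f" and uL: "(\<lambda>p. ind_strip T p * u p) \<in> L2 lborel"
      and uX: "(cls (\<lambda>p. ind_strip T p * u p), z) \<in> X"
      and uH: "AE t in lborel. t \<in> {0<..<T} \<longrightarrow> (\<exists>y. wderiv 1 (cls (\<lambda>x. u (t, x))) y)"
      and ueq: "\<And>\<phi>. \<phi> \<in> test_functions (open_strip T) \<Longrightarrow>
      mul b (cls (\<lambda>p. ind_strip T p * u p)) \<bullet> cls (dd (1, 0) \<phi>) + 1/2 * (mul a z \<bullet> cls (dd (0, 1) \<phi>))
      - mul (\<lambda>p. b p * B p) z \<bullet> cls \<phi>
      + (lam * (mul b (cls (\<lambda>p. ind_strip T p * u p)) \<bullet> cls \<phi>) + mul bt (cls (\<lambda>p. ind_strip T p * u p)) \<bullet> cls \<phi>) = - (mul b (strip_class T g) \<bullet> cls \<phi>)"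
      using existence[of "cls f" "mul b (strip_class T g)"] by blast
    have uS: "u \<in> L2 (lebesgue_on (strip T))" unfolding L2_strip_iff by (rule L2_lborel_lebesgue[OF uL])
    have zS: "fn z \<in> L2 (lebesgue_on (strip T))"
      unfolding L2_strip_iff by (intro bounded_borel_L2' bounded_borel_ind_strip L2_lborel_lebesgue fn_L2)
    have scz: "strip_class T (fn z) = z" using uX by (simp add: strip_class_def X_def mul_def)
    have scu: "strip_class T u = cls (\<lambda>p. ind_strip T p * u p)" by (rule strip_class_def)
    \<comment> \<open>The abstract derivative \<open>z\<close> is thereby a distributional
      derivative in the sense of the problem, so the chosen one has the same class.\<close>
    have dx: "has_distr_deriv (open_strip T) (0, 1) u (fn z)"
      unfolding strip_distr_deriv_iff[OF uS zS] scz scu using uX by (auto simp: X_def dest: wderivD)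
    note ch = chosen_distr_deriv[OF dx zS distr_dx_def]
    have "AE t in lebesgue_on {0..T}. (\<lambda>x. u (t, x)) \<in> H1_real"
    proof -
      have "AE t in lborel. t \<in> {0..T} \<longrightarrow> (\<lambda>x. u (t, x)) \<in> H1_real"
        using uH AE_lborel_singleton[of 0] AE_lborel_singleton[of T]
      proof eventually_elim
        case (elim t)
        show ?case
        proof
          assume t: "t \<in> {0..T}"
          with elim have "t \<in> {0<..<T}" by auto
          then show "(\<lambda>x. u (t, x)) \<in> H1_real" using elim(1) wderiv_imp_H1_real[OF ut[OF t]] by blast
        qed
      qed
      then show ?thesis by (subst AE_restrict_space_iff) (auto intro: AE_completion)
    qed
    then have "u \<in> L2_H1 T" unfolding L2_H1_def using uS dx zS by blast
    moreover have "u \<in> C_L2 T"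
      unfolding C_L2_def
    proof (intro CollectI ballI conjI)
      fix t assume t: "t \<in> {0..T}"
      show "(\<lambda>x. u (t, x)) \<in> L2 lebesgue" by (rule L2_lborel_lebesgue[OF ut[OF t]])
      show "((\<lambda>s. L2_norm lebesgue (\<lambda>x. u (s, x) - u (t, x))) \<longlongrightarrow> 0) (at t within {0..T})"
      proof (rule Lim_transform_eventually[OF uc[OF t]])
        have "norm (cls (\<lambda>x. u (s, x)) - cls (\<lambda>x. u (t, x))) = L2_norm lebesgue (\<lambda>x. u (s, x) - u (t, x))" if "s \<in> {0..T}" for s
          using L2_norm_lebesgue[OF L2_diff[OF ut[OF that, THEN L2_lborel_lebesgue] ut[OF t, THEN L2_lborel_lebesgue]]]
          by (simp add: cls_diff[OF ut[OF that, THEN L2_lborel_lebesgue] ut[OF t, THEN L2_lborel_lebesgue]])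
        then show "\<forall>\<^sub>F s in at t within {0..T}. norm (cls (\<lambda>x. u (s, x)) - cls (\<lambda>x. u (t, x))) = L2_norm lebesgue (\<lambda>x. u (s, x) - u (t, x))"
          by (simp add: eventually_at_filter)
      qed
    qed
    moreover have "AE x in lebesgue. u (T, x) = f x"
      using T by (intro AE_completion cls_eqD[OF uT L2_lborel_lebesgue[OF ut] f]) auto
    moreover have "residual (strip_class T u) (strip_class T (distr_dx T u)) (mul b (strip_class T g)) (strip_class T (distr_dt T \<phi>)) (strip_class T (distr_dx T \<phi>)) (strip_class T \<phi>) = 0"
      if \<phi>: "\<phi> \<in> H11_0 T" for \<phi>
    proof (rule residual_zero_on_H11_0[OF \<phi>])
      fix \<psi> assume "\<psi> \<in> test_functions (open_strip T)"
      from ueq[OF this] show "residual (strip_class T u) (strip_class T (distr_dx T u)) (mul b (strip_class T g)) (cls (dd (1, 0) \<psi>)) (cls (dd (0, 1) \<psi>)) (cls \<psi>) = 0"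
        unfolding residual_def ch(3) scz scu by linarith
    qed
    moreover have "\<phi> \<in> H11 T" if "\<phi> \<in> H11_0 T" for \<phi> using that by (simp add: H11_0_def)
    ultimately have "weak_solution T \<rho> a' B' lam g f u"
      unfolding weak_solution_def
      using weak_form_iff_residual[OF r uS ch(2) g H11_derivatives(1,3,5)] by blast
    then show ?thesis by blast
  qed
  \<comment> \<open>What a weak solution provides in terms of classes, gathered once because the
    comparison uses it for both solutions.\<close>
  have data: "u \<in> L2 (lebesgue_on (strip T))" "distr_dx T u \<in> L2 (lebesgue_on (strip T))"
    "wderiv (0, 1) (strip_class T u) (strip_class T (distr_dx T u))"
    "\<And>\<psi>. \<psi> \<in> test_functions (open_strip T) \<Longrightarrow>
      residual (strip_class T u) (strip_class T (distr_dx T u)) (mul b (strip_class T g)) (cls (dd (1, 0) \<psi>)) (cls (dd (0, 1) \<psi>)) (cls \<psi>) = 0"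
    "\<And>t. t \<in> {0..T} \<Longrightarrow> (\<lambda>x. u (t, x)) \<in> L2 lebesgue"
    "\<And>t. t \<in> {0..T} \<Longrightarrow> ((\<lambda>s. cls (\<lambda>x. u (s, x))) \<longlongrightarrow> cls (\<lambda>x. u (t, x))) (at t within {0..T})"
    "cls (\<lambda>x. u (T, x)) = cls f"
    if u: "weak_solution T \<rho> a' B' lam g f u" for u
  proof -
    show uS: "u \<in> L2 (lebesgue_on (strip T))" using u by (simp add: weak_solution_def L2_H1_def)
    obtain h where h: "h \<in> L2 (lebesgue_on (strip T))" "has_distr_deriv (open_strip T) (0, 1) u h"
      using u unfolding weak_solution_def L2_H1_def by blast
    note ch = chosen_distr_deriv[OF h(2,1) distr_dx_def]
    show "distr_dx T u \<in> L2 (lebesgue_on (strip T))" by (rule ch(2))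
    show "wderiv (0, 1) (strip_class T u) (strip_class T (distr_dx T u))" by (rule strip_wderiv[OF uS ch(2,1)])
    show sl: "(\<lambda>x. u (t, x)) \<in> L2 lebesgue" if "t \<in> {0..T}" for t
      using u that by (simp add: weak_solution_def C_L2_def)
    show "((\<lambda>s. cls (\<lambda>x. u (s, x))) \<longlongrightarrow> cls (\<lambda>x. u (t, x))) (at t within {0..T})" if t: "t \<in> {0..T}" for t
    proof (rule Lim_null[THEN iffD2], rule tendsto_norm_zero_cancel, rule Lim_transform_eventually)
      show "((\<lambda>s. L2_norm lebesgue (\<lambda>x. u (s, x) - u (t, x))) \<longlongrightarrow> 0) (at t within {0..T})"
        using u t by (simp add: weak_solution_def C_L2_def)
      have "L2_norm lebesgue (\<lambda>x. u (s, x) - u (t, x)) = norm (cls (\<lambda>x. u (s, x)) - cls (\<lambda>x. u (t, x)))" if "s \<in> {0..T}" for s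
        using L2_norm_lebesgue[OF L2_diff[OF sl[OF that] sl[OF t]]] by (simp add: cls_diff[OF sl[OF that] sl[OF t]])
      then show "\<forall>\<^sub>F s in at t within {0..T}. L2_norm lebesgue (\<lambda>x. u (s, x) - u (t, x)) = norm (cls (\<lambda>x. u (s, x)) - cls (\<lambda>x. u (t, x)))"
        by (simp add: eventually_at_filter)
    qed
    show "cls (\<lambda>x. u (T, x)) = cls f"
      using u T by (intro cls_eqI sl f) (auto simp: weak_solution_def AE_completion_iff)
    fix \<psi> assume \<psi>: "\<psi> \<in> test_functions (open_strip T)"
    have H: "\<psi> \<in> H11 T" by (rule test_in_H11[OF \<psi>])
    \<comment> \<open>A test function approximates itself, but the norm of the zero function still
      contains chosen derivatives, which have to be shown to vanish almost everywhere.\<close>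
    have "\<psi> \<in> H11_0 T"
    proof -
      have "H11_norm T (\<lambda>p. \<psi> p - \<psi> p) = 0"
      proof -
        have "distr_dx T (\<lambda>p. 0) \<in> L2 (lebesgue_on (strip T))" "distr_dt T (\<lambda>p. 0) \<in> L2 (lebesgue_on (strip T))"
          using H11_derivatives(3,5)[OF test_in_H11[OF test_zero]] by auto
        moreover have "strip_class T (distr_dx T (\<lambda>p. 0)) = 0" "strip_class T (distr_dt T (\<lambda>p. 0)) = 0"
          using test_distr_classes[OF test_zero, of T] by (simp_all add: dd_const[abs_def] cls_zero)
        ultimately show ?thesis
          by (simp add: H11_norm_def L2_norm_strip) (simp add: L2_norm_def)
      qed
      then show ?thesis using H \<psi> unfolding H11_0_def by force
    qed
    then show "residual (strip_class T u) (strip_class T (distr_dx T u)) (mul b (strip_class T g)) (cls (dd (1, 0) \<psi>)) (cls (dd (0, 1) \<psi>)) (cls \<psi>) = 0"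
      using u weak_form_iff_residual[OF r uS ch(2) g H11_derivatives(1,3,5)[OF H]]
      unfolding weak_solution_def test_distr_classes[OF \<psi>] strip_class_test[OF \<psi>] by blast
  qed
  show "AE x in lebesgue. u (t, x) = w (t, x)"
    if u: "weak_solution T \<rho> a' B' lam g f u" and w: "weak_solution T \<rho> a' B' lam g f w" and t: "t \<in> {0..T}"
  proof -
    define d where "d p = u p - w p" for p
    define v where "v = strip_class T d"
    \<comment> \<open>Taken as the difference of the two chosen derivatives, so that the equations
      subtract term by term and the sources cancel.\<close>
    define z where "z = strip_class T (distr_dx T u) - strip_class T (distr_dx T w)"
    define D where "D t = cls (\<lambda>x. d (t, x))" for t
    note du = data[OF u] and dw = data[OF w]
    have dS: "d \<in> L2 (lebesgue_on (strip T))" unfolding d_def by (intro L2_diff du(1) dw(1))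
    have v: "v = strip_class T u - strip_class T w" unfolding v_def d_def by (rule strip_class_diff[OF du(1) dw(1)])
    have dsl: "(\<lambda>x. d (t, x)) \<in> L2 lebesgue" if "t \<in> {0..T}" for t
      unfolding d_def using that by (intro L2_diff du(5) dw(5))
    have D_eq: "D t = cls (\<lambda>x. u (t, x)) - cls (\<lambda>x. w (t, x))" if "t \<in> {0..T}" for t
      unfolding D_def d_def by (rule cls_diff[OF du(5)[OF that] dw(5)[OF that]])
    have Dlim: "(D \<longlongrightarrow> D t) (at t within {0..T})" if t: "t \<in> {0..T}" for t
    proof (rule Lim_transform_eventually)
      show "((\<lambda>s. cls (\<lambda>x. u (s, x)) - cls (\<lambda>x. w (s, x))) \<longlongrightarrow> D t) (at t within {0..T})"
        unfolding D_eq[OF t] by (intro tendsto_diff du(6) dw(6) t)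
      show "\<forall>\<^sub>F s in at t within {0..T}. cls (\<lambda>x. u (s, x)) - cls (\<lambda>x. w (s, x)) = D s"
        using D_eq by (simp add: eventually_at_filter)
    qed
    have T0: "T \<in> {0..T}" using T by simp
    have "D T = 0" unfolding D_eq[OF T0] du(7) dw(7) by simp
    then have DT: "(D \<longlongrightarrow> 0) (at T within {0..T})" using Dlim[OF T0] by simp
    have sl: "AE t in lborel. (t \<notin> {0<..<T} \<longrightarrow> (AE x in lborel. fn v (t, x) = 0)) \<and>
      (t \<in> {0<..<T} \<longrightarrow> (\<lambda>x. fn v (t, x)) \<in> L2 lborel \<and> cls (\<lambda>x. fn v (t, x)) = D t)"
      unfolding v_def D_def by (rule AE_slices[OF dS dsl])
    have "v = 0"
    proof (rule residual_uniqueness[OF sl DT])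
      show "mul (ind_strip T) v = v" unfolding v_def by (rule strip_class_supported[OF dS])
      show "mul (ind_strip T) z = z" unfolding z_def by (simp add: mul_diff bounded_borel_ind_strip strip_class_supported du(2) dw(2))
      show "wderiv (0, 1) v z" unfolding v z_def by (rule wderiv_diff[OF du(3) dw(3)])
      fix \<psi> assume \<psi>: "\<psi> \<in> test_functions (open_strip T)"
      show "residual v z 0 (cls (dd (1, 0) \<psi>)) (cls (dd (0, 1) \<psi>)) (cls \<psi>) = 0"
        using du(4)[OF \<psi>] dw(4)[OF \<psi>] unfolding v z_def residual_def
          mul_diff[OF b(1)] mul_diff[OF bt] mul_diff[OF bbB] mul_diff[OF a(1)] inner_diff_left right_diff_distrib inner_zero_left
        by linarith
    qed
    \<comment> \<open>Vanishing on the plane gives vanishing slices for almost every time;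
      continuity in time then reaches the prescribed t.\<close>
    then have "AE p in lborel. fn v p = 0" using fn_zero by simp
    then have "AE p in lborel \<Otimes>\<^sub>M lborel. fn v p = 0" by (subst lborel_prod)
    then have "AE t in lborel. AE x in lborel. fn v (t, x) = 0" by (rule lborel_pair.AE_pair)
    then have "AE t in lborel. t \<in> {0<..<T} \<longrightarrow> D t = 0"
      using sl
    proof eventually_elim
      case (elim t)
      show ?case
      proof
        assume "t \<in> {0<..<T}"
        with elim have *: "(\<lambda>x. fn v (t, x)) \<in> L2 lborel" "D t = cls (\<lambda>x. fn v (t, x))" by auto
        show "D t = 0"
          unfolding *(2) using cls_eqI[OF L2_lborel_lebesgue[OF *(1)] L2_zero elim(1)] by (simp add: cls_zero)
      qed
    qed
    then have "D t = 0" by (rule AE_zero_imp_continuous_zero[OF T _ t Dlim[OF t]])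
    then have "cls (\<lambda>x. u (t, x)) = cls (\<lambda>x. w (t, x))" using D_eq[OF t] by simp
    then show ?thesis by (intro AE_completion cls_eqD du(5) dw(5) t)
  qed
qed

end

theorem proposition5p4:
  fixes T lam m' M' :: real and I :: nat
    and g \<rho> a B :: "real \<times> real \<Rightarrow> real" and f :: "real \<Rightarrow> real"
  assumes "T > 0" and "I \<ge> 3" and "lam \<ge> 0"
    and "g \<in> Cc_strip T"
    and "f \<in> C0_real" and "f \<in> L2 lebesgue"
    and "0 < m'" and "m' < M'"
    and "\<rho> \<in> Theta T m' M'" and "a \<in> Theta T m' M'" and "B \<in> Xi T M'"
    and "Ht_hypothesis T I \<rho>"
  shows "(\<exists>u. weak_solution T \<rho> a B lam g f u) \<and>
    (\<forall>u v. weak_solution T \<rho> a B lam g f u \<and> weak_solution T \<rho> a B lam g f v \<longrightarrow>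
       (\<forall>t\<in>{0..T}. AE x in lebesgue. u (t, x) = v (t, x)))"
proof -
  obtain m L b bt a' B' where P: "parabolic T m L lam b bt a' B' (real ` {1..I})"
    and r: "AE p in lebesgue. p \<in> open_strip T \<longrightarrow> inverse (\<rho> p) = b p"
    "AE p in lebesgue. p \<in> open_strip T \<longrightarrow> - (time_deriv T \<rho> p / \<rho> p) * inverse (\<rho> p) = bt p"
    "AE p in lebesgue. p \<in> open_strip T \<longrightarrow> a p = a' p"
    "AE p in lebesgue. p \<in> open_strip T \<longrightarrow> B p = B' p"
    using coefficients[OF assms(1,2,3,7,8,9,10,11,12)] by blast
  note U = parabolic.unique_weak_solution[OF P r Cc_strip_L2[OF assms(4)] assms(6)]
  show ?thesis
  proof (intro conjI allI impI ballI)
    show "\<exists>u. weak_solution T \<rho> a B lam g f u" by (rule U(1))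
    show "AE x in lebesgue. u (t, x) = v (t, x)"
      if "weak_solution T \<rho> a B lam g f u \<and> weak_solution T \<rho> a B lam g f v" "t \<in> {0..T}" for u v t
      using that U(2) by blast
  qed
qed

end
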